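(* Let $N\ge 3$ and let $\Omega\subset\mathbb{R}^N$ be a bounded domain of class $C^{2,\alpha}$ (for some $\alpha>0$). Then the equilibrium measure for $\mathcal{E}$ is unique, i.e. there is exactly one $\rho^\ast\in P(\partial\Omega)$ with $\mathcal{E}(\phi_{\rho^\ast})=\inf_{\rho\in P(\partial\Omega)}\mathcal{E}(\phi_\rho)$.
   Context: $P(\partial\Omega)$ is the set of positive Borel measures $\rho$ on $\mathbb{R}^N$ supported on $\partial\Omega$ with $\rho(\partial\Omega)=1$. $D^{1,2}(\mathbb{R}^N)$ is the completion of $C_c^\infty(\mathbb{R}^N)$ with respect to $\|\nabla\cdot\|_{L^2}$. Set $\mathcal{X}=D^{1,2}(\mathbb{R}^N)\cap\{\phi\in C^{0,1}(\mathbb{R}^N):\|\nabla\phi\|_\infty\le 1\}$; functions in $\mathcal X$ are bounded, continuous and tend to $0$ at infinity. For $\rho\in P(\partial\Omega)$ let $$\mathcal{I}_\rho(\phi)=\int_{\mathbb{R}^N}\left(1-\sqrt{1-|\nabla\phi|^2}\right)dx-\langle\rho,\phi\rangle,\quad \phi\in\mathcal{X},\qquad \langle\rho,\phi\rangle=\int_{\partial\Omega}\phi\,d\rho .$$ It is known that $\mathcal{I}_\rho$ has a unique minimizer on $\mathcal{X}$, denoted $\phi_\rho$. The electrostatic energy is $\mathcal{E}(\phi_\rho):=-\mathcal{I}_\rho(\phi_\rho)$. *)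

theory Defs
  imports "HOL-Analysis.Analysis"
begin

section \<open>Differentiability classes\<close>

text \<open>Outside the points of differentiability the value is an unspecified constant. The functions
  considered below are smooth or Lipschitz, so by Rademacher's theorem these points form a null set
  and \<open>gradient f\<close> represents the weak gradient of \<open>f\<close>.\<close>

definition gradient :: "('a::real_inner \<Rightarrow> real) \<Rightarrow> 'a \<Rightarrow> 'a" where
  "gradient f x = (THE D. GDERIV f x :> D)"

primrec C_k_on :: "nat \<Rightarrow> 'a::euclidean_space set \<Rightarrow> ('a \<Rightarrow> real) \<Rightarrow> bool" where
  "C_k_on 0 U f \<longleftrightarrow> continuous_on U f"
| "C_k_on (Suc k) U f \<longleftrightarrow> (\<forall>x\<in>U. f differentiable (at x)) \<and>
     (\<forall>v. C_k_on k U (\<lambda>x. frechet_derivative f (at x) v))"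

definition locally_Hoelder_on :: "real \<Rightarrow> 'a::euclidean_space set \<Rightarrow> ('a \<Rightarrow> real) \<Rightarrow> bool" where
  "locally_Hoelder_on \<alpha> U f \<longleftrightarrow>
     (\<forall>x\<in>U. \<exists>r>0. \<exists>C. \<forall>y\<in>ball x r \<inter> U. \<forall>z\<in>ball x r \<inter> U. \<bar>f y - f z\<bar> \<le> C * dist y z powr \<alpha>)"

text \<open>For \<open>\<alpha> > 0\<close> and open \<open>U\<close> this is the space \<open>C^{k,\<alpha>}(U)\<close>: all directional derivatives of order
  \<open>k\<close> are locally Hoelder continuous with exponent \<open>\<alpha>\<close> (hence continuous, as are those of lower
  order).\<close>

primrec C_k_Hoelder_on :: "nat \<Rightarrow> real \<Rightarrow> 'a::euclidean_space set \<Rightarrow> ('a \<Rightarrow> real) \<Rightarrow> bool" where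
  "C_k_Hoelder_on 0 \<alpha> U f \<longleftrightarrow> locally_Hoelder_on \<alpha> U f"
| "C_k_Hoelder_on (Suc k) \<alpha> U f \<longleftrightarrow> (\<forall>x\<in>U. f differentiable (at x)) \<and>
     (\<forall>v. C_k_Hoelder_on k \<alpha> U (\<lambda>x. frechet_derivative f (at x) v))"

definition bounded_domain :: "'a::euclidean_space set \<Rightarrow> bool" where
  "bounded_domain \<Omega> \<longleftrightarrow> open \<Omega> \<and> connected \<Omega> \<and> \<Omega> \<noteq> {} \<and> bounded \<Omega>"

text \<open>Near each boundary point, \<open>\<Omega>\<close> is the part above the graph of a \<open>C^{k,\<alpha>}\<close> function of the
  coordinates orthogonal to some unit vector \<open>e\<close>. The function \<open>\<gamma>\<close> is declared on the whole space,
  but only its restriction to the hyperplane orthogonal to \<open>e\<close> matters; a \<open>C^{k,\<alpha>}\<close> function on the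
  hyperplane extends to the whole space by composition with the orthogonal projection.\<close>

definition C_k_Hoelder_boundary :: "nat \<Rightarrow> real \<Rightarrow> 'a::euclidean_space set \<Rightarrow> bool" where
  "C_k_Hoelder_boundary k \<alpha> \<Omega> \<longleftrightarrow>
     (\<forall>x0\<in>frontier \<Omega>. \<exists>r>0. \<exists>e \<gamma>. norm e = 1 \<and> C_k_Hoelder_on k \<alpha> UNIV \<gamma> \<and>
        \<Omega> \<inter> ball x0 r = {x \<in> ball x0 r. \<gamma> (x - (x \<bullet> e) *\<^sub>R e) < x \<bullet> e})"


section \<open>The function spaces\<close>

definition test_functions :: "('a::euclidean_space \<Rightarrow> real) set" where
  "test_functions = {f. (\<forall>k. C_k_on k UNIV f) \<and> compact (closure {x. f x \<noteq> 0})}"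

definition sobolev_exponent :: "'a::euclidean_space itself \<Rightarrow> real" where
  "sobolev_exponent _ = 2 * real DIM('a) / (real DIM('a) - 2)"

text \<open>The completion of the test functions with respect to the \<open>L\<^sup>2\<close> norm of the gradient, in
  dimension at least 3. By the Sobolev inequality a Cauchy sequence for this norm also converges in
  \<open>L^p\<close> with the exponent \<open>p = 2N/(N-2)\<close>, and the completion is identified, as usual, with the space
  of these limits.\<close>

definition D12 :: "('a::euclidean_space \<Rightarrow> real) set" where
  "D12 = {u \<in> borel_measurable lebesgue. \<exists>\<phi>::nat \<Rightarrow> 'a \<Rightarrow> real.
      (\<forall>n. \<phi> n \<in> test_functions) \<and>
      (\<forall>\<epsilon>>0. \<exists>M. \<forall>m\<ge>M. \<forall>n\<ge>M.
         (\<integral>\<^sup>+x. ennreal ((norm (gradient (\<phi> m) x - gradient (\<phi> n) x))\<^sup>2) \<partial>lebesgue) < ennreal \<epsilon>) \<and>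
      (\<lambda>n. \<integral>\<^sup>+x. ennreal (\<bar>\<phi> n x - u x\<bar> powr sobolev_exponent TYPE('a)) \<partial>lebesgue) \<longlonglongrightarrow> 0}"

definition admissible :: "('a::euclidean_space \<Rightarrow> real) set" where
  "admissible = D12 \<inter> {\<phi>. (\<exists>L. L-lipschitz_on UNIV \<phi>) \<and> (AE x in lebesgue. norm (gradient \<phi> x) \<le> 1)}"


section \<open>Energy\<close>

text \<open>For closed \<open>S\<close>, a Borel measure is supported on \<open>S\<close> iff the complement of \<open>S\<close> is a null set.\<close>

definition prob_measures_on :: "'a::euclidean_space set \<Rightarrow> 'a measure set" where
  "prob_measures_on S = {\<rho>. sets \<rho> = sets borel \<and> emeasure \<rho> (- S) = 0 \<and> emeasure \<rho> S = 1}"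

definition born_infeld_action :: "'a::euclidean_space measure \<Rightarrow> ('a \<Rightarrow> real) \<Rightarrow> real" where
  "born_infeld_action \<rho> \<phi> =
     (LINT x|lebesgue. 1 - sqrt (1 - (norm (gradient \<phi> x))\<^sup>2)) - (LINT x|\<rho>. \<phi> x)"

text \<open>For \<open>\<rho>\<close> in \<open>prob_measures_on (frontier \<Omega>)\<close>, \<open>\<Omega>\<close> bounded and dimension at least 3, there is
  exactly one minimizer. Such \<open>\<rho>\<close> vanish off \<open>frontier \<Omega>\<close>, so integrating over the whole space in
  \<open>born_infeld_action\<close> is integrating over \<open>frontier \<Omega>\<close>.\<close>

definition potential :: "'a::euclidean_space measure \<Rightarrow> 'a \<Rightarrow> real" where
  "potential \<rho> = (THE \<phi>. is_arg_min (born_infeld_action \<rho>) (\<lambda>\<psi>. \<psi> \<in> admissible) \<phi>)"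

definition electrostatic_energy :: "'a::euclidean_space measure \<Rightarrow> real" where
  "electrostatic_energy \<rho> = - born_infeld_action \<rho> (potential \<rho>)"

end

theory Submission
  imports Defs "HOL-Probability.Probability"
begin

text \<open>The energy is the supremum over admissible \<open>v\<close> of the integral of \<open>v\<close> against the measure minus
  the Born-Infeld energy of \<open>v\<close>, so it is weakly lower semicontinuous and a minimizer exists on the
  compact boundary. Varying an equilibrium measure \<open>\<rho>\<close> towards Dirac measures shows that its potential
  \<open>\<phi>\<close> is at least its mean \<open>m\<close> on the boundary; truncation then gives \<open>0 \<le> \<phi> \<le> m\<close> and \<open>\<phi> = m\<close> on the
  closure of \<open>\<Omega>\<close>. Any other equilibrium measure has therefore the same potential. An interior ball at
  each boundary point and a radial barrier bound the slope of \<open>\<phi>\<close> at the boundary by some \<open>\<kappa> < 1\<close>, and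
  comparison with translates extends this bound to the whole space. Hence the action can be varied
  around \<open>\<phi>\<close> in both directions by small Lipschitz functions, and the Euler-Lagrange equation recovers
  the measure from \<open>\<phi>\<close>.\<close>

text \<open>The constraint of slope at most 1 is the obstacle. Adding a multiple of a test function
  to a minimizer may leave the admissible set, so minimality by itself yields only one-sided
  information, which does not determine the measure. The slope bound strictly below 1 removes this
  difficulty; it is extracted from minimality alone, by comparing energies of pointwise maxima and
  minima. Such comparisons are possible because a potential that is constant on the boundary no
  longer sees the measure: it is the only function of least energy among those that are at least
  \<open>m\<close> there (\<open>unique\<close>). Two quantitative facts carry the function space
  part. The integrand 1 - sqrt (1 - |g|^2) is uniformly convex up to the boundary of the unit ball,
  and a 1-Lipschitz function is bounded by a power less than 1/2 of its Dirichlet integral. Together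
  they make minimizing sequences converge uniformly and show how fast potentials move when the
  measure is perturbed. Since \<open>gradient\<close> is a pointwise derivative, Rademacher's
  theorem links it to the integrals, and \<open>admissible\<close> is identified with a space
  described by two finite integrals.\<close>

section \<open>Rademacher's theorem\<close>

text \<open>A Vitali covering argument. Almost all of \<open>S\<close> is covered by disjoint closed
  intervals on which \<open>f\<close> stretches lengths by at most \<open>p\<close>, chosen inside
  an open set of slightly larger measure. Their images carry at most \<open>p\<close> times that
  measure, and the uncovered null set has a null image because \<open>f\<close> is
  Lipschitz.\<close>

lemma emeasure_image_le_slope:
  fixes f :: "real \<Rightarrow> real"
  assumes mono: "strict_mono f"
    and lip: "\<And>x y. \<bar>f x - f y\<bar> \<le> L * \<bar>x - y\<bar>"
    and S: "S \<in> sets lebesgue" and fS: "f ` S \<in> sets lebesgue" and p: "p \<ge> 0"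
    and small: "\<And>x d. x \<in> S \<Longrightarrow> 0 < d \<Longrightarrow> \<exists>a b. a < x \<and> x < b \<and> b - a < d \<and> f b - f a \<le> p * (b - a)"
  shows "emeasure lebesgue (f ` S) \<le> ennreal p * emeasure lebesgue S"
proof -
  have key: "emeasure lebesgue (f ` S) \<le> ennreal p * (emeasure lebesgue S + ennreal e)" if e: "e > 0" for e
  proof -
    obtain G where G: "open G" "S \<subseteq> G" "(G - S) \<in> lmeasurable" "emeasure lebesgue (G - S) < ennreal e"
      using sets_lebesgue_outer_open[OF S e] by blast
    define K where "K = {(a, b). a < b \<and> {a..b} \<subseteq> G \<and> f b - f a \<le> p * (b - a)}"
    define c where "c = (\<lambda>(a::real, b). (a + b) / 2)"
    define r where "r = (\<lambda>(a::real, b). (b - a) / 2)"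
    have ball: "cball (c i) (r i) = {fst i..snd i}" for i
      by (auto simp: c_def r_def cball_eq_atLeastAtMost field_simps split: prod.splits)
    obtain C where C: "countable C" "C \<subseteq> K"
       "pairwise (\<lambda>i j. disjnt (cball (c i) (r i)) (cball (c j) (r j))) C"
       "negligible (S - (\<Union>i\<in>C. cball (c i) (r i)))"
    proof (rule Vitali_covering_theorem_cballs[of K r S c])
      show "0 < r i" if "i \<in> K" for i using that by (auto simp: K_def r_def)
      fix x d :: real assume x: "x \<in> S" "0 < d"
      then obtain t where t: "t > 0" "ball x t \<subseteq> G"
        using G open_contains_ball by blast
      obtain a b where ab: "a < x" "x < b" "b - a < min d t" "f b - f a \<le> p * (b - a)"
        using small[OF x(1), of "min d t"] x t by auto
      have "{a..b} \<subseteq> ball x t" using ab by (auto simp: dist_real_def)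
      then have "(a, b) \<in> K" using ab t by (auto simp: K_def)
      moreover have "x \<in> cball (c (a, b)) (r (a, b))" using ab ball[of "(a,b)"] by auto
      moreover have "r (a, b) < d" using ab by (auto simp: r_def)
      ultimately show "\<exists>i. i \<in> K \<and> x \<in> cball (c i) (r i) \<and> r i < d" by blast
    qed blast
    define N where "N = S - (\<Union>i\<in>C. cball (c i) (r i))"
    have "negligible (f ` N)"
    proof (rule negligible_locally_Lipschitz_image)
      show "negligible N" using C(4) by (simp add: N_def)
      show "\<exists>T B. open T \<and> x \<in> T \<and> (\<forall>y\<in>N \<inter> T. norm (f y - f x) \<le> B * norm (y - x))" if "x \<in> N" for x
        using lip by (intro exI[of _ UNIV] exI[of _ L]) auto
    qed simp
    then have N0: "f ` N \<in> null_sets lebesgue" by (simp add: negligible_iff_null_sets)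
    define U where "U = (\<Union>i\<in>C. {f (fst i)..f (snd i)})"
    have U: "U \<in> sets lebesgue" unfolding U_def using C(1) by (intro sets.countable_UN'') auto
    have lt: "fst i < snd i" if "i \<in> C" for i using C(2) that by (auto simp: K_def)
    have ord: "snd i < fst j \<or> snd j < fst i" if "i \<in> C" "j \<in> C" "i \<noteq> j" for i j
    proof (rule ccontr)
      assume a: "\<not> ?thesis"
      have "disjnt {fst i..snd i} {fst j..snd j}"
        using C(3) that unfolding pairwise_def ball by blast
      moreover have "max (fst i) (fst j) \<in> {fst i..snd i} \<inter> {fst j..snd j}"
        using a lt[OF that(1)] lt[OF that(2)] by auto
      ultimately show False by (auto simp: disjnt_def)
    qed
    have sub: "f ` S \<subseteq> f ` N \<union> U"
      unfolding N_def U_def ball using mono by (auto simp: strict_mono_less_eq)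
    have "emeasure lebesgue (f ` S) \<le> emeasure lebesgue (f ` N \<union> U)"
      using sub N0 U by (intro emeasure_mono) auto
    also have "\<dots> = emeasure lebesgue U"
      using N0 U by (metis emeasure_Un_null_set sup_commute)
    also have "U = (\<Union>((\<lambda>i. {f (fst i)..f (snd i)}) ` C))" by (simp add: U_def)
    also have "emeasure lebesgue \<dots> = (\<integral>\<^sup>+i. emeasure lebesgue {f (fst i)..f (snd i)} \<partial>count_space C)"
    proof (rule emeasure_UN_countable)
      show "disjoint_family_on (\<lambda>i. {f (fst i)..f (snd i)}) C"
        unfolding disjoint_family_on_def
      proof (intro ballI impI)
        fix i j assume "i \<in> C" "j \<in> C" "i \<noteq> j"
        from ord[OF this] show "{f (fst i)..f (snd i)} \<inter> {f (fst j)..f (snd j)} = {}"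
          using strict_monoD[OF mono] by (auto) (meson less_le_not_le order_trans)+
      qed
    qed (use C in auto)
    also have "\<dots> \<le> (\<integral>\<^sup>+i. ennreal p * emeasure lebesgue {fst i..snd i} \<partial>count_space C)"
    proof (rule nn_integral_mono)
      fix i assume "i \<in> space (count_space C)"
      then have i: "i \<in> C" by simp
      have "f (fst i) \<le> f (snd i)" using lt[OF i] mono by (simp add: strict_mono_less_eq)
      moreover have "f (snd i) - f (fst i) \<le> p * (snd i - fst i)" using C(2) i by (auto simp: K_def)
      ultimately show "emeasure lebesgue {f (fst i)..f (snd i)} \<le> ennreal p * emeasure lebesgue {fst i..snd i}"
        using lt[OF i] p by (simp add: ennreal_mult[symmetric])
    qed
    also have "\<dots> = ennreal p * (\<integral>\<^sup>+i. emeasure lebesgue {fst i..snd i} \<partial>count_space C)"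
      by (simp add: nn_integral_cmult)
    also have "(\<integral>\<^sup>+i. emeasure lebesgue {fst i..snd i} \<partial>count_space C) = emeasure lebesgue (\<Union>((\<lambda>i. {fst i..snd i}) ` C))"
    proof (rule emeasure_UN_countable[symmetric])
      show "disjoint_family_on (\<lambda>i. {fst i..snd i}) C"
        using C(3) unfolding disjoint_family_on_def pairwise_def ball disjnt_def by blast
    qed (use C in auto)
    also have "\<dots> \<le> emeasure lebesgue G"
      using C(2) G unfolding K_def by (intro emeasure_mono UN_least) (auto dest!: subsetD)
    also have "\<dots> \<le> emeasure lebesgue (S \<union> (G - S))"
      using G S by (intro emeasure_mono) auto
    also have "\<dots> \<le> emeasure lebesgue S + emeasure lebesgue (G - S)"
      using G S by (intro emeasure_subadditive) auto
    also have "\<dots> \<le> emeasure lebesgue S + ennreal e"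
      using G by (intro add_mono) auto
    finally show ?thesis by (simp add: mult_left_mono)
  qed
  show ?thesis
  proof (rule ennreal_le_epsilon)
    fix e :: real assume e: "0 < e"
    have "emeasure lebesgue (f ` S) \<le> ennreal p * (emeasure lebesgue S + ennreal (e / (p + 1)))"
      using key e p by simp
    also have "\<dots> = ennreal p * emeasure lebesgue S + ennreal (p * (e / (p + 1)))"
      using p e by (subst ennreal_mult) (auto simp: distrib_left)
    also have "\<dots> \<le> ennreal p * emeasure lebesgue S + ennreal e"
      using p e by (intro add_left_mono ennreal_leI) (simp add: field_simps)
    finally show "emeasure lebesgue (f ` S) \<le> ennreal p * emeasure lebesgue S + ennreal e" .
  qed
qed

text \<open>Requiring \<open>x\<close> to be interior to the interval makes the set a countable
  intersection of open sets for an arbitrary \<open>Q\<close>, so its measurability is free.\<close>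

definition slopes :: "(real \<Rightarrow> real \<Rightarrow> bool) \<Rightarrow> real set" where
  "slopes Q = {x. \<forall>d>0. \<exists>a b. a < x \<and> x < b \<and> b - a < d \<and> Q a b}"

lemma slopes_borel: "slopes Q \<in> sets borel"
proof -
  have eq: "slopes Q = (\<Inter>n::nat. \<Union>{{a<..<b} |a b. b - a < 1 / real (Suc n) \<and> Q a b})" (is "_ = ?R")
  proof (intro set_eqI iffI)
    fix x assume "x \<in> slopes Q"
    then show "x \<in> ?R" unfolding slopes_def
    proof (intro InterI, clarsimp)
      fix n :: nat assume a: "\<forall>d>0. \<exists>a<x. \<exists>b>x. b - a < d \<and> Q a b"
      have "(0::real) < 1 / (1 + real n)" by simp
      with a obtain a b where "a < x" "x < b" "b - a < 1 / (1 + real n)" "Q a b"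
        by blast
      then show "\<exists>u. (\<exists>a b. u = {a<..<b} \<and> b - a < 1 / (1 + real n) \<and> Q a b) \<and> x \<in> u"
        by (intro exI[of _ "{a<..<b}"]) auto
    qed
  next
    fix x assume x: "x \<in> ?R"
    show "x \<in> slopes Q" unfolding slopes_def
    proof (intro CollectI allI impI)
      fix d :: real assume "d > 0"
      then obtain n where n: "1 / real (Suc n) < d"
        using nat_approx_posE by blast
      from x obtain a b where "x \<in> {a<..<b}" "b - a < 1 / real (Suc n)" "Q a b" by blast
      then show "\<exists>a b. a < x \<and> x < b \<and> b - a < d \<and> Q a b"
        using n by (intro exI[of _ a] exI[of _ b]) auto
    qed
  qed
  have "open (\<Union>{{a<..<b} |a b. b - a < 1 / real (Suc n) \<and> Q a b})" for n :: nat
    by (intro open_Union) auto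
  then show ?thesis unfolding eq by (intro sets.countable_INT'') auto
qed

text \<open>The limit is the supremum of the eventual lower bounds. Rational thresholds suffice to
  see this, which later leaves only countably many exceptional null sets.\<close>

lemma tendsto_if_no_oscillation:
  fixes q :: "'a \<Rightarrow> real"
  assumes F: "F \<noteq> bot" and B: "eventually (\<lambda>x. \<bar>q x\<bar> \<le> B) F"
    and no: "\<And>r s. r < s \<Longrightarrow> r \<in> \<rat> \<Longrightarrow> s \<in> \<rat> \<Longrightarrow> eventually (\<lambda>x. r \<le> q x) F \<or> eventually (\<lambda>x. q x \<le> s) F"
  shows "\<exists>c. (q \<longlongrightarrow> c) F"
proof -
  define A where "A = {r. eventually (\<lambda>x. r \<le> q x) F}"
  have bd: "r \<le> B" if "r \<in> A" for r
  proof -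
    have "eventually (\<lambda>x. r \<le> B) F"
      using that B unfolding A_def by (auto elim: eventually_elim2)
    then show ?thesis using F by simp
  qed
  have ne: "- B \<in> A" using B unfolding A_def by (auto elim: eventually_mono)
  have bdd: "bdd_above A" using bd by (rule bdd_aboveI)
  have "(q \<longlongrightarrow> Sup A) F"
  proof (rule order_tendstoI)
    fix a assume "a < Sup A"
    then obtain r where "r \<in> A" "a < r" using ne bdd less_cSup_iff by (metis empty_iff)
    then show "eventually (\<lambda>x. a < q x) F" unfolding A_def by (auto elim: eventually_mono)
  next
    fix a assume "Sup A < a"
    then obtain s where s: "s \<in> \<rat>" "Sup A < s" "s < a" using Rats_dense_in_real by blast
    then obtain r where r: "r \<in> \<rat>" "Sup A < r" "r < s" using Rats_dense_in_real by blast
    have "r \<notin> A" using r cSup_upper[OF _ bdd] by fastforce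
    then have "eventually (\<lambda>x. q x \<le> s) F" using no[of r s] r s by (auto simp: A_def)
    then show "eventually (\<lambda>x. q x < a) F" using s by (auto elim: eventually_mono)
  qed
  then show ?thesis by blast
qed

text \<open>The increment from \<open>x\<close> to \<open>x + h\<close> has \<open>x\<close> as an
  endpoint. The strict inequality leaves room to push this endpoint slightly past \<open>x\<close>
  by continuity, which gives an interval around \<open>x\<close>.\<close>

lemma frequently_slope:
  fixes f :: "real \<Rightarrow> real"
  assumes cont: "continuous_on UNIV f"
    and fr: "frequently (\<lambda>h. (f (x + h) - f x) / h < p) (at 0)"
  shows "x \<in> slopes (\<lambda>a b. f b - f a \<le> p * (b - a))"
  unfolding slopes_def
proof (intro CollectI allI impI)
  fix d :: real assume d: "d > 0"
  have "eventually (\<lambda>h. h \<noteq> 0 \<and> \<bar>h\<bar> < d / 2) (at (0::real))"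
    unfolding eventually_at using d by (intro exI[of _ "d/2"]) (auto simp: dist_real_def)
  with fr have "frequently (\<lambda>h. (f (x + h) - f x) / h < p \<and> h \<noteq> 0 \<and> \<bar>h\<bar> < d / 2) (at 0)"
    by (rule frequently_eventually_frequently)
  then obtain h where h: "(f (x + h) - f x) / h < p" "h \<noteq> 0" "\<bar>h\<bar> < d / 2"
    using frequently_ex by blast
  have ct: "(f \<longlongrightarrow> f x) (at x within A)" for A
    using cont by (meson UNIV_I continuous_on_def top_greatest tendsto_within_subset)
  show "\<exists>a b. a < x \<and> x < b \<and> b - a < d \<and> f b - f a \<le> p * (b - a)"
  proof (cases "h > 0")
    case True
    have 1: "f (x + h) - f x - p * (x + h - x) < 0" using h True by (simp add: field_simps)
    have "((\<lambda>a. f (x + h) - f a - p * (x + h - a)) \<longlongrightarrow> f (x + h) - f x - p * (x + h - x)) (at_left x)"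
      by (intro tendsto_intros ct)
    then have "eventually (\<lambda>a. f (x + h) - f a - p * (x + h - a) < 0) (at_left x)"
      using 1 by (rule order_tendstoD(2))
    moreover have "eventually (\<lambda>a. a \<in> {x - d/2<..<x}) (at_left x)"
      using d by (intro eventually_at_leftI[of "x - d/2"]) auto
    ultimately have "eventually (\<lambda>a. f (x + h) - f a - p * (x + h - a) < 0 \<and> a \<in> {x - d/2<..<x}) (at_left x)"
      by eventually_elim auto
    then obtain a where "f (x + h) - f a - p * (x + h - a) < 0" "a \<in> {x - d/2<..<x}"
      using eventually_happens'[OF trivial_limit_at_left_real] by blast
    then show ?thesis using h True by (intro exI[of _ a] exI[of _ "x + h"]) auto
  next
    case False
    then have h0: "h < 0" using h by auto
    have 1: "f x - f (x + h) - p * (x - (x + h)) < 0" using h h0 by (simp add: field_simps)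
    have "((\<lambda>b. f b - f (x + h) - p * (b - (x + h))) \<longlongrightarrow> f x - f (x + h) - p * (x - (x + h))) (at_right x)"
      by (intro tendsto_intros ct)
    then have "eventually (\<lambda>b. f b - f (x + h) - p * (b - (x + h)) < 0) (at_right x)"
      using 1 by (rule order_tendstoD(2))
    moreover have "eventually (\<lambda>b. b \<in> {x<..<x + d/2}) (at_right x)"
      using d by (intro eventually_at_rightI[of _ "x + d/2"]) auto
    ultimately have "eventually (\<lambda>b. f b - f (x + h) - p * (b - (x + h)) < 0 \<and> b \<in> {x<..<x + d/2}) (at_right x)"
      by eventually_elim auto
    then obtain b where "f b - f (x + h) - p * (b - (x + h)) < 0" "b \<in> {x<..<x + d/2}"
      using eventually_happens'[OF trivial_limit_at_right_real] by blast
    then show ?thesis using h h0 by (intro exI[of _ "x + h"] exI[of _ b]) auto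
  qed
qed

text \<open>The covering lemma is used for \<open>f\<close> and for its inverse. On a set
  \<open>S\<close> where slopes at most \<open>p\<close> and slopes at least \<open>q > p\<close>
  both occur at arbitrarily small scales, it gives |f(S)| <= p |S| and |S| <= |f(S)| / q. Hence |S|
  <= (p / q) |S|, which forces |S| = 0 when |S| is finite.\<close>

lemma bilipschitz_AE_differentiable:
  fixes f :: "real \<Rightarrow> real"
  assumes lo: "\<And>x y. x \<le> y \<Longrightarrow> y - x \<le> f y - f x"
    and up: "\<And>x y. x \<le> y \<Longrightarrow> f y - f x \<le> L * (y - x)"
  shows "AE x in lborel. f differentiable (at x)"
proof -
  have mono: "strict_mono f"
  proof (rule strict_monoI)
    fix x y :: real assume "x < y" then show "f x < f y" using lo[of x y] by simp
  qed
  have lip: "\<bar>f x - f y\<bar> \<le> L * \<bar>x - y\<bar>" for x y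
    using lo[of x y] up[of x y] lo[of y x] up[of y x] by (cases "x \<le> y") auto
  have "L \<ge> 1" using lo[of 0 1] up[of 0 1] by simp
  have "L-lipschitz_on UNIV f"
    using lip \<open>L \<ge> 1\<close> by (intro lipschitz_onI) (auto simp: dist_real_def)
  then have cont: "continuous_on UNIV f" by (rule lipschitz_on_continuous_on)
  have surj: "surj f"
  proof (rule surjI)
    fix y
    have "\<exists>x. - \<bar>y - f 0\<bar> \<le> x \<and> x \<le> \<bar>y - f 0\<bar> \<and> f x = y"
      using lo[of "- \<bar>y - f 0\<bar>" 0] lo[of 0 "\<bar>y - f 0\<bar>"] cont
      by (intro IVT') (auto intro: continuous_on_subset)
    then show "f (SOME x. f x = y) = y" by (metis (mono_tags) someI)
  qed
  define g where "g = inv f"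
  have inj: "inj f" using mono by (simp add: strict_mono_imp_inj_on)
  have fg: "f (g y) = y" for y using surj by (simp add: g_def surj_f_inv_f)
  have gf: "g (f y) = y" for y using inj by (simp add: g_def)
  have gmono: "strict_mono g"
    by (rule strict_monoI) (metis fg mono strict_mono_less)
  have glip: "\<bar>g x - g y\<bar> \<le> 1 * \<bar>x - y\<bar>" for x y
    using lo[of "g x" "g y"] lo[of "g y" "g x"] by (cases "g x \<le> g y") (auto simp: fg)
  have "1-lipschitz_on UNIV g" using glip by (intro lipschitz_onI) (auto simp: dist_real_def)
  then have gcont: "continuous_on UNIV g" by (rule lipschitz_on_continuous_on)
  have fimg: "f ` S = g -` S" for S
    by (auto simp: gf) (metis fg image_eqI)
  have fborel: "f ` S \<in> sets borel" if "S \<in> sets borel" for S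
    unfolding fimg by (rule measurable_sets_borel[OF borel_measurable_continuous_onI[OF gcont] that])
  have "AE x in lborel. \<forall>p\<in>\<rat>. \<forall>q\<in>\<rat>. p < q \<longrightarrow> x \<notin> slopes (\<lambda>a b. f b - f a \<le> p * (b - a))
         \<or> x \<notin> slopes (\<lambda>a b. q * (b - a) \<le> f b - f a)" (is "AE x in lborel. \<forall>p\<in>\<rat>. \<forall>q\<in>\<rat>. p < q \<longrightarrow> x \<notin> ?A p \<or> x \<notin> ?B q")
  proof (subst AE_ball_countable[OF countable_rat], intro ballI, subst AE_ball_countable[OF countable_rat], intro ballI)
    fix p q :: real assume "p \<in> \<rat>" "q \<in> \<rat>"
    \<comment> \<open>Intersecting with a bounded interval makes the measure finite, so that it can
      be cancelled at the end.\<close>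
    have null: "emeasure lborel (?A p \<inter> ?B q \<inter> {-real n..real n}) = 0" if pq: "p < q" for n :: nat
    proof (cases "p \<ge> 1")
      case False
      \<comment> \<open>All slopes of \<open>f\<close> are at least 1, so none is at most
        \<open>p < 1\<close>.\<close>
      have "?A p = {}"
      proof (rule ccontr)
        assume "?A p \<noteq> {}"
        then obtain x where "x \<in> ?A p" by blast
        then have "\<exists>a b. a < x \<and> x < b \<and> b - a < 1 \<and> f b - f a \<le> p * (b - a)"
          unfolding slopes_def by (auto dest: spec[of _ 1])
        then obtain a b where "a < x" "x < b" "f b - f a \<le> p * (b - a)" by blast
        have pp: "p * (b - a) < 1 * (b - a)" using False \<open>a < x\<close> \<open>x < b\<close> by (intro mult_strict_right_mono) auto
        have "b - a \<le> f b - f a" using lo[of a b] \<open>a < x\<close> \<open>x < b\<close> by simp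
        also have "\<dots> \<le> p * (b - a)" by fact
        also have "\<dots> < 1 * (b - a)" by fact
        finally show False by simp
      qed
      then show ?thesis by simp
    next
      case True
      let ?S = "?A p \<inter> ?B q \<inter> {-real n..real n}"
      have S: "?S \<in> sets borel" by (intro sets.Int slopes_borel) auto
      have fS: "f ` ?S \<in> sets borel" by (rule fborel[OF S])
      have 1: "emeasure lebesgue (f ` ?S) \<le> ennreal p * emeasure lebesgue ?S"
        using S fS True by (intro emeasure_image_le_slope[OF mono lip]) (auto simp: slopes_def)
      have "emeasure lebesgue (g ` (f ` ?S)) \<le> ennreal (1 / q) * emeasure lebesgue (f ` ?S)"
      proof (intro emeasure_image_le_slope[OF gmono glip])
        show "g ` f ` ?S \<in> sets lebesgue" "f ` ?S \<in> sets lebesgue" using S fS by (auto simp: gf image_image)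
        show "0 \<le> 1 / q" using True pq by simp
        fix y d :: real assume y: "y \<in> f ` ?S" and d: "0 < d"
        then obtain x where x: "y = f x" "x \<in> ?S" by auto
        from x(2) have "x \<in> ?B q" by blast
        moreover have "0 < d / L" using d \<open>L \<ge> 1\<close> by simp
        ultimately obtain a b where ab: "a < x" "x < b" "b - a < d / L" "q * (b - a) \<le> f b - f a"
          unfolding slopes_def by blast
        have "f a < y" "y < f b" using ab mono x by (auto simp: strict_mono_less)
        moreover have "f b - f a < d" using up[of a b] ab \<open>L \<ge> 1\<close> by (simp add: field_simps)
        moreover have "g (f b) - g (f a) \<le> 1 / q * (f b - f a)" using ab True pq by (simp add: gf field_simps)
        ultimately show "\<exists>a b. a < y \<and> y < b \<and> b - a < d \<and> g b - g a \<le> 1 / q * (b - a)" by blast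
      qed
      then have 2: "emeasure lebesgue ?S \<le> ennreal (1 / q) * emeasure lebesgue (f ` ?S)"
        by (simp add: image_image gf)
      have "emeasure lebesgue ?S \<le> emeasure lebesgue {-real n..real n}" using S by (intro emeasure_mono) auto
      also have "\<dots> < \<infinity>" by simp
      finally obtain s where s: "s \<ge> 0" "emeasure lebesgue ?S = ennreal s"
        by (cases "emeasure lebesgue ?S") auto
      have "emeasure lebesgue ?S \<le> ennreal (1 / q) * (ennreal p * emeasure lebesgue ?S)"
        using 1 2 by (meson mult_left_mono order_trans zero_le)
      also have "\<dots> = ennreal (1 / q * (p * s))"
      proof -
        have "ennreal p * ennreal s = ennreal (p * s)" using s True by (intro ennreal_mult[symmetric]) auto
        moreover have "ennreal (1 / q) * ennreal (p * s) = ennreal (1 / q * (p * s))"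
          using s True pq by (intro ennreal_mult[symmetric]) auto
        ultimately show ?thesis using s by (simp only:)
      qed
      finally have "s \<le> 1 / q * (p * s)" using s True pq by (simp add: ennreal_le_iff)
      then have "s * q \<le> p * s" using True pq by (simp add: field_simps)
      then have "s * (q - p) \<le> 0" by (simp add: algebra_simps)
      then have "s = 0" using pq s by (simp add: mult_le_0_iff)
      then show ?thesis using s S by simp
    qed
    show "AE x in lborel. p < q \<longrightarrow> x \<notin> ?A p \<or> x \<notin> ?B q"
    proof (cases "p < q")
      case True
      have "AE x in lborel. \<forall>n::nat. x \<notin> ?A p \<inter> ?B q \<inter> {-real n..real n}"
        unfolding AE_all_countable
      proof
        fix n
        have "?A p \<inter> ?B q \<inter> {-real n..real n} \<in> null_sets lborel"
          using null[OF True, of n] by (auto intro!: null_setsI sets.Int slopes_borel)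
        then show "AE x in lborel. x \<notin> ?A p \<inter> ?B q \<inter> {-real n..real n}" by (rule AE_not_in)
      qed
      then show ?thesis
      proof eventually_elim
        case (elim x)
        obtain n where "\<bar>x\<bar> \<le> real n" using real_arch_simple by blast
        then show ?case using elim[rule_format, of n] by auto
      qed
    qed simp
  qed
  then show ?thesis
  proof eventually_elim
    case (elim x)
    have "\<exists>c. ((\<lambda>h. (f (x + h) - f x) / h) \<longlongrightarrow> c) (at 0)"
    proof (rule tendsto_if_no_oscillation[where B=L])
      show "eventually (\<lambda>h. \<bar>(f (x + h) - f x) / h\<bar> \<le> L) (at 0)"
        using lip[of "x + _" x] by (auto simp: eventually_at_filter abs_divide pos_divide_le_eq intro!: always_eventually)
      fix r s :: real assume rs: "r < s" "r \<in> \<rat>" "s \<in> \<rat>"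
      have "x \<notin> ?A r \<or> x \<notin> ?B s" using elim rs by blast
      moreover have "x \<in> ?A r" if "frequently (\<lambda>h. (f (x + h) - f x) / h < r) (at 0)"
        using frequently_slope[OF cont that] .
      moreover have "x \<in> ?B s" if "frequently (\<lambda>h. s < (f (x + h) - f x) / h) (at 0)"
      proof -
        have "(- f (x + h) - - f x) / h = - ((f (x + h) - f x) / h)" for h
          by (cases "h = 0") (simp_all add: field_simps)
        with that have "frequently (\<lambda>h. (- f (x + h) - - f x) / h < - s) (at 0)" by (simp only: neg_less_iff_less)
        then have "x \<in> slopes (\<lambda>a b. (- f b) - (- f a) \<le> (- s) * (b - a))"
          by (intro frequently_slope continuous_intros cont)
        then show ?thesis by (simp add: algebra_simps)
      qed
      ultimately have "\<not> frequently (\<lambda>h. (f (x + h) - f x) / h < r) (at 0) \<or> \<not> frequently (\<lambda>h. s < (f (x + h) - f x) / h) (at 0)"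
        by blast
      then show "eventually (\<lambda>h. r \<le> (f (x + h) - f x) / h) (at 0) \<or> eventually (\<lambda>h. (f (x + h) - f x) / h \<le> s) (at 0)"
        by (simp add: not_frequently not_less)
    qed simp
    then obtain c where "(f has_field_derivative c) (at x)" unfolding DERIV_def by blast
    then show ?case
      unfolding differentiable_def using has_field_derivative_imp_has_derivative by blast
  qed
qed

text \<open>Adding \<open>(L + 1) * x\<close> makes all slopes lie between 1 and
  \<open>2 * L + 1\<close> and does not affect differentiability.\<close>

lemma lipschitz_real_AE_differentiable:
  fixes f :: "real \<Rightarrow> real"
  assumes "L-lipschitz_on UNIV f"
  shows "AE x in lborel. f differentiable (at x)"
proof -
  have L: "\<bar>f x - f y\<bar> \<le> L * \<bar>x - y\<bar>" for x y using lipschitz_onD[OF assms, of x y] by (simp add: dist_real_def)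
  define h where "h = (\<lambda>x. f x + (L + 1) * x)"
  have "AE x in lborel. h differentiable (at x)"
  proof (rule bilipschitz_AE_differentiable[where L="2 * L + 1"])
    fix x y :: real assume "x \<le> y"
    then show "y - x \<le> h y - h x" "h y - h x \<le> (2 * L + 1) * (y - x)"
      using L[of x y] by (auto simp: h_def algebra_simps)
  qed
  then show ?thesis
  proof eventually_elim
    case (elim x)
    have "(\<lambda>x. h x - (L + 1) * x) differentiable (at x)" using elim by (intro derivative_intros)
    then show ?case by (simp add: h_def)
  qed
qed

section \<open>Integration along the lines of a fixed direction\<close>

lemma nn_integral_lborel_shift:
  fixes c :: "'a::euclidean_space"
  assumes [measurable]: "f \<in> borel_measurable borel"
  shows "(\<integral>\<^sup>+x. f (x + c) \<partial>lborel) = (\<integral>\<^sup>+x. f x \<partial>lborel)"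
proof -
  have "(\<integral>\<^sup>+x. f x \<partial>lborel) = (\<integral>\<^sup>+x. f x \<partial>distr lborel borel ((+) c))"
    by (simp add: lborel_distr_plus)
  also have "\<dots> = (\<integral>\<^sup>+x. f (x + c) \<partial>lborel)"
    by (subst nn_integral_distr) (auto simp: add.commute)
  finally show ?thesis ..
qed

lemma integral_lborel_shift:
  fixes c :: "'a::euclidean_space" and f :: "'a \<Rightarrow> real"
  assumes [measurable]: "f \<in> borel_measurable borel"
  shows "(\<integral>x. f (x + c) \<partial>lborel) = (\<integral>x. f x \<partial>lborel)"
proof -
  have "(\<integral>x. f x \<partial>lborel) = (\<integral>x. f x \<partial>distr lborel borel ((+) c))"
    by (simp add: lborel_distr_plus)
  also have "\<dots> = (\<integral>x. f (x + c) \<partial>lborel)"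
    by (subst integral_distr) (auto simp: add.commute)
  finally show ?thesis ..
qed

lemma integrable_lborel_shift:
  fixes c :: "'a::euclidean_space" and f :: "'a \<Rightarrow> real"
  assumes "integrable lborel f"
  shows "integrable lborel (\<lambda>x. f (x + c))"
proof -
  have "integrable (distr lborel borel ((+) c)) f" using assms by (simp add: lborel_distr_plus)
  then have "integrable lborel (\<lambda>x. f (c + x))"
    using borel_measurable_integrable[OF assms] by (subst (asm) integrable_distr_eq) auto
  then show ?thesis by (simp add: add.commute)
qed

text \<open>After exchanging the integrals, translation invariance makes the integral over
  \<open>x\<close> independent of \<open>t\<close>. This is Fubini's theorem for lines of arbitrary
  direction; the weight \<open>g\<close> selects a segment of the line.\<close>

lemma nn_integral_lborel_line:
  fixes v :: "'a::euclidean_space"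
  assumes f[measurable]: "f \<in> borel_measurable borel" and g[measurable]: "g \<in> borel_measurable borel"
  shows "(\<integral>\<^sup>+x. \<integral>\<^sup>+t. g t * f (x + t *\<^sub>R v) \<partial>lborel \<partial>lborel) = (\<integral>\<^sup>+t. g t \<partial>lborel) * (\<integral>\<^sup>+x. f x \<partial>lborel)"
proof -
  have "(\<integral>\<^sup>+x. \<integral>\<^sup>+t. g t * f (x + t *\<^sub>R v) \<partial>lborel \<partial>lborel) = (\<integral>\<^sup>+t. \<integral>\<^sup>+x. g t * f (x + t *\<^sub>R v) \<partial>lborel \<partial>lborel)"
    by (subst lborel_pair.Fubini') auto
  also have "\<dots> = (\<integral>\<^sup>+t. g t * (\<integral>\<^sup>+x. f x \<partial>lborel) \<partial>lborel)"
    by (intro nn_integral_cong) (simp add: nn_integral_cmult nn_integral_lborel_shift)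
  also have "\<dots> = (\<integral>\<^sup>+t. g t \<partial>lborel) * (\<integral>\<^sup>+x. f x \<partial>lborel)"
    by (simp add: nn_integral_multc)
  finally show ?thesis .
qed

lemma null_set_if_null_on_lines:
  fixes v :: "'a::euclidean_space"
  assumes B[measurable]: "B \<in> sets borel" and null: "\<And>x. AE t in lborel. x + t *\<^sub>R v \<notin> B"
  shows "emeasure lborel B = 0"
proof -
  have "emeasure lborel B = (\<integral>\<^sup>+t. indicator {0..1::real} t \<partial>lborel) * (\<integral>\<^sup>+x. indicator B x \<partial>lborel)"
    by simp
  also have "\<dots> = (\<integral>\<^sup>+x. \<integral>\<^sup>+t. indicator {0..1::real} t * indicator B (x + t *\<^sub>R v) \<partial>lborel \<partial>lborel)"
    by (rule nn_integral_lborel_line[symmetric]) auto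
  also have "\<dots> = (\<integral>\<^sup>+x. 0 \<partial>(lborel::'a measure))"
  proof (rule nn_integral_cong)
    fix x :: 'a
    have "(\<integral>\<^sup>+t. indicator {0..1::real} t * indicator B (x + t *\<^sub>R v) \<partial>lborel) = (\<integral>\<^sup>+t. 0 \<partial>(lborel::real measure))"
      using null[of x] by (intro nn_integral_cong_AE) (auto elim: eventually_mono)
    then show "(\<integral>\<^sup>+t. indicator {0..1::real} t * indicator B (x + t *\<^sub>R v) \<partial>lborel) = 0" by simp
  qed
  finally show ?thesis by simp
qed

lemma AE_on_lines:
  fixes v :: "'a::euclidean_space"
  assumes "AE x in lborel. P x"
  shows "AE x in lborel. AE t in lborel. P (x + t *\<^sub>R v)"
proof -
  obtain N where N: "{x. \<not> P x} \<subseteq> N" "emeasure lborel N = 0" and [measurable]: "N \<in> sets borel"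
    using assms by (elim AE_E) auto
  have "(\<integral>\<^sup>+x. \<integral>\<^sup>+t. 1 * indicator N (x + t *\<^sub>R v) \<partial>(lborel::real measure) \<partial>lborel) = (\<integral>\<^sup>+t. 1 \<partial>(lborel::real measure)) * (\<integral>\<^sup>+x. indicator N x \<partial>lborel)"
    by (rule nn_integral_lborel_line) auto
  also have "\<dots> = 0" using N by simp
  finally have "AE x in lborel. (\<integral>\<^sup>+t. indicator N (x + t *\<^sub>R v) \<partial>(lborel::real measure)) = 0"
    by (subst (asm) nn_integral_0_iff_AE) auto
  then show ?thesis
  proof eventually_elim
    case (elim x)
    then have "AE t in lborel. indicator N (x + t *\<^sub>R v) = (0::ennreal)"
      by (subst (asm) nn_integral_0_iff_AE) auto
    then show ?case by eventually_elim (use N in \<open>auto simp: indicator_def split: if_splits\<close>)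
  qed
qed

text \<open>After the constant \<open>M\<close> is added, \<open>H\<close> becomes the density of a
  measure that agrees with \<open>M\<close> times Lebesgue measure on boxes, hence on all Borel
  sets; densities are unique almost everywhere.\<close>

lemma AE_zero_if_box_integrals_zero:
  fixes H :: "'a::euclidean_space \<Rightarrow> real"
  assumes [measurable]: "H \<in> borel_measurable borel" and M: "\<And>x. \<bar>H x\<bar> \<le> M"
    and zero: "\<And>a b. (\<integral>x. H x * indicator (box a b) x \<partial>lborel) = 0"
  shows "AE x in lborel. H x = 0"
proof -
  have eq: "emeasure (density lborel (\<lambda>x. ennreal (H x + M))) (box a b) = ennreal M * emeasure lborel (box a b)" for a b
  proof -
    have nn: "0 \<le> H x + M" for x using M[of x] by linarith
    have "M \<ge> 0" using M[of undefined] by linarith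
    have int1: "integrable lborel (indicator (box a b) :: 'a \<Rightarrow> real)"
      by (simp add: emeasure_lborel_box_eq)
    have int2: "integrable lborel (\<lambda>x. H x * indicator (box a b) x)"
    proof (rule Bochner_Integration.integrable_bound)
      show "integrable lborel (\<lambda>x. M * indicator (box a b) x)" using int1 by (rule integrable_mult_right)
      show "AE x in lborel. norm (H x * indicator (box a b) x) \<le> norm (M * indicator (box a b) x)"
        using M by (auto simp: indicator_def intro!: AE_I2 order_trans[OF M])
    qed simp
    have "emeasure (density lborel (\<lambda>x. ennreal (H x + M))) (box a b) = (\<integral>\<^sup>+x. ennreal (H x + M) * indicator (box a b) x \<partial>lborel)"
      by (subst emeasure_density) auto
    also have "\<dots> = (\<integral>\<^sup>+x. ennreal (H x * indicator (box a b) x + M * indicator (box a b) x) \<partial>lborel)"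
      by (intro nn_integral_cong) (auto simp: indicator_def)
    also have "\<dots> = ennreal (\<integral>x. H x * indicator (box a b) x + M * indicator (box a b) x \<partial>lborel)"
      using nn by (intro nn_integral_eq_integral Bochner_Integration.integrable_add int2 integrable_mult_right int1)
        (auto simp: indicator_def)
    also have "(\<integral>x. H x * indicator (box a b) x + M * indicator (box a b) x \<partial>lborel) = M * measure lborel (box a b)"
      using int1 int2 zero[of a b] by (subst Bochner_Integration.integral_add) auto
    also have "ennreal \<dots> = ennreal M * emeasure lborel (box a b)"
      using \<open>M \<ge> 0\<close> emeasure_lborel_box_finite[of a b]
      by (subst emeasure_eq_ennreal_measure) (auto simp: ennreal_mult)
    finally show ?thesis .
  qed
  have "density lborel (\<lambda>x. ennreal (H x + M)) = density lborel (\<lambda>x. ennreal M)"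
  proof (rule measure_eqI_generator_eq)
    let ?E = "range (\<lambda>(a, b). box a b::'a set)"
    show "Int_stable ?E" by (auto simp: Int_stable_def box_Int_box)
    show "?E \<subseteq> Pow UNIV" "sets (density lborel (\<lambda>x. ennreal (H x + M))) = sigma_sets UNIV ?E"
      "sets (density (lborel::'a measure) (\<lambda>x. ennreal M)) = sigma_sets UNIV ?E"
      by (simp_all add: borel_eq_box)
    let ?A = "\<lambda>n::nat. box (- (real n *\<^sub>R One)) (real n *\<^sub>R One) :: 'a set"
    show "range ?A \<subseteq> ?E" "(\<Union>i. ?A i) = UNIV" unfolding UN_box_eq_UNIV by auto
    show "emeasure (density lborel (\<lambda>x. ennreal (H x + M))) (?A i) \<noteq> \<infinity>" for i
      unfolding eq by (simp add: emeasure_lborel_box_eq ennreal_mult_eq_top_iff)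
    show "emeasure (density lborel (\<lambda>x. ennreal (H x + M))) X = emeasure (density lborel (\<lambda>x. ennreal M)) X"
      if "X \<in> ?E" for X
      using that by (auto simp: eq emeasure_density nn_integral_cmult)
  qed
  then have "AE x in lborel. ennreal (H x + M) = ennreal M"
    by (subst (asm) sigma_finite_measure.density_unique_iff[OF sigma_finite_lborel]) auto
  then show ?thesis
  proof eventually_elim
    case (elim x)
    have "0 \<le> H x + M" "0 \<le> M" using M[of x] by linarith+
    with elim show ?case by (simp add: ennreal_inj)
  qed
qed

section \<open>Directional derivatives of Lipschitz functions\<close>

definition diffquot :: "('a::real_vector \<Rightarrow> real) \<Rightarrow> 'a \<Rightarrow> 'a \<Rightarrow> real \<Rightarrow> real" where
  "diffquot u v x t = (u (x + t *\<^sub>R v) - u x) / t"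

text \<open>For continuous \<open>u\<close> a limit along one fixed sequence is Borel measurable as
  a function of the point, whatever its value where the quotients diverge. It is the directional
  derivative wherever that exists.\<close>

definition dirderiv :: "('a::real_vector \<Rightarrow> real) \<Rightarrow> 'a \<Rightarrow> 'a \<Rightarrow> real" where
  "dirderiv u v x = lim (\<lambda>n. diffquot u v x (1 / real (Suc n)))"

lemma abs_diffquot_le:
  fixes u :: "'a::real_normed_vector \<Rightarrow> real"
  assumes "L-lipschitz_on UNIV u"
  shows "\<bar>diffquot u v x t\<bar> \<le> L * norm v"
proof (cases "t = 0")
  case True
  then show ?thesis using lipschitz_on_nonneg[OF assms] by (simp add: diffquot_def)
next
  case False
  have "\<bar>u (x + t *\<^sub>R v) - u x\<bar> \<le> L * dist (x + t *\<^sub>R v) x"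
    using lipschitz_onD[OF assms, of "x + t *\<^sub>R v" x] by (simp add: dist_real_def)
  then show ?thesis using False by (simp add: diffquot_def dist_norm abs_divide pos_divide_le_eq mult_ac)
qed

lemma diffquot_borel[measurable]:
  fixes u :: "'a::euclidean_space \<Rightarrow> real"
  assumes "continuous_on UNIV u"
  shows "(\<lambda>x. diffquot u v x t) \<in> borel_measurable borel"
proof -
  have [measurable]: "u \<in> borel_measurable borel" using assms by (rule borel_measurable_continuous_onI)
  show ?thesis unfolding diffquot_def by measurable
qed

lemma dirderiv_borel[measurable]:
  fixes u :: "'a::euclidean_space \<Rightarrow> real"
  assumes [measurable]: "continuous_on UNIV u"
  shows "dirderiv u v \<in> borel_measurable borel"
  unfolding dirderiv_def by (intro borel_measurable_lim_metric) measurable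

lemma inverse_Suc_filterlim: "filterlim (\<lambda>n. 1 / real (Suc n)) (at 0) sequentially"
proof -
  have "(\<lambda>n. 1 / real (Suc n)) \<longlonglongrightarrow> 0" by (rule LIMSEQ_Suc, rule lim_1_over_n)
  then show ?thesis by (simp add: filterlim_at)
qed

lemma dirderiv_eq:
  assumes "(diffquot u v x \<longlongrightarrow> c) (at 0)"
  shows "dirderiv u v x = c"
  unfolding dirderiv_def
  using filterlim_compose[OF assms inverse_Suc_filterlim] by (rule limI)

text \<open>For fixed \<open>t\<close> the conditions on \<open>x\<close> are closed because
  \<open>u\<close> is continuous, so intersections over uncountably many \<open>t\<close> are closed
  as well. All other operations are indexed by naturals or rationals.\<close>

lemma diffquot_limit_borel:
  fixes u :: "'a::euclidean_space \<Rightarrow> real"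
  assumes L: "L-lipschitz_on UNIV u"
  shows "{x. \<exists>c. (diffquot u v x \<longlongrightarrow> c) (at 0)} \<in> sets borel"
proof -
  have cont: "continuous_on UNIV u" using L by (rule lipschitz_on_continuous_on)
  have ev: "eventually P (at (0::real)) \<longleftrightarrow> (\<exists>m::nat. \<forall>t\<in>{t. t \<noteq> 0 \<and> \<bar>t\<bar> < 1 / real (Suc m)}. P t)" for P
  proof
    assume "eventually P (at 0)"
    then obtain d where d: "d > 0" "\<And>t. t \<noteq> 0 \<Longrightarrow> \<bar>t\<bar> < d \<Longrightarrow> P t"
      by (auto simp: eventually_at dist_real_def)
    obtain m where "1 / real (Suc m) < d" using nat_approx_posE d(1) by blast
    then show "\<exists>m::nat. \<forall>t\<in>{t. t \<noteq> 0 \<and> \<bar>t\<bar> < 1 / real (Suc m)}. P t"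
      using d by (intro exI[of _ m]) auto
  next
    assume "\<exists>m::nat. \<forall>t\<in>{t. t \<noteq> 0 \<and> \<bar>t\<bar> < 1 / real (Suc m)}. P t"
    then obtain m :: nat where "\<forall>t\<in>{t. t \<noteq> 0 \<and> \<bar>t\<bar> < 1 / real (Suc m)}. P t" by blast
    then show "eventually P (at 0)" unfolding eventually_at
      by (intro exI[of _ "1 / real (Suc m)"]) (auto simp: dist_real_def)
  qed
  define A where "A = (\<lambda>r::real. {x. eventually (\<lambda>t. r \<le> diffquot u v x t) (at 0)})"
  define B where "B = (\<lambda>r::real. {x. eventually (\<lambda>t. diffquot u v x t \<le> r) (at 0)})"
  have cl: "continuous_on UNIV (\<lambda>x. diffquot u v x t)" for t
    unfolding diffquot_def divide_inverse by (intro continuous_intros continuous_on_compose2[OF cont]) auto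
  have A: "A r \<in> sets borel" for r
  proof -
    have "A r = (\<Union>m::nat. \<Inter>t\<in>{t. t \<noteq> 0 \<and> \<bar>t\<bar> < 1 / real (Suc m)}. {x. r \<le> diffquot u v x t})"
      by (auto simp: A_def ev)
    also have "\<dots> \<in> sets borel"
      by (intro sets.countable_UN'' borel_closed closed_INT ballI closed_Collect_le continuous_on_const cl) auto
    finally show ?thesis .
  qed
  have B: "B r \<in> sets borel" for r
  proof -
    have "B r = (\<Union>m::nat. \<Inter>t\<in>{t. t \<noteq> 0 \<and> \<bar>t\<bar> < 1 / real (Suc m)}. {x. diffquot u v x t \<le> r})"
      by (auto simp: B_def ev)
    also have "\<dots> \<in> sets borel"
      by (intro sets.countable_UN'' borel_closed closed_INT ballI closed_Collect_le continuous_on_const cl) auto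
    finally show ?thesis .
  qed
  have "{x. \<exists>c. (diffquot u v x \<longlongrightarrow> c) (at 0)} = (\<Inter>r\<in>\<rat>. \<Inter>s\<in>\<rat>. if r < s then A r \<union> B s else UNIV)"
  proof (intro set_eqI iffI)
    fix x assume "x \<in> {x. \<exists>c. (diffquot u v x \<longlongrightarrow> c) (at 0)}"
    then obtain c where c: "(diffquot u v x \<longlongrightarrow> c) (at 0)" by blast
    show "x \<in> (\<Inter>r\<in>\<rat>. \<Inter>s\<in>\<rat>. if r < s then A r \<union> B s else UNIV)"
    proof (intro INT_I)
      fix r s :: real
      show "x \<in> (if r < s then A r \<union> B s else UNIV)"
      proof (cases "r < c")
        case True
        then show ?thesis using order_tendstoD(1)[OF c True] by (auto simp: A_def elim: eventually_mono)
      next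
        case False
        have "eventually (\<lambda>t. diffquot u v x t \<le> s) (at 0)" if "r < s"
        proof -
          have "eventually (\<lambda>t. diffquot u v x t < s) (at 0)"
            using False that by (intro order_tendstoD(2)[OF c]) auto
          then show ?thesis by (rule eventually_mono) simp
        qed
        then show ?thesis by (simp add: B_def)
      qed
    qed
  next
    fix x assume x: "x \<in> (\<Inter>r\<in>\<rat>. \<Inter>s\<in>\<rat>. if r < s then A r \<union> B s else UNIV)"
    have "\<exists>c. (diffquot u v x \<longlongrightarrow> c) (at 0)"
    proof (rule tendsto_if_no_oscillation[where B="L * norm v"])
      show "eventually (\<lambda>t. \<bar>diffquot u v x t\<bar> \<le> L * norm v) (at 0)"
        using abs_diffquot_le[OF L] by simp
      show "eventually (\<lambda>t. r \<le> diffquot u v x t) (at 0) \<or> eventually (\<lambda>t. diffquot u v x t \<le> s) (at 0)"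
        if "r < s" "r \<in> \<rat>" "s \<in> \<rat>" for r s
      proof -
        have "x \<in> (if r < s then A r \<union> B s else UNIV)" using x that by blast
        then show ?thesis using that by (simp add: A_def B_def)
      qed
    qed simp
    then show "x \<in> {x. \<exists>c. (diffquot u v x \<longlongrightarrow> c) (at 0)}" by simp
  qed
  also have "\<dots> \<in> sets borel"
    using A B by (intro sets.countable_INT'' countable_rat) auto
  finally show ?thesis .
qed

lemma lipschitz_line:
  fixes u :: "'a::real_normed_vector \<Rightarrow> real"
  assumes L: "L-lipschitz_on UNIV u"
  shows "(L * norm v)-lipschitz_on UNIV (\<lambda>t. u (x + t *\<^sub>R v))"
proof (rule lipschitz_onI)
  show "0 \<le> L * norm v" using lipschitz_on_nonneg[OF L] by simp
  fix s t :: real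
  have "dist (u (x + s *\<^sub>R v)) (u (x + t *\<^sub>R v)) \<le> L * dist (x + s *\<^sub>R v) (x + t *\<^sub>R v)"
    using L by (rule lipschitz_onD) auto
  also have "dist (x + s *\<^sub>R v) (x + t *\<^sub>R v) = norm v * dist s t"
    by (simp add: dist_norm scaleR_diff_left[symmetric] del: scaleR_diff_left)
  finally show "dist (u (x + s *\<^sub>R v)) (u (x + t *\<^sub>R v)) \<le> L * norm v * dist s t" by (simp add: mult.assoc)
qed

text \<open>By the one-dimensional theorem the exceptional set meets every line of direction
  \<open>v\<close> in a null set; its Borel measurability is what Fubini's theorem asks for.\<close>

lemma AE_diffquot_limit:
  fixes u :: "'a::euclidean_space \<Rightarrow> real"
  assumes L: "L-lipschitz_on UNIV u"
  shows "AE x in lborel. (diffquot u v x \<longlongrightarrow> dirderiv u v x) (at 0)"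
proof -
  let ?G = "{x. \<exists>c. (diffquot u v x \<longlongrightarrow> c) (at 0)}"
  have G: "- ?G \<in> sets borel" using diffquot_limit_borel[OF L] by (rule borel_comp)
  have "emeasure lborel (- ?G) = 0"
  proof (rule null_set_if_null_on_lines[OF G])
    fix x
    have "AE t in lborel. (\<lambda>t. u (x + t *\<^sub>R v)) differentiable (at t)"
      by (rule lipschitz_real_AE_differentiable[OF lipschitz_line[OF L]])
    then show "AE t in lborel. x + t *\<^sub>R v \<notin> - ?G"
    proof eventually_elim
      case (elim t)
      then obtain c where "((\<lambda>t. u (x + t *\<^sub>R v)) has_real_derivative c) (at t)"
        using real_differentiableE by blast
      then have "((\<lambda>h. (u (x + (t + h) *\<^sub>R v) - u (x + t *\<^sub>R v)) / h) \<longlongrightarrow> c) (at 0)"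
        by (simp add: DERIV_def)
      then have "(diffquot u v (x + t *\<^sub>R v) \<longlongrightarrow> c) (at 0)"
        unfolding diffquot_def[abs_def] by (simp add: scaleR_add_left add.assoc)
      then show ?case by auto
    qed
  qed
  then have "AE x in lborel. x \<notin> - ?G" using G by (intro AE_not_in) (auto simp: null_sets_def)
  then show ?thesis by eventually_elim (auto dest: dirderiv_eq)
qed

lemma abs_dirderiv_le:
  fixes u :: "'a::real_normed_vector \<Rightarrow> real"
  assumes L: "L-lipschitz_on UNIV u" and "(diffquot u v x \<longlongrightarrow> c) (at 0)"
  shows "\<bar>c\<bar> \<le> L * norm v"
  using assms(2) by (intro tendsto_upperbound[OF tendsto_rabs[OF assms(2)]]) (auto simp: abs_diffquot_le[OF L])

text \<open>Additivity cannot be read off at a single point, as the limits are known for each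
  direction separately. It is proved in the weak sense: the defect of the difference quotients is
  the difference between a quotient and its own small translate, so its integral over any box tends
  to 0.\<close>

lemma dirderiv_add:
  fixes u :: "'a::euclidean_space \<Rightarrow> real"
  assumes L: "L-lipschitz_on UNIV u"
  shows "AE x in lborel. dirderiv u (v + w) x = dirderiv u v x + dirderiv u w x"
proof -
  define q where "q = (\<lambda>n v x. diffquot u v x (1 / real (Suc n)))"
  define M where "M = L * norm (v + w) + L * norm v + L * norm w"
  have cont: "continuous_on UNIV u" using L by (rule lipschitz_on_continuous_on)
  have q[measurable]: "q n v \<in> borel_measurable borel" for n v
    unfolding q_def by (rule diffquot_borel[OF cont])
  have qb: "\<bar>q n v x\<bar> \<le> L * norm v" for n v x unfolding q_def by (rule abs_diffquot_le[OF L])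
  have M: "\<bar>q n (v + w) x - q n v x - q n w x\<bar> \<le> M" for n x
    using qb[of n "v + w" x] qb[of n v x] qb[of n w x] unfolding M_def by linarith
  have "M \<ge> 0" using M[of 0 0] by linarith
  have qlim: "AE x in lborel. (\<lambda>n. q n v x) \<longlonglongrightarrow> dirderiv u v x" for v
    using AE_diffquot_limit[OF L, of v]
    unfolding q_def by eventually_elim (rule filterlim_compose[OF _ inverse_Suc_filterlim])
  have Hlim: "AE x in lborel. (\<lambda>n. q n (v + w) x - q n v x - q n w x) \<longlonglongrightarrow> dirderiv u (v + w) x - dirderiv u v x - dirderiv u w x"
    using qlim[of "v + w"] qlim[of v] qlim[of w] by eventually_elim (intro tendsto_intros)
  define H where "H = (\<lambda>x. if (\<bar>dirderiv u (v + w) x - dirderiv u v x - dirderiv u w x\<bar> \<le> M) then dirderiv u (v + w) x - dirderiv u v x - dirderiv u w x else 0)"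
  have dm[measurable]: "dirderiv u v \<in> borel_measurable borel" for v by (rule dirderiv_borel[OF cont])
  have Hm[measurable]: "H \<in> borel_measurable borel" unfolding H_def by measurable
  have Heq: "AE x in lborel. H x = dirderiv u (v + w) x - dirderiv u v x - dirderiv u w x"
    using Hlim
  proof eventually_elim
    case (elim x)
    have "\<bar>dirderiv u (v + w) x - dirderiv u v x - dirderiv u w x\<bar> \<le> M"
      using M by (intro tendsto_upperbound[OF tendsto_rabs[OF elim]]) auto
    then show ?case by (simp add: H_def)
  qed
  have "AE x in lborel. H x = 0"
  proof (rule AE_zero_if_box_integrals_zero[OF Hm])
    show "\<bar>H x\<bar> \<le> M" for x using \<open>M \<ge> 0\<close> by (simp add: H_def)
    fix a b :: 'a
    define B where "B = box a b"
    have Bint: "integrable lborel (indicator B :: 'a \<Rightarrow> real)" by (simp add: B_def emeasure_lborel_box_eq)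
    have Bm[measurable]: "B \<in> sets borel" by (simp add: B_def)
    have lim1: "(\<lambda>n. \<integral>x. (q n (v + w) x - q n v x - q n w x) * indicator B x \<partial>lborel) \<longlonglongrightarrow> (\<integral>x. H x * indicator B x \<partial>lborel)"
    proof (rule integral_dominated_convergence[where w="\<lambda>x. M * indicator B x"])
      show "integrable lborel (\<lambda>x. M * indicator B x)" using Bint by (rule integrable_mult_right)
      show "AE x in lborel. (\<lambda>n. (q n (v + w) x - q n v x - q n w x) * indicator B x) \<longlonglongrightarrow> H x * indicator B x"
        using Hlim Heq by eventually_elim (auto intro!: tendsto_intros)
      show "AE x in lborel. norm ((q n (v + w) x - q n v x - q n w x) * indicator B x) \<le> M * indicator B x" for n
        using M by (auto simp: indicator_def)
    qed auto
    obtain R where "\<forall>x\<in>B. norm x \<le> R"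
      using bounded_box[of a b] unfolding B_def bounded_iff by blast
    then have R': "norm x \<le> R" if "x \<in> B" for x using that by auto
    have eq: "(\<integral>x. (q n (v + w) x - q n v x - q n w x) * indicator B x \<partial>lborel)
        = (\<integral>x. q n w x * (indicator B (x - (1 / real (Suc n)) *\<^sub>R v) - indicator B x) \<partial>lborel)" for n
    proof -
      let ?c = "(1 / real (Suc n)) *\<^sub>R v"
      \<comment> \<open>Moving along \<open>v + w\<close> is moving along \<open>v\<close> and then
        along \<open>w\<close>; what remains is the quotient along \<open>w\<close>, taken at the
        shifted point and at \<open>x\<close>.\<close>
      have 1: "q n (v + w) x - q n v x - q n w x = q n w (x + ?c) - q n w x" for x
      proof -
        have "x + ?c + (1 / real (Suc n)) *\<^sub>R w = x + (1 / real (Suc n)) *\<^sub>R (v + w)"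
          by (simp only: scaleR_add_right add.assoc)
        then show ?thesis by (simp only: q_def diffquot_def diff_divide_distrib)
      qed
      have i1: "integrable lborel (\<lambda>x. q n w x * indicator B x)"
        using qb[of n w] by (intro Bochner_Integration.integrable_bound[OF integrable_mult_right[OF Bint, of "L * norm w"]])
          (auto simp: indicator_def intro!: AE_I2 order_trans[OF qb])
      have i2: "integrable lborel (\<lambda>x. q n w (x + ?c) * indicator B x)"
        using qb[of n w] by (intro Bochner_Integration.integrable_bound[OF integrable_mult_right[OF Bint, of "L * norm w"]])
          (auto simp: indicator_def intro!: AE_I2 order_trans[OF qb])
      have i3: "integrable lborel (\<lambda>x. q n w x * indicator B (x - ?c))"
        using integrable_lborel_shift[OF i2, of "- ?c"] by simp
      have "(\<integral>x. (q n (v + w) x - q n v x - q n w x) * indicator B x \<partial>lborel)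
          = (\<integral>x. q n w (x + ?c) * indicator B x \<partial>lborel) - (\<integral>x. q n w x * indicator B x \<partial>lborel)"
        unfolding 1 left_diff_distrib by (rule Bochner_Integration.integral_diff[OF i2 i1])
      also have "(\<integral>x. q n w (x + ?c) * indicator B x \<partial>lborel) = (\<integral>x. q n w x * indicator B (x - ?c) \<partial>lborel)"
        using integral_lborel_shift[of "\<lambda>x. q n w x * indicator B (x - ?c)" ?c] by simp
      also have "\<dots> - (\<integral>x. q n w x * indicator B x \<partial>lborel) = (\<integral>x. q n w x * (indicator B (x - ?c) - indicator B x) \<partial>lborel)"
        unfolding right_diff_distrib by (rule Bochner_Integration.integral_diff[OF i3 i1, symmetric])
      finally show ?thesis .
    qed
    have lim2: "(\<lambda>n. \<integral>x. q n w x * (indicator B (x - (1 / real (Suc n)) *\<^sub>R v) - indicator B x) \<partial>lborel) \<longlonglongrightarrow> (\<integral>x. 0 \<partial>(lborel::'a measure))"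
    proof (rule integral_dominated_convergence[where w="\<lambda>x. L * norm w * indicator (cball 0 (R + norm v)) x"])
      show "integrable lborel (\<lambda>x::'a. L * norm w * indicator (cball 0 (R + norm v)) x)"
        using emeasure_lborel_cball_finite[of "0::'a" "R + norm v"]
        by (intro integrable_mult_right integrable_real_indicator) auto
      \<comment> \<open>Off the boundary of the box the two indicators eventually agree, and the
        boundary is a null set.\<close>
      have "emeasure lborel (cbox a b - box a b) = 0"
        using emeasure_lborel_box_finite[of a b]
        by (subst emeasure_Diff) (auto simp: emeasure_lborel_box_eq emeasure_lborel_cbox_eq box_subset_cbox)
      then have "AE y in lborel. y \<notin> cbox a b - box a b" by (intro AE_not_in) (auto simp: null_sets_def)
      then show "AE x in lborel. (\<lambda>n. q n w x * (indicator B (x - (1 / real (Suc n)) *\<^sub>R v) - indicator B x)) \<longlonglongrightarrow> 0"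
      proof eventually_elim
        case (elim x)
        have "(\<lambda>n. 1 / real (Suc n)) \<longlonglongrightarrow> 0" by (rule LIMSEQ_Suc, rule lim_1_over_n)
        then have "(\<lambda>n. x - (1 / real (Suc n)) *\<^sub>R v) \<longlonglongrightarrow> x - 0 *\<^sub>R v" by (intro tendsto_intros)
        then have conv: "(\<lambda>n. x - (1 / real (Suc n)) *\<^sub>R v) \<longlonglongrightarrow> x" by simp
        have "eventually (\<lambda>n. (x - (1 / real (Suc n)) *\<^sub>R v \<in> B) = (x \<in> B)) sequentially"
        proof (cases "x \<in> box a b")
          case True
          then show ?thesis using topological_tendstoD[OF conv open_box True] by (simp add: B_def)
        next
          case False
          then have "x \<in> - cbox a b" using elim by auto
          then have "eventually (\<lambda>n. x - (1 / real (Suc n)) *\<^sub>R v \<in> - cbox a b) sequentially"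
            using topological_tendstoD[OF conv] closed_cbox by blast
          then show ?thesis by (rule eventually_mono) (use False box_subset_cbox[of a b] in \<open>auto simp: B_def\<close>)
        qed
        then have "eventually (\<lambda>n. q n w x * (indicator B (x - (1 / real (Suc n)) *\<^sub>R v) - indicator B x) = 0) sequentially"
          by eventually_elim (auto simp: indicator_def)
        then show ?case by (rule tendsto_eventually)
      qed
      show "AE x in lborel. norm (q n w x * (indicator B (x - (1 / real (Suc n)) *\<^sub>R v) - indicator B x)) \<le> L * norm w * indicator (cball 0 (R + norm v)) x" for n
      proof (rule AE_I2)
        fix x
        let ?y = "x - (1 / real (Suc n)) *\<^sub>R v"
        have nv: "norm ((1 / real (Suc n)) *\<^sub>R v) \<le> norm v"
        proof -
          have "1 / real (Suc n) * norm v \<le> 1 * norm v" by (intro mult_right_mono) auto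
          then show ?thesis by simp
        qed
        have "norm x \<le> R + norm v" if "?y \<in> B"
        proof -
          have "norm x = norm (?y + (1 / real (Suc n)) *\<^sub>R v)" by simp
          also have "\<dots> \<le> norm ?y + norm ((1 / real (Suc n)) *\<^sub>R v)" by (rule norm_triangle_ineq)
          also have "\<dots> \<le> R + norm v" using R'[OF that] nv by simp
          finally show ?thesis .
        qed
        moreover have "norm x \<le> R + norm v" if "x \<in> B" using R'[OF that] norm_ge_zero[of v] by linarith
        ultimately show "norm (q n w x * (indicator B ?y - indicator B x)) \<le> L * norm w * indicator (cball 0 (R + norm v)) x"
          using qb[of n w x] order_trans[OF abs_ge_zero qb[of n w x]] by (auto simp: indicator_def)
      qed
    qed auto
    show "(\<integral>x. H x * indicator (box a b) x \<partial>lborel) = 0"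
      using LIMSEQ_unique[OF lim1[unfolded eq] lim2] by (simp add: B_def)
  qed
  then show ?thesis using Heq by eventually_elim simp
qed

lemma dirderiv_scaleR:
  fixes u :: "'a::euclidean_space \<Rightarrow> real"
  assumes L: "L-lipschitz_on UNIV u"
  shows "AE x in lborel. dirderiv u (c *\<^sub>R v) x = c * dirderiv u v x"
proof (cases "c = 0")
  case True
  then show ?thesis by (simp add: dirderiv_def diffquot_def)
next
  case False
  show ?thesis using AE_diffquot_limit[OF L, of v]
  proof eventually_elim
    case (elim x)
    have "filterlim (\<lambda>t. t * c) (at 0) (at 0)"
      using False by (simp add: filterlim_at eventually_at_filter tendsto_mult_left_zero)
    from filterlim_compose[OF elim this]
    have "((\<lambda>t. c * diffquot u v x (t * c)) \<longlongrightarrow> c * dirderiv u v x) (at 0)" by (rule tendsto_mult_left)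
    moreover have "(\<lambda>t. c * diffquot u v x (t * c)) = diffquot u (c *\<^sub>R v) x"
      using False by (auto simp: diffquot_def fun_eq_iff)
    ultimately show ?case by (intro dirderiv_eq) simp
  qed
qed

lemma dirderiv_sum:
  fixes u :: "'a::euclidean_space \<Rightarrow> real"
  assumes L: "L-lipschitz_on UNIV u" and "finite S"
  shows "AE x in lborel. dirderiv u (\<Sum>b\<in>S. r b *\<^sub>R b) x = (\<Sum>b\<in>S. r b * dirderiv u b x)"
  using assms(2)
proof (induction S)
  case empty
  then show ?case by (simp add: dirderiv_def diffquot_def)
next
  case (insert b S)
  show ?case
    using insert.IH dirderiv_scaleR[OF L, of "r b" b] dirderiv_add[OF L, of "r b *\<^sub>R b" "\<Sum>b\<in>S. r b *\<^sub>R b"]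
    by eventually_elim (simp add: insert.hyps)
qed

definition dirgrad :: "('a::euclidean_space \<Rightarrow> real) \<Rightarrow> 'a \<Rightarrow> 'a" where
  "dirgrad u x = (\<Sum>b\<in>Basis. dirderiv u b x *\<^sub>R b)"

text \<open>The unit sphere is compact, so finitely many directions of \<open>D\<close> come within
  \<open>d\<close> of every unit vector. Their quotients converge simultaneously, and the Lipschitz
  bound transfers the estimate to all other directions.\<close>

lemma has_gradient_if_dense_directions:
  fixes u :: "'a::euclidean_space \<Rightarrow> real"
  assumes L: "L-lipschitz_on UNIV u"
    and D: "\<And>X. open X \<Longrightarrow> X \<noteq> {} \<Longrightarrow> \<exists>d\<in>D. d \<in> X"
    and lim: "\<And>v. v \<in> D \<Longrightarrow> (diffquot u v x \<longlongrightarrow> v \<bullet> g) (at 0)"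
  shows "GDERIV u x :> g"
proof -
  have L0: "L \<ge> 0" using L by (rule lipschitz_on_nonneg)
  show ?thesis
    unfolding gderiv_def has_derivative_at_alt
  proof (intro conjI allI impI)
    show "bounded_linear (\<lambda>h. h \<bullet> g)" by (rule bounded_linear_inner_left)
    fix e :: real assume "e > 0"
    \<comment> \<open>The errors from replacing the direction in \<open>u\<close>, from the limit,
      and from replacing the direction in the linear part add up to
      \<open>t * d * (L + norm g + 1)\<close>.\<close>
    define d where "d = e / (L + norm g + 1)"
    have d0: "d > 0" using \<open>e > 0\<close> L0 by (simp add: d_def add_nonneg_pos)
    have "compact (sphere (0::'a) 1)" by simp
    moreover have "sphere (0::'a) 1 \<subseteq> \<Union>((\<lambda>v. ball v d) ` D)"
    proof
      fix w :: 'a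
      obtain v where "v \<in> D" "v \<in> ball w d" using D[of "ball w d"] d0 by auto
      then show "w \<in> \<Union>((\<lambda>v. ball v d) ` D)" by (auto simp: dist_commute)
    qed
    ultimately obtain D' where D': "D' \<subseteq> D" "finite D'" "sphere (0::'a) 1 \<subseteq> \<Union>((\<lambda>v. ball v d) ` D')"
      by (elim compactE_image) auto
    have "eventually (\<lambda>t. \<forall>v\<in>D'. dist (diffquot u v x t) (v \<bullet> g) < d) (at 0)"
      using D' lim d0 by (intro eventually_ball_finite) (auto dest!: subsetD intro: tendstoD)
    then obtain r where r: "r > 0" "\<And>t v. t \<noteq> 0 \<Longrightarrow> \<bar>t\<bar> < r \<Longrightarrow> v \<in> D' \<Longrightarrow> \<bar>diffquot u v x t - v \<bullet> g\<bar> < d"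
      by (auto simp: eventually_at dist_real_def)
    show "\<exists>r>0. \<forall>y. norm (y - x) < r \<longrightarrow> norm (u y - u x - (y - x) \<bullet> g) \<le> e * norm (y - x)"
    proof (intro exI[of _ r] conjI allI impI r(1))
      fix y assume y: "norm (y - x) < r"
      show "norm (u y - u x - (y - x) \<bullet> g) \<le> e * norm (y - x)"
      proof (cases "y = x")
        case False
        define t where "t = norm (y - x)"
        define w where "w = (1 / t) *\<^sub>R (y - x)"
        have t: "t > 0" "t < r" using False y by (auto simp: t_def)
        have w: "norm w = 1" "y = x + t *\<^sub>R w" using t by (auto simp: w_def t_def)
        obtain v where v: "v \<in> D'" "dist v w < d" using D'(3) w by auto
        have 1: "\<bar>u (x + t *\<^sub>R w) - u (x + t *\<^sub>R v)\<bar> \<le> L * (t * d)"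
        proof -
          have "\<bar>u (x + t *\<^sub>R w) - u (x + t *\<^sub>R v)\<bar> \<le> L * dist (x + t *\<^sub>R w) (x + t *\<^sub>R v)"
            using lipschitz_onD[OF L, of "x + t *\<^sub>R w" "x + t *\<^sub>R v"] by (simp add: dist_real_def)
          also have "dist (x + t *\<^sub>R w) (x + t *\<^sub>R v) = t * dist v w"
            using t by (simp add: dist_norm scaleR_diff_right[symmetric] norm_minus_commute del: scaleR_diff_right)
          also have "L * (t * dist v w) \<le> L * (t * d)" using v t L0 by (intro mult_left_mono) auto
          finally show ?thesis .
        qed
        have 2: "\<bar>u (x + t *\<^sub>R v) - u x - t * (v \<bullet> g)\<bar> \<le> t * d"
        proof -
          have "u (x + t *\<^sub>R v) - u x - t * (v \<bullet> g) = t * (diffquot u v x t - v \<bullet> g)"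
            using t by (simp add: diffquot_def field_simps)
          then show ?thesis using r(2)[of t v] t v by (simp add: abs_mult)
        qed
        have 3: "\<bar>t * (v \<bullet> g) - t * (w \<bullet> g)\<bar> \<le> t * d * norm g"
        proof -
          have "\<bar>(v - w) \<bullet> g\<bar> \<le> norm (v - w) * norm g" by (rule Cauchy_Schwarz_ineq2)
          also have "\<dots> \<le> d * norm g" using v by (intro mult_right_mono) (auto simp: dist_norm)
          finally have "t * \<bar>(v - w) \<bullet> g\<bar> \<le> t * (d * norm g)" using t by simp
          moreover have "\<bar>t * (v \<bullet> g) - t * (w \<bullet> g)\<bar> = t * \<bar>(v - w) \<bullet> g\<bar>"
            using t by (simp add: right_diff_distrib[symmetric] inner_diff_left abs_mult)
          ultimately show ?thesis by (simp add: mult.assoc)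
        qed
        have "norm (u y - u x - (y - x) \<bullet> g) = \<bar>u (x + t *\<^sub>R w) - u x - t * (w \<bullet> g)\<bar>"
          using w by simp
        also have "\<dots> \<le> L * (t * d) + t * d + t * d * norm g" using 1 2 3 by linarith
        also have "\<dots> = t * (d * (L + norm g + 1))" by (simp add: algebra_simps)
        also have "L + norm g + 1 > 0" using L0 norm_ge_zero[of g] by linarith
        then have "d * (L + norm g + 1) = e" by (simp add: d_def)
        finally show ?thesis by (simp add: t_def mult.commute)
      qed simp
    qed
  qed
qed

theorem rademacher:
  fixes u :: "'a::euclidean_space \<Rightarrow> real"
  assumes L: "L-lipschitz_on UNIV u"
  shows "AE x in lborel. GDERIV u x :> dirgrad u x"
proof -
  obtain D :: "'a set" where "countable D \<and> (\<forall>X. open X \<longrightarrow> X \<noteq> {} \<longrightarrow> (\<exists>d\<in>D. d \<in> X))"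
    using countable_dense_exists by (rule exE)
  then have D: "countable D" "\<And>X. open X \<Longrightarrow> X \<noteq> {} \<Longrightarrow> \<exists>d\<in>D. d \<in> X" by blast+
  have "AE x in lborel. \<forall>v\<in>D. (diffquot u v x \<longlongrightarrow> v \<bullet> dirgrad u x) (at 0)"
  proof (subst AE_ball_countable[OF D(1)], intro ballI)
    fix v :: 'a
    show "AE x in lborel. (diffquot u v x \<longlongrightarrow> v \<bullet> dirgrad u x) (at 0)"
      using AE_diffquot_limit[OF L, of v] dirderiv_sum[OF L finite_Basis, of "\<lambda>b. v \<bullet> b"]
    proof eventually_elim
      case (elim x)
      have "dirderiv u v x = (\<Sum>b\<in>Basis. (v \<bullet> b) * dirderiv u b x)"
        using elim(2) by (simp add: euclidean_representation)
      also have "\<dots> = v \<bullet> dirgrad u x" by (simp add: dirgrad_def inner_sum_right mult.commute)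
      finally show ?case using elim(1) by simp
    qed
  qed
  then show ?thesis by eventually_elim (rule has_gradient_if_dense_directions[OF L D(2)], auto)
qed

section \<open>Gradients of Lipschitz functions\<close>

lemma gradient_eq: "GDERIV u x :> g \<Longrightarrow> gradient u x = g"
  unfolding gradient_def
proof (rule the_equality)
  fix D assume "GDERIV u x :> g" "GDERIV u x :> D"
  then have "(\<lambda>h. h \<bullet> D) = (\<lambda>h. h \<bullet> g)"
    unfolding gderiv_def by (rule has_derivative_unique[rotated])
  then have "\<forall>h. h \<bullet> D = h \<bullet> g" by (metis (mono_tags))
  then show "D = g" by (simp add: vector_eq_ldot)
qed

lemma GDERIV_gradient:
  fixes u :: "'a::euclidean_space \<Rightarrow> real"
  assumes "u differentiable (at x)"
  shows "GDERIV u x :> gradient u x"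
proof -
  obtain f' where f': "(u has_derivative f') (at x)" using assms unfolding differentiable_def by blast
  then have lin: "linear f'" by (rule has_derivative_linear)
  have "f' h = h \<bullet> (\<Sum>b\<in>Basis. f' b *\<^sub>R b)" for h
  proof -
    have "f' h = f' (\<Sum>b\<in>Basis. (h \<bullet> b) *\<^sub>R b)" by (simp add: euclidean_representation)
    also have "\<dots> = h \<bullet> (\<Sum>b\<in>Basis. f' b *\<^sub>R b)"
      by (simp add: linear_sum[OF lin] linear_scale[OF lin] inner_sum_right mult.commute)
    finally show ?thesis .
  qed
  then have "GDERIV u x :> (\<Sum>b\<in>Basis. f' b *\<^sub>R b)"
    unfolding gderiv_def using f' by (metis (no_types, lifting) ext)
  then show ?thesis using gradient_eq by metis
qed

lemma GDERIV_imp_gradient: "GDERIV u x :> g \<Longrightarrow> GDERIV u x :> gradient u x"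
  using gradient_eq by metis

text \<open>The default value of \<open>gradient\<close> is one constant for all functions and
  points. Measurability of \<open>gradient\<close> therefore reduces to that of
  \<open>dirgrad\<close> and of the set of points of differentiability.\<close>

lemma gradient_not_differentiable:
  assumes "\<not> GDERIV u x :> gradient u x"
  shows "gradient u x = (THE D. False)"
proof -
  have "(\<lambda>D. GDERIV u x :> D) = (\<lambda>D. False)" using assms GDERIV_imp_gradient by blast
  then show ?thesis unfolding gradient_def by simp
qed

lemma AE_GDERIV:
  fixes u :: "'a::euclidean_space \<Rightarrow> real"
  assumes "L-lipschitz_on UNIV u"
  shows "AE x in lborel. GDERIV u x :> gradient u x"
  using rademacher[OF assms] by eventually_elim (rule GDERIV_imp_gradient)

lemma diffquot_tendsto:
  assumes "GDERIV u x :> g"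
  shows "(diffquot u v x \<longlongrightarrow> v \<bullet> g) (at 0)"
proof -
  have "((\<lambda>t. x + t *\<^sub>R v) has_derivative (\<lambda>t. t *\<^sub>R v)) (at 0)"
    by (auto intro!: derivative_eq_intros)
  moreover have "(u has_derivative (\<lambda>h. h \<bullet> g)) (at (x + 0 *\<^sub>R v))" using assms by (simp add: gderiv_def)
  ultimately have "((\<lambda>t. u (x + t *\<^sub>R v)) has_derivative (\<lambda>t. (t *\<^sub>R v) \<bullet> g)) (at 0)"
    by (rule has_derivative_compose)
  then have "((\<lambda>t. u (x + t *\<^sub>R v)) has_real_derivative (v \<bullet> g)) (at 0)"
    unfolding has_field_derivative_def by (simp add: mult_commute_abs)
  then show ?thesis by (simp add: DERIV_def diffquot_def[abs_def])
qed

lemma GDERIV_line: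
  assumes "GDERIV u (x + t *\<^sub>R v) :> g"
  shows "((\<lambda>t. u (x + t *\<^sub>R v)) has_real_derivative (v \<bullet> g)) (at t)"
proof -
  have "((\<lambda>t. x + t *\<^sub>R v) has_derivative (\<lambda>t. t *\<^sub>R v)) (at t)"
    by (auto intro!: derivative_eq_intros)
  from has_derivative_compose[OF this assms[unfolded gderiv_def]]
  show ?thesis unfolding has_field_derivative_def by (simp add: mult_commute_abs)
qed

lemma norm_gradient_le:
  fixes u :: "'a::euclidean_space \<Rightarrow> real"
  assumes L: "L-lipschitz_on UNIV u" and g: "GDERIV u x :> g"
  shows "norm g \<le> L"
proof -
  have "\<bar>g \<bullet> g\<bar> \<le> L * norm g" using abs_dirderiv_le[OF L diffquot_tendsto[OF g]] .
  then have "norm g * norm g \<le> L * norm g" by (simp add: norm_eq_sqrt_inner)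
  then show ?thesis using lipschitz_on_nonneg[OF L] by (cases "g = 0") auto
qed

lemma dirgrad_eq:
  fixes u :: "'a::euclidean_space \<Rightarrow> real"
  assumes "GDERIV u x :> g"
  shows "dirgrad u x = g"
proof -
  have "dirderiv u b x = b \<bullet> g" for b by (rule dirderiv_eq[OF diffquot_tendsto[OF assms]])
  then show ?thesis unfolding dirgrad_def by (simp add: inner_commute[of _ g] euclidean_representation)
qed

text \<open>Differentiability at \<open>x\<close> can be tested with countably many increments: by
  continuity the inequality that defines the derivative extends from the dense set \<open>D\<close>
  to all increments.\<close>

lemma gradient_borel:
  fixes u :: "'a::euclidean_space \<Rightarrow> real"
  assumes cont: "continuous_on UNIV u"
  shows "gradient u \<in> borel_measurable borel"
proof -
  have [measurable]: "u \<in> borel_measurable borel" using cont by (rule borel_measurable_continuous_onI)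
  have [measurable]: "dirderiv u v \<in> borel_measurable borel" for v by (rule dirderiv_borel[OF cont])
  have dg[measurable]: "dirgrad u \<in> borel_measurable borel" unfolding dirgrad_def by measurable
  obtain D :: "'a set" where "countable D \<and> (\<forall>X. open X \<longrightarrow> X \<noteq> {} \<longrightarrow> (\<exists>d\<in>D. d \<in> X))"
    using countable_dense_exists by (rule exE)
  then have D: "countable D" "\<And>X. open X \<Longrightarrow> X \<noteq> {} \<Longrightarrow> \<exists>d\<in>D. d \<in> X" by blast+
  define A where "A = (\<lambda>(n::nat) (m::nat) h. if norm h < 1 / real (Suc m)
     then {x. \<bar>u (x + h) - u x - h \<bullet> dirgrad u x\<bar> \<le> 1 / real (Suc n) * norm h} else UNIV)"
  have A: "A n m h \<in> sets borel" for n m h unfolding A_def by simp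
  have eq: "{x. GDERIV u x :> gradient u x} = (\<Inter>n. \<Union>m. \<Inter>h\<in>D. A n m h)"
  proof (intro set_eqI iffI)
    fix x assume "x \<in> {x. GDERIV u x :> gradient u x}"
    then have g: "GDERIV u x :> dirgrad u x" using dirgrad_eq by (metis mem_Collect_eq)
    show "x \<in> (\<Inter>n. \<Union>m. \<Inter>h\<in>D. A n m h)"
    proof (rule INT_I)
      fix n :: nat
      have "0 < 1 / real (Suc n)" by simp
      with g[unfolded gderiv_def has_derivative_at_alt] obtain d where d: "d > 0"
        "\<forall>y. norm (y - x) < d \<longrightarrow> norm (u y - u x - (y - x) \<bullet> dirgrad u x) \<le> 1 / real (Suc n) * norm (y - x)"
        by blast
      obtain m where m: "1 / real (Suc m) < d" using nat_approx_posE d(1) by blast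
      have "x \<in> A n m h" for h
        using d(2)[rule_format, of "x + h"] m by (auto simp: A_def)
      then show "x \<in> (\<Union>m. \<Inter>h\<in>D. A n m h)" by blast
    qed
  next
    fix x assume x: "x \<in> (\<Inter>n. \<Union>m. \<Inter>h\<in>D. A n m h)"
    have "GDERIV u x :> dirgrad u x" unfolding gderiv_def has_derivative_at_alt
    proof (intro conjI allI impI)
      show "bounded_linear (\<lambda>h. h \<bullet> dirgrad u x)" by (rule bounded_linear_inner_left)
      fix e :: real assume "e > 0"
      obtain n where n: "1 / real (Suc n) < e" using nat_approx_posE \<open>e > 0\<close> by blast
      obtain m where m: "\<And>h. h \<in> D \<Longrightarrow> x \<in> A n m h" using x by blast
      show "\<exists>d>0. \<forall>y. norm (y - x) < d \<longrightarrow> norm (u y - u x - (y - x) \<bullet> dirgrad u x) \<le> e * norm (y - x)"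
      proof (intro exI[of _ "1 / real (Suc m)"] conjI allI impI)
        fix y assume y: "norm (y - x) < 1 / real (Suc m)"
        define f where "f = (\<lambda>h. 1 / real (Suc n) * norm h - \<bar>u (x + h) - u x - h \<bullet> dirgrad u x\<bar>)"
        have fc: "continuous_on UNIV f" unfolding f_def
          by (intro continuous_intros continuous_on_compose2[OF cont]) auto
        have "f (y - x) \<ge> 0"
        proof (rule ccontr)
          assume "\<not> ?thesis"
          then have "y - x \<in> f -` {..<0} \<inter> ball 0 (1 / real (Suc m))" using y by (simp add: dist_norm norm_minus_commute)
          then have "f -` {..<0} \<inter> ball 0 (1 / real (Suc m)) \<noteq> {}" by blast
          moreover have "open (f -` {..<0} \<inter> ball 0 (1 / real (Suc m)))"
            using fc by (intro open_Int open_vimage) auto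
          ultimately obtain h where "h \<in> D" "h \<in> f -` {..<0} \<inter> ball 0 (1 / real (Suc m))"
            using D(2) by meson
          then have "h \<in> D" "f h < 0" "norm h < 1 / real (Suc m)" by (auto simp: dist_norm)
          then show False using m[of h] by (simp add: A_def f_def)
        qed
        then have "norm (u y - u x - (y - x) \<bullet> dirgrad u x) \<le> 1 / real (Suc n) * norm (y - x)" by (simp add: f_def)
        also have "\<dots> \<le> e * norm (y - x)" using n by (intro mult_right_mono) auto
        finally show "norm (u y - u x - (y - x) \<bullet> dirgrad u x) \<le> e * norm (y - x)" .
      qed simp
    qed
    then show "x \<in> {x. GDERIV u x :> gradient u x}" by (auto intro: GDERIV_imp_gradient)
  qed
  have G[measurable]: "{x. GDERIV u x :> gradient u x} \<in> sets borel"
    unfolding eq by (intro sets.countable_INT'' sets.countable_UN'' sets.countable_INT' A D(1)) auto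
  have "gradient u = (\<lambda>x. if x \<in> {x. GDERIV u x :> gradient u x} then dirgrad u x else (THE D. False))"
    using dirgrad_eq gradient_not_differentiable by fastforce
  also have "\<dots> \<in> borel_measurable borel" by measurable
  finally show ?thesis .
qed

section \<open>Integrating gradients along segments\<close>

lemma lipschitz_borel:
  fixes u :: "'a::euclidean_space \<Rightarrow> real"
  shows "L-lipschitz_on UNIV u \<Longrightarrow> u \<in> borel_measurable borel"
  by (intro borel_measurable_continuous_onI lipschitz_on_continuous_on)

lemma lipschitz_gradient_borel:
  fixes u :: "'a::euclidean_space \<Rightarrow> real"
  shows "L-lipschitz_on UNIV u \<Longrightarrow> gradient u \<in> borel_measurable borel"
  by (intro gradient_borel lipschitz_on_continuous_on)

text \<open>The integral of a difference quotient over the unit interval is the average of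
  \<open>f\<close> just after 1 minus its average just after 0, and these averages converge by
  continuity. The quotients themselves converge to \<open>g\<close> under the common bound
  \<open>L\<close>.\<close>

lemma lipschitz_FTC:
  fixes f :: "real \<Rightarrow> real"
  assumes L: "L-lipschitz_on UNIV f" and g[measurable]: "g \<in> borel_measurable borel"
    and deriv: "AE t in lborel. (f has_real_derivative g t) (at t)"
  shows "integrable lborel (\<lambda>t. g t * indicator {0..1} t)"
    and "(\<integral>t. g t * indicator {0..1} t \<partial>lborel) = f 1 - f 0"
proof -
  have fc: "continuous_on UNIV f" using L by (rule lipschitz_on_continuous_on)
  have fm[measurable]: "f \<in> borel_measurable borel" using L by (rule lipschitz_borel)
  define q where "q = (\<lambda>n t. (f (t + 1 / real (Suc n)) - f t) / (1 / real (Suc n)))"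
  have qm[measurable]: "q n \<in> borel_measurable borel" for n unfolding q_def by measurable
  have qb: "\<bar>q n t\<bar> \<le> L" for n t
    using abs_diffquot_le[OF L, of 1 t "1 / real (Suc n)"] by (simp add: q_def diffquot_def)
  have qlim: "AE t in lborel. (\<lambda>n. q n t) \<longlonglongrightarrow> g t"
    using deriv unfolding q_def DERIV_def
    by eventually_elim (rule filterlim_compose[OF _ inverse_Suc_filterlim])
  have wint: "integrable lborel (\<lambda>t. L * indicator {0..1::real} t)" by (intro integrable_mult_right integrable_real_indicator) auto
  have dom: "AE t in lborel. norm (q n t * indicator {0..1} t) \<le> L * indicator {0..1} t" for n
    using qb by (auto simp: indicator_def)
  have ptw: "AE t in lborel. (\<lambda>n. q n t * indicator {0..1} t) \<longlonglongrightarrow> g t * indicator {0..1} t"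
    using qlim by eventually_elim (intro tendsto_intros)
  show "integrable lborel (\<lambda>t. g t * indicator {0..1} t)"
    by (rule integrable_dominated_convergence[OF _ _ wint ptw dom]) auto
  have lim: "(\<lambda>n. \<integral>t. q n t * indicator {0..1} t \<partial>lborel) \<longlonglongrightarrow> (\<integral>t. g t * indicator {0..1} t \<partial>lborel)"
    by (rule integral_dominated_convergence[OF _ _ wint ptw dom]) auto
  \<comment> \<open>The margin keeps \<open>t + h\<close>, with \<open>t\<close> and
    \<open>h\<close> between 0 and 1, in the interior of the interval.\<close>
  obtain F where F: "\<And>x. x \<in> {-1..3} \<Longrightarrow> (F has_vector_derivative f x) (at x within {-1..3})"
    using antiderivative_continuous[of "-1" 3 f] continuous_on_subset[OF fc] by blast
  have F': "(F has_real_derivative f x) (at x)" if "-1 < x" "x < 3" for x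
  proof -
    have "at x within {-1..3} = at x" using that by (intro at_within_Icc_at)
    then show ?thesis using F[of x] that by (simp add: has_real_derivative_iff_has_vector_derivative)
  qed
  have fi: "isCont f x" for x using fc by (simp add: continuous_on_eq_continuous_at)
  have eq: "(\<integral>t. q n t * indicator {0..1} t \<partial>lborel)
     = (F (1 + 1 / real (Suc n)) - F 1) / (1 / real (Suc n)) - (F (0 + 1 / real (Suc n)) - F 0) / (1 / real (Suc n))" for n
  proof -
    let ?h = "1 / real (Suc n)"
    have h: "0 < ?h" "?h \<le> 1" by auto
    have "(\<integral>t. q n t * indicator {0..1} t \<partial>lborel) = (F (1 + ?h) - F 1) / ?h - (F (0 + ?h) - F 0) / ?h"
    proof (rule integral_FTC_Icc_real[where F="\<lambda>t. (F (t + ?h) - F t) / ?h"])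
      fix t :: real assume t: "0 \<le> t" "t \<le> 1"
      have "((\<lambda>t. F (t + ?h)) has_real_derivative f (t + ?h)) (at t)"
        using F'[of "t + ?h"] t h by (simp only: DERIV_shift)
      moreover have "(F has_real_derivative f t) (at t)" using F'[of t] t by simp
      ultimately show "((\<lambda>t. (F (t + ?h) - F t) / ?h) has_real_derivative q n t) (at t)"
        unfolding q_def by (intro DERIV_cdivide DERIV_diff)
      have "isCont (\<lambda>t. f (t + ?h)) t" by (intro continuous_intros isCont_o2[OF _ fi])
      then show "isCont (q n) t" unfolding q_def by (intro continuous_intros fi) auto
    qed simp
    then show ?thesis .
  qed
  have "(\<lambda>n. (F (1 + 1 / real (Suc n)) - F 1) / (1 / real (Suc n)) - (F (0 + 1 / real (Suc n)) - F 0) / (1 / real (Suc n)))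
      \<longlonglongrightarrow> f 1 - f 0"
    using F'[of 1] F'[of 0] unfolding DERIV_def
    by (intro tendsto_diff filterlim_compose[OF _ inverse_Suc_filterlim]) simp_all
  with lim show "(\<integral>t. g t * indicator {0..1} t \<partial>lborel) = f 1 - f 0"
    unfolding eq by (rule LIMSEQ_unique)
qed

text \<open>For almost every starting point the gradient exists almost everywhere on the line. The
  exceptional starting points are removed later, by continuity or by integration over
  \<open>x\<close>.\<close>

lemma AE_line_FTC:
  fixes u :: "'a::euclidean_space \<Rightarrow> real"
  assumes L: "L-lipschitz_on UNIV u"
  shows "AE x in lborel. integrable lborel (\<lambda>t. (v \<bullet> gradient u (x + t *\<^sub>R v)) * indicator {0..1::real} t) \<and>
    (\<integral>t. (v \<bullet> gradient u (x + t *\<^sub>R v)) * indicator {0..1::real} t \<partial>lborel) = u (x + v) - u x"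
  using AE_on_lines[OF AE_GDERIV[OF L], of v]
proof eventually_elim
  case (elim x)
  have gm[measurable]: "gradient u \<in> borel_measurable borel" by (rule lipschitz_gradient_borel[OF L])
  have m: "(\<lambda>t. v \<bullet> gradient u (x + t *\<^sub>R v)) \<in> borel_measurable borel" by measurable
  have "AE t in lborel. ((\<lambda>t. u (x + t *\<^sub>R v)) has_real_derivative (v \<bullet> gradient u (x + t *\<^sub>R v))) (at t)"
    using elim by eventually_elim (rule GDERIV_line)
  from lipschitz_FTC[OF lipschitz_line[OF L] m this] show ?case by simp
qed

lemma AE_continuous_imp_all:
  fixes f g :: "'a::euclidean_space \<Rightarrow> real"
  assumes "AE x in lborel. f x \<le> g x" and f: "continuous_on UNIV f" and g: "continuous_on UNIV g"
  shows "f x \<le> g x"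
proof (rule ccontr)
  assume a: "\<not> ?thesis"
  have op: "open {x. g x < f x}" by (intro open_Collect_less f g)
  have "{x. g x < f x} \<in> null_sets lborel"
    using assms(1) op by (subst (asm) AE_iff_null) (auto simp: not_le)
  then have "negligible {x. g x < f x}"
    using null_sets_completionI negligible_iff_null_sets by blast
  moreover have "x \<in> {x. g x < f x}" using a by (simp add: not_le)
  then have "{x. g x < f x} \<noteq> {}" by blast
  ultimately show False using open_not_negligible[OF op] by simp
qed

text \<open>The segment formula yields the estimate for almost every starting point. Both sides are
  continuous in that point, so the estimate holds everywhere. This turns the constraint on the
  gradient in \<open>admissible\<close> into the Lipschitz constant 1.\<close>

lemma lipschitz_if_gradient_le:
  fixes u :: "'a::euclidean_space \<Rightarrow> real"
  assumes L: "L-lipschitz_on UNIV u" and K: "AE x in lborel. norm (gradient u x) \<le> K" "K \<ge> 0"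
  shows "K-lipschitz_on UNIV u"
proof (rule lipschitz_onI[OF _ K(2)])
  have uc: "continuous_on UNIV u" using L by (rule lipschitz_on_continuous_on)
  have "\<bar>u (x + v) - u x\<bar> \<le> K * norm v" for x v
  proof (rule AE_continuous_imp_all[where f="\<lambda>x. \<bar>u (x + v) - u x\<bar>" and g="\<lambda>x. K * norm v"])
    show "AE x in lborel. \<bar>u (x + v) - u x\<bar> \<le> K * norm v"
      using AE_line_FTC[OF L, of v] AE_on_lines[OF K(1), of v]
    proof eventually_elim
      case (elim x)
      have "\<bar>u (x + v) - u x\<bar> = \<bar>\<integral>t. (v \<bullet> gradient u (x + t *\<^sub>R v)) * indicator {0..1::real} t \<partial>lborel\<bar>"
        using elim by simp
      also have "\<dots> \<le> (\<integral>t. \<bar>(v \<bullet> gradient u (x + t *\<^sub>R v)) * indicator {0..1::real} t\<bar> \<partial>lborel)"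
        by (rule integral_abs_bound)
      also have "\<dots> \<le> (\<integral>t. (K * norm v) * indicator {0..1::real} t \<partial>lborel)"
      proof (rule integral_mono_AE)
        show "integrable lborel (\<lambda>t. \<bar>(v \<bullet> gradient u (x + t *\<^sub>R v)) * indicator {0..1::real} t\<bar>)"
          using elim by (intro integrable_abs) auto
        show "integrable lborel (\<lambda>t. (K * norm v) * indicator {0..1::real} t)"
          by (intro integrable_mult_right integrable_real_indicator) auto
        show "AE t in lborel. \<bar>(v \<bullet> gradient u (x + t *\<^sub>R v)) * indicator {0..1::real} t\<bar> \<le> (K * norm v) * indicator {0..1::real} t"
          using elim(2)
        proof eventually_elim
          case (elim t)
          have "\<bar>v \<bullet> gradient u (x + t *\<^sub>R v)\<bar> \<le> norm v * norm (gradient u (x + t *\<^sub>R v))" by (rule Cauchy_Schwarz_ineq2)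
          also have "\<dots> \<le> norm v * K" using elim by (intro mult_left_mono) auto
          finally show ?case by (auto simp: indicator_def mult.commute)
        qed
      qed
      also have "\<dots> = K * norm v" by simp
      finally show ?case .
    qed
    show "continuous_on UNIV (\<lambda>x. \<bar>u (x + v) - u x\<bar>)"
      by (intro continuous_intros continuous_on_compose2[OF uc]) auto
  qed (rule continuous_on_const)
  from this[of _ "_ - _"] show "dist (u x) (u y) \<le> K * dist x y" for x y
    using \<open>\<And>x v. \<bar>u (x + v) - u x\<bar> \<le> K * norm v\<close>[of y "x - y"] by (simp add: dist_real_def dist_norm)
qed

text \<open>A difference quotient is the average of the directional derivative over a segment;
  Cauchy-Schwarz on the segment and translation invariance give the bound.\<close>

lemma nn_integral_diffquot_le:
  fixes u :: "'a::euclidean_space \<Rightarrow> real"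
  assumes L: "L-lipschitz_on UNIV u" and "h \<noteq> 0"
  shows "(\<integral>\<^sup>+x. ennreal ((diffquot u v x h)\<^sup>2) \<partial>lborel) \<le> (\<integral>\<^sup>+x. ennreal ((v \<bullet> gradient u x)\<^sup>2) \<partial>lborel)"
proof -
  have gm[measurable]: "gradient u \<in> borel_measurable borel" by (rule lipschitz_gradient_borel[OF L])
  let ?I = "\<lambda>t. indicator {0..1::real} t :: ennreal"
  have "(\<integral>\<^sup>+x. ennreal ((diffquot u v x h)\<^sup>2) \<partial>lborel)
     \<le> (\<integral>\<^sup>+x. \<integral>\<^sup>+t. ?I t * ennreal ((v \<bullet> gradient u (x + t *\<^sub>R (h *\<^sub>R v)))\<^sup>2) \<partial>lborel \<partial>lborel)"
  proof (rule nn_integral_mono_AE)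
    show "AE x in lborel. ennreal ((diffquot u v x h)\<^sup>2) \<le> (\<integral>\<^sup>+t. ?I t * ennreal ((v \<bullet> gradient u (x + t *\<^sub>R (h *\<^sub>R v)))\<^sup>2) \<partial>lborel)"
      using AE_line_FTC[OF L, of "h *\<^sub>R v"]
    proof eventually_elim
      case (elim x)
      let ?g = "\<lambda>t. v \<bullet> gradient u (x + t *\<^sub>R (h *\<^sub>R v))"
      have "integrable lborel (\<lambda>t. (1 / h) * (((h *\<^sub>R v) \<bullet> gradient u (x + t *\<^sub>R (h *\<^sub>R v))) * indicator {0..1::real} t))"
        using elim by (intro integrable_mult_right) auto
      then have gi: "integrable lborel (\<lambda>t. ?g t * indicator {0..1::real} t)"
        using \<open>h \<noteq> 0\<close> by simp
      have "diffquot u v x h = (1 / h) * (\<integral>t. ((h *\<^sub>R v) \<bullet> gradient u (x + t *\<^sub>R (h *\<^sub>R v))) * indicator {0..1::real} t \<partial>lborel)"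
        using elim by (simp add: diffquot_def)
      also have "\<dots> = (\<integral>t. ?g t * indicator {0..1::real} t \<partial>lborel)"
        using \<open>h \<noteq> 0\<close> by (subst integral_mult_right_zero[symmetric]) simp
      finally have "\<bar>diffquot u v x h\<bar> \<le> (\<integral>t. \<bar>?g t * indicator {0..1::real} t\<bar> \<partial>lborel)"
        using integral_abs_bound by metis
      then have "ennreal \<bar>diffquot u v x h\<bar> \<le> ennreal (\<integral>t. \<bar>?g t * indicator {0..1::real} t\<bar> \<partial>lborel)"
        by (rule ennreal_leI)
      also have "\<dots> = (\<integral>\<^sup>+t. ennreal \<bar>?g t * indicator {0..1::real} t\<bar> \<partial>lborel)"
        using gi by (intro nn_integral_eq_integral[symmetric]) auto
      also have "\<dots> = (\<integral>\<^sup>+t. (ennreal \<bar>?g t\<bar> * ?I t) * ?I t \<partial>lborel)"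
        by (intro nn_integral_cong) (auto simp: indicator_def)
      finally have "(ennreal \<bar>diffquot u v x h\<bar>)\<^sup>2 \<le> (\<integral>\<^sup>+t. (ennreal \<bar>?g t\<bar> * ?I t) * ?I t \<partial>lborel)\<^sup>2"
        by (rule power_mono) simp
      also have "\<dots> \<le> (\<integral>\<^sup>+t. (ennreal \<bar>?g t\<bar> * ?I t)\<^sup>2 \<partial>lborel) * (\<integral>\<^sup>+t. (?I t)\<^sup>2 \<partial>lborel)"
        by (rule Cauchy_Schwarz_nn_integral) auto
      also have "(\<integral>\<^sup>+t. (?I t)\<^sup>2 \<partial>lborel) = (\<integral>\<^sup>+t. ?I t \<partial>lborel)"
        by (intro nn_integral_cong) (auto simp: indicator_def)
      also have "\<dots> = 1" by simp
      also have "(\<integral>\<^sup>+t. (ennreal \<bar>?g t\<bar> * ?I t)\<^sup>2 \<partial>lborel) = (\<integral>\<^sup>+t. ?I t * ennreal ((?g t)\<^sup>2) \<partial>lborel)"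
        by (intro nn_integral_cong) (auto simp: indicator_def ennreal_power)
      finally show ?case by (simp add: ennreal_power)
    qed
  qed
  also have "\<dots> = (\<integral>\<^sup>+t. ?I t \<partial>lborel) * (\<integral>\<^sup>+x. ennreal ((v \<bullet> gradient u x)\<^sup>2) \<partial>lborel)"
    by (rule nn_integral_lborel_line) auto
  finally show ?thesis by simp
qed

lemma sum_Basis_inner_sq: "(\<Sum>b\<in>Basis. (b \<bullet> g)\<^sup>2) = (norm (g::'a::euclidean_space))\<^sup>2"
  unfolding power2_norm_eq_inner by (subst euclidean_inner) (simp add: power2_eq_square inner_commute)

abbreviation norm_sq_integral :: "('a::euclidean_space \<Rightarrow> 'b::real_normed_vector) \<Rightarrow> ennreal" where
  "norm_sq_integral g \<equiv> (\<integral>\<^sup>+x. ennreal ((norm (g x))\<^sup>2) \<partial>lborel)"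

abbreviation powr_integral :: "real \<Rightarrow> ('a::euclidean_space \<Rightarrow> real) \<Rightarrow> ennreal" where
  "powr_integral q u \<equiv> (\<integral>\<^sup>+x. ennreal (\<bar>u x\<bar> powr q) \<partial>lborel)"

lemma nn_integral_le_if_AE_tendsto:
  fixes h :: "'b \<Rightarrow> ennreal"
  assumes "\<And>n. g n \<in> borel_measurable M" "AE x in M. (\<lambda>n. g n x) \<longlonglongrightarrow> h x"
    and "\<And>n::nat. (\<integral>\<^sup>+x. g n x \<partial>M) \<le> c n" "c \<longlonglongrightarrow> C"
  shows "(\<integral>\<^sup>+x. h x \<partial>M) \<le> C"
proof -
  have "(\<integral>\<^sup>+x. h x \<partial>M) = (\<integral>\<^sup>+x. liminf (\<lambda>n. g n x) \<partial>M)"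
    using assms(2) by (intro nn_integral_cong_AE) (auto elim!: eventually_mono dest!: lim_imp_Liminf[rotated])
  also have "\<dots> \<le> liminf (\<lambda>n. \<integral>\<^sup>+x. g n x \<partial>M)" using assms(1) by (rule nn_integral_liminf)
  also have "\<dots> \<le> liminf c" using assms(3) by (intro Liminf_mono) auto
  also have "\<dots> = C" using assms(4) by (intro lim_imp_Liminf) auto
  finally show ?thesis .
qed

text \<open>For a fixed step the finite-difference version of the Dirichlet integral depends only on
  values of the function, so it passes to the pointwise limit by Fatou's lemma. A second use of
  Fatou's lemma, as the step tends to 0, recovers the gradient.\<close>

lemma gradient_norm_lsc:
  fixes u :: "'a::euclidean_space \<Rightarrow> real"
  assumes Lf: "\<And>n. (L n)-lipschitz_on UNIV (f n)" and Lu: "M-lipschitz_on UNIV u"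
    and conv: "AE x in lborel. (\<lambda>n. f n x) \<longlonglongrightarrow> u x"
    and C: "\<And>n::nat. norm_sq_integral (gradient (f n)) \<le> C"
  shows "norm_sq_integral (gradient u) \<le> C"
proof -
  define S where "S = (\<lambda>(w :: 'a \<Rightarrow> real) h x. \<Sum>b\<in>Basis. ennreal ((diffquot w b x h)\<^sup>2))"
  have dm: "(\<lambda>x. diffquot w b x h) \<in> borel_measurable borel" if "K-lipschitz_on UNIV w" for w :: "'a \<Rightarrow> real" and b h K
    using lipschitz_on_continuous_on[OF that] by (rule diffquot_borel)
  have Sm: "S w h \<in> borel_measurable borel" if "K-lipschitz_on UNIV w" for w :: "'a \<Rightarrow> real" and h K
    unfolding S_def using dm[OF that] by (intro borel_measurable_sum measurable_compose[OF _ measurable_ennreal] borel_measurable_power)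
  have Sf: "(\<integral>\<^sup>+x. S (f n) h x \<partial>lborel) \<le> C" if "h \<noteq> 0" for n h
  proof -
    have gm[measurable]: "gradient (f n) \<in> borel_measurable borel" by (rule lipschitz_gradient_borel[OF Lf])
    have "(\<integral>\<^sup>+x. S (f n) h x \<partial>lborel) = (\<Sum>b\<in>Basis. \<integral>\<^sup>+x. ennreal ((diffquot (f n) b x h)\<^sup>2) \<partial>lborel)"
      unfolding S_def using dm[OF Lf] by (intro nn_integral_sum) simp
    also have "\<dots> \<le> (\<Sum>b\<in>Basis. \<integral>\<^sup>+x. ennreal ((b \<bullet> gradient (f n) x)\<^sup>2) \<partial>lborel)"
      using that by (intro sum_mono nn_integral_diffquot_le[OF Lf])
    also have "\<dots> = (\<integral>\<^sup>+x. (\<Sum>b\<in>Basis. ennreal ((b \<bullet> gradient (f n) x)\<^sup>2)) \<partial>lborel)"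
      by (intro nn_integral_sum[symmetric]) auto
    also have "\<dots> = norm_sq_integral (gradient (f n))"
      by (intro nn_integral_cong) (simp add: sum_Basis_inner_sq)
    also have "\<dots> \<le> C" by (rule C)
    finally show ?thesis .
  qed
  have Su: "(\<integral>\<^sup>+x. S u h x \<partial>lborel) \<le> C" if "h \<noteq> 0" for h
  proof -
    have "AE x in lborel. \<forall>b\<in>Basis. (\<lambda>n. f n (x + h *\<^sub>R b)) \<longlonglongrightarrow> u (x + h *\<^sub>R b)"
    proof (subst AE_ball_countable, simp add: countable_finite, intro ballI)
      fix b :: 'a
      obtain N where N: "{x. \<not> (\<lambda>n. f n x) \<longlonglongrightarrow> u x} \<subseteq> N" "emeasure lborel N = 0" and [measurable]: "N \<in> sets borel"
        using conv by (elim AE_E) auto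
      have "(\<integral>\<^sup>+x. indicator N (x + h *\<^sub>R b) \<partial>lborel) = 0"
        using N by (subst nn_integral_lborel_shift) auto
      then have "AE x in lborel. indicator N (x + h *\<^sub>R b) = (0::ennreal)"
        by (subst (asm) nn_integral_0_iff_AE) auto
      then show "AE x in lborel. (\<lambda>n. f n (x + h *\<^sub>R b)) \<longlonglongrightarrow> u (x + h *\<^sub>R b)"
        by eventually_elim (use N in \<open>auto simp: indicator_def split: if_splits\<close>)
    qed
    with conv have lim: "AE x in lborel. (\<lambda>n. S (f n) h x) \<longlonglongrightarrow> S u h x"
    proof eventually_elim
      case (elim x)
      show ?case unfolding S_def diffquot_def using elim that
        by (intro tendsto_sum tendsto_ennrealI tendsto_intros) auto
    qed
    show ?thesis
      by (rule nn_integral_le_if_AE_tendsto[OF _ lim Sf[OF that] tendsto_const]) (use Sm[OF Lf] in simp)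
  qed
  have lim: "AE x in lborel. (\<lambda>n. S u (1 / real (Suc n)) x) \<longlonglongrightarrow> ennreal ((norm (gradient u x))\<^sup>2)"
    using AE_GDERIV[OF Lu]
  proof eventually_elim
    case (elim x)
    have "(\<lambda>n. S u (1 / real (Suc n)) x) \<longlonglongrightarrow> (\<Sum>b\<in>Basis. ennreal ((b \<bullet> gradient u x)\<^sup>2))"
      unfolding S_def
      by (intro tendsto_sum tendsto_ennrealI tendsto_power filterlim_compose[OF diffquot_tendsto[OF elim] inverse_Suc_filterlim])
    then show ?case by (simp add: sum_Basis_inner_sq)
  qed
  show ?thesis
    by (rule nn_integral_le_if_AE_tendsto[OF _ lim Su tendsto_const]) (use Sm[OF Lu] in auto)
qed

section \<open>The Sobolev inequality\<close>

text \<open>The convention x^0 = 1, also for 0 and infinity, lets factors with exponent 0 disappear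
  from products. The Gagliardo-Nirenberg induction ends at such an exponent.\<close>

definition epow :: "ennreal \<Rightarrow> real \<Rightarrow> ennreal" where
  "epow x s = (if s = 0 then 1 else if x = \<top> then \<top> else ennreal (enn2real x powr s))"

lemma epow_zero[simp]: "epow x 0 = 1" by (simp add: epow_def)

lemma epow_0_left: "s \<noteq> 0 \<Longrightarrow> epow 0 s = 0" by (simp add: epow_def)

lemma epow_one[simp]: "epow x 1 = x" by (cases x) (auto simp: epow_def)

lemma epow_ennreal: "a \<ge> 0 \<Longrightarrow> s \<noteq> 0 \<Longrightarrow> epow (ennreal a) s = ennreal (a powr s)"
  by (simp add: epow_def)

lemma epow_top: "s \<noteq> 0 \<Longrightarrow> epow \<top> s = \<top>" by (simp add: epow_def)

lemma epow_mono: "x \<le> y \<Longrightarrow> s \<ge> 0 \<Longrightarrow> epow x s \<le> epow y s"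
  by (cases x; cases y) (auto simp: epow_def top_unique intro!: ennreal_leI powr_mono2)

lemma epow_mult:
  assumes "s \<ge> 0" shows "epow (x * y) s = epow x s * epow y s"
proof (cases "s = 0")
  case False
  show ?thesis
  proof (cases x; cases y)
    fix a b :: real assume "0 \<le> a" "x = ennreal a" "0 \<le> b" "y = ennreal b"
    then show ?thesis using False by (simp add: ennreal_mult[symmetric] epow_ennreal powr_mult)
  next
    fix a :: real assume "0 \<le> a" "x = ennreal a" "y = \<top>"
    then show ?thesis using False by (cases "a = 0") (auto simp: epow_def ennreal_mult_top)
  next
    fix b :: real assume "0 \<le> b" "y = ennreal b" "x = \<top>"
    then show ?thesis using False by (cases "b = 0") (auto simp: epow_def ennreal_top_mult)
  next
    assume "x = \<top>" "y = \<top>"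
    then show ?thesis using False by (simp add: epow_def)
  qed
qed simp

lemma epow_add:
  assumes "s \<ge> 0" "t \<ge> 0" shows "epow x (s + t) = epow x s * epow x t"
proof (cases "s = 0 \<or> t = 0")
  case False
  then have "s + t \<noteq> 0" using assms by auto
  then show ?thesis using False
    by (cases x) (simp_all add: epow_ennreal epow_top ennreal_mult[symmetric] powr_add)
qed auto

lemma epow_epow:
  assumes "s \<ge> 0" "t \<ge> 0" shows "epow (epow x s) t = epow x (s * t)"
proof (cases "s = 0 \<or> t = 0")
  case True
  then show ?thesis by (auto simp: epow_def)
next
  case False
  then show ?thesis by (cases x) (simp_all add: epow_ennreal epow_top powr_powr)
qed

lemma epow_prod: "s \<ge> 0 \<Longrightarrow> epow (\<Prod>i\<in>I. f i) s = (\<Prod>i\<in>I. epow (f i) s)"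
  by (induction I rule: infinite_finite_induct) (auto simp: epow_mult, (simp add: epow_def)+)

lemma epow_const_power: "s \<ge> 0 \<Longrightarrow> epow x s ^ n = epow x (real n * s)"
  by (induction n) (simp_all add: epow_add[symmetric] algebra_simps)

lemma epow_measurable[measurable]:
  assumes [measurable]: "f \<in> borel_measurable M"
  shows "(\<lambda>x. epow (f x) s) \<in> borel_measurable M"
  unfolding epow_def by measurable

lemma epow_young:
  assumes "s \<ge> 0" "t \<ge> 0" "s + t = 1"
  shows "epow x s * epow y t \<le> ennreal s * x + ennreal t * y"
proof (cases "s = 0 \<or> t = 0")
  case True
  then show ?thesis using assms by auto
next
  case False
  show ?thesis
  proof (cases x; cases y)
    fix a b assume ab: "0 \<le> a" "x = ennreal a" "0 \<le> b" "y = ennreal b"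
    have "a powr s * b powr t \<le> s * a + t * b"
      using Youngs_inequality_0[of s t a b] assms ab by (cases "a = 0 \<or> b = 0") auto
    then show ?thesis using ab False assms
      by (simp add: epow_ennreal ennreal_mult[symmetric] ennreal_plus[symmetric] del: ennreal_plus)
  qed (use False assms in \<open>auto simp: ennreal_mult_top\<close>)
qed

lemma hoelder_epow:
  assumes [measurable]: "f \<in> borel_measurable M" "g \<in> borel_measurable M"
    and st: "s \<ge> 0" "t \<ge> 0" "s + t = 1"
  shows "(\<integral>\<^sup>+x. epow (f x) s * epow (g x) t \<partial>M) \<le> epow (\<integral>\<^sup>+x. f x \<partial>M) s * epow (\<integral>\<^sup>+x. g x \<partial>M) t"
proof (cases "s = 0 \<or> t = 0")
  case True
  then show ?thesis using st by auto
next
  case False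
  define F G where "F = (\<integral>\<^sup>+x. f x \<partial>M)" and "G = (\<integral>\<^sup>+x. g x \<partial>M)"
  show ?thesis
  proof (cases "F = 0 \<or> G = 0")
    case True
    have "AE x in M. epow (f x) s * epow (g x) t = 0"
    proof (cases "F = 0")
      case True
      then have "AE x in M. f x = 0" unfolding F_def by (subst (asm) nn_integral_0_iff_AE) auto
      then show ?thesis by eventually_elim (use False in \<open>simp add: epow_0_left\<close>)
    next
      case False
      then have "AE x in M. g x = 0" using True unfolding G_def by (subst (asm) nn_integral_0_iff_AE) auto
      then show ?thesis by eventually_elim (use \<open>\<not> (s = 0 \<or> t = 0)\<close> in \<open>simp add: epow_0_left\<close>)
    qed
    then have "(\<integral>\<^sup>+x. epow (f x) s * epow (g x) t \<partial>M) = 0" by (subst nn_integral_0_iff_AE) auto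
    then show ?thesis by simp
  next
    case nz: False
    show ?thesis
    proof (cases "F = \<top> \<or> G = \<top>")
      case True
      have "epow F s \<noteq> 0" "epow G t \<noteq> 0"
        using nz False by (cases F; cases G; simp add: epow_def)+
      then have "epow F s * epow G t = \<top>"
        using True False by (auto simp: epow_top ennreal_mult_eq_top_iff)
      then show ?thesis by (simp add: F_def G_def)
    next
      case fin: False
      obtain a b where ab: "F = ennreal a" "G = ennreal b" "a > 0" "b > 0"
        using nz fin by (cases F; cases G) (auto simp: less_le)
      have sp: "epow (f x) s * epow (g x) t = epow F s * epow G t * (epow (f x / F) s * epow (g x / G) t)" for x
      proof -
        have "epow F s * epow (f x / F) s = epow (F * (f x / F)) s" using st by (simp add: epow_mult)
        also have "F * (f x / F) = f x" using nz fin by (simp add: ennreal_times_divide ennreal_mult_divide_eq mult.commute[of F])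
        finally have 1: "epow (f x) s = epow F s * epow (f x / F) s" by simp
        have "epow G t * epow (g x / G) t = epow (G * (g x / G)) t" using st by (simp add: epow_mult)
        also have "G * (g x / G) = g x" using nz fin by (simp add: ennreal_times_divide ennreal_mult_divide_eq mult.commute[of G])
        finally have 2: "epow (g x) t = epow G t * epow (g x / G) t" by simp
        show ?thesis unfolding 1 2 by (simp add: mult_ac)
      qed
      have "(\<integral>\<^sup>+x. epow (f x) s * epow (g x) t \<partial>M) = epow F s * epow G t * (\<integral>\<^sup>+x. epow (f x / F) s * epow (g x / G) t \<partial>M)"
        unfolding sp by (intro nn_integral_cmult) measurable
      also have "\<dots> \<le> epow F s * epow G t * (\<integral>\<^sup>+x. ennreal s * (f x / F) + ennreal t * (g x / G) \<partial>M)"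
        by (intro mult_left_mono nn_integral_mono epow_young st) auto
      also have "(\<integral>\<^sup>+x. ennreal s * (f x / F) + ennreal t * (g x / G) \<partial>M) = ennreal s * (F / F) + ennreal t * (G / G)"
        by (simp add: nn_integral_add nn_integral_cmult nn_integral_divide F_def G_def)
      also have "\<dots> = 1"
      proof -
        have "F / F = 1" "G / G = 1" using nz fin by (simp_all add: ennreal_divide_self less_top zero_less_iff_neq_zero)
        then show ?thesis using st by (simp add: ennreal_plus[symmetric] del: ennreal_plus)
      qed
      finally show ?thesis by (simp add: F_def G_def)
    qed
  qed
qed

lemma hoelder_epow_prod:
  assumes "finite S" and [measurable]: "f \<in> borel_measurable M" "\<And>i. i \<in> S \<Longrightarrow> g i \<in> borel_measurable M"
    and "v \<ge> 0" "\<And>i. i \<in> S \<Longrightarrow> w i \<ge> 0" "v + (\<Sum>i\<in>S. w i) = 1"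
  shows "(\<integral>\<^sup>+x. epow (f x) v * (\<Prod>i\<in>S. epow (g i x) (w i)) \<partial>M)
    \<le> epow (\<integral>\<^sup>+x. f x \<partial>M) v * (\<Prod>i\<in>S. epow (\<integral>\<^sup>+x. g i x \<partial>M) (w i))"
  using assms
proof (induction S arbitrary: v w rule: finite_induct)
  case empty
  then show ?case by simp
next
  case (insert j S)
  \<comment> \<open>The total weight of all factors except \<open>g j\<close>; dividing by it gives
    weights of sum 1 for the induction hypothesis.\<close>
  define c where "c = 1 - w j"
  have c: "c = v + (\<Sum>i\<in>S. w i)" using insert.prems insert.hyps by (simp add: c_def)
  have w0: "w i \<ge> 0" if "i \<in> S" for i using insert.prems that by auto
  have c0: "c \<ge> 0" unfolding c using insert.prems w0 by (simp add: sum_nonneg)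
  have gm: "g i \<in> borel_measurable M" if "i \<in> S" for i using insert.prems that by auto
  have [measurable]: "g j \<in> borel_measurable M" "f \<in> borel_measurable M" using insert.prems by auto
  show ?case
  proof (cases "c = 0")
    case True
    then have "v = 0" "w j = 1" using c insert.prems(3) w0 by (auto simp: c_def sum_nonneg add_nonneg_eq_0_iff)
    moreover have "(\<Sum>i\<in>S. w i) = 0" using True c \<open>v = 0\<close> by simp
    then have "w i = 0" if "i \<in> S" for i using that w0 insert.hyps by (simp add: sum_nonneg_eq_0_iff)
    ultimately show ?thesis using insert.hyps by simp
  next
    case False
    then have cp: "c > 0" using c0 by simp
    define H where "H = (\<lambda>x. epow (f x) (v / c) * (\<Prod>i\<in>S. epow (g i x) (w i / c)))"
    have [measurable]: "H \<in> borel_measurable M" unfolding H_def using gm by measurable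
    have Hc: "epow (f x) v * (\<Prod>i\<in>S. epow (g i x) (w i)) = epow (H x) c" for x
      using cp insert.prems(3) w0 unfolding H_def
      by (simp add: epow_mult epow_prod epow_epow cong: prod.cong)
    have IH: "(\<integral>\<^sup>+x. H x \<partial>M) \<le> epow (\<integral>\<^sup>+x. f x \<partial>M) (v / c) * (\<Prod>i\<in>S. epow (\<integral>\<^sup>+x. g i x \<partial>M) (w i / c))"
      unfolding H_def
    proof (rule insert.IH)
      show "v / c + (\<Sum>i\<in>S. w i / c) = 1" using c cp by (simp add: sum_divide_distrib[symmetric] add_divide_distrib[symmetric])
    qed (use cp insert.prems w0 gm in auto)
    have "(\<integral>\<^sup>+x. epow (f x) v * (\<Prod>i\<in>insert j S. epow (g i x) (w i)) \<partial>M) = (\<integral>\<^sup>+x. epow (H x) c * epow (g j x) (w j) \<partial>M)"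
      using insert.hyps by (intro nn_integral_cong) (simp add: Hc[symmetric] mult_ac)
    also have "\<dots> \<le> epow (\<integral>\<^sup>+x. H x \<partial>M) c * epow (\<integral>\<^sup>+x. g j x \<partial>M) (w j)"
      by (rule hoelder_epow) (use c0 insert.prems in \<open>auto simp: c_def\<close>)
    also have "\<dots> \<le> epow (epow (\<integral>\<^sup>+x. f x \<partial>M) (v / c) * (\<Prod>i\<in>S. epow (\<integral>\<^sup>+x. g i x \<partial>M) (w i / c))) c * epow (\<integral>\<^sup>+x. g j x \<partial>M) (w j)"
      by (intro mult_right_mono epow_mono IH c0) auto
    also have "\<dots> = epow (\<integral>\<^sup>+x. f x \<partial>M) v * (\<Prod>i\<in>S. epow (\<integral>\<^sup>+x. g i x \<partial>M) (w i)) * epow (\<integral>\<^sup>+x. g j x \<partial>M) (w j)"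
      using cp insert.prems(3) w0 by (simp add: epow_mult epow_prod epow_epow cong: prod.cong)
    also have "\<dots> = epow (\<integral>\<^sup>+x. f x \<partial>M) v * (\<Prod>i\<in>insert j S. epow (\<integral>\<^sup>+x. g i x \<partial>M) (w i))"
      using insert.hyps by (simp add: mult_ac)
    finally show ?thesis .
  qed
qed

text \<open>The inductive form of the Gagliardo--Nirenberg argument: one coordinate is integrated out at a
  time, and Hoelder's inequality is applied to the factors that depend on it.\<close>

lemma gagliardo_induct:
  fixes f :: "('i \<Rightarrow> real) \<Rightarrow> ennreal"
  assumes "finite I" "p \<ge> 0" "(real (card I) - 1) * p \<le> 1"
    and "f \<in> borel_measurable (Pi\<^sub>M I (\<lambda>_. lborel))"
  shows "(\<integral>\<^sup>+x. epow (f x) (1 - (real (card I) - 1) * p) * (\<Prod>i\<in>I. epow (\<integral>\<^sup>+y. f (x(i := y)) \<partial>lborel) p) \<partial>(Pi\<^sub>M I (\<lambda>_. lborel)))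
    \<le> epow (\<integral>\<^sup>+x. f x \<partial>(Pi\<^sub>M I (\<lambda>_. lborel))) (1 + p)"
  using assms(1,3,4)
proof (induction I arbitrary: f rule: finite_induct)
  case empty
  then show ?case by (simp add: nn_integral_empty product_sigma_finite.nn_integral_empty product_sigma_finite_def lborel.sigma_finite_measure_axioms)
next
  case (insert j I)
  interpret product_sigma_finite "\<lambda>_::'i. lborel :: real measure"
    by (simp add: product_sigma_finite_def lborel.sigma_finite_measure_axioms)
  let ?P = "Pi\<^sub>M I (\<lambda>_. lborel :: real measure)" and ?Q = "Pi\<^sub>M (insert j I) (\<lambda>_. lborel :: real measure)"
  have fm[measurable]: "f \<in> borel_measurable ?Q" using insert.prems by simp
  have cardI: "real (card (insert j I)) - 1 = real (card I)" using insert.hyps by simp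
  define F where "F = (\<lambda>x. \<integral>\<^sup>+y. f (x(j := y)) \<partial>lborel)"
  have Fm[measurable]: "F \<in> borel_measurable ?P" unfolding F_def by measurable
  have upd: "(\<lambda>(x, y). x(i := y)) \<in> measurable (?Q \<Otimes>\<^sub>M lborel) ?Q" if "i \<in> insert j I" for i
    unfolding split_beta' using that by (intro measurable_fun_upd[where J="insert j I"]) auto
  have gm: "(\<lambda>x. \<integral>\<^sup>+y. f (x(i := y)) \<partial>lborel) \<in> borel_measurable ?Q" if "i \<in> insert j I" for i
    using measurable_compose[OF upd[OF that] fm]
    by (intro lborel.borel_measurable_nn_integral) (simp add: split_beta')
  have le1: "real (card I) * p \<le> 1" using insert.prems cardI by simp
  have IHc: "(real (card I) - 1) * p \<le> 1" using le1 \<open>p \<ge> 0\<close> by (simp add: left_diff_distrib)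
  have Gm: "(\<lambda>x. epow (f x) (1 - real (card I) * p) * (\<Prod>i\<in>insert j I. epow (\<integral>\<^sup>+y. f (x(i := y)) \<partial>lborel) p)) \<in> borel_measurable ?Q"
    using gm by (intro borel_measurable_times_ennreal borel_measurable_prod_ennreal epow_measurable fm) auto
  have inner: "(\<integral>\<^sup>+y. epow (f (x(j := y))) (1 - real (card I) * p) * (\<Prod>i\<in>insert j I. epow (\<integral>\<^sup>+z. f (x(j := y, i := z)) \<partial>lborel) p) \<partial>lborel)
      \<le> epow (F x) (1 - (real (card I) - 1) * p) * (\<Prod>i\<in>I. epow (\<integral>\<^sup>+z. F (x(i := z)) \<partial>lborel) p)"
    if x: "x \<in> space ?P" for x
  proof -
    define g where "g = (\<lambda>i y. \<integral>\<^sup>+z. f (x(i := z, j := y)) \<partial>lborel)"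
    have ne: "i \<noteq> j" if "i \<in> I" for i using that insert.hyps by auto
    have fj: "(\<lambda>y. f (x(j := y))) \<in> borel_measurable lborel"
      using measurable_compose[OF measurable_component_update[OF x insert.hyps(2)] fm] .
    have pm: "(\<lambda>(y, z). f (x(i := z, j := y))) \<in> borel_measurable (lborel \<Otimes>\<^sub>M lborel)" if "i \<in> I" for i
    proof -
      have 1: "(\<lambda>yz. x(i := snd yz)) \<in> measurable (lborel \<Otimes>\<^sub>M lborel :: (real \<times> real) measure) ?P"
        using that x by (intro measurable_fun_upd[where J=I] measurable_const) auto
      have "(\<lambda>yz. (x(i := snd yz))(j := fst yz)) \<in> measurable (lborel \<Otimes>\<^sub>M lborel :: (real \<times> real) measure) ?Q"
        by (intro measurable_fun_upd[where J=I] 1) auto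
      from measurable_compose[OF this fm] show ?thesis by (simp add: split_beta')
    qed
    have gmi: "g i \<in> borel_measurable lborel" if "i \<in> I" for i
      unfolding g_def using pm[OF that] by (rule lborel.borel_measurable_nn_integral)
    \<comment> \<open>The factor for \<open>i = j\<close> does not depend on \<open>y\<close> and is
      pulled out. The remaining weights, \<open>1 - card I * p\<close> for \<open>f\<close> and
      \<open>p\<close> for each \<open>i\<close> in \<open>I\<close>, add up to 1.\<close>
    have "(\<integral>\<^sup>+y. epow (f (x(j := y))) (1 - real (card I) * p) * (\<Prod>i\<in>insert j I. epow (\<integral>\<^sup>+z. f (x(j := y, i := z)) \<partial>lborel) p) \<partial>lborel)
       = (\<integral>\<^sup>+y. epow (F x) p * (epow (f (x(j := y))) (1 - real (card I) * p) * (\<Prod>i\<in>I. epow (g i y) p)) \<partial>lborel)"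
    proof (rule nn_integral_cong)
      fix y
      have tw: "x(j := y, i := z) = x(i := z, j := y)" if "i \<in> I" for i z using ne[OF that] by auto
      have "(\<Prod>i\<in>I. epow (\<integral>\<^sup>+z. f (x(j := y, i := z)) \<partial>lborel) p) = (\<Prod>i\<in>I. epow (g i y) p)"
        unfolding g_def using tw by (intro prod.cong refl) simp
      then show "epow (f (x(j := y))) (1 - real (card I) * p) * (\<Prod>i\<in>insert j I. epow (\<integral>\<^sup>+z. f (x(j := y, i := z)) \<partial>lborel) p)
        = epow (F x) p * (epow (f (x(j := y))) (1 - real (card I) * p) * (\<Prod>i\<in>I. epow (g i y) p))"
        using insert.hyps by (simp add: F_def mult_ac)
    qed
    also have "\<dots> = epow (F x) p * (\<integral>\<^sup>+y. epow (f (x(j := y))) (1 - real (card I) * p) * (\<Prod>i\<in>I. epow (g i y) p) \<partial>lborel)"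
      using gmi by (intro nn_integral_cmult borel_measurable_times_ennreal borel_measurable_prod_ennreal epow_measurable fj) auto
    also have "\<dots> \<le> epow (F x) p * (epow (\<integral>\<^sup>+y. f (x(j := y)) \<partial>lborel) (1 - real (card I) * p) * (\<Prod>i\<in>I. epow (\<integral>\<^sup>+y. g i y \<partial>lborel) p))"
      using le1 \<open>p \<ge> 0\<close> gmi by (intro mult_left_mono hoelder_epow_prod insert.hyps fj) auto
    also have "(\<Prod>i\<in>I. epow (\<integral>\<^sup>+y. g i y \<partial>lborel) p) = (\<Prod>i\<in>I. epow (\<integral>\<^sup>+z. F (x(i := z)) \<partial>lborel) p)"
    proof (intro prod.cong refl arg_cong2[where f=epow])
      fix i assume "i \<in> I"
      show "(\<integral>\<^sup>+y. g i y \<partial>lborel) = (\<integral>\<^sup>+z. F (x(i := z)) \<partial>lborel)"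
        unfolding g_def F_def using pm[OF \<open>i \<in> I\<close>] by (rule lborel_pair.Fubini'[symmetric])
    qed
    also have "epow (F x) p * (epow (\<integral>\<^sup>+y. f (x(j := y)) \<partial>lborel) (1 - real (card I) * p) * (\<Prod>i\<in>I. epow (\<integral>\<^sup>+z. F (x(i := z)) \<partial>lborel) p))
       = epow (F x) (p + (1 - real (card I) * p)) * (\<Prod>i\<in>I. epow (\<integral>\<^sup>+z. F (x(i := z)) \<partial>lborel) p)"
      using le1 \<open>p \<ge> 0\<close> by (subst epow_add) (auto simp: F_def mult.assoc)
    also have "p + (1 - real (card I) * p) = 1 - (real (card I) - 1) * p" by (simp add: algebra_simps)
    finally show ?thesis .
  qed
  have "(\<integral>\<^sup>+x. epow (f x) (1 - (real (card (insert j I)) - 1) * p) * (\<Prod>i\<in>insert j I. epow (\<integral>\<^sup>+y. f (x(i := y)) \<partial>lborel) p) \<partial>?Q)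
     = (\<integral>\<^sup>+x. \<integral>\<^sup>+y. epow (f (x(j := y))) (1 - real (card I) * p) * (\<Prod>i\<in>insert j I. epow (\<integral>\<^sup>+z. f (x(j := y, i := z)) \<partial>lborel) p) \<partial>lborel \<partial>?P)"
    unfolding cardI by (rule product_nn_integral_insert[OF insert.hyps Gm])
  also have "\<dots> \<le> (\<integral>\<^sup>+x. epow (F x) (1 - (real (card I) - 1) * p) * (\<Prod>i\<in>I. epow (\<integral>\<^sup>+z. F (x(i := z)) \<partial>lborel) p) \<partial>?P)"
    by (rule nn_integral_mono) (rule inner)
  also have "\<dots> \<le> epow (\<integral>\<^sup>+x. F x \<partial>?P) (1 + p)" by (rule insert.IH[OF IHc Fm])
  also have "(\<integral>\<^sup>+x. F x \<partial>?P) = (\<integral>\<^sup>+x. f x \<partial>?Q)"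
    unfolding F_def by (rule product_nn_integral_insert[OF insert.hyps fm, symmetric])
  finally show ?case .
qed

text \<open>Each of the \<open>N\<close> line integrals dominates \<open>w\<close>, so the product
  of their powers with exponent \<open>1 / (N - 1)\<close> dominates the power of \<open>w\<close>
  on the left. In coordinates this product is the one estimated by
  \<open>gagliardo_induct\<close>.\<close>

theorem gagliardo_nirenberg:
  fixes f :: "'a::euclidean_space \<Rightarrow> ennreal"
  assumes dim: "DIM('a) \<ge> 2" and f[measurable]: "f \<in> borel_measurable borel" and w[measurable]: "w \<in> borel_measurable borel"
    and le: "\<And>x b. b \<in> Basis \<Longrightarrow> w x \<le> (\<integral>\<^sup>+t. f (x + t *\<^sub>R b) \<partial>lborel)"
  shows "(\<integral>\<^sup>+x. epow (w x) (real DIM('a) / (real DIM('a) - 1)) \<partial>lborel) \<le> epow (\<integral>\<^sup>+x. f x \<partial>lborel) (real DIM('a) / (real DIM('a) - 1))"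
proof -
  define n where "n = real DIM('a)"
  \<comment> \<open>With this exponent the power of \<open>f\<close> in the inductive inequality is
    0 and only the line integrals remain.\<close>
  define p where "p = 1 / (n - 1)"
  have n: "n \<ge> 2" using dim by (simp add: n_def)
  have p: "p \<ge> 0" "(n - 1) * p = 1" "1 + p = n / (n - 1)" "n * p = n / (n - 1)"
    using n by (auto simp: p_def field_simps)
  let ?P = "Pi\<^sub>M (Basis::'a set) (\<lambda>_. lborel :: real measure)"
  let ?E = "\<lambda>x. \<Sum>b\<in>Basis. x b *\<^sub>R (b::'a)"
  have Em[measurable]: "?E \<in> measurable ?P borel" by measurable
  have fE: "(\<integral>\<^sup>+x. h x \<partial>lborel) = (\<integral>\<^sup>+x. h (?E x) \<partial>?P)" if "h \<in> borel_measurable borel" for h :: "'a \<Rightarrow> ennreal"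
    using that by (subst lborel_eq) (simp add: nn_integral_distr[OF Em])
  have upd: "?E (x(b := y)) = ?E x + (y - x b) *\<^sub>R b" if "b \<in> Basis" for x b y
  proof -
    have "?E (x(b := y)) = y *\<^sub>R b + (\<Sum>c\<in>Basis - {b}. x c *\<^sub>R c)"
      using that by (subst sum.remove[of _ b]) auto
    moreover have "?E x = x b *\<^sub>R b + (\<Sum>c\<in>Basis - {b}. x c *\<^sub>R c)"
      using that by (subst sum.remove[of _ b]) auto
    ultimately show ?thesis by (simp add: scaleR_diff_left)
  qed
  have line: "w (?E x) \<le> (\<integral>\<^sup>+y. f (?E (x(b := y))) \<partial>lborel)" if "b \<in> Basis" for x b
  proof -
    have "(\<integral>\<^sup>+y. f (?E (x(b := y))) \<partial>lborel) = (\<integral>\<^sup>+y. f (?E x + (y + - x b) *\<^sub>R b) \<partial>lborel)"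
      using upd[OF that] by simp
    also have "\<dots> = (\<integral>\<^sup>+t. f (?E x + t *\<^sub>R b) \<partial>lborel)"
      by (rule nn_integral_lborel_shift[where f="\<lambda>t. f (?E x + t *\<^sub>R b)"]) measurable
    finally show ?thesis using le[OF that, of "?E x"] by simp
  qed
  have "(\<integral>\<^sup>+x. epow (w x) (n / (n - 1)) \<partial>lborel) = (\<integral>\<^sup>+x. epow (w (?E x)) (n * p) \<partial>?P)"
    unfolding p by (rule fE) measurable
  also have "\<dots> = (\<integral>\<^sup>+x. epow (f (?E x)) (1 - (real (card (Basis::'a set)) - 1) * p) * (\<Prod>b\<in>(Basis::'a set). epow (w (?E x)) p) \<partial>?P)"
    using p(1,2) by (intro nn_integral_cong) (simp add: epow_const_power n_def)
  also have "\<dots> \<le> (\<integral>\<^sup>+x. epow (f (?E x)) (1 - (real (card (Basis::'a set)) - 1) * p) * (\<Prod>b\<in>(Basis::'a set). epow (\<integral>\<^sup>+y. f (?E (x(b := y))) \<partial>lborel) p) \<partial>?P)"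
    by (intro nn_integral_mono mult_left_mono prod_mono_ennreal epow_mono line p(1)) auto
  also have "\<dots> \<le> epow (\<integral>\<^sup>+x. f (?E x) \<partial>?P) (1 + p)"
    using p n by (intro gagliardo_induct) (auto simp: n_def)
  also have "(\<integral>\<^sup>+x. f (?E x) \<partial>?P) = (\<integral>\<^sup>+x. f x \<partial>lborel)" by (rule fE[symmetric]) measurable
  finally show ?thesis unfolding p n_def .
qed

section \<open>The Sobolev inequality for compactly supported functions of class C^1\<close>

definition C1_supported :: "('a::euclidean_space \<Rightarrow> real) \<Rightarrow> real \<Rightarrow> bool" where
  "C1_supported u R \<longleftrightarrow> (\<forall>x. GDERIV u x :> gradient u x) \<and> continuous_on UNIV (gradient u) \<and> (\<forall>x. R < norm x \<longrightarrow> u x = 0)"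

lemma C1_supported_GDERIV: "C1_supported u R \<Longrightarrow> GDERIV u x :> gradient u x"
  by (simp add: C1_supported_def)

lemma C1_supported_continuous: "C1_supported u R \<Longrightarrow> continuous_on UNIV u"
  unfolding C1_supported_def gderiv_def
  by (meson continuous_at_imp_continuous_on has_derivative_continuous)

lemma gradient_eq_if_open:
  assumes "open S" "x \<in> S" "\<And>y. y \<in> S \<Longrightarrow> u y = v y" "GDERIV u x :> g"
  shows "GDERIV v x :> g"
  using assms unfolding gderiv_def by (metis has_derivative_transform_within_open)

lemma GDERIV_const_zero: "GDERIV (\<lambda>x. c) x :> 0"
  by (simp add: gderiv_def)

lemma gradient_zero_outside:
  fixes u :: "'a::euclidean_space \<Rightarrow> real"
  assumes "\<And>x. R < norm x \<Longrightarrow> u x = 0" "R < norm x"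
  shows "GDERIV u x :> 0"
proof (rule gradient_eq_if_open[of "- cball 0 R" _ "\<lambda>x. 0"])
  show "GDERIV (\<lambda>x. 0) x :> 0" by (rule GDERIV_const_zero)
qed (use assms in auto)

lemma continuous_supported_bounded:
  fixes v :: "'a::euclidean_space \<Rightarrow> 'b::real_normed_vector"
  assumes "continuous_on UNIV v" "\<And>x. R < norm x \<Longrightarrow> v x = 0"
  obtains B where "B \<ge> 0" "\<And>x. norm (v x) \<le> B"
proof -
  have "bounded (v ` cball 0 R)"
    using assms(1) by (intro compact_imp_bounded compact_continuous_image) (auto intro: continuous_on_subset)
  then obtain B where B: "\<And>x. norm x \<le> R \<Longrightarrow> norm (v x) \<le> B" unfolding bounded_iff by (metis image_eqI mem_cball_0)
  have "norm (v x) \<le> max B 0" for x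
    using B[of x] assms(2)[of x] by (cases "norm x \<le> R") auto
  then show ?thesis using that[of "max B 0"] by auto
qed

lemma C1_supported_gradient_bounded:
  fixes u :: "'a::euclidean_space \<Rightarrow> real"
  assumes u: "C1_supported u R"
  obtains B where "B \<ge> 0" "\<And>x. norm (gradient u x) \<le> B"
proof (rule continuous_supported_bounded)
  show "continuous_on UNIV (gradient u)" using u by (simp add: C1_supported_def)
  show "gradient u x = 0" if "R < norm x" for x
    using that gradient_zero_outside[of R u x] gradient_eq u by (auto simp: C1_supported_def)
qed (rule that)

lemma onorm_inner_le: "onorm (\<lambda>h. h \<bullet> g) \<le> norm g"
proof (rule onorm_bound)
  show "norm (h \<bullet> g) \<le> norm g * norm h" for h using Cauchy_Schwarz_ineq2[of h g] by (simp add: mult.commute)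
qed simp

lemma C1_supported_lipschitz:
  fixes u :: "'a::euclidean_space \<Rightarrow> real"
  assumes u: "C1_supported u R"
  obtains L where "L-lipschitz_on UNIV u"
proof -
  obtain B where B: "B \<ge> 0" "\<And>x. norm (gradient u x) \<le> B" using C1_supported_gradient_bounded[OF u] by blast
  have "norm (u x - u y) \<le> B * norm (x - y)" for x y
  proof (rule differentiable_bound[of UNIV u "\<lambda>x h. h \<bullet> gradient u x"])
    show "(u has_derivative (\<lambda>h. h \<bullet> gradient u x)) (at x within UNIV)" for x
      using C1_supported_GDERIV[OF u] by (simp add: gderiv_def)
    show "onorm (\<lambda>h. h \<bullet> gradient u x) \<le> B" for x
      using onorm_inner_le B(2) by (rule order_trans)
  qed auto
  then have "B-lipschitz_on UNIV u" using B(1) by (intro lipschitz_onI) (auto simp: dist_norm)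
  then show ?thesis by (rule that)
qed

lemma test_function_C1_supported:
  fixes u :: "'a::euclidean_space \<Rightarrow> real"
  assumes "u \<in> test_functions"
  obtains R where "C1_supported u R"
proof -
  have "C_k_on (Suc 0) UNIV u" and cpt: "compact (closure {x. u x \<noteq> 0})" using assms unfolding test_functions_def by blast+
  then have d: "u differentiable (at x)" and c: "continuous_on UNIV (\<lambda>x. frechet_derivative u (at x) v)" for x v
    by auto
  have g: "GDERIV u x :> gradient u x" for x using d by (rule GDERIV_gradient)
  have fd: "frechet_derivative u (at x) v = v \<bullet> gradient u x" for x v
    using frechet_derivative_at[OF g[of x, unfolded gderiv_def]] by metis
  have eq: "(\<lambda>x. \<Sum>b\<in>Basis. (b \<bullet> gradient u x) *\<^sub>R b) = gradient u"
    by (rule ext) (simp add: inner_commute[of _ "gradient u _"] euclidean_representation)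
  have "continuous_on UNIV (\<lambda>x. \<Sum>b\<in>Basis. (b \<bullet> gradient u x) *\<^sub>R b)"
    by (intro continuous_on_sum continuous_on_scaleR continuous_on_const c[unfolded fd])
  then have "continuous_on UNIV (gradient u)" unfolding eq .
  moreover have "bounded {x. u x \<noteq> 0}" using cpt compact_imp_bounded bounded_closure bounded_subset closure_subset by metis
  then obtain R where "\<forall>x\<in>{x. u x \<noteq> 0}. norm x \<le> R" unfolding bounded_iff by blast
  then have "\<forall>x. R < norm x \<longrightarrow> u x = 0" by force
  ultimately show ?thesis using that g unfolding C1_supported_def by blast
qed

lemma DERIV_abs_powr:
  fixes r :: real
  assumes "\<gamma> > 1"
  shows "((\<lambda>r. \<bar>r\<bar> powr \<gamma>) has_real_derivative \<gamma> * \<bar>r\<bar> powr (\<gamma> - 1) * sgn r) (at r)"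
proof -
  consider "r > 0" | "r < 0" | "r = 0" by linarith
  then show ?thesis
  proof cases
    case 1
    have "((\<lambda>r. r powr \<gamma>) has_real_derivative \<gamma> * r powr (\<gamma> - 1)) (at r)"
      using 1 by (rule has_real_derivative_powr)
    then have "((\<lambda>r. \<bar>r\<bar> powr \<gamma>) has_real_derivative \<gamma> * r powr (\<gamma> - 1)) (at r)"
      by (rule DERIV_cong_ev[THEN iffD1, rotated 3])
        (use 1 in \<open>auto intro!: eventually_nhds_in_open[of "{0<..}", THEN eventually_mono]\<close>)
    then show ?thesis using 1 by simp
  next
    case 2
    have "((\<lambda>r. (- r) powr \<gamma>) has_real_derivative - (\<gamma> * (- r) powr (\<gamma> - 1))) (at r)"
      using 2 by (auto intro!: derivative_eq_intros simp: powr_diff)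
    then have "((\<lambda>r. \<bar>r\<bar> powr \<gamma>) has_real_derivative - (\<gamma> * (- r) powr (\<gamma> - 1))) (at r)"
      by (rule DERIV_cong_ev[THEN iffD1, rotated 3])
        (use 2 in \<open>auto intro!: eventually_nhds_in_open[of "{..<0}", THEN eventually_mono]\<close>)
    then show ?thesis using 2 by simp
  next
    case 3
    have "((\<lambda>h. \<bar>h\<bar> powr (\<gamma> - 1)) \<longlongrightarrow> \<bar>0\<bar> powr (\<gamma> - 1)) (at (0::real))"
      using assms by (intro tendsto_powr' tendsto_intros) auto
    then have "((\<lambda>h. \<bar>h\<bar> powr (\<gamma> - 1)) \<longlongrightarrow> 0) (at (0::real))" by simp
    then have "((\<lambda>h::real. \<bar>h\<bar> powr \<gamma> / h) \<longlongrightarrow> 0) (at 0)"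
    proof (rule tendsto_rabs_zero_cancel[OF Lim_null_comparison, rotated])
      have "\<bar>\<bar>h\<bar> powr \<gamma> / h\<bar> = \<bar>h\<bar> powr (\<gamma> - 1)" if "h \<noteq> 0" for h :: real
        using that by (simp add: abs_divide powr_diff)
      then show "eventually (\<lambda>h::real. norm \<bar>\<bar>h\<bar> powr \<gamma> / h\<bar> \<le> \<bar>h\<bar> powr (\<gamma> - 1)) (at 0)"
        by (auto simp: eventually_at_filter)
    qed
    then show ?thesis using 3 by (simp add: DERIV_def)
  qed
qed

text \<open>The fundamental theorem of calculus for the power of |u| along \<open>b\<close>,
  starting at a point outside the support. An exponent \<open>\<gamma> > 1\<close> makes the power
  differentiable also where \<open>u\<close> vanishes.\<close>

lemma powr_abs_le_line_integral:
  fixes u :: "'a::euclidean_space \<Rightarrow> real"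
  assumes u: "C1_supported u R" and b: "b \<in> Basis" and \<gamma>: "\<gamma> > 1"
  shows "ennreal (\<bar>u x\<bar> powr \<gamma>) \<le> (\<integral>\<^sup>+t. ennreal (\<gamma> * \<bar>u (x + t *\<^sub>R b)\<bar> powr (\<gamma> - 1) * norm (gradient u (x + t *\<^sub>R b))) \<partial>lborel)"
proof -
  have uc: "continuous_on UNIV u" by (rule C1_supported_continuous[OF u])
  have gc: "continuous_on UNIV (gradient u)" using u by (simp add: C1_supported_def)
  define F where "F = (\<lambda>t. \<gamma> * \<bar>u (x + t *\<^sub>R b)\<bar> powr (\<gamma> - 1) * norm (gradient u (x + t *\<^sub>R b)))"
  define f where "f = (\<lambda>t. \<gamma> * \<bar>u (x + t *\<^sub>R b)\<bar> powr (\<gamma> - 1) * sgn (u (x + t *\<^sub>R b)) * (b \<bullet> gradient u (x + t *\<^sub>R b)))"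
  define T where "T = \<bar>R\<bar> + norm x + 1"
  have T0: "T \<ge> 0" using norm_ge_zero[of x] by (simp add: T_def)
  have Fc: "continuous_on UNIV F" unfolding F_def using \<gamma>
    by (intro continuous_intros continuous_on_powr' continuous_on_compose2[OF uc] continuous_on_compose2[OF gc]) auto
  have nb: "norm b = 1" using b by (rule norm_Basis)
  have "norm (x + (- T) *\<^sub>R b) \<ge> T - norm x"
    using norm_triangle_ineq4[of "x + (- T) *\<^sub>R b" x] nb by (simp add: T_def)
  then have u0: "u (x + (- T) *\<^sub>R b) = 0" using u by (auto simp: C1_supported_def T_def)
  have "((\<lambda>t. \<bar>u (x + t *\<^sub>R b)\<bar> powr \<gamma>) has_real_derivative f t) (at t)" for t
    using DERIV_chain2[OF DERIV_abs_powr[OF \<gamma>] GDERIV_line[OF C1_supported_GDERIV[OF u]]] by (simp add: f_def)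
  then have "(f has_integral \<bar>u (x + 0 *\<^sub>R b)\<bar> powr \<gamma> - \<bar>u (x + (- T) *\<^sub>R b)\<bar> powr \<gamma>) {-T..0}"
    by (intro fundamental_theorem_of_calculus)
      (use T0 in \<open>auto simp: has_real_derivative_iff_has_vector_derivative intro: has_vector_derivative_at_within\<close>)
  then have fi: "(f has_integral \<bar>u x\<bar> powr \<gamma>) {-T..0}" using u0 by simp
  have Fi: "F integrable_on {-T..0}" using Fc by (intro integrable_continuous_real continuous_on_subset[OF Fc]) auto
  have fF: "norm (f t) \<le> F t" for t
  proof -
    have "\<bar>b \<bullet> gradient u (x + t *\<^sub>R b)\<bar> \<le> norm (gradient u (x + t *\<^sub>R b))"
      using Cauchy_Schwarz_ineq2[of b "gradient u (x + t *\<^sub>R b)"] nb by simp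
    moreover have "\<bar>sgn (u (x + t *\<^sub>R b))\<bar> \<le> 1" by (simp add: sgn_if)
    ultimately have "\<bar>sgn (u (x + t *\<^sub>R b))\<bar> * \<bar>b \<bullet> gradient u (x + t *\<^sub>R b)\<bar> \<le> 1 * norm (gradient u (x + t *\<^sub>R b))"
      by (intro mult_mono) auto
    then show ?thesis using \<gamma> by (simp add: f_def F_def abs_mult mult.assoc mult_left_mono)
  qed
  have "\<bar>u x\<bar> powr \<gamma> = norm (integral {-T..0} f)" using fi by (simp add: integral_unique)
  also have "\<dots> \<le> integral {-T..0} F"
    using fi Fi fF by (intro integral_norm_bound_integral) auto
  also have "\<dots> = (\<integral>t. indicator {-T..0} t *\<^sub>R F t \<partial>lborel)"
    using set_borel_integral_eq_integral(2)[OF borel_integrable_atLeastAtMost'[OF continuous_on_subset[OF Fc]], of "-T" 0]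
    by (simp add: set_lebesgue_integral_def)
  finally have "ennreal (\<bar>u x\<bar> powr \<gamma>) \<le> ennreal (\<integral>t. indicator {-T..0} t *\<^sub>R F t \<partial>lborel)" by (rule ennreal_leI)
  also have "\<dots> = (\<integral>\<^sup>+t. ennreal (indicator {-T..0} t *\<^sub>R F t) \<partial>lborel)"
    using borel_integrable_atLeastAtMost'[OF continuous_on_subset[OF Fc], of "-T" 0] \<gamma>
    by (intro nn_integral_eq_integral[symmetric]) (auto simp: set_integrable_def F_def)
  also have "\<dots> \<le> (\<integral>\<^sup>+t. ennreal (F t) \<partial>lborel)"
    using order_trans[OF norm_ge_zero fF] by (intro nn_integral_mono ennreal_leI) (auto simp: indicator_def)
  finally show ?thesis by (simp add: F_def)
qed

text \<open>The square of the exponent \<open>\<gamma>\<close> to which |u| is raised in the next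
  proof; it arises as the factor in front of the derivative of that power.\<close>

definition sobolev_const :: "'a::euclidean_space itself \<Rightarrow> real" where
  "sobolev_const _ = (2 * (real DIM('a) - 1) / (real DIM('a) - 2))\<^sup>2"

text \<open>The Gagliardo-Nirenberg inequality is applied to a power of |u| whose exponent
  \<open>\<gamma>\<close> is chosen so that both \<open>2 * (\<gamma> - 1)\<close> and
  \<open>\<gamma> * (n / (n - 1))\<close> equal the Sobolev exponent \<open>q\<close>. After
  Cauchy-Schwarz the integral of |u|^q appears on both sides, on the right with a power less than 1,
  and can be cancelled.\<close>

lemma sobolev_C1_supported:
  fixes u :: "'a::euclidean_space \<Rightarrow> real"
  assumes dim: "DIM('a) \<ge> 3" and u: "C1_supported u R"
    and D: "norm_sq_integral (gradient u) \<le> ennreal d" "d \<ge> 0"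
  shows "powr_integral (sobolev_exponent TYPE('a)) u
     \<le> ennreal ((sobolev_const TYPE('a) * d) powr (sobolev_exponent TYPE('a) / 2))"
proof -
  define n where "n = real DIM('a)"
  define \<gamma> where "\<gamma> = 2 * (n - 1) / (n - 2)"
  define q where "q = sobolev_exponent TYPE('a)"
  have n: "n \<ge> 3" using dim by (simp add: n_def)
  have qn: "q = 2 * n / (n - 2)" by (simp add: q_def n_def sobolev_exponent_def)
  have \<gamma>: "\<gamma> > 1" "2 * (\<gamma> - 1) = q" "\<gamma> * (n / (n - 1)) = q" "q > 0"
  proof -
    show "\<gamma> > 1" "q > 0" using n by (simp_all add: \<gamma>_def qn field_simps)
    show "2 * (\<gamma> - 1) = q" using n by (simp add: \<gamma>_def qn diff_divide_eq_iff field_simps)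
    have "2 * a / b * (n / a) = 2 * n / b" if "a \<noteq> 0" for a b :: real using that by simp
    moreover have "n - 1 \<noteq> 0" using n by simp
    ultimately show "\<gamma> * (n / (n - 1)) = q" unfolding \<gamma>_def qn by blast
  qed
  have uc: "continuous_on UNIV u" by (rule C1_supported_continuous[OF u])
  have gc: "continuous_on UNIV (gradient u)" using u by (simp add: C1_supported_def)
  have [measurable]: "u \<in> borel_measurable borel" "gradient u \<in> borel_measurable borel"
    using uc gc by (auto intro: borel_measurable_continuous_onI)
  define S where "S = powr_integral q u"
  define f where "f = (\<lambda>x. \<gamma> * \<bar>u x\<bar> powr (\<gamma> - 1) * norm (gradient u x))"
  have [measurable]: "f \<in> borel_measurable borel" unfolding f_def by measurable
  \<comment> \<open>Only a finite integral can be cancelled.\<close>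
  have "S < \<top>"
  proof -
    have "bounded (u ` cball 0 R)" by (intro compact_imp_bounded compact_continuous_image continuous_on_subset[OF uc]) auto
    then obtain B where "\<forall>y\<in>u ` cball 0 R. \<bar>y\<bar> \<le> B" unfolding bounded_iff by auto
    then have B: "\<bar>u x\<bar> \<le> \<bar>B\<bar>" if "norm x \<le> R" for x using that by force
    have "S \<le> (\<integral>\<^sup>+x. ennreal (\<bar>B\<bar> powr q) * indicator (cball (0::'a) R) x \<partial>lborel)"
      unfolding S_def
    proof (rule nn_integral_mono)
      fix x :: 'a
      show "ennreal (\<bar>u x\<bar> powr q) \<le> ennreal (\<bar>B\<bar> powr q) * indicator (cball 0 R) x"
      proof (cases "norm x \<le> R")
        case True
        then show ?thesis using B[OF True] \<gamma>(4) by (auto intro!: ennreal_leI powr_mono2)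
      next
        case False
        then have "u x = 0" using u by (simp add: C1_supported_def)
        then show ?thesis by simp
      qed
    qed
    also have "\<dots> = ennreal (\<bar>B\<bar> powr q) * emeasure lborel (cball (0::'a) R)" by (rule nn_integral_cmult_indicator) simp
    also have "\<dots> < \<top>" using emeasure_lborel_cball_finite[of "0::'a" R] by (simp add: ennreal_mult_less_top)
    finally show ?thesis .
  qed
  then obtain s where s: "s \<ge> 0" "S = ennreal s" by (cases S) auto
  define A where "A = (\<integral>\<^sup>+x. ennreal (f x) \<partial>lborel)"
  have "A\<^sup>2 = (\<integral>\<^sup>+x. ennreal (\<gamma> * \<bar>u x\<bar> powr (\<gamma> - 1)) * ennreal (norm (gradient u x)) \<partial>lborel)\<^sup>2"
    unfolding A_def f_def using \<gamma>(1) by (simp add: ennreal_mult)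
  also have "\<dots> \<le> (\<integral>\<^sup>+x. (ennreal (\<gamma> * \<bar>u x\<bar> powr (\<gamma> - 1)))\<^sup>2 \<partial>lborel) * (\<integral>\<^sup>+x. (ennreal (norm (gradient u x)))\<^sup>2 \<partial>lborel)"
    by (rule Cauchy_Schwarz_nn_integral) auto
  also have "(\<integral>\<^sup>+x. (ennreal (\<gamma> * \<bar>u x\<bar> powr (\<gamma> - 1)))\<^sup>2 \<partial>lborel) = (\<integral>\<^sup>+x. ennreal (\<gamma>\<^sup>2) * ennreal (\<bar>u x\<bar> powr q) \<partial>lborel)"
  proof (rule nn_integral_cong)
    fix x
    have "(\<bar>u x\<bar> powr (\<gamma> - 1))\<^sup>2 = \<bar>u x\<bar> powr q" using \<gamma>(2) by (simp add: power2_eq_square powr_add[symmetric])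
    then show "(ennreal (\<gamma> * \<bar>u x\<bar> powr (\<gamma> - 1)))\<^sup>2 = ennreal (\<gamma>\<^sup>2) * ennreal (\<bar>u x\<bar> powr q)"
      using \<gamma>(1) by (simp add: ennreal_power ennreal_mult[symmetric] power_mult_distrib)
  qed
  also have "\<dots> = ennreal (\<gamma>\<^sup>2) * S" unfolding S_def by (rule nn_integral_cmult) measurable
  also have "(\<integral>\<^sup>+x. (ennreal (norm (gradient u x)))\<^sup>2 \<partial>lborel) = norm_sq_integral (gradient u)"
    by (simp add: ennreal_power)
  also have "ennreal (\<gamma>\<^sup>2) * S * \<dots> \<le> ennreal (\<gamma>\<^sup>2) * S * ennreal d" by (intro mult_left_mono D) simp
  also have "\<dots> = ennreal (\<gamma>\<^sup>2 * s * d)" using s D by (simp add: ennreal_mult)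
  finally have A2: "A\<^sup>2 \<le> ennreal (\<gamma>\<^sup>2 * s * d)" .
  have "A \<noteq> \<top>"
  proof
    assume "A = \<top>"
    then have "A\<^sup>2 = \<top>" by (simp add: power2_eq_square)
    with A2 show False by (simp add: top_unique)
  qed
  then obtain a where a: "a \<ge> 0" "A = ennreal a" by (cases A) auto
  have a2: "a\<^sup>2 \<le> \<gamma>\<^sup>2 * s * d" using A2 a s D by (simp add: ennreal_power)
  have "S = (\<integral>\<^sup>+x. epow (ennreal (\<bar>u x\<bar> powr \<gamma>)) (n / (n - 1)) \<partial>lborel)"
    unfolding S_def using n \<gamma>(3) by (intro nn_integral_cong) (simp add: epow_ennreal powr_powr)
  also have "\<dots> \<le> epow A (n / (n - 1))"
    unfolding A_def n_def
  proof (rule gagliardo_nirenberg)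
    show "ennreal (\<bar>u x\<bar> powr \<gamma>) \<le> (\<integral>\<^sup>+t. ennreal (f (x + t *\<^sub>R b)) \<partial>lborel)" if "b \<in> Basis" for x b
      unfolding f_def by (rule powr_abs_le_line_integral[OF u that \<gamma>(1)])
  qed (use dim in auto)
  finally have "ennreal s \<le> ennreal (a powr (n / (n - 1)))" using a s n by (simp add: epow_ennreal)
  then have sa: "s \<le> a powr (n / (n - 1))" by (simp add: ennreal_le_iff)
  \<comment> \<open>The estimate will read \<open>s \<le> (\<gamma>\<^sup>2 * s * d) powr e\<close>
    with \<open>e < 1\<close>. Solving it for \<open>s\<close> produces the exponent
    \<open>e / (1 - e)\<close>, which is half the Sobolev exponent.\<close>
  define e where "e = n / (2 * (n - 1))"
  have e: "0 < e" "e < 1" "e / (1 - e) = q / 2" "2 * e = n / (n - 1)"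
  proof -
    have 1: "1 - e = (n - 2) / (2 * (n - 1))" using n by (simp add: e_def field_simps)
    have "n / (2 * a) / (b / (2 * a)) = n / b" if "a \<noteq> 0" for a b :: real using that by simp
    moreover have "n - 1 \<noteq> 0" using n by simp
    ultimately have "e / ((n - 2) / (2 * (n - 1))) = n / (n - 2)" unfolding e_def by blast
    then have "e / (1 - e) = n / (n - 2)" by (simp only: 1)
    moreover have "2 * n / b / 2 = n / b" for b :: real by simp
    ultimately show "e / (1 - e) = q / 2" unfolding qn by metis
    show "0 < e" "e < 1" "2 * e = n / (n - 1)" using n by (simp_all add: e_def field_simps)
  qed
  have "a powr (n / (n - 1)) = (a\<^sup>2) powr e"
    unfolding e(4)[symmetric] using a by (cases "a = 0") (auto simp: powr_powr powr_numeral[symmetric] simp del: powr_numeral)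
  also have "\<dots> \<le> (\<gamma>\<^sup>2 * s * d) powr e" using a2 e by (intro powr_mono2) auto
  finally have s1: "s \<le> (\<gamma>\<^sup>2 * s * d) powr e" using sa by linarith
  have "s \<le> (\<gamma>\<^sup>2 * d) powr (q / 2)"
  proof (cases "s = 0")
    case False
    then have sp: "s > 0" using s by simp
    have "s = s powr (1 - e) * s powr e" using sp by (simp add: powr_add[symmetric])
    also have "s powr e > 0" using sp by simp
    have "s powr (1 - e) * s powr e \<le> (\<gamma>\<^sup>2 * d) powr e * s powr e"
    proof -
      have "(\<gamma>\<^sup>2 * s * d) powr e = (\<gamma>\<^sup>2 * d) powr e * s powr e"
        using sp D by (subst powr_mult[symmetric]) (auto simp: mult_ac)
      then show ?thesis using s1 calculation by simp
    qed
    then have "s powr (1 - e) \<le> (\<gamma>\<^sup>2 * d) powr e" using \<open>s powr e > 0\<close> by simp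
    then have "(s powr (1 - e)) powr (1 / (1 - e)) \<le> ((\<gamma>\<^sup>2 * d) powr e) powr (1 / (1 - e))"
      using e by (intro powr_mono2) auto
    then show ?thesis using e sp by (simp add: powr_powr)
  qed simp
  then show ?thesis using s(2) by (simp add: S_def q_def sobolev_const_def \<gamma>_def n_def ennreal_leI)
qed

section \<open>Mollification\<close>

text \<open>The powers in the denominator close the family under differentiation: the derivative of
  a member is a combination of those with \<open>k + 1\<close> and \<open>k + 2\<close>.\<close>

definition bump_profile :: "nat \<Rightarrow> real \<Rightarrow> real" where
  "bump_profile k t = (if t > 0 then exp (- 1 / t) / t ^ k else 0)"

lemma bump_profile_tendsto_0: "(bump_profile k \<longlongrightarrow> 0) (at 0)"
proof (rule filterlim_split_at)
  have "((\<lambda>s::real. s ^ k / exp s) \<longlongrightarrow> 0) at_top" by (rule tendsto_power_div_exp_0)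
  then have "((\<lambda>t::real. inverse t ^ k / exp (inverse t)) \<longlongrightarrow> 0) (at_right 0)"
    using filterlim_inverse_at_top_right by (rule filterlim_compose)
  moreover have "eventually (\<lambda>t. inverse t ^ k / exp (inverse t) = bump_profile k t) (at_right 0)"
    by (auto simp: eventually_at_filter bump_profile_def exp_minus field_simps)
  ultimately show "(bump_profile k \<longlongrightarrow> 0) (at_right 0)" by (rule Lim_transform_eventually)
  have "eventually (\<lambda>t. 0 = bump_profile k t) (at_left 0)"
    by (auto simp: eventually_at_filter bump_profile_def)
  with tendsto_const show "(bump_profile k \<longlongrightarrow> 0) (at_left 0)" by (rule Lim_transform_eventually)
qed

lemma bump_profile_DERIV:
  "(bump_profile k has_real_derivative bump_profile (k + 2) t - real k * bump_profile (k + 1) t) (at t)"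
proof -
  consider "t > 0" | "t < 0" | "t = 0" by linarith
  then show ?thesis
  proof cases
    case 1
    have "((\<lambda>t. exp (- 1 / t) / t ^ k) has_real_derivative
       (exp (- 1 / t) * (1 / t\<^sup>2) * t ^ k - exp (- 1 / t) * (real k * t ^ (k - 1))) / (t ^ k * t ^ k)) (at t)"
      using 1 by (auto intro!: derivative_eq_intros simp: power2_eq_square)
    also have "(exp (- 1 / t) * (1 / t\<^sup>2) * t ^ k - exp (- 1 / t) * (real k * t ^ (k - 1))) / (t ^ k * t ^ k)
        = bump_profile (k + 2) t - real k * bump_profile (k + 1) t"
      using 1 by (cases k) (auto simp: bump_profile_def field_simps power2_eq_square)
    finally have "((\<lambda>t. exp (- 1 / t) / t ^ k) has_real_derivative bump_profile (k + 2) t - real k * bump_profile (k + 1) t) (at t)" .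
    then show ?thesis unfolding has_field_derivative_def
      by (rule has_derivative_transform_within_open[where s="{0<..}"]) (use 1 in \<open>auto simp: bump_profile_def\<close>)
  next
    case 2
    have "((\<lambda>t. 0) has_real_derivative bump_profile (k + 2) t - real k * bump_profile (k + 1) t) (at t)"
      using 2 by (simp add: bump_profile_def)
    then show ?thesis unfolding has_field_derivative_def
      by (rule has_derivative_transform_within_open[where s="{..<0}"]) (use 2 in \<open>auto simp: bump_profile_def\<close>)
  next
    case 3
    have "((\<lambda>h. (bump_profile k (0 + h) - bump_profile k 0) / h) \<longlongrightarrow> 0) (at 0)"
    proof (rule Lim_transform_eventually[OF bump_profile_tendsto_0[of "k + 1"]])
      show "eventually (\<lambda>h. bump_profile (k + 1) h = (bump_profile k (0 + h) - bump_profile k 0) / h) (at 0)"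
        by (auto simp: eventually_at_filter bump_profile_def field_simps)
    qed
    then show ?thesis using 3 by (simp add: DERIV_def bump_profile_def)
  qed
qed

text \<open>An algebra of smooth functions that contains a bump supported in the ball of radius \<open>1 / c\<close> and
  is closed under directional derivatives.\<close>

inductive_set bump_algebra :: "real \<Rightarrow> ('a::euclidean_space \<Rightarrow> real) set" for c :: real where
  const: "(\<lambda>x. a) \<in> bump_algebra c"
| inner: "(\<lambda>x. x \<bullet> v) \<in> bump_algebra c"
| bump: "(\<lambda>x. bump_profile k (1 - c\<^sup>2 * (x \<bullet> x))) \<in> bump_algebra c"
| add: "f \<in> bump_algebra c \<Longrightarrow> g \<in> bump_algebra c \<Longrightarrow> (\<lambda>x. f x + g x) \<in> bump_algebra c"
| mult: "f \<in> bump_algebra c \<Longrightarrow> g \<in> bump_algebra c \<Longrightarrow> (\<lambda>x. f x * g x) \<in> bump_algebra c"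

lemma bump_algebra_derivative:
  "f \<in> bump_algebra c \<Longrightarrow> \<exists>D. (\<forall>x. (f has_derivative D x) (at x)) \<and> (\<forall>v. (\<lambda>x. D x v) \<in> bump_algebra c)"
proof (induction rule: bump_algebra.induct)
  case (const a)
  show ?case by (intro exI[of _ "\<lambda>x v. 0"]) (auto intro: bump_algebra.const)
next
  case (inner v)
  show ?case by (intro exI[of _ "\<lambda>x h. h \<bullet> v"]) (auto intro: bump_algebra.const bounded_linear_imp_has_derivative bounded_linear_inner_left)
next
  case (bump k)
  let ?D = "\<lambda>x h. (- 2 * c\<^sup>2) * (x \<bullet> h) * (bump_profile (k + 2) (1 - c\<^sup>2 * (x \<bullet> x)) + (- real k) * bump_profile (k + 1) (1 - c\<^sup>2 * (x \<bullet> x)))"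
  have "((\<lambda>x. bump_profile k (1 - c\<^sup>2 * (x \<bullet> x))) has_derivative ?D x) (at x)" for x :: 'a
  proof -
    have 1: "((\<lambda>x::'a. 1 - c\<^sup>2 * (x \<bullet> x)) has_derivative (\<lambda>h. - 2 * c\<^sup>2 * (x \<bullet> h))) (at x)"
      by (auto intro!: derivative_eq_intros simp: inner_commute)
    have "(bump_profile k has_derivative (\<lambda>h. (bump_profile (k + 2) t - real k * bump_profile (k + 1) t) * h)) (at t)" for t
      using bump_profile_DERIV by (simp add: has_field_derivative_def)
    from has_derivative_compose[OF 1 this] show ?thesis by (simp add: algebra_simps)
  qed
  moreover have "(\<lambda>x::'a. ?D x h) \<in> bump_algebra c" for h
    by (intro bump_algebra.intros)
  ultimately show ?case by (intro exI[of _ ?D]) auto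
next
  case (add f g)
  then obtain D E where "\<And>x. (f has_derivative D x) (at x)" "\<And>v. (\<lambda>x. D x v) \<in> bump_algebra c"
    "\<And>x. (g has_derivative E x) (at x)" "\<And>v. (\<lambda>x. E x v) \<in> bump_algebra c" by blast
  then show ?case
    by (intro exI[of _ "\<lambda>x h. D x h + E x h"]) (auto intro: bump_algebra.add has_derivative_add)
next
  case (mult f g)
  then obtain D E where DE: "\<And>x. (f has_derivative D x) (at x)" "\<And>v. (\<lambda>x. D x v) \<in> bump_algebra c"
    "\<And>x. (g has_derivative E x) (at x)" "\<And>v. (\<lambda>x. E x v) \<in> bump_algebra c" by blast
  then show ?case using mult
    by (intro exI[of _ "\<lambda>x h. f x * E x h + D x h * g x"]) (auto intro!: bump_algebra.add bump_algebra.mult has_derivative_mult)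
qed

lemma bump_algebra_GDERIV:
  assumes "f \<in> bump_algebra c"
  shows "GDERIV f x :> gradient f x" "(\<lambda>x. v \<bullet> gradient f x) \<in> bump_algebra c"
proof -
  obtain D where D: "\<And>x. (f has_derivative D x) (at x)" "\<And>v. (\<lambda>x. D x v) \<in> bump_algebra c"
    using bump_algebra_derivative[OF assms] by blast
  show g: "GDERIV f x :> gradient f x" for x using D(1) by (intro GDERIV_gradient) (auto simp: differentiable_def)
  have "D x v = v \<bullet> gradient f x" for x v
    using fun_cong[OF has_derivative_unique[OF D(1) g[of x, unfolded gderiv_def]]] .
  then show "(\<lambda>x. v \<bullet> gradient f x) \<in> bump_algebra c" using D(2)[of v] by simp
qed

lemma bump_algebra_continuous: "f \<in> bump_algebra c \<Longrightarrow> continuous_on UNIV f"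
  using bump_algebra_GDERIV(1) unfolding gderiv_def
  by (meson continuous_at_imp_continuous_on has_derivative_continuous)

lemma bump_algebra_gradient_continuous:
  assumes "f \<in> bump_algebra c" shows "continuous_on UNIV (gradient f)"
proof -
  have eq: "(\<lambda>x. \<Sum>b\<in>Basis. (b \<bullet> gradient f x) *\<^sub>R b) = gradient f"
    by (rule ext) (simp add: inner_commute[of _ "gradient f _"] euclidean_representation)
  have "continuous_on UNIV (\<lambda>x. \<Sum>b\<in>Basis. (b \<bullet> gradient f x) *\<^sub>R b)"
    using bump_algebra_GDERIV(2)[OF assms] bump_algebra_continuous
    by (intro continuous_on_sum continuous_on_scaleR continuous_on_const) blast
  then show ?thesis unfolding eq .
qed

lemma bump_algebra_C1_supported:
  assumes "f \<in> bump_algebra c" "\<And>x. R < norm x \<Longrightarrow> f x = 0"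
  shows "C1_supported f R"
  using assms bump_algebra_GDERIV(1) bump_algebra_gradient_continuous unfolding C1_supported_def by blast

lemma bump_algebra_directional_support:
  fixes f :: "'a::euclidean_space \<Rightarrow> real"
  assumes "\<And>x. R < norm x \<Longrightarrow> f x = 0" "R < norm x"
  shows "v \<bullet> gradient f x = 0"
  using gradient_eq[OF gradient_zero_outside[of R f x]] assms by simp

section \<open>Convolution with compactly supported smooth kernels\<close>

lemma integrable_continuous_supported:
  fixes f :: "'a::euclidean_space \<Rightarrow> 'b::euclidean_space"
  assumes "continuous_on UNIV f" "\<And>x. R < norm x \<Longrightarrow> f x = 0"
  shows "integrable lborel f"
proof -
  have "integrable lborel (\<lambda>x. indicator (cball 0 R) x *\<^sub>R f x)"
    using assms(1) by (intro borel_integrable_compact) (auto intro: continuous_on_subset)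
  moreover have "(\<lambda>x. indicator (cball 0 R) x *\<^sub>R f x) = f"
    using assms(2) by (auto simp: fun_eq_iff indicator_def not_le)
  ultimately show ?thesis by simp
qed

text \<open>The mean value inequality, applied to the deviation from the linear part; the factor 1/2
  of Taylor's formula is given away. Besides mollification it controls the boundary graph in the
  interior ball condition.\<close>

lemma GDERIV_quadratic_bound:
  fixes f :: "'a::euclidean_space \<Rightarrow> real"
  assumes g: "\<And>x. GDERIV f x :> gradient f x" and "K \<ge> 0"
    and K: "\<And>x. x \<in> closed_segment z (z + h) \<Longrightarrow> norm (gradient f x - gradient f z) \<le> K * norm (x - z)"
  shows "\<bar>f (z + h) - f z - h \<bullet> gradient f z\<bar> \<le> K * (norm h)\<^sup>2"
proof -
  have "norm (f (z + h) - f z - (\<lambda>h. h \<bullet> gradient f z) ((z + h) - z)) \<le> norm ((z + h) - z) * (K * norm h)"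
  proof (rule differentiable_bound_linearization[where S="closed_segment z (z + h)" and f'="\<lambda>x h. h \<bullet> gradient f x" and ?x0.0=z])
    show "z + t *\<^sub>R (z + h - z) \<in> closed_segment z (z + h)" if "t \<in> {0..1}" for t
      using that by (auto simp: in_segment algebra_simps intro!: exI[of _ t])
    show "(f has_derivative (\<lambda>h. h \<bullet> gradient f x)) (at x within closed_segment z (z + h))" for x
      using g by (auto simp: gderiv_def intro: has_derivative_at_withinI)
    fix x assume x: "x \<in> closed_segment z (z + h)"
    have "(\<lambda>h. h \<bullet> gradient f x) - (\<lambda>h. h \<bullet> gradient f z) = (\<lambda>h. h \<bullet> (gradient f x - gradient f z))"
      by (auto simp: inner_diff_right)
    then have "onorm ((\<lambda>h. h \<bullet> gradient f x) - (\<lambda>h. h \<bullet> gradient f z)) \<le> norm (gradient f x - gradient f z)"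
      using onorm_inner_le by simp
    also have "\<dots> \<le> K * norm (x - z)" by (rule K[OF x])
    also have "\<dots> \<le> K * norm h" using segment_bound(1)[OF x] \<open>K \<ge> 0\<close> by (intro mult_left_mono) auto
    finally show "onorm ((\<lambda>h. h \<bullet> gradient f x) - (\<lambda>h. h \<bullet> gradient f z)) \<le> K * norm h" .
  qed simp
  then show ?thesis by (simp add: power2_eq_square mult_ac)
qed

text \<open>The convolution of \<open>v\<close> with the reflection of \<open>f\<close>; derivatives
  fall on the smooth factor \<open>f\<close>, with a sign.\<close>

definition smear :: "('a::euclidean_space \<Rightarrow> real) \<Rightarrow> ('a \<Rightarrow> real) \<Rightarrow> 'a \<Rightarrow> real" where
  "smear v f x = (\<integral>y. v y * f (y - x) \<partial>lborel)"

text \<open>Each directional derivative is again a member of the algebra with bounded support, hence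
  Lipschitz; the constants are summed over the basis.\<close>

lemma C1_gradient_lipschitz:
  fixes f :: "'a::euclidean_space \<Rightarrow> real"
  assumes f: "f \<in> bump_algebra c" "\<And>x. R < norm x \<Longrightarrow> f x = 0"
  obtains K where "K \<ge> 0" "\<And>x y. norm (gradient f x - gradient f y) \<le> K * norm (x - y)"
proof -
  have "\<exists>L. L-lipschitz_on UNIV (\<lambda>x. b \<bullet> gradient f x)" for b
    by (rule C1_supported_lipschitz[OF bump_algebra_C1_supported[OF bump_algebra_GDERIV(2)[OF f(1)]
      bump_algebra_directional_support[OF f(2)]]]) auto
  then have "\<forall>b. \<exists>L. L-lipschitz_on UNIV (\<lambda>x. b \<bullet> gradient f x)" by blast
  then obtain L where L: "\<And>b. (L b)-lipschitz_on UNIV (\<lambda>x. b \<bullet> gradient f x)" by (elim choice[THEN exE]) auto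
  have "norm (gradient f x - gradient f y) \<le> (\<Sum>b\<in>Basis. L b) * norm (x - y)" for x y
  proof -
    have "norm (gradient f x - gradient f y) \<le> (\<Sum>b\<in>Basis. \<bar>(gradient f x - gradient f y) \<bullet> b\<bar>)" by (rule norm_le_l1)
    also have "\<dots> \<le> (\<Sum>b\<in>Basis. L b * norm (x - y))"
      using lipschitz_onD[OF L] by (intro sum_mono) (simp add: dist_real_def dist_norm inner_diff_left inner_diff_right inner_commute)
    finally show ?thesis by (simp add: sum_distrib_right)
  qed
  moreover have "(\<Sum>b\<in>Basis. L b) \<ge> 0" using lipschitz_on_nonneg[OF L] by (simp add: sum_nonneg)
  ultimately show ?thesis using that by blast
qed

lemma smear_integrable:
  fixes v :: "'a::euclidean_space \<Rightarrow> real" and f :: "'a \<Rightarrow> 'b::euclidean_space"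
  assumes "continuous_on UNIV v" "\<And>x. R < norm x \<Longrightarrow> v x = 0" "continuous_on UNIV f"
  shows "integrable lborel (\<lambda>y. v y *\<^sub>R f (y - x))"
  using assms by (intro integrable_continuous_supported[of _ R] continuous_intros continuous_on_compose2[OF assms(3)]) auto

text \<open>Differentiation under the integral: the gradient of \<open>f\<close> is globally
  Lipschitz, so the quadratic remainder of \<open>f\<close> is uniform in the point and integrates
  against |v|.\<close>

lemma smear_GDERIV:
  fixes v :: "'a::euclidean_space \<Rightarrow> real"
  assumes v: "continuous_on UNIV v" "\<And>x. R < norm x \<Longrightarrow> v x = 0"
    and f: "f \<in> bump_algebra c" "\<And>x. r < norm x \<Longrightarrow> f x = 0"
  shows "GDERIV (smear v f) x :> - (\<integral>y. v y *\<^sub>R gradient f (y - x) \<partial>lborel)"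
proof -
  obtain K where K: "K \<ge> 0" "\<And>x y. norm (gradient f x - gradient f y) \<le> K * norm (x - y)"
    using C1_gradient_lipschitz[OF f] by blast
  define G where "G = (\<integral>y. v y *\<^sub>R gradient f (y - x) \<partial>lborel)"
  define V where "V = (\<integral>y. \<bar>v y\<bar> \<partial>lborel)"
  have vi: "integrable lborel (\<lambda>y. \<bar>v y\<bar>)" using integrable_continuous_supported[OF v] by (rule integrable_abs)
  have V0: "V \<ge> 0" unfolding V_def by simp
  have fi: "integrable lborel (\<lambda>y. v y * f (y - x))" for x
    using smear_integrable[OF v bump_algebra_continuous[OF f(1)], where x=x] by simp
  have gi: "integrable lborel (\<lambda>y. v y *\<^sub>R gradient f (y - x))"
    by (rule smear_integrable[OF v bump_algebra_gradient_continuous[OF f(1)]])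
  have hi: "integrable lborel (\<lambda>y. v y * (h \<bullet> gradient f (y - x)))" for h
    using integrable_inner_right[OF gi, of h] by simp
  have key: "\<bar>smear v f (x + h) - smear v f x - h \<bullet> (- G)\<bar> \<le> K * V * (norm h)\<^sup>2" for h
  proof -
    have "h \<bullet> G = (\<integral>y. v y * (h \<bullet> gradient f (y - x)) \<partial>lborel)"
      unfolding G_def using integral_inner_right[OF gi, of h] by simp
    then have eq: "smear v f (x + h) - smear v f x - h \<bullet> (- G)
      = (\<integral>y. v y * f (y - (x + h)) - v y * f (y - x) + v y * (h \<bullet> gradient f (y - x)) \<partial>lborel)"
      unfolding smear_def
      by (subst Bochner_Integration.integral_add[OF Bochner_Integration.integrable_diff[OF fi fi] hi],
        subst Bochner_Integration.integral_diff[OF fi fi]) simp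
    have "\<bar>smear v f (x + h) - smear v f x - h \<bullet> (- G)\<bar> \<le> (\<integral>y. \<bar>v y * f (y - (x + h)) - v y * f (y - x) + v y * (h \<bullet> gradient f (y - x))\<bar> \<partial>lborel)"
      unfolding eq by (rule integral_abs_bound)
    also have "\<dots> \<le> (\<integral>y. (K * (norm h)\<^sup>2) * \<bar>v y\<bar> \<partial>lborel)"
    proof (rule integral_mono)
      show "integrable lborel (\<lambda>y. \<bar>v y * f (y - (x + h)) - v y * f (y - x) + v y * (h \<bullet> gradient f (y - x))\<bar>)"
        using fi hi by (intro integrable_abs Bochner_Integration.integrable_add Bochner_Integration.integrable_diff)
      show "integrable lborel (\<lambda>y. (K * (norm h)\<^sup>2) * \<bar>v y\<bar>)" using vi by (rule integrable_mult_right)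
      fix y
      have "\<bar>f ((y - x) + (- h)) - f (y - x) - (- h) \<bullet> gradient f (y - x)\<bar> \<le> K * (norm (- h))\<^sup>2"
        using bump_algebra_GDERIV(1)[OF f(1)] K by (intro GDERIV_quadratic_bound) auto
      then have "\<bar>v y\<bar> * \<bar>f (y - (x + h)) - f (y - x) + h \<bullet> gradient f (y - x)\<bar> \<le> \<bar>v y\<bar> * (K * (norm h)\<^sup>2)"
        by (intro mult_left_mono) (simp_all add: diff_diff_eq)
      then show "\<bar>v y * f (y - (x + h)) - v y * f (y - x) + v y * (h \<bullet> gradient f (y - x))\<bar> \<le> (K * (norm h)\<^sup>2) * \<bar>v y\<bar>"
      proof -
        have "v y * f (y - (x + h)) - v y * f (y - x) + v y * (h \<bullet> gradient f (y - x))
          = v y * (f (y - (x + h)) - f (y - x) + h \<bullet> gradient f (y - x))"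
          by (simp only: right_diff_distrib distrib_left)
        moreover assume "\<bar>v y\<bar> * \<bar>f (y - (x + h)) - f (y - x) + h \<bullet> gradient f (y - x)\<bar> \<le> \<bar>v y\<bar> * (K * (norm h)\<^sup>2)"
        ultimately show ?thesis by (simp only: abs_mult mult.commute[of "K * (norm h)\<^sup>2"])
      qed
    qed
    also have "\<dots> = K * V * (norm h)\<^sup>2" by (simp add: V_def)
    finally show ?thesis .
  qed
  show ?thesis unfolding gderiv_def has_derivative_at_alt G_def[symmetric]
  proof (intro conjI allI impI)
    show "bounded_linear (\<lambda>h. h \<bullet> (- G))" by (rule bounded_linear_inner_left)
    fix e :: real assume e: "e > 0"
    show "\<exists>d>0. \<forall>y. norm (y - x) < d \<longrightarrow> norm (smear v f y - smear v f x - (y - x) \<bullet> (- G)) \<le> e * norm (y - x)"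
    proof (intro exI[of _ "e / (K * V + 1)"] conjI allI impI)
      have KV: "K * V + 1 > 0" using K(1) V0 by (simp add: add_nonneg_pos)
      then show "e / (K * V + 1) > 0" using e by simp
      fix y assume y: "norm (y - x) < e / (K * V + 1)"
      have "norm (smear v f y - smear v f x - (y - x) \<bullet> (- G)) \<le> K * V * (norm (y - x))\<^sup>2"
        using key[of "y - x"] by simp
      also have "\<dots> \<le> (K * V + 1) * norm (y - x) * norm (y - x)"
        by (simp add: power2_eq_square mult.assoc[symmetric] mult_right_mono)
      also have "\<dots> \<le> e * norm (y - x)" using y KV by (intro mult_right_mono) (auto simp: field_simps)
      finally show "norm (smear v f y - smear v f x - (y - x) \<bullet> (- G)) \<le> e * norm (y - x)" .
    qed
  qed
qed

lemma smear_C_k: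
  fixes v :: "'a::euclidean_space \<Rightarrow> real"
  assumes v: "continuous_on UNIV v" "\<And>x. R < norm x \<Longrightarrow> v x = 0"
    and f: "f \<in> bump_algebra c" "\<And>x. r < norm x \<Longrightarrow> f x = 0"
  shows "C_k_on k UNIV (smear v f)"
  using f
proof (induction k arbitrary: f)
  case 0
  then show ?case using smear_GDERIV[OF v 0] unfolding gderiv_def
    by (auto intro!: continuous_at_imp_continuous_on has_derivative_continuous)
next
  case (Suc k)
  have g: "GDERIV (smear v f) x :> - (\<integral>y. v y *\<^sub>R gradient f (y - x) \<partial>lborel)" for x
    by (rule smear_GDERIV[OF v Suc.prems])
  \<comment> \<open>A derivative of the convolution is, up to sign, the convolution with a
    derivative of the kernel, which again lies in \<open>bump_algebra\<close>. This is why the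
    induction ranges over all kernels.\<close>
  have "frechet_derivative (smear v f) (at x) w = smear v (\<lambda>z. (- 1) * (w \<bullet> gradient f z)) x" for x w
  proof -
    have gi: "integrable lborel (\<lambda>y. v y *\<^sub>R gradient f (y - x))"
      by (rule smear_integrable[OF v bump_algebra_gradient_continuous[OF Suc.prems(1)]])
    have "frechet_derivative (smear v f) (at x) w = w \<bullet> - (\<integral>y. v y *\<^sub>R gradient f (y - x) \<partial>lborel)"
      using frechet_derivative_at[OF g[of x, unfolded gderiv_def]] by metis
    also have "\<dots> = - (\<integral>y. v y * (w \<bullet> gradient f (y - x)) \<partial>lborel)"
      using integral_inner_right[OF gi, of w] by simp
    finally show ?thesis by (simp add: smear_def)
  qed
  moreover have "C_k_on k UNIV (smear v (\<lambda>z. (- 1) * (w \<bullet> gradient f z)))" for w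
    using bump_algebra_GDERIV(2)[OF Suc.prems(1)] bump_algebra_directional_support[OF Suc.prems(2)]
    by (intro Suc.IH bump_algebra.mult bump_algebra.const) auto
  moreover have "smear v f differentiable (at x)" for x
    using g[of x] unfolding gderiv_def differentiable_def by blast
  ultimately show ?case by simp
qed

lemma smear_support:
  assumes "\<And>x. R < norm x \<Longrightarrow> v x = 0" "\<And>x. r < norm x \<Longrightarrow> f x = 0" "R + r < norm x"
  shows "smear v f x = 0"
proof -
  have "v y * f (y - x) = 0" for y
  proof (cases "R < norm y")
    case False
    then have "r < norm (y - x)" using assms(3) norm_triangle_sub[of x y] by (simp add: norm_minus_commute)
    then show ?thesis using assms(2) by simp
  qed (simp add: assms(1))
  then have "(\<lambda>y. v y * f (y - x)) = (\<lambda>y. 0)" by blast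
  then show ?thesis by (simp add: smear_def)
qed

lemma smear_test_function:
  fixes v :: "'a::euclidean_space \<Rightarrow> real"
  assumes v: "continuous_on UNIV v" "\<And>x. R < norm x \<Longrightarrow> v x = 0"
    and f: "f \<in> bump_algebra c" "\<And>x. r < norm x \<Longrightarrow> f x = 0"
  shows "smear v f \<in> test_functions"
proof -
  have "{x. smear v f x \<noteq> 0} \<subseteq> cball 0 (R + r)"
    using smear_support[of R v r f] assms by (force simp: not_less)
  then have "bounded {x. smear v f x \<noteq> 0}" using bounded_cball bounded_subset by blast
  then show ?thesis using smear_C_k[OF assms] by (simp add: test_functions_def compact_closure)
qed

lemma integral_lborel_scale:
  fixes F :: "'a::euclidean_space \<Rightarrow> real"
  assumes c: "c > 0" and [measurable]: "F \<in> borel_measurable borel"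
  shows "(\<integral>x. F x \<partial>lborel) = c ^ DIM('a) * (\<integral>x. F (c *\<^sub>R x) \<partial>lborel)"
proof -
  have "(\<integral>x. F x \<partial>lborel) = (\<integral>x. F x \<partial>density (distr lborel borel (\<lambda>x. 0 + c *\<^sub>R x)) (\<lambda>_. ennreal (\<bar>c\<bar> ^ DIM('a))))"
    using lborel_affine[of c "0::'a"] c by simp
  also have "\<dots> = (\<integral>x. \<bar>c\<bar> ^ DIM('a) * F x \<partial>distr lborel borel (\<lambda>x. 0 + c *\<^sub>R x))"
    by (subst integral_real_density) auto
  also have "\<dots> = (\<integral>x. \<bar>c\<bar> ^ DIM('a) * F (0 + c *\<^sub>R x) \<partial>lborel)"
    by (subst integral_distr) auto
  finally show ?thesis using c by simp
qed

text \<open>Difference quotients have integral 0 by translation invariance, and they converge almost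
  everywhere under a bound with bounded support.\<close>

lemma integral_gradient_zero:
  fixes w :: "'a::euclidean_space \<Rightarrow> real"
  assumes L: "L-lipschitz_on UNIV w" and supp: "\<And>x. R < norm x \<Longrightarrow> w x = 0"
  shows "integrable lborel (\<lambda>x. v \<bullet> gradient w x)" "(\<integral>x. v \<bullet> gradient w x \<partial>lborel) = 0"
proof -
  have wc: "continuous_on UNIV w" using L by (rule lipschitz_on_continuous_on)
  have [measurable]: "gradient w \<in> borel_measurable borel" "w \<in> borel_measurable borel"
    using lipschitz_gradient_borel[OF L] lipschitz_borel[OF L] by auto
  define q where "q = (\<lambda>n x. diffquot w v x (1 / real (Suc n)))"
  have qm[measurable]: "q n \<in> borel_measurable borel" for n unfolding q_def by (rule diffquot_borel[OF wc])
  let ?W = "\<lambda>x::'a. L * norm v * indicator (cball 0 (R + norm v)) x"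
  have W: "integrable lborel ?W"
    using emeasure_lborel_cball_finite[of "0::'a" "R + norm v"]
    by (intro integrable_mult_right integrable_real_indicator) auto
  have ptw: "AE x in lborel. (\<lambda>n. q n x) \<longlonglongrightarrow> v \<bullet> gradient w x"
    using AE_GDERIV[OF L] unfolding q_def
    by eventually_elim (rule filterlim_compose[OF diffquot_tendsto inverse_Suc_filterlim])
  have dom: "AE x in lborel. norm (q n x) \<le> ?W x" for n
  proof (rule AE_I2)
    fix x
    have b: "\<bar>q n x\<bar> \<le> L * norm v" unfolding q_def by (rule abs_diffquot_le[OF L])
    show "norm (q n x) \<le> ?W x"
    proof (cases "norm x \<le> R + norm v")
      case True
      then show ?thesis using b by simp
    next
      case False
      have "norm ((1 / real (Suc n)) *\<^sub>R v) \<le> norm v"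
      proof -
        have "1 / real (Suc n) * norm v \<le> 1 * norm v" by (intro mult_right_mono) auto
        then show ?thesis by simp
      qed
      moreover have "norm x - norm ((1 / real (Suc n)) *\<^sub>R v) \<le> norm (x + (1 / real (Suc n)) *\<^sub>R v)"
        by (rule norm_diff_ineq)
      ultimately have "R < norm (x + (1 / real (Suc n)) *\<^sub>R v)" "R < norm x" using False norm_ge_zero[of v] by linarith+
      then have "q n x = 0" using supp by (simp add: q_def diffquot_def)
      then show ?thesis using False by simp
    qed
  qed
  have wi: "integrable lborel w" by (rule integrable_continuous_supported[OF wc supp])
  have q0: "(\<integral>x. q n x \<partial>lborel) = 0" for n
  proof -
    have "(\<integral>x. q n x \<partial>lborel) = ((\<integral>x. w (x + (1 / real (Suc n)) *\<^sub>R v) \<partial>lborel) - (\<integral>x. w x \<partial>lborel)) / (1 / real (Suc n))"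
      unfolding q_def diffquot_def using Bochner_Integration.integral_diff[OF integrable_lborel_shift[OF wi] wi, of "(1 / real (Suc n)) *\<^sub>R v"]
      by (simp only: integral_divide_zero)
    then show ?thesis using integral_lborel_shift[of w "(1 / real (Suc n)) *\<^sub>R v"] by simp
  qed
  show "integrable lborel (\<lambda>x. v \<bullet> gradient w x)"
    by (rule integrable_dominated_convergence[OF _ _ W ptw dom]) auto
  have "(\<lambda>n. \<integral>x. q n x \<partial>lborel) \<longlonglongrightarrow> (\<integral>x. v \<bullet> gradient w x \<partial>lborel)"
    by (rule integral_dominated_convergence[OF _ _ W ptw dom]) auto
  then show "(\<integral>x. v \<bullet> gradient w x \<partial>lborel) = 0" unfolding q0 by (rule LIMSEQ_unique[OF _ tendsto_const])
qed

section \<open>Normalized mollifiers and the convergence of gradients\<close>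

definition bump :: "real \<Rightarrow> 'a::euclidean_space \<Rightarrow> real" where
  "bump c x = bump_profile 0 (1 - c\<^sup>2 * (x \<bullet> x))"

lemma bump_in_algebra: "bump c \<in> bump_algebra c"
  unfolding bump_def[abs_def] by (rule bump_algebra.bump)

lemma bump_nonneg: "bump c x \<ge> 0" by (simp add: bump_def bump_profile_def)

lemma bump_support: "c > 0 \<Longrightarrow> 1 / c < norm x \<Longrightarrow> bump c x = 0"
proof -
  assume c: "c > 0" "1 / c < norm x"
  then have "1 < c * norm x" by (simp add: field_simps)
  then have "1 < (c * norm x)\<^sup>2" by (simp add: one_less_power)
  then show ?thesis by (simp add: bump_def bump_profile_def power_mult_distrib power2_norm_eq_inner)
qed

lemma bump_scale: "bump c x = bump 1 (c *\<^sub>R x)"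
  by (simp add: bump_def power2_eq_square mult_ac)

lemma bump_integral_pos:
  assumes c: "c > 0" shows "(\<integral>x. bump c x \<partial>(lborel::'a::euclidean_space measure)) > 0"
proof -
  have cont: "continuous_on UNIV (bump c :: 'a \<Rightarrow> real)" by (rule bump_algebra_continuous[OF bump_in_algebra])
  have int: "integrable lborel (bump c :: 'a \<Rightarrow> real)" using bump_support[OF c] by (rule integrable_continuous_supported[OF cont])
  have "(\<integral>x. bump c x \<partial>(lborel::'a measure)) \<noteq> 0"
  proof
    assume "(\<integral>x. bump c x \<partial>(lborel::'a measure)) = 0"
    then have "AE x in (lborel::'a measure). bump c x = 0"
      using int by (subst (asm) integral_nonneg_eq_0_iff_AE) (auto simp: bump_nonneg)
    then have ae: "AE x in (lborel::'a measure). bump c x \<le> 0" by eventually_elim simp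
    have "bump c (0::'a) \<le> 0" by (rule AE_continuous_imp_all[OF ae cont continuous_on_const])
    then show False by (simp add: bump_def bump_profile_def)
  qed
  moreover have "(\<integral>x. bump c x \<partial>(lborel::'a measure)) \<ge> 0" using bump_nonneg by (rule Bochner_Integration.integral_nonneg)
  ultimately show ?thesis by linarith
qed

definition mollifier :: "real \<Rightarrow> 'a::euclidean_space \<Rightarrow> real" where
  "mollifier c x = 1 / (\<integral>x. bump c x \<partial>(lborel::'a measure)) * bump c x"

lemma mollifier_in_algebra: "mollifier c \<in> bump_algebra c"
  unfolding mollifier_def[abs_def] by (intro bump_algebra.mult bump_algebra.const bump_in_algebra)

lemma mollifier_support: "c > 0 \<Longrightarrow> 1 / c < norm x \<Longrightarrow> mollifier c x = 0"
  by (simp add: mollifier_def bump_support)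

lemma mollifier_nonneg: "mollifier c x \<ge> 0"
  unfolding mollifier_def by (intro mult_nonneg_nonneg bump_nonneg) (simp add: bump_nonneg)

lemma mollifier_integrable: "c > 0 \<Longrightarrow> integrable lborel (mollifier c)"
  using mollifier_support by (intro integrable_continuous_supported bump_algebra_continuous[OF mollifier_in_algebra])

lemma mollifier_integral: "c > 0 \<Longrightarrow> (\<integral>x. mollifier c x \<partial>(lborel::'a::euclidean_space measure)) = 1"
  unfolding mollifier_def using bump_integral_pos[of c, where 'a='a] by simp

text \<open>The L^1 norm of a directional derivative of the mollifier grows like \<open>c\<close>,
  while the support has radius \<open>1 / c\<close>. The two effects cancel in the error estimate
  for gradients of mollifications.\<close>

lemma mollifier_gradient_integral:
  fixes b :: "'a::euclidean_space"
  assumes c: "c > 0"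
  shows "(\<integral>z. \<bar>b \<bullet> gradient (mollifier c) z\<bar> \<partial>lborel) = c * ((\<integral>z. \<bar>b \<bullet> gradient (bump 1) z\<bar> \<partial>lborel) / (\<integral>x. bump 1 x \<partial>(lborel::'a measure)))"
proof -
  have [measurable]: "(bump 1 :: 'a \<Rightarrow> real) \<in> borel_measurable borel" "gradient (bump 1 :: 'a \<Rightarrow> real) \<in> borel_measurable borel"
    using bump_algebra_continuous[OF bump_in_algebra] by (auto intro: borel_measurable_continuous_onI gradient_borel)
  define I where "I = (\<integral>x. bump c x \<partial>(lborel::'a measure))"
  have I: "I > 0" unfolding I_def by (rule bump_integral_pos[OF c])
  have s1: "(\<integral>x. bump 1 x \<partial>(lborel::'a measure)) = c ^ DIM('a) * I"
  proof -
    have "(\<lambda>x::'a. bump 1 (c *\<^sub>R x)) = bump c" by (rule ext) (rule bump_scale[symmetric])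
    then show ?thesis unfolding I_def using integral_lborel_scale[OF c, of "bump 1 :: 'a \<Rightarrow> real"] by simp
  qed
  have grad: "gradient (mollifier c) z = (c / I) *\<^sub>R gradient (bump 1) (c *\<^sub>R z)" for z :: 'a
  proof (rule gradient_eq)
    have 1: "((\<lambda>x::'a. c *\<^sub>R x) has_derivative (\<lambda>h. c *\<^sub>R h)) (at z)" by (auto intro!: derivative_eq_intros)
    have "((bump 1 :: 'a \<Rightarrow> real) has_derivative (\<lambda>h. h \<bullet> gradient (bump 1) (c *\<^sub>R z))) (at (c *\<^sub>R z))"
      using bump_algebra_GDERIV(1)[OF bump_in_algebra] by (simp add: gderiv_def)
    from has_derivative_compose[OF 1 this]
    have "((\<lambda>x. 1 / I * bump 1 (c *\<^sub>R x)) has_derivative (\<lambda>h. 1 / I * ((c *\<^sub>R h) \<bullet> gradient (bump 1) (c *\<^sub>R z)))) (at z)"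
      by (intro has_derivative_mult_right)
    then show "GDERIV (mollifier c) z :> (c / I) *\<^sub>R gradient (bump 1) (c *\<^sub>R z)"
      unfolding gderiv_def mollifier_def[abs_def] I_def[symmetric] bump_scale[of c] by simp
  qed
  have "(\<integral>z. \<bar>b \<bullet> gradient (mollifier c) z\<bar> \<partial>lborel) = (\<integral>z. (c / I) * \<bar>b \<bullet> gradient (bump 1) (c *\<^sub>R z)\<bar> \<partial>lborel)"
    using c I by (simp add: grad abs_mult)
  also have "\<dots> = (c / I) * (\<integral>z. \<bar>b \<bullet> gradient (bump 1) (c *\<^sub>R z)\<bar> \<partial>lborel)" by simp
  also have "(\<integral>z. \<bar>b \<bullet> gradient (bump 1) (c *\<^sub>R z)\<bar> \<partial>lborel) = (\<integral>z. \<bar>b \<bullet> gradient (bump 1) z\<bar> \<partial>lborel) / c ^ DIM('a)"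
    using integral_lborel_scale[OF c, of "\<lambda>z. \<bar>b \<bullet> gradient (bump 1) z\<bar>"] c by simp
  finally show ?thesis unfolding s1 using c I by simp
qed

lemma mollify_shift:
  fixes v :: "'a::euclidean_space \<Rightarrow> real"
  assumes "continuous_on UNIV v" "continuous_on UNIV f"
  shows "smear v f x = (\<integral>z. v (x + z) * f z \<partial>lborel)"
proof -
  have [measurable]: "v \<in> borel_measurable borel" "f \<in> borel_measurable borel"
    using assms by (auto intro: borel_measurable_continuous_onI)
  show ?thesis unfolding smear_def
    using integral_lborel_shift[of "\<lambda>y. v y * f (y - x)" x] by (simp add: add.commute)
qed

lemma shifted_integrable:
  fixes v :: "'a::euclidean_space \<Rightarrow> real"
  assumes "continuous_on UNIV v" "continuous_on UNIV f" "\<And>z. r < norm z \<Longrightarrow> f z = 0"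
  shows "integrable lborel (\<lambda>z. v (x + z) * f z)"
  using assms by (intro integrable_continuous_supported[of _ r] continuous_intros continuous_on_compose2[OF assms(1)]) auto

lemma mollify_close:
  fixes v :: "'a::euclidean_space \<Rightarrow> real"
  assumes L: "L-lipschitz_on UNIV v" and c: "c > 0"
  shows "\<bar>smear v (mollifier c) x - v x\<bar> \<le> L / c"
proof -
  have vc: "continuous_on UNIV v" using L by (rule lipschitz_on_continuous_on)
  have mc: "continuous_on UNIV (mollifier c :: 'a \<Rightarrow> real)" by (rule bump_algebra_continuous[OF mollifier_in_algebra])
  have i1: "integrable lborel (\<lambda>z. v (x + z) * mollifier c z)" by (rule shifted_integrable[OF vc mc mollifier_support[OF c]])
  have i2: "integrable lborel (\<lambda>z. v x * mollifier c z)" using mollifier_integrable[OF c] by (rule integrable_mult_right)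
  have eq: "smear v (mollifier c) x - v x = (\<integral>z. v (x + z) * mollifier c z - v x * mollifier c z \<partial>lborel)"
    using Bochner_Integration.integral_diff[OF i1 i2] mollifier_integral[OF c, where 'a='a] by (simp add: mollify_shift[OF vc mc])
  have "\<bar>smear v (mollifier c) x - v x\<bar> \<le> (\<integral>z. \<bar>v (x + z) * mollifier c z - v x * mollifier c z\<bar> \<partial>lborel)"
    unfolding eq by (rule integral_abs_bound)
  also have "\<dots> \<le> (\<integral>z. (L / c) * mollifier c z \<partial>(lborel::'a measure))"
  proof (rule integral_mono)
    show "integrable lborel (\<lambda>z. \<bar>v (x + z) * mollifier c z - v x * mollifier c z\<bar>)"
      using i1 i2 by (intro integrable_abs Bochner_Integration.integrable_diff)
    show "integrable lborel (\<lambda>z::'a. (L / c) * mollifier c z)" using mollifier_integrable[OF c] by (rule integrable_mult_right)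
    fix z :: 'a
    show "\<bar>v (x + z) * mollifier c z - v x * mollifier c z\<bar> \<le> (L / c) * mollifier c z"
    proof (cases "1 / c < norm z")
      case True
      then show ?thesis using mollifier_support[OF c, of z] by simp
    next
      case False
      have "\<bar>v (x + z) - v x\<bar> \<le> L * dist (x + z) x" using lipschitz_onD[OF L, of "x + z" x] by (simp add: dist_real_def)
      also have "\<dots> \<le> L * (1 / c)" using False lipschitz_on_nonneg[OF L] by (intro mult_left_mono) (auto simp: dist_norm)
      finally have "\<bar>v (x + z) - v x\<bar> * mollifier c z \<le> L / c * mollifier c z"
        using mollifier_nonneg[of c z] by (intro mult_right_mono) auto
      then show ?thesis using mollifier_nonneg[of c z] by (simp add: left_diff_distrib[symmetric] abs_mult del: left_diff_distrib)
    qed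
  qed
  also have "\<dots> = L / c" using mollifier_integral[OF c, where 'a='a] by simp
  finally show ?thesis .
qed

lemma mollify_lipschitz:
  fixes v :: "'a::euclidean_space \<Rightarrow> real"
  assumes L: "L-lipschitz_on UNIV v" and c: "c > 0"
  shows "L-lipschitz_on UNIV (smear v (mollifier c))"
proof (rule lipschitz_onI)
  have vc: "continuous_on UNIV v" using L by (rule lipschitz_on_continuous_on)
  have mc: "continuous_on UNIV (mollifier c :: 'a \<Rightarrow> real)" by (rule bump_algebra_continuous[OF mollifier_in_algebra])
  fix x y :: 'a
  have i: "integrable lborel (\<lambda>z. v (x + z) * mollifier c z)" for x by (rule shifted_integrable[OF vc mc mollifier_support[OF c]])
  have eq: "smear v (mollifier c) x - smear v (mollifier c) y = (\<integral>z. v (x + z) * mollifier c z - v (y + z) * mollifier c z \<partial>lborel)"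
    using Bochner_Integration.integral_diff[OF i i] by (simp add: mollify_shift[OF vc mc])
  have "\<bar>smear v (mollifier c) x - smear v (mollifier c) y\<bar> \<le> (\<integral>z. \<bar>v (x + z) * mollifier c z - v (y + z) * mollifier c z\<bar> \<partial>lborel)"
    unfolding eq by (rule integral_abs_bound)
  also have "\<dots> \<le> (\<integral>z. (L * dist x y) * mollifier c z \<partial>(lborel::'a measure))"
  proof (rule integral_mono)
    show "integrable lborel (\<lambda>z. \<bar>v (x + z) * mollifier c z - v (y + z) * mollifier c z\<bar>)"
      using i by (intro integrable_abs Bochner_Integration.integrable_diff)
    show "integrable lborel (\<lambda>z::'a. (L * dist x y) * mollifier c z)" using mollifier_integrable[OF c] by (rule integrable_mult_right)
    fix z :: 'a
    have "\<bar>v (x + z) - v (y + z)\<bar> \<le> L * dist x y" using lipschitz_onD[OF L, of "x + z" "y + z"] by (simp add: dist_real_def)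
    then have "\<bar>v (x + z) - v (y + z)\<bar> * mollifier c z \<le> L * dist x y * mollifier c z"
      using mollifier_nonneg[of c z] by (intro mult_right_mono) auto
    then show "\<bar>v (x + z) * mollifier c z - v (y + z) * mollifier c z\<bar> \<le> (L * dist x y) * mollifier c z"
      using mollifier_nonneg[of c z] by (simp add: left_diff_distrib[symmetric] abs_mult del: left_diff_distrib)
  qed
  also have "\<dots> = L * dist x y" using mollifier_integral[OF c, where 'a='a] by simp
  finally show "dist (smear v (mollifier c) x) (smear v (mollifier c) y) \<le> L * dist x y" by (simp add: dist_real_def)
qed (rule lipschitz_on_nonneg[OF L])

text \<open>The kernel \<open>b \<bullet> gradient (mollifier c)\<close> reproduces derivatives of
  affine functions exactly: its integral is 0, and its first moment is computed by integration by
  parts. Only the remainder of the expansion of \<open>v\<close> at \<open>x\<close> contributes, so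
  an expansion at this single point is enough.\<close>

lemma mollify_gradient_error:
  fixes v :: "'a::euclidean_space \<Rightarrow> real"
  assumes v: "continuous_on UNIV v" "\<And>x. R < norm x \<Longrightarrow> v x = 0" and c: "c > 0"
    and e: "\<And>z. norm z \<le> 1 / c \<Longrightarrow> \<bar>v (x + z) - v x - z \<bullet> g\<bar> \<le> e * norm z" "e \<ge> 0"
  shows "\<bar>b \<bullet> gradient (smear v (mollifier c)) x - b \<bullet> g\<bar>
     \<le> e * ((\<integral>z. \<bar>b \<bullet> gradient (bump 1) z\<bar> \<partial>lborel) / (\<integral>x. bump 1 x \<partial>(lborel::'a measure)))"
proof -
  let ?m = "mollifier c :: 'a \<Rightarrow> real"
  define k where "k = (\<lambda>z. b \<bullet> gradient ?m z)"
  have kb: "k \<in> bump_algebra c" unfolding k_def by (rule bump_algebra_GDERIV(2)[OF mollifier_in_algebra])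
  have kc: "continuous_on UNIV k" by (rule bump_algebra_continuous[OF kb])
  have k0: "k z = 0" if "1 / c < norm z" for z
    unfolding k_def using bump_algebra_directional_support[OF mollifier_support[OF c] that] .
  have ki: "integrable lborel (\<lambda>z. \<bar>k z\<bar>)" using integrable_continuous_supported[OF kc k0] by (rule integrable_abs)
  have gi: "integrable lborel (\<lambda>y. v y *\<^sub>R gradient ?m (y - x))"
    by (rule smear_integrable[OF v bump_algebra_gradient_continuous[OF mollifier_in_algebra]])
  have "b \<bullet> gradient (smear v ?m) x = b \<bullet> - (\<integral>y. v y *\<^sub>R gradient ?m (y - x) \<partial>lborel)"
    using gradient_eq[OF smear_GDERIV[OF v mollifier_in_algebra mollifier_support[OF c]]] by simp
  also have "\<dots> = - smear v k x"
    unfolding smear_def k_def using integral_inner_right[OF gi, of b] by simp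
  also have "\<dots> = - (\<integral>z. v (x + z) * k z \<partial>lborel)" by (simp add: mollify_shift[OF v(1) kc])
  finally have e1: "b \<bullet> gradient (smear v ?m) x = - (\<integral>z. v (x + z) * k z \<partial>lborel)" .
  have i1: "integrable lborel (\<lambda>z. v (x + z) * k z)" by (rule shifted_integrable[OF v(1) kc k0])
  obtain L where L: "L-lipschitz_on UNIV ?m"
    using C1_supported_lipschitz[OF bump_algebra_C1_supported[OF mollifier_in_algebra mollifier_support[OF c]]] by blast
  have k_int0: "(\<integral>z. k z \<partial>lborel) = 0"
    unfolding k_def by (rule integral_gradient_zero(2)[OF L mollifier_support[OF c]])
  \<comment> \<open>The derivative of \<open>w\<close> along \<open>b\<close> has integral 0, which
    evaluates the first moment of \<open>k\<close>.\<close>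
  define w where "w = (\<lambda>z. (z \<bullet> g) * ?m z)"
  have wb: "w \<in> bump_algebra c" unfolding w_def by (intro bump_algebra.intros mollifier_in_algebra)
  have w0: "w z = 0" if "1 / c < norm z" for z using mollifier_support[OF c that] by (simp add: w_def)
  obtain L' where L': "L'-lipschitz_on UNIV w" using C1_supported_lipschitz[OF bump_algebra_C1_supported[OF wb w0]] by blast
  have gw: "b \<bullet> gradient w z = (b \<bullet> g) * ?m z + (z \<bullet> g) * k z" for z
  proof -
    have 1: "((\<lambda>z. z \<bullet> g) has_derivative (\<lambda>h. h \<bullet> g)) (at z)"
      by (intro bounded_linear_imp_has_derivative bounded_linear_inner_left)
    have 2: "(?m has_derivative (\<lambda>h. h \<bullet> gradient ?m z)) (at z)"
      using bump_algebra_GDERIV(1)[OF mollifier_in_algebra] by (simp add: gderiv_def)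
    have "GDERIV w z :> ?m z *\<^sub>R g + (z \<bullet> g) *\<^sub>R gradient ?m z"
      unfolding w_def gderiv_def using has_derivative_mult[OF 1 2] by (simp add: inner_add_right mult.commute add.commute)
    from gradient_eq[OF this] show ?thesis by (simp add: k_def inner_add_right)
  qed
  have i3: "integrable lborel (\<lambda>z. (z \<bullet> g) * k z)"
    by (rule integrable_continuous_supported[of _ "1/c"]) (use k0 in \<open>auto intro!: continuous_intros kc\<close>)
  have i4: "integrable lborel (\<lambda>z. (b \<bullet> g) * ?m z)" using mollifier_integrable[OF c] by (rule integrable_mult_right)
  have "0 = (\<integral>z. (b \<bullet> g) * ?m z + (z \<bullet> g) * k z \<partial>lborel)"
    using integral_gradient_zero(2)[OF L' w0, where v=b] by (simp add: gw)
  also have "\<dots> = (b \<bullet> g) + (\<integral>z. (z \<bullet> g) * k z \<partial>lborel)"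
    using mollifier_integral[OF c, where 'a='a] by (simp add: Bochner_Integration.integral_add[OF i4 i3])
  finally have e2: "b \<bullet> g = - (\<integral>z. (z \<bullet> g) * k z \<partial>lborel)" by simp
  have i5: "integrable lborel (\<lambda>z. v x * k z)" using integrable_continuous_supported[OF kc k0] by (rule integrable_mult_right)
  have eq: "b \<bullet> gradient (smear v ?m) x - b \<bullet> g = - (\<integral>z. v (x + z) * k z - v x * k z - (z \<bullet> g) * k z \<partial>lborel)"
    using Bochner_Integration.integral_diff[OF Bochner_Integration.integrable_diff[OF i1 i5] i3]
      Bochner_Integration.integral_diff[OF i1 i5] k_int0 unfolding e1 e2 by simp
  have "\<bar>b \<bullet> gradient (smear v ?m) x - b \<bullet> g\<bar> \<le> (\<integral>z. \<bar>v (x + z) * k z - v x * k z - (z \<bullet> g) * k z\<bar> \<partial>lborel)"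
    unfolding eq abs_minus_cancel by (rule integral_abs_bound)
  also have "\<dots> \<le> (\<integral>z. (e / c) * \<bar>k z\<bar> \<partial>lborel)"
  proof (rule integral_mono)
    show "integrable lborel (\<lambda>z. \<bar>v (x + z) * k z - v x * k z - (z \<bullet> g) * k z\<bar>)"
      using i1 i5 i3 by (intro integrable_abs Bochner_Integration.integrable_diff)
    show "integrable lborel (\<lambda>z. (e / c) * \<bar>k z\<bar>)" using ki by (rule integrable_mult_right)
    fix z :: 'a
    show "\<bar>v (x + z) * k z - v x * k z - (z \<bullet> g) * k z\<bar> \<le> (e / c) * \<bar>k z\<bar>"
    proof (cases "1 / c < norm z")
      case True
      then show ?thesis using k0 by simp
    next
      case False
      have "\<bar>v (x + z) - v x - z \<bullet> g\<bar> \<le> e * norm z" using False by (intro e) simp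
      also have "\<dots> \<le> e * (1 / c)" using False e(2) by (intro mult_left_mono) auto
      finally have "\<bar>v (x + z) - v x - z \<bullet> g\<bar> * \<bar>k z\<bar> \<le> e / c * \<bar>k z\<bar>"
        by (intro mult_right_mono) auto
      moreover have "v (x + z) * k z - v x * k z - (z \<bullet> g) * k z = (v (x + z) - v x - z \<bullet> g) * k z"
        by (simp only: left_diff_distrib)
      ultimately show ?thesis by (simp only: abs_mult)
    qed
  qed
  also have "\<dots> = (e / c) * (\<integral>z. \<bar>k z\<bar> \<partial>lborel)" by simp
  finally show ?thesis unfolding k_def mollifier_gradient_integral[OF c] using c by simp
qed

text \<open>Since convergence holds at every point of differentiability, it holds almost everywhere
  for Lipschitz functions, which prepares dominated convergence of the gradients.\<close>

lemma mollify_gradient_tendsto: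
  fixes v :: "'a::euclidean_space \<Rightarrow> real"
  assumes v: "continuous_on UNIV v" "\<And>x. R < norm x \<Longrightarrow> v x = 0" and g: "GDERIV v x :> g"
  shows "(\<lambda>n. gradient (smear v (mollifier (real (Suc n)))) x) \<longlonglongrightarrow> g"
proof -
  have lim: "(\<lambda>n. b \<bullet> gradient (smear v (mollifier (real (Suc n)))) x) \<longlonglongrightarrow> b \<bullet> g" for b
  proof (rule LIMSEQ_I)
    fix r :: real assume r: "r > 0"
    define C where "C = (\<integral>z. \<bar>b \<bullet> gradient (bump 1) z\<bar> \<partial>lborel) / (\<integral>x. bump 1 x \<partial>(lborel::'a measure))"
    have C: "C \<ge> 0" unfolding C_def using bump_integral_pos[of 1, where 'a='a] by (intro divide_nonneg_pos Bochner_Integration.integral_nonneg) auto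
    define e where "e = r / (C + 1)"
    have e: "e > 0" using r C by (simp add: e_def)
    from g[unfolded gderiv_def has_derivative_at_alt] e obtain d where d: "d > 0"
      "\<forall>y. norm (y - x) < d \<longrightarrow> norm (v y - v x - (y - x) \<bullet> g) \<le> e * norm (y - x)" by blast
    obtain N where N: "1 / real (Suc N) < d" using nat_approx_posE d(1) by blast
    show "\<exists>N. \<forall>n\<ge>N. norm (b \<bullet> gradient (smear v (mollifier (real (Suc n)))) x - b \<bullet> g) < r"
    proof (intro exI allI impI)
      fix n assume n: "n \<ge> N"
      have "1 / real (Suc n) \<le> 1 / real (Suc N)" using n by (intro divide_left_mono) auto
      then have n': "1 / real (Suc n) < d" using N by linarith
      have "\<bar>b \<bullet> gradient (smear v (mollifier (real (Suc n)))) x - b \<bullet> g\<bar> \<le> e * C" unfolding C_def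
      proof (rule mollify_gradient_error[OF v])
        show "\<bar>v (x + z) - v x - z \<bullet> g\<bar> \<le> e * norm z" if "norm z \<le> 1 / real (Suc n)" for z
          using d(2)[rule_format, of "x + z"] that n' by simp
      qed (use e in auto)
      also have "\<dots> < e * (C + 1)" using e by simp
      also have "\<dots> = r" using C by (simp add: e_def)
      finally show "norm (b \<bullet> gradient (smear v (mollifier (real (Suc n)))) x - b \<bullet> g) < r" by simp
    qed
  qed
  have "(\<lambda>n. \<Sum>b\<in>Basis. (b \<bullet> gradient (smear v (mollifier (real (Suc n)))) x) *\<^sub>R b) \<longlonglongrightarrow> (\<Sum>b\<in>Basis. (b \<bullet> g) *\<^sub>R b)"
    by (intro tendsto_sum tendsto_scaleR lim tendsto_const)
  moreover have "(\<Sum>b\<in>Basis. (b \<bullet> y) *\<^sub>R b) = y" for y :: 'a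
    by (simp add: inner_commute[of _ y] euclidean_representation)
  ultimately show ?thesis by simp
qed

lemma nn_integral_supported_tendsto_0:
  fixes f :: "nat \<Rightarrow> 'a::euclidean_space \<Rightarrow> real"
  assumes [measurable]: "\<And>n. f n \<in> borel_measurable borel"
    and b: "\<And>n. AE x in lborel. \<bar>f n x\<bar> \<le> B" and supp: "\<And>n x. R < norm x \<Longrightarrow> f n x = 0"
    and lim: "AE x in lborel. (\<lambda>n. f n x) \<longlonglongrightarrow> 0"
  shows "(\<lambda>n. \<integral>\<^sup>+x. ennreal (f n x) \<partial>lborel) \<longlonglongrightarrow> 0"
proof -
  have [measurable]: "cball (0::'a) R \<in> sets borel" by simp
  have "(\<lambda>n. \<integral>\<^sup>+x. ennreal (f n x) \<partial>lborel) \<longlonglongrightarrow> (\<integral>\<^sup>+x. 0 \<partial>(lborel::'a measure))"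
  proof (rule nn_integral_dominated_convergence[where w="\<lambda>x. ennreal B * indicator (cball 0 R) x"])
    show "AE x in lborel. ennreal (f n x) \<le> ennreal B * indicator (cball 0 R) x" for n
      using b[of n]
    proof eventually_elim
      case (elim x)
      then show ?case using supp[of x n] by (cases "norm x \<le> R") (auto intro!: ennreal_leI)
    qed
    have "(\<integral>\<^sup>+x. ennreal B * indicator (cball (0::'a) R) x \<partial>lborel) = ennreal B * emeasure lborel (cball (0::'a) R)"
      by (rule nn_integral_cmult_indicator) simp
    then show "(\<integral>\<^sup>+x. ennreal B * indicator (cball (0::'a) R) x \<partial>lborel) < \<infinity>"
      using emeasure_lborel_cball_finite[of "0::'a" R] by (simp add: ennreal_mult_less_top)
    show "AE x in lborel. (\<lambda>n. ennreal (f n x)) \<longlonglongrightarrow> 0"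
      using lim by eventually_elim (use tendsto_ennrealI in fastforce)
  qed measurable
  then show ?thesis by simp
qed

lemma approximation_compact:
  fixes v :: "'a::euclidean_space \<Rightarrow> real"
  assumes L: "L-lipschitz_on UNIV v" and supp: "\<And>x. R < norm x \<Longrightarrow> v x = 0" and q: "q > 0" and e: "e > 0"
  shows "\<exists>\<phi>\<in>test_functions. norm_sq_integral (\<lambda>x. gradient \<phi> x - gradient v x) < ennreal e
     \<and> powr_integral q (\<lambda>x. \<phi> x - v x) < ennreal e"
proof -
  have vc: "continuous_on UNIV v" using L by (rule lipschitz_on_continuous_on)
  have L0: "L \<ge> 0" using L by (rule lipschitz_on_nonneg)
  define \<phi> where "\<phi> = (\<lambda>n. smear v (mollifier (real (Suc n))))"
  have test: "\<phi> n \<in> test_functions" for n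
    unfolding \<phi>_def by (rule smear_test_function[OF vc supp mollifier_in_algebra mollifier_support]) auto
  have lip: "L-lipschitz_on UNIV (\<phi> n)" for n unfolding \<phi>_def by (rule mollify_lipschitz[OF L]) simp
  have close: "\<bar>\<phi> n x - v x\<bar> \<le> L / real (Suc n)" for n x unfolding \<phi>_def by (rule mollify_close[OF L]) simp
  have supp\<phi>: "\<phi> n x = 0" if "\<bar>R\<bar> + 1 < norm x" for n x
  proof -
    have "R + 1 / real (Suc n) \<le> \<bar>R\<bar> + 1" by (intro add_mono) auto
    then have R: "R + 1 / real (Suc n) < norm x" using that by linarith
    have m0: "mollifier (real (Suc n)) z = 0" if "1 / real (Suc n) < norm z" for z :: 'a
      using that by (intro mollifier_support) auto
    show ?thesis unfolding \<phi>_def by (rule smear_support[OF supp m0 R])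
  qed
  have suppv: "v x = 0" if "\<bar>R\<bar> + 1 < norm x" for x using that by (intro supp) auto
  have [measurable]: "\<phi> n \<in> borel_measurable borel" "gradient (\<phi> n) \<in> borel_measurable borel" for n
    using lipschitz_borel[OF lip] lipschitz_gradient_borel[OF lip] by auto
  have [measurable]: "v \<in> borel_measurable borel" "gradient v \<in> borel_measurable borel"
    using lipschitz_borel[OF L] lipschitz_gradient_borel[OF L] by auto
  have 1: "(\<lambda>n. \<integral>\<^sup>+x. ennreal ((norm (gradient (\<phi> n) x - gradient v x))\<^sup>2) \<partial>lborel) \<longlonglongrightarrow> 0"
  proof (rule nn_integral_supported_tendsto_0[where B="(L + L)\<^sup>2" and R="\<bar>R\<bar> + 1"])
    fix n
    show "AE x in lborel. \<bar>(norm (gradient (\<phi> n) x - gradient v x))\<^sup>2\<bar> \<le> (L + L)\<^sup>2"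
      using AE_GDERIV[OF L] AE_GDERIV[OF lip[of n]]
    proof eventually_elim
      case (elim x)
      have "norm (gradient (\<phi> n) x - gradient v x) \<le> norm (gradient (\<phi> n) x) + norm (gradient v x)" by (rule norm_triangle_ineq4)
      also have "\<dots> \<le> L + L" by (intro add_mono norm_gradient_le[OF L elim(1)] norm_gradient_le[OF lip elim(2)])
      finally have "(norm (gradient (\<phi> n) x - gradient v x))\<^sup>2 \<le> (L + L)\<^sup>2" by (rule power_mono) simp
      then show ?case by (simp only: abs_power2)
    qed
    show "(norm (gradient (\<phi> n) x - gradient v x))\<^sup>2 = 0" if "\<bar>R\<bar> + 1 < norm x" for x
      using gradient_eq[OF gradient_zero_outside[of "\<bar>R\<bar> + 1" "\<phi> n" x]] gradient_eq[OF gradient_zero_outside[of "\<bar>R\<bar> + 1" v x]]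
        supp\<phi> suppv that by simp
  next
    show "AE x in lborel. (\<lambda>n. (norm (gradient (\<phi> n) x - gradient v x))\<^sup>2) \<longlonglongrightarrow> 0"
      using AE_GDERIV[OF L]
    proof eventually_elim
      case (elim x)
      have "(\<lambda>n. (norm (gradient (\<phi> n) x - gradient v x))\<^sup>2) \<longlonglongrightarrow> (norm (gradient v x - gradient v x))\<^sup>2"
        unfolding \<phi>_def by (intro tendsto_intros mollify_gradient_tendsto[OF vc supp elim])
      then show ?case by simp
    qed
  qed measurable
  have 2: "(\<lambda>n. \<integral>\<^sup>+x. ennreal (\<bar>\<phi> n x - v x\<bar> powr q) \<partial>lborel) \<longlonglongrightarrow> 0"
  proof (rule nn_integral_supported_tendsto_0[where B="L powr q" and R="\<bar>R\<bar> + 1"])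
    fix n
    have "\<bar>\<phi> n x - v x\<bar> \<le> L" for x
    proof -
      have "L / real (Suc n) \<le> L / 1" using L0 by (intro divide_left_mono) auto
      then show ?thesis using close[of n x] by simp
    qed
    then show "AE x in lborel. \<bar>\<bar>\<phi> n x - v x\<bar> powr q\<bar> \<le> L powr q" using q by (auto intro!: powr_mono2)
    show "\<bar>\<phi> n x - v x\<bar> powr q = 0" if "\<bar>R\<bar> + 1 < norm x" for x using supp\<phi>[OF that] suppv[OF that] by simp
  next
    have "(\<lambda>n. L / real (Suc n)) \<longlonglongrightarrow> L * 0"
      unfolding divide_inverse by (intro tendsto_mult tendsto_const LIMSEQ_inverse_real_of_nat)
    then have l0: "(\<lambda>n. L / real (Suc n)) \<longlonglongrightarrow> 0" by simp
    have "(\<lambda>n. \<bar>\<phi> n x - v x\<bar>) \<longlonglongrightarrow> 0" for x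
      by (rule Lim_null_comparison[OF _ l0]) (use close in auto)
    then have "(\<lambda>n. \<bar>\<phi> n x - v x\<bar> powr q) \<longlonglongrightarrow> 0 powr q" for x
      using q by (intro tendsto_powr' tendsto_const) auto
    then show "AE x in lborel. (\<lambda>n. \<bar>\<phi> n x - v x\<bar> powr q) \<longlonglongrightarrow> 0" by simp
  qed measurable
  have "eventually (\<lambda>n. norm_sq_integral (\<lambda>x. gradient (\<phi> n) x - gradient v x) < ennreal e
     \<and> powr_integral q (\<lambda>x. \<phi> n x - v x) < ennreal e) sequentially"
    using e by (intro eventually_conj order_tendstoD(2)[OF 1] order_tendstoD(2)[OF 2]) auto
  then obtain n where "norm_sq_integral (\<lambda>x. gradient (\<phi> n) x - gradient v x) < ennreal e
     \<and> powr_integral q (\<lambda>x. \<phi> n x - v x) < ennreal e"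
    by (auto simp: eventually_sequentially)
  then show ?thesis using test by blast
qed

section \<open>Density of test functions by removal of small values\<close>

lemma inner_gradient_le:
  assumes u: "GDERIV u x :> g" and w: "GDERIV w x :> g'" and le: "\<And>y. \<bar>w y - w x\<bar> \<le> \<bar>u y - u x\<bar>"
  shows "norm (g'::'a::euclidean_space) \<le> norm g"
proof -
  have "\<bar>g' \<bullet> g'\<bar> \<le> \<bar>g' \<bullet> g\<bar>"
  proof (rule tendsto_le[OF _ tendsto_rabs[OF diffquot_tendsto[OF u]] tendsto_rabs[OF diffquot_tendsto[OF w]]])
    show "eventually (\<lambda>t. \<bar>diffquot w g' x t\<bar> \<le> \<bar>diffquot u g' x t\<bar>) (at 0)"
      using le by (intro always_eventually) (auto simp: diffquot_def abs_divide intro!: divide_right_mono)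
  qed simp
  also have "\<dots> \<le> norm g' * norm g" by (rule Cauchy_Schwarz_ineq2)
  finally have "norm g' * norm g' \<le> norm g' * norm g" by (simp add: norm_eq_sqrt_inner)
  then show ?thesis by (cases "g' = 0") auto
qed

lemma gradient_zero_at_min:
  fixes u :: "'a::euclidean_space \<Rightarrow> real"
  assumes "GDERIV u x :> g" "\<And>y. u x \<le> u y"
  shows "g = 0"
proof -
  have "(\<lambda>h. h \<bullet> g) = (\<lambda>h. 0)"
    using assms by (intro differential_zero_maxmin[of x UNIV u]) (auto simp: gderiv_def)
  then have "g \<bullet> g = 0" by (rule fun_cong)
  then show ?thesis by simp
qed

lemma lipschitz_abs:
  fixes u :: "'a::metric_space \<Rightarrow> real"
  assumes "L-lipschitz_on UNIV u" shows "L-lipschitz_on UNIV (\<lambda>x. \<bar>u x\<bar>)"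
proof (rule lipschitz_onI[OF _ lipschitz_on_nonneg[OF assms]])
  fix x y
  have "dist \<bar>u x\<bar> \<bar>u y\<bar> \<le> dist (u x) (u y)" by (simp add: dist_real_def)
  also have "\<dots> \<le> L * dist x y" using assms by (rule lipschitz_onD) auto
  finally show "dist \<bar>u x\<bar> \<bar>u y\<bar> \<le> L * dist x y" .
qed

text \<open>Where \<open>u\<close> vanishes, |u| attains its minimum, so the gradient of |u| is 0
  there. Increments of \<open>u\<close> and of |u| from such a point have equal size, which carries
  this over to \<open>u\<close>.\<close>

lemma AE_gradient_zero_on_zero_set:
  fixes u :: "'a::euclidean_space \<Rightarrow> real"
  assumes L: "L-lipschitz_on UNIV u"
  shows "AE x in lborel. u x = 0 \<longrightarrow> gradient u x = 0"
  using AE_GDERIV[OF L] AE_GDERIV[OF lipschitz_abs[OF L]]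
proof eventually_elim
  case (elim x)
  show ?case
  proof
    assume u0: "u x = 0"
    have "gradient (\<lambda>x. \<bar>u x\<bar>) x = 0" using u0 by (intro gradient_zero_at_min[OF elim(2)]) simp
    moreover have "norm (gradient u x) \<le> norm (gradient (\<lambda>x. \<bar>u x\<bar>) x)"
      using u0 by (intro inner_gradient_le[OF elim(2) elim(1)]) simp
    ultimately show "gradient u x = 0" by simp
  qed
qed

text \<open>If |u(x)| exceeds \<open>e\<close>, the Lipschitz bound keeps |u| above
  \<open>e / 2\<close> on a ball of fixed radius, and this costs a fixed amount \<open>c\<close> of
  the integral. Far out, less than \<open>c\<close> is left.\<close>

lemma small_outside_ball:
  fixes u :: "'a::euclidean_space \<Rightarrow> real"
  assumes L: "L-lipschitz_on UNIV u" and q: "q > 0"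
    and fin: "powr_integral q u < \<top>" and e: "e > 0"
  shows "\<exists>R. \<forall>x. R < norm x \<longrightarrow> \<bar>u x\<bar> \<le> e"
proof -
  have um[measurable]: "u \<in> borel_measurable borel" by (rule lipschitz_borel[OF L])
  have L0: "L \<ge> 0" using L by (rule lipschitz_on_nonneg)
  define f where "f = (\<lambda>x. ennreal (\<bar>u x\<bar> powr q))"
  have fm[measurable]: "f \<in> borel_measurable borel" unfolding f_def by measurable
  define r where "r = e / (2 * (L + 1))"
  have r: "r > 0" using e L0 by (simp add: r_def)
  define c where "c = ennreal ((e / 2) powr q) * emeasure lborel (cball (0::'a) r)"
  have cpos: "c > 0"
    unfolding c_def using e r content_cball_pos[of r "0::'a"]
    by (simp add: zero_less_iff_neq_zero emeasure_lborel_cball_finite measure_def enn2real_positive_iff)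
  have "(\<lambda>n. \<integral>\<^sup>+x. f x * indicator (- cball 0 (real n)) x \<partial>lborel) \<longlonglongrightarrow> (\<integral>\<^sup>+x. 0 \<partial>(lborel::'a measure))"
  proof (rule nn_integral_dominated_convergence[where w=f])
    show "(\<integral>\<^sup>+x. f x \<partial>lborel) < \<infinity>" using fin by (simp add: f_def)
    show "AE x in lborel. (\<lambda>n. f x * indicator (- cball 0 (real n)) x) \<longlonglongrightarrow> 0"
    proof (rule AE_I2)
      fix x :: 'a
      obtain N :: nat where N: "norm x \<le> real N" using real_arch_simple by blast
      have "eventually (\<lambda>n. f x * indicator (- cball 0 (real n)) x = 0) sequentially"
        unfolding eventually_sequentially using N by (intro exI[of _ N]) (auto simp: indicator_def)
      then show "(\<lambda>n. f x * indicator (- cball 0 (real n)) x) \<longlonglongrightarrow> 0" by (rule tendsto_eventually)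
    qed
  qed (auto simp: indicator_def)
  then have "eventually (\<lambda>n. (\<integral>\<^sup>+x. f x * indicator (- cball 0 (real n)) x \<partial>lborel) < c) sequentially"
    using cpos by (intro order_tendstoD(2)) auto
  then obtain n :: nat where n: "(\<integral>\<^sup>+x. f x * indicator (- cball 0 (real n)) x \<partial>lborel) < c"
    by (auto simp: eventually_sequentially)
  have "\<bar>u x\<bar> \<le> e" if x: "real n + r < norm x" for x
  proof (rule ccontr)
    assume "\<not> \<bar>u x\<bar> \<le> e"
    then have big: "e < \<bar>u x\<bar>" by simp
    have "c = ennreal ((e / 2) powr q) * emeasure lborel (cball x r)"
      using r by (simp add: c_def emeasure_cball)
    also have "\<dots> = (\<integral>\<^sup>+y. ennreal ((e / 2) powr q) * indicator (cball x r) y \<partial>lborel)"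
      by (rule nn_integral_cmult_indicator[symmetric]) simp
    also have "\<dots> \<le> (\<integral>\<^sup>+y. f y * indicator (- cball 0 (real n)) y \<partial>lborel)"
    proof (rule nn_integral_mono)
      fix y
      show "ennreal ((e / 2) powr q) * indicator (cball x r) y \<le> f y * indicator (- cball 0 (real n)) y"
      proof (cases "y \<in> cball x r")
        case True
        have "norm x \<le> norm y + dist x y" using norm_triangle_sub[of x y] by (simp add: dist_norm)
        then have ny: "real n < norm y" using x True by simp
        have "\<bar>u x - u y\<bar> \<le> L * dist x y" using lipschitz_onD[OF L, of x y] by (simp add: dist_real_def)
        also have "\<dots> \<le> L * r" using True L0 by (intro mult_left_mono) auto
        also have "\<dots> \<le> e / 2" using L0 e by (simp add: r_def field_simps)
        finally have "e / 2 \<le> \<bar>u y\<bar>" using big by linarith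
        then have "(e / 2) powr q \<le> \<bar>u y\<bar> powr q" using e q by (intro powr_mono2) auto
        then show ?thesis using ny True by (simp add: f_def ennreal_leI)
      qed simp
    qed
    also have "\<dots> < c" by (rule n)
    finally show False by simp
  qed
  then show ?thesis by blast
qed

text \<open>Soft thresholding. Applied to a function that tends to 0 at infinity it produces bounded
  support without a cut-off factor, and it does not increase the size of increments.\<close>

definition shrink :: "real \<Rightarrow> real \<Rightarrow> real" where
  "shrink e r = r - max (- e) (min e r)"

lemma shrink_lipschitz: "\<bar>shrink e r - shrink e s\<bar> \<le> \<bar>r - s\<bar>"
  by (auto simp: shrink_def max_def min_def)

lemma shrink_small: "\<bar>r\<bar> \<le> e \<Longrightarrow> shrink e r = 0"
  by (auto simp: shrink_def max_def min_def)

lemma shrink_error: "e \<ge> 0 \<Longrightarrow> \<bar>shrink e r - r\<bar> \<le> min e \<bar>r\<bar>"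
  by (auto simp: shrink_def max_def min_def)

text \<open>Where \<open>u\<close> is not 0, thresholding at a small level just adds a constant
  nearby; where \<open>u\<close> is 0, it is identically 0 nearby and both gradients vanish.\<close>

lemma gradient_shrink_tendsto:
  fixes u :: "'a::euclidean_space \<Rightarrow> real"
  assumes uc: "continuous_on UNIV u" and g: "GDERIV u x :> gradient u x" and z: "u x = 0 \<longrightarrow> gradient u x = 0"
    and e: "e \<longlonglongrightarrow> 0" "\<And>n. e n > 0"
  shows "(\<lambda>n. gradient (\<lambda>x. shrink (e n) (u x)) x) \<longlonglongrightarrow> gradient u x"
proof (cases "u x = 0")
  case True
  have "gradient (\<lambda>x. shrink (e n) (u x)) x = 0" for n
  proof (rule gradient_eq, rule gradient_eq_if_open[of "u -` {- e n<..<e n}" _ "\<lambda>x. 0"])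
    show "open (u -` {- e n<..<e n})" using uc by (intro open_vimage) auto
    show "GDERIV (\<lambda>x. 0) x :> 0" by (rule GDERIV_const_zero)
  qed (use True e in \<open>auto simp: shrink_small\<close>)
  then show ?thesis using True z by simp
next
  case False
  have "eventually (\<lambda>n. e n < \<bar>u x\<bar>) sequentially" using False by (intro order_tendstoD(2)[OF e(1)]) auto
  then have "eventually (\<lambda>n. gradient (\<lambda>x. shrink (e n) (u x)) x = gradient u x) sequentially"
  proof eventually_elim
    case (elim n)
    define c where "c = (if u x > 0 then - e n else e n)"
    have 1: "GDERIV (\<lambda>x. u x + c) x :> gradient u x"
      using g unfolding gderiv_def by (auto intro!: derivative_eq_intros)
    have "open {y. (if u x > 0 then e n < u y else u y < - e n)}"
      using uc by (cases "u x > 0") (auto intro!: open_Collect_less continuous_on_const)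
    then have "GDERIV (\<lambda>x. shrink (e n) (u x)) x :> gradient u x"
    proof (rule gradient_eq_if_open[OF _ _ _ 1])
      show "x \<in> {y. (if u x > 0 then e n < u y else u y < - e n)}" using elim by auto
      show "u y + c = shrink (e n) (u y)" if "y \<in> {y. (if u x > 0 then e n < u y else u y < - e n)}" for y
        using that e(2)[of n] by (cases "u x > 0") (auto simp: c_def shrink_def)
    qed
    then show ?case by (rule gradient_eq)
  qed
  then show ?thesis by (rule tendsto_eventually)
qed

lemma powr_sum_le:
  fixes a b q :: real
  assumes "a \<ge> 0" "b \<ge> 0" "q > 0"
  shows "(a + b) powr q \<le> 2 powr q * (a powr q + b powr q)"
proof -
  have "(a + b) powr q \<le> (2 * max a b) powr q" using assms by (intro powr_mono2) auto
  also have "\<dots> = 2 powr q * (max a b) powr q" using assms by (subst powr_mult) auto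
  also have "\<dots> \<le> 2 powr q * (a powr q + b powr q)" by (intro mult_left_mono) (auto simp: max_def)
  finally show ?thesis .
qed

lemma norm_sum_sq_le: "(norm (a + b))\<^sup>2 \<le> 2 * (norm a)\<^sup>2 + 2 * (norm (b::'a::real_normed_vector))\<^sup>2"
proof -
  have "(norm (a + b))\<^sup>2 \<le> (norm a + norm b)\<^sup>2" by (intro power_mono norm_triangle_ineq) simp
  also have "\<dots> \<le> 2 * (norm a)\<^sup>2 + 2 * (norm b)\<^sup>2"
    using sum_squares_bound[of "norm a" "norm b"] by (simp add: power2_sum)
  finally show ?thesis .
qed

lemma nn_integral_norm_sq_triangle:
  fixes f g h :: "'a::euclidean_space \<Rightarrow> 'a"
  assumes [measurable]: "f \<in> borel_measurable borel" "g \<in> borel_measurable borel" "h \<in> borel_measurable borel"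
  shows "norm_sq_integral (\<lambda>x. f x - h x)
    \<le> 2 * norm_sq_integral (\<lambda>x. f x - g x) + 2 * norm_sq_integral (\<lambda>x. g x - h x)"
proof -
  have "norm_sq_integral (\<lambda>x. f x - h x)
    \<le> (\<integral>\<^sup>+x. 2 * ennreal ((norm (f x - g x))\<^sup>2) + 2 * ennreal ((norm (g x - h x))\<^sup>2) \<partial>lborel)"
  proof (rule nn_integral_mono)
    fix x
    have "(norm (f x - h x))\<^sup>2 \<le> 2 * (norm (f x - g x))\<^sup>2 + 2 * (norm (g x - h x))\<^sup>2"
      using norm_sum_sq_le[of "f x - g x" "g x - h x"] by simp
    then have "ennreal ((norm (f x - h x))\<^sup>2) \<le> ennreal (2 * (norm (f x - g x))\<^sup>2 + 2 * (norm (g x - h x))\<^sup>2)" by (rule ennreal_leI)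
    then show "ennreal ((norm (f x - h x))\<^sup>2) \<le> 2 * ennreal ((norm (f x - g x))\<^sup>2) + 2 * ennreal ((norm (g x - h x))\<^sup>2)"
      by (simp add: ennreal_mult)
  qed
  also have "\<dots> = 2 * norm_sq_integral (\<lambda>x. f x - g x) + 2 * norm_sq_integral (\<lambda>x. g x - h x)"
    by (simp add: nn_integral_add nn_integral_cmult)
  finally show ?thesis .
qed

lemma nn_integral_powr_triangle:
  fixes f g h :: "'a::euclidean_space \<Rightarrow> real"
  assumes [measurable]: "f \<in> borel_measurable borel" "g \<in> borel_measurable borel" "h \<in> borel_measurable borel" and q: "q > 0"
  shows "powr_integral q (\<lambda>x. f x - h x)
    \<le> ennreal (2 powr q) * (powr_integral q (\<lambda>x. f x - g x) + powr_integral q (\<lambda>x. g x - h x))"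
proof -
  have "powr_integral q (\<lambda>x. f x - h x)
    \<le> (\<integral>\<^sup>+x. ennreal (2 powr q) * (ennreal (\<bar>f x - g x\<bar> powr q) + ennreal (\<bar>g x - h x\<bar> powr q)) \<partial>lborel)"
  proof (rule nn_integral_mono)
    fix x
    have "\<bar>f x - h x\<bar> powr q \<le> (\<bar>f x - g x\<bar> + \<bar>g x - h x\<bar>) powr q" using q by (intro powr_mono2) auto
    also have "\<dots> \<le> 2 powr q * (\<bar>f x - g x\<bar> powr q + \<bar>g x - h x\<bar> powr q)" using q by (intro powr_sum_le) auto
    finally have "ennreal (\<bar>f x - h x\<bar> powr q) \<le> ennreal (2 powr q * (\<bar>f x - g x\<bar> powr q + \<bar>g x - h x\<bar> powr q))" by (rule ennreal_leI)
    then show "ennreal (\<bar>f x - h x\<bar> powr q) \<le> ennreal (2 powr q) * (ennreal (\<bar>f x - g x\<bar> powr q) + ennreal (\<bar>g x - h x\<bar> powr q))"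
      by (simp add: ennreal_mult)
  qed
  also have "\<dots> = ennreal (2 powr q) * (powr_integral q (\<lambda>x. f x - g x) + powr_integral q (\<lambda>x. g x - h x))"
    by (simp add: nn_integral_add nn_integral_cmult)
  finally show ?thesis .
qed

text \<open>Thresholding followed by mollification. A multiplicative cut-off would put an extra term
  into the gradient; thresholding converges by domination with a multiple of |gradient u|^2.\<close>

lemma approximation_test_functions:
  fixes u :: "'a::euclidean_space \<Rightarrow> real"
  assumes L: "L-lipschitz_on UNIV u" and q: "q > 0"
    and fin1: "norm_sq_integral (gradient u) < \<top>"
    and fin2: "powr_integral q u < \<top>" and \<epsilon>: "\<epsilon> > 0"
  shows "\<exists>\<phi>\<in>test_functions. norm_sq_integral (\<lambda>x. gradient \<phi> x - gradient u x) < ennreal \<epsilon>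
     \<and> powr_integral q (\<lambda>x. \<phi> x - u x) < ennreal \<epsilon>"
proof -
  have uc: "continuous_on UNIV u" using L by (rule lipschitz_on_continuous_on)
  have [measurable]: "u \<in> borel_measurable borel" "gradient u \<in> borel_measurable borel"
    using lipschitz_borel[OF L] lipschitz_gradient_borel[OF L] by auto
  define e where "e = (\<lambda>n. 1 / real (Suc n))"
  define w where "w = (\<lambda>n x. shrink (e n) (u x))"
  have e0: "e n > 0" for n by (simp add: e_def)
  have elim: "e \<longlonglongrightarrow> 0" unfolding e_def by (rule LIMSEQ_Suc, rule lim_1_over_n)
  have wle: "\<bar>w n y - w n x\<bar> \<le> \<bar>u y - u x\<bar>" for n x y unfolding w_def by (rule shrink_lipschitz)
  have wL: "L-lipschitz_on UNIV (w n)" for n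
  proof (rule lipschitz_onI[OF _ lipschitz_on_nonneg[OF L]])
    fix x y
    have "dist (w n x) (w n y) \<le> dist (u x) (u y)" using wle by (simp add: dist_real_def)
    also have "\<dots> \<le> L * dist x y" using L by (rule lipschitz_onD) auto
    finally show "dist (w n x) (w n y) \<le> L * dist x y" .
  qed
  have [measurable]: "w n \<in> borel_measurable borel" "gradient (w n) \<in> borel_measurable borel" for n
    using lipschitz_borel[OF wL] lipschitz_gradient_borel[OF wL] by auto
  have 1: "(\<lambda>n. \<integral>\<^sup>+x. ennreal ((norm (gradient (w n) x - gradient u x))\<^sup>2) \<partial>lborel) \<longlonglongrightarrow> (\<integral>\<^sup>+x. 0 \<partial>(lborel::'a measure))"
  proof (rule nn_integral_dominated_convergence[where w="\<lambda>x. 4 * ennreal ((norm (gradient u x))\<^sup>2)"])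
    show "(\<integral>\<^sup>+x. 4 * ennreal ((norm (gradient u x))\<^sup>2) \<partial>lborel) < \<infinity>"
      using fin1 by (simp add: nn_integral_cmult ennreal_mult_less_top)
    show "AE x in lborel. ennreal ((norm (gradient (w n) x - gradient u x))\<^sup>2) \<le> 4 * ennreal ((norm (gradient u x))\<^sup>2)" for n
      using AE_GDERIV[OF L] AE_GDERIV[OF wL[of n]]
    proof eventually_elim
      case (elim x)
      have "norm (gradient (w n) x - gradient u x) \<le> norm (gradient (w n) x) + norm (gradient u x)" by (rule norm_triangle_ineq4)
      also have "\<dots> \<le> 2 * norm (gradient u x)" using inner_gradient_le[OF elim wle] by simp
      finally have "(norm (gradient (w n) x - gradient u x))\<^sup>2 \<le> (2 * norm (gradient u x))\<^sup>2" by (rule power_mono) simp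
      then have "ennreal ((norm (gradient (w n) x - gradient u x))\<^sup>2) \<le> ennreal (4 * (norm (gradient u x))\<^sup>2)"
        by (intro ennreal_leI) (simp add: power_mult_distrib)
      then show ?case by (simp add: ennreal_mult)
    qed
    show "AE x in lborel. (\<lambda>n. ennreal ((norm (gradient (w n) x - gradient u x))\<^sup>2)) \<longlonglongrightarrow> 0"
      using AE_GDERIV[OF L] AE_gradient_zero_on_zero_set[OF L]
    proof eventually_elim
      case (elim x)
      have "(\<lambda>n. ennreal ((norm (gradient (w n) x - gradient u x))\<^sup>2)) \<longlonglongrightarrow> ennreal ((norm (gradient u x - gradient u x))\<^sup>2)"
        unfolding w_def using gradient_shrink_tendsto[OF uc elim \<open>e \<longlonglongrightarrow> 0\<close> e0]
        by (intro tendsto_ennrealI tendsto_intros)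
      then show ?case by simp
    qed
  qed measurable
  have 2: "(\<lambda>n. \<integral>\<^sup>+x. ennreal (\<bar>w n x - u x\<bar> powr q) \<partial>lborel) \<longlonglongrightarrow> (\<integral>\<^sup>+x. 0 \<partial>(lborel::'a measure))"
  proof (rule nn_integral_dominated_convergence[where w="\<lambda>x. ennreal (\<bar>u x\<bar> powr q)"])
    have we: "\<bar>w n x - u x\<bar> \<le> min (e n) \<bar>u x\<bar>" for n x
      unfolding w_def using e0 by (intro shrink_error less_imp_le)
    show "AE x in lborel. ennreal (\<bar>w n x - u x\<bar> powr q) \<le> ennreal (\<bar>u x\<bar> powr q)" for n
      using we q by (intro AE_I2 ennreal_leI powr_mono2) auto
    have "(\<lambda>n. \<bar>w n x - u x\<bar>) \<longlonglongrightarrow> 0" for x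
      by (rule Lim_null_comparison[OF _ elim]) (use we in auto)
    then have "(\<lambda>n. ennreal (\<bar>w n x - u x\<bar> powr q)) \<longlonglongrightarrow> ennreal (0 powr q)" for x
      using q by (intro tendsto_ennrealI tendsto_powr' tendsto_const) auto
    then show "AE x in lborel. (\<lambda>n. ennreal (\<bar>w n x - u x\<bar> powr q)) \<longlonglongrightarrow> 0" by simp
  qed (use fin2 in auto)
  \<comment> \<open>The denominator covers the constants of both triangle inequalities used
    below.\<close>
  define \<delta> where "\<delta> = \<epsilon> / (4 + 2 * 2 powr q)"
  have den: "4 + 2 * 2 powr q > (0::real)" by (simp add: add_pos_nonneg)
  have \<delta>: "\<delta> > 0" using \<epsilon> den by (simp add: \<delta>_def)
  have \<delta>4: "4 * \<delta> < \<epsilon>" "2 powr q * (2 * \<delta>) < \<epsilon>"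
  proof -
    have "\<epsilon> = 4 * \<delta> + 2 powr q * (2 * \<delta>)"
    proof -
      have "\<delta> * (4 + 2 * 2 powr q) = \<epsilon>" using den by (simp add: \<delta>_def)
      then show ?thesis by (simp add: algebra_simps)
    qed
    moreover have "2 powr q * (2 * \<delta>) > 0" using \<delta> by simp
    ultimately show "4 * \<delta> < \<epsilon>" "2 powr q * (2 * \<delta>) < \<epsilon>" using \<delta> by linarith+
  qed
  have "eventually (\<lambda>n. norm_sq_integral (\<lambda>x. gradient (w n) x - gradient u x) < ennreal \<delta>
     \<and> powr_integral q (\<lambda>x. w n x - u x) < ennreal \<delta>) sequentially"
    using \<delta> by (intro eventually_conj order_tendstoD(2)[OF 1] order_tendstoD(2)[OF 2]) auto
  then obtain n where n: "norm_sq_integral (\<lambda>x. gradient (w n) x - gradient u x) < ennreal \<delta>"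
     "powr_integral q (\<lambda>x. w n x - u x) < ennreal \<delta>"
    by (auto simp: eventually_sequentially)
  obtain R where R: "\<And>x. R < norm x \<Longrightarrow> \<bar>u x\<bar> \<le> e n" using small_outside_ball[OF L q fin2 e0] by blast
  have "w n x = 0" if "R < norm x" for x unfolding w_def using R[OF that] by (rule shrink_small)
  from approximation_compact[OF wL this q \<delta>]
  obtain \<phi> where \<phi>: "\<phi> \<in> test_functions" "norm_sq_integral (\<lambda>x. gradient \<phi> x - gradient (w n) x) < ennreal \<delta>"
     "powr_integral q (\<lambda>x. \<phi> x - w n x) < ennreal \<delta>" by blast
  obtain R' where "C1_supported \<phi> R'" using test_function_C1_supported[OF \<phi>(1)] by blast
  then have \<phi>m[measurable]: "\<phi> \<in> borel_measurable borel" "gradient \<phi> \<in> borel_measurable borel"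
    using C1_supported_continuous by (auto simp: C1_supported_def intro: borel_measurable_continuous_onI)
  have "norm_sq_integral (\<lambda>x. gradient \<phi> x - gradient u x)
    \<le> 2 * norm_sq_integral (\<lambda>x. gradient \<phi> x - gradient (w n) x) + 2 * norm_sq_integral (\<lambda>x. gradient (w n) x - gradient u x)"
    by (rule nn_integral_norm_sq_triangle) measurable
  also have "\<dots> \<le> 2 * ennreal \<delta> + 2 * ennreal \<delta>"
    using \<phi> n by (intro add_mono mult_left_mono) auto
  also have "\<dots> = ennreal (4 * \<delta>)" using \<delta> by (simp add: ennreal_mult[symmetric] ennreal_plus[symmetric] del: ennreal_plus flip: ennreal_numeral)
  also have "\<dots> < ennreal \<epsilon>" using \<delta>4 \<delta> \<epsilon> by (intro ennreal_lessI) auto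
  finally have A: "norm_sq_integral (\<lambda>x. gradient \<phi> x - gradient u x) < ennreal \<epsilon>" .
  have "powr_integral q (\<lambda>x. \<phi> x - u x)
    \<le> ennreal (2 powr q) * (powr_integral q (\<lambda>x. \<phi> x - w n x) + powr_integral q (\<lambda>x. w n x - u x))"
    by (rule nn_integral_powr_triangle) (use q in measurable)
  also have "\<dots> \<le> ennreal (2 powr q) * (ennreal \<delta> + ennreal \<delta>)"
    using \<phi> n by (intro add_mono mult_left_mono) auto
  also have "\<dots> = ennreal (2 powr q * (2 * \<delta>))" using \<delta> by (simp add: ennreal_mult[symmetric] ennreal_plus[symmetric] del: ennreal_plus)
  also have "\<dots> < ennreal \<epsilon>" using \<delta>4 \<delta> \<epsilon> by (intro ennreal_lessI) auto
  finally have B: "powr_integral q (\<lambda>x. \<phi> x - u x) < ennreal \<epsilon>" .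
  show ?thesis using A B \<phi>(1) by blast
qed

section \<open>The admissible functions\<close>

lemma powr_AE_subseq:
  fixes f :: "nat \<Rightarrow> 'a::euclidean_space \<Rightarrow> real"
  assumes [measurable]: "\<And>n. f n \<in> borel_measurable borel" "u \<in> borel_measurable borel" and q: "q > 0"
    and lim: "(\<lambda>n. \<integral>\<^sup>+x. ennreal (\<bar>f n x - u x\<bar> powr q) \<partial>lborel) \<longlonglongrightarrow> 0"
  shows "\<exists>r::nat \<Rightarrow> nat. strict_mono r \<and> (AE x in lborel. (\<lambda>n. f (r n) x) \<longlonglongrightarrow> u x)"
proof -
  \<comment> \<open>The first terms may have infinite integrals. They are discarded so that the
    \<open>q\<close>-th powers form a sequence of integrable functions converging to 0 in the
    mean.\<close>
  have "eventually (\<lambda>n. powr_integral q (\<lambda>x. f n x - u x) < 1) sequentially"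
    by (rule order_tendstoD(2)[OF lim]) simp
  then obtain N where N: "\<And>n. n \<ge> N \<Longrightarrow> powr_integral q (\<lambda>x. f n x - u x) < 1"
    unfolding eventually_sequentially by blast
  define v where "v = (\<lambda>n x. \<bar>f (n + N) x - u x\<bar> powr q)"
  have [measurable]: "v n \<in> borel_measurable borel" for n unfolding v_def by measurable
  have vi: "integrable lborel (v n)" for n
  proof (rule integrableI_nonneg)
    show "(\<integral>\<^sup>+x. ennreal (v n x) \<partial>lborel) < \<infinity>"
      using N[of "n + N"] unfolding v_def by (simp add: less_trans[of _ 1])
  qed (auto simp: v_def)
  have eq: "ennreal (\<integral>x. norm (v n x) \<partial>lborel) = powr_integral q (\<lambda>x. f (n + N) x - u x)" for n
    using nn_integral_eq_integral[OF integrable_norm[OF vi[of n]]] by (simp add: v_def)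
  have "(\<lambda>n. ennreal (\<integral>x. norm (v n x) \<partial>lborel)) \<longlonglongrightarrow> 0"
    unfolding eq by (rule LIMSEQ_ignore_initial_segment[OF lim])
  then have "(\<lambda>n. \<integral>x. norm (v n x) \<partial>lborel) \<longlonglongrightarrow> 0"
    by (subst (asm) ennreal_tendsto_0_iff) auto
  then obtain r where r: "strict_mono (r :: nat \<Rightarrow> nat)" "AE x in lborel. (\<lambda>n. v (r n) x) \<longlonglongrightarrow> 0"
    using tendsto_L1_AE_subseq[where u=v, OF vi] by blast
  have "AE x in lborel. (\<lambda>n. f (r n + N) x) \<longlonglongrightarrow> u x"
    using r(2)
  proof eventually_elim
    case (elim x)
    have "(\<lambda>n. v (r n) x powr (1 / q)) \<longlonglongrightarrow> 0 powr (1 / q)"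
      using q by (intro tendsto_powr' elim tendsto_const) (auto simp: v_def)
    then have "(\<lambda>n. \<bar>f (r n + N) x - u x\<bar>) \<longlonglongrightarrow> 0"
      using q by (simp add: v_def powr_powr)
    then show ?case by (simp add: tendsto_rabs_zero_iff LIM_zero_iff)
  qed
  moreover have "strict_mono (\<lambda>n. r n + N)" using r(1) by (simp add: strict_mono_def)
  ultimately show ?thesis by blast
qed

lemma AE_gradient_lincomb:
  fixes u v :: "'a::euclidean_space \<Rightarrow> real"
  assumes "L-lipschitz_on UNIV u" "M-lipschitz_on UNIV v"
  shows "AE x in lborel. gradient (\<lambda>x. a * u x + b * v x) x = a *\<^sub>R gradient u x + b *\<^sub>R gradient v x"
  using AE_GDERIV[OF assms(1)] AE_GDERIV[OF assms(2)]
proof eventually_elim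
  case (elim x)
  show ?case
  proof (rule gradient_eq)
    have "((\<lambda>x. a * u x + b * v x) has_derivative (\<lambda>h. a * (h \<bullet> gradient u x) + b * (h \<bullet> gradient v x))) (at x)"
      using elim unfolding gderiv_def by (intro has_derivative_add has_derivative_mult_right)
    then show "GDERIV (\<lambda>x. a * u x + b * v x) x :> a *\<^sub>R gradient u x + b *\<^sub>R gradient v x"
      by (simp add: gderiv_def inner_add_right)
  qed
qed

lemma lipschitz_lincomb:
  fixes u v :: "'a::metric_space \<Rightarrow> real"
  assumes "L-lipschitz_on UNIV u" "M-lipschitz_on UNIV v"
  shows "(\<bar>a\<bar> * L + \<bar>b\<bar> * M)-lipschitz_on UNIV (\<lambda>x. a * u x + b * v x)"
proof (rule lipschitz_onI)
  show "0 \<le> \<bar>a\<bar> * L + \<bar>b\<bar> * M"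
    using lipschitz_on_nonneg[OF assms(1)] lipschitz_on_nonneg[OF assms(2)] by simp
  fix x y
  have 1: "\<bar>u x - u y\<bar> \<le> L * dist x y" "\<bar>v x - v y\<bar> \<le> M * dist x y"
    using lipschitz_onD[OF assms(1), of x y] lipschitz_onD[OF assms(2), of x y] by (auto simp: dist_real_def)
  have "\<bar>a * u x + b * v x - (a * u y + b * v y)\<bar> = \<bar>a * (u x - u y) + b * (v x - v y)\<bar>" by (simp add: algebra_simps)
  also have "\<dots> \<le> \<bar>a\<bar> * \<bar>u x - u y\<bar> + \<bar>b\<bar> * \<bar>v x - v y\<bar>" by (metis abs_mult abs_triangle_ineq)
  also have "\<dots> \<le> \<bar>a\<bar> * (L * dist x y) + \<bar>b\<bar> * (M * dist x y)" using 1 by (intro add_mono mult_left_mono) auto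
  finally show "dist (a * u x + b * v x) (a * u y + b * v y) \<le> (\<bar>a\<bar> * L + \<bar>b\<bar> * M) * dist x y"
    by (simp add: dist_real_def algebra_simps)
qed

text \<open>The explicit form of \<open>admissible\<close>: for Lipschitz functions the
  approximating sequences of \<open>D12\<close> are traded for finiteness of two integrals.\<close>

definition energy_space :: "('a::euclidean_space \<Rightarrow> real) set" where
  "energy_space = {u. 1-lipschitz_on UNIV u \<and> integrable lborel (\<lambda>x. (norm (gradient u x))\<^sup>2)
     \<and> integrable lborel (\<lambda>x. \<bar>u x\<bar> powr sobolev_exponent TYPE('a))}"

definition dirichlet :: "('a::euclidean_space \<Rightarrow> real) \<Rightarrow> real" where
  "dirichlet u = (\<integral>x. (norm (gradient u x))\<^sup>2 \<partial>lborel)"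

lemma dirichlet_nonneg: "dirichlet u \<ge> 0"
  by (simp add: dirichlet_def)

lemma energy_spaceD:
  fixes u :: "'a::euclidean_space \<Rightarrow> real"
  assumes "u \<in> energy_space"
  shows "1-lipschitz_on UNIV u" "integrable lborel (\<lambda>x. (norm (gradient u x))\<^sup>2)"
    "integrable lborel (\<lambda>x. \<bar>u x\<bar> powr sobolev_exponent TYPE('a))"
  using assms by (auto simp: energy_space_def)

lemma energy_space_borel:
  assumes "u \<in> energy_space"
  shows "u \<in> borel_measurable borel" "gradient u \<in> borel_measurable borel" "continuous_on UNIV u"
  using lipschitz_borel lipschitz_gradient_borel lipschitz_on_continuous_on energy_spaceD(1)[OF assms] by blast+

lemma nn_dirichlet:
  assumes "integrable lborel (\<lambda>x. (norm (gradient u x))\<^sup>2)"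
  shows "norm_sq_integral (gradient u) = ennreal (dirichlet u)"
  unfolding dirichlet_def using assms by (intro nn_integral_eq_integral) auto

lemma sobolev_exponent_pos:
  assumes "DIM('a::euclidean_space) \<ge> 3" shows "sobolev_exponent TYPE('a) > 0"
  using assms by (simp add: sobolev_exponent_def)

lemma C1_supported_dirichlet_finite:
  fixes u :: "'a::euclidean_space \<Rightarrow> real"
  assumes u: "C1_supported u R"
  shows "norm_sq_integral (gradient u) < \<top>"
proof -
  have "integrable lborel (\<lambda>x. (norm (gradient u x))\<^sup>2)"
  proof (rule integrable_continuous_supported[of _ R])
    show "continuous_on UNIV (\<lambda>x. (norm (gradient u x))\<^sup>2)"
      using u by (intro continuous_intros) (simp add: C1_supported_def)
    show "(norm (gradient u x))\<^sup>2 = 0" if "R < norm x" for x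
      using gradient_eq[OF gradient_zero_outside[of R u x]] u that by (simp add: C1_supported_def)
  qed
  from nn_dirichlet[OF this] show ?thesis by simp
qed

lemma D12_if_integrable:
  fixes u :: "'a::euclidean_space \<Rightarrow> real"
  assumes dim: "DIM('a) \<ge> 3" and L: "L-lipschitz_on UNIV u"
    and fin1: "norm_sq_integral (gradient u) < \<top>"
    and fin2: "powr_integral (sobolev_exponent TYPE('a)) u < \<top>"
  shows "u \<in> D12"
proof -
  let ?q = "sobolev_exponent TYPE('a)"
  have [measurable]: "u \<in> borel_measurable borel" "gradient u \<in> borel_measurable borel"
    using lipschitz_borel[OF L] lipschitz_gradient_borel[OF L] by auto
  have "\<forall>n. \<exists>\<phi>\<in>test_functions. norm_sq_integral (\<lambda>x. gradient \<phi> x - gradient u x) < ennreal (1 / real (Suc n))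
     \<and> powr_integral ?q (\<lambda>x. \<phi> x - u x) < ennreal (1 / real (Suc n))"
    by (intro allI approximation_test_functions[OF L sobolev_exponent_pos[OF dim] fin1 fin2]) simp
  from choice[OF this[unfolded Bex_def]]
  obtain \<phi> where \<phi>: "\<And>n. \<phi> n \<in> test_functions"
      "\<And>n. norm_sq_integral (\<lambda>x. gradient (\<phi> n) x - gradient u x) < ennreal (1 / real (Suc n))"
      "\<And>n. powr_integral ?q (\<lambda>x. \<phi> n x - u x) < ennreal (1 / real (Suc n))"
    by blast
  have \<phi>m[measurable]: "gradient (\<phi> n) \<in> borel_measurable borel" for n
    by (rule test_function_C1_supported[OF \<phi>(1)[of n]]) (simp add: C1_supported_def borel_measurable_continuous_onI)
  have l0: "(\<lambda>n. ennreal (1 / real (Suc n))) \<longlonglongrightarrow> 0"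
    using tendsto_ennrealI[OF LIMSEQ_Suc[OF lim_1_over_n]] by simp
  have "u \<in> borel_measurable lebesgue" by (intro measurable_completion) simp
  moreover have "\<exists>M. \<forall>m\<ge>M. \<forall>n\<ge>M. (\<integral>\<^sup>+x. ennreal ((norm (gradient (\<phi> m) x - gradient (\<phi> n) x))\<^sup>2) \<partial>lebesgue) < ennreal \<epsilon>"
    if e: "\<epsilon> > 0" for \<epsilon> :: real
  proof -
    have "\<epsilon> / 4 > 0" using e by simp
    then obtain M where M: "1 / real (Suc M) < \<epsilon> / 4" using nat_approx_posE by blast
    show ?thesis
    proof (intro exI[of _ M] allI impI)
      fix m n assume mn: "m \<ge> M" "n \<ge> M"
      have le: "norm_sq_integral (\<lambda>x. gradient (\<phi> k) x - gradient u x) \<le> ennreal (1 / real (Suc M))" if "k \<ge> M" for k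
        using \<phi>(2)[of k] that by (elim order_trans[OF less_imp_le]) (auto intro!: ennreal_leI divide_left_mono)
      have sym: "norm_sq_integral (\<lambda>x. gradient u x - gradient (\<phi> n) x) = norm_sq_integral (\<lambda>x. gradient (\<phi> n) x - gradient u x)"
        by (simp add: norm_minus_commute)
      have "norm_sq_integral (\<lambda>x. gradient (\<phi> m) x - gradient (\<phi> n) x)
        \<le> 2 * norm_sq_integral (\<lambda>x. gradient (\<phi> m) x - gradient u x) + 2 * norm_sq_integral (\<lambda>x. gradient u x - gradient (\<phi> n) x)"
        by (rule nn_integral_norm_sq_triangle) measurable
      also have "\<dots> \<le> 2 * ennreal (1 / real (Suc M)) + 2 * ennreal (1 / real (Suc M))"
        unfolding sym using le mn by (intro add_mono mult_left_mono) auto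
      also have "\<dots> = ennreal (4 * (1 / real (Suc M)))"
        by (simp add: ennreal_mult[symmetric] ennreal_plus[symmetric] del: ennreal_plus flip: ennreal_numeral)
      also have "\<dots> < ennreal \<epsilon>" using M e by (intro ennreal_lessI) auto
      finally show "(\<integral>\<^sup>+x. ennreal ((norm (gradient (\<phi> m) x - gradient (\<phi> n) x))\<^sup>2) \<partial>lebesgue) < ennreal \<epsilon>"
        by (simp add: nn_integral_completion)
    qed
  qed
  moreover have "(\<lambda>n. \<integral>\<^sup>+x. ennreal (\<bar>\<phi> n x - u x\<bar> powr ?q) \<partial>lebesgue) \<longlonglongrightarrow> 0"
    unfolding nn_integral_completion
    by (rule tendsto_sandwich[OF _ _ tendsto_const l0]) (use \<phi>(3) in \<open>auto intro!: always_eventually less_imp_le\<close>)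
  ultimately show ?thesis unfolding D12_def using \<phi>(1) by blast
qed

text \<open>The pointwise gradient of \<open>u\<close> has to be recognized as the mean square limit
  of the gradients of the approximating test functions. This follows from lower semicontinuity,
  applied to differences of approximations. The factor 2 in the Sobolev bound is the cost of (a +
  b)^2 <= 2 a^2 + 2 b^2.\<close>

lemma D12_lipschitz:
  fixes u :: "'a::euclidean_space \<Rightarrow> real"
  assumes dim: "DIM('a) \<ge> 3" and u: "u \<in> D12" and L: "L-lipschitz_on UNIV u"
  shows "norm_sq_integral (gradient u) < \<top>"
    and "norm_sq_integral (gradient u) \<le> ennreal d \<Longrightarrow> d \<ge> 0 \<Longrightarrow>
      (powr_integral (sobolev_exponent TYPE('a)) u)
      \<le> ennreal ((sobolev_const TYPE('a) * (2 * d)) powr (sobolev_exponent TYPE('a) / 2))"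
proof -
  let ?q = "sobolev_exponent TYPE('a)"
  have q: "?q > 0" by (rule sobolev_exponent_pos[OF dim])
  have um[measurable]: "u \<in> borel_measurable borel" "gradient u \<in> borel_measurable borel"
    using lipschitz_borel[OF L] lipschitz_gradient_borel[OF L] by auto
  obtain \<phi> :: "nat \<Rightarrow> 'a \<Rightarrow> real" where \<phi>: "\<And>n. \<phi> n \<in> test_functions"
    "\<And>\<epsilon>. \<epsilon> > 0 \<Longrightarrow> \<exists>M. \<forall>m\<ge>M. \<forall>n\<ge>M. (\<integral>\<^sup>+x. ennreal ((norm (gradient (\<phi> m) x - gradient (\<phi> n) x))\<^sup>2) \<partial>lebesgue) < ennreal \<epsilon>"
    "(\<lambda>n. \<integral>\<^sup>+x. ennreal (\<bar>\<phi> n x - u x\<bar> powr ?q) \<partial>lebesgue) \<longlonglongrightarrow> 0"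
    using u unfolding D12_def by blast
  have "\<exists>R. C1_supported (\<phi> n) R" for n by (rule test_function_C1_supported[OF \<phi>(1)]) blast
  then have "\<forall>n. \<exists>R. C1_supported (\<phi> n) R" by blast
  from choice[OF this] obtain R where R: "\<And>n. C1_supported (\<phi> n) (R n)" by blast
  have "\<exists>K. K-lipschitz_on UNIV (\<phi> n)" for n by (rule C1_supported_lipschitz[OF R]) blast
  then have "\<forall>n. \<exists>K. K-lipschitz_on UNIV (\<phi> n)" by blast
  from choice[OF this] obtain K where K: "\<And>n. (K n)-lipschitz_on UNIV (\<phi> n)" by blast
  have \<phi>m[measurable]: "\<phi> n \<in> borel_measurable borel" "gradient (\<phi> n) \<in> borel_measurable borel" for n
    using lipschitz_borel[OF K] lipschitz_gradient_borel[OF K] by auto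
  obtain r :: "nat \<Rightarrow> nat" where r: "strict_mono r" "AE x in lborel. (\<lambda>n. \<phi> (r n) x) \<longlonglongrightarrow> u x"
    using powr_AE_subseq[where f=\<phi>, OF \<phi>m(1) um(1) q] \<phi>(3) unfolding nn_integral_completion by blast
  have close: "\<exists>M. \<forall>m\<ge>M. norm_sq_integral (\<lambda>x. gradient u x - gradient (\<phi> m) x) \<le> ennreal \<epsilon>"
    if e: "\<epsilon> > 0" for \<epsilon>
  proof -
    obtain M where M: "\<And>m n. m \<ge> M \<Longrightarrow> n \<ge> M \<Longrightarrow> norm_sq_integral (\<lambda>x. gradient (\<phi> m) x - gradient (\<phi> n) x) < ennreal \<epsilon>"
      using \<phi>(2)[OF e] unfolding nn_integral_completion by blast
    show ?thesis
    proof (intro exI[of _ M] allI impI)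
      fix m assume m: "m \<ge> M"
      \<comment> \<open>For fixed \<open>m\<close> these differences converge almost everywhere to
        \<open>u - \<phi> m\<close>, and their Dirichlet integrals are small by the Cauchy
        property.\<close>
      define f where "f = (\<lambda>n x. 1 * \<phi> (r (n + M)) x + (- 1) * \<phi> m x)"
      have rM: "r (n + M) \<ge> M" for n using seq_suble[OF r(1), of "n + M"] by simp
      have "norm_sq_integral (gradient (\<lambda>x. 1 * u x + (- 1) * \<phi> m x)) \<le> ennreal \<epsilon>"
      proof (rule gradient_norm_lsc[where f=f])
        show "(\<bar>1\<bar> * K (r (n + M)) + \<bar>-1\<bar> * K m)-lipschitz_on UNIV (f n)" for n unfolding f_def by (intro lipschitz_lincomb K)
        show "(\<bar>1\<bar> * L + \<bar>-1\<bar> * K m)-lipschitz_on UNIV (\<lambda>x. 1 * u x + (- 1) * \<phi> m x)" by (intro lipschitz_lincomb K L)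
        show "AE x in lborel. (\<lambda>n. f n x) \<longlonglongrightarrow> 1 * u x + (- 1) * \<phi> m x"
          using r(2)
        proof eventually_elim
          case (elim x)
          have "(\<lambda>n. \<phi> (r (n + M)) x) \<longlonglongrightarrow> u x" by (rule LIMSEQ_ignore_initial_segment[OF elim])
          then show ?case unfolding f_def by (intro tendsto_intros)
        qed
        show "norm_sq_integral (gradient (f n)) \<le> ennreal \<epsilon>" for n
        proof -
          have "norm_sq_integral (gradient (f n))
            = norm_sq_integral (\<lambda>x. gradient (\<phi> (r (n + M))) x - gradient (\<phi> m) x)"
            unfolding f_def using AE_gradient_lincomb[OF K K, of 1 "r (n + M)" "-1" m]
            by (intro nn_integral_cong_AE) (auto elim!: eventually_mono)
          also have "\<dots> \<le> ennreal \<epsilon>" using M[OF rM m] by (rule less_imp_le)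
          finally show ?thesis .
        qed
      qed
      also have "norm_sq_integral (gradient (\<lambda>x. 1 * u x + (- 1) * \<phi> m x))
         = norm_sq_integral (\<lambda>x. gradient u x - gradient (\<phi> m) x)"
        using AE_gradient_lincomb[OF L K, of 1 "-1" m] by (intro nn_integral_cong_AE) (auto elim!: eventually_mono)
      finally show "norm_sq_integral (\<lambda>x. gradient u x - gradient (\<phi> m) x) \<le> ennreal \<epsilon>" .
    qed
  qed
  have z[measurable]: "(\<lambda>x. 0::'a) \<in> borel_measurable borel" by simp
  obtain M where M: "norm_sq_integral (\<lambda>x. gradient u x - gradient (\<phi> M) x) \<le> ennreal 1"
    using close[of 1] by auto
  have "norm_sq_integral (\<lambda>x. gradient u x - 0)
     \<le> 2 * norm_sq_integral (\<lambda>x. gradient u x - gradient (\<phi> M) x) + 2 * norm_sq_integral (\<lambda>x. gradient (\<phi> M) x - 0)"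
    by (rule nn_integral_norm_sq_triangle) measurable
  also have "\<dots> < \<top>"
    using C1_supported_dirichlet_finite[OF R, of M] order_le_less_trans[OF M, of \<top>]
    by (simp add: ennreal_add_less_top ennreal_mult_less_top)
  finally show "norm_sq_integral (gradient u) < \<top>" by simp
  assume d: "norm_sq_integral (gradient u) \<le> ennreal d" "d \<ge> 0"
  let ?S = "\<lambda>t. (sobolev_const TYPE('a) * t) powr (?q / 2)"
  have bound: "powr_integral ?q u \<le> ennreal (?S (2 * d + 2 * \<epsilon>))" if e: "\<epsilon> > 0" for \<epsilon>
  proof -
    obtain M where M: "\<And>m. m \<ge> M \<Longrightarrow> norm_sq_integral (\<lambda>x. gradient u x - gradient (\<phi> m) x) \<le> ennreal \<epsilon>"
      using close[OF e] by blast
    have S: "powr_integral ?q (\<phi> m) \<le> ennreal (?S (2 * d + 2 * \<epsilon>))" if "m \<ge> M" for m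
    proof (rule sobolev_C1_supported[OF dim R])
      have "norm_sq_integral (\<lambda>x. gradient (\<phi> m) x - 0)
         \<le> 2 * norm_sq_integral (\<lambda>x. gradient (\<phi> m) x - gradient u x) + 2 * norm_sq_integral (\<lambda>x. gradient u x - 0)"
        by (rule nn_integral_norm_sq_triangle) measurable
      also have "\<dots> \<le> 2 * ennreal \<epsilon> + 2 * ennreal d"
        using M[OF that] d by (intro add_mono mult_left_mono) (auto simp: norm_minus_commute)
      also have "\<dots> = ennreal (2 * d + 2 * \<epsilon>)" using e d by (simp add: ennreal_mult add.commute)
      finally show "norm_sq_integral (gradient (\<phi> m)) \<le> ennreal (2 * d + 2 * \<epsilon>)" by simp
    qed (use e d in auto)
    show ?thesis
    proof (rule nn_integral_le_if_AE_tendsto[OF _ _ S tendsto_const])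
      show "AE x in lborel. (\<lambda>n. ennreal (\<bar>\<phi> (r (n + M)) x\<bar> powr ?q)) \<longlonglongrightarrow> ennreal (\<bar>u x\<bar> powr ?q)"
        using r(2)
      proof eventually_elim
        case (elim x)
        have "(\<lambda>n. \<phi> (r (n + M)) x) \<longlonglongrightarrow> u x" by (rule LIMSEQ_ignore_initial_segment[OF elim])
        then show ?case using q by (intro tendsto_ennrealI tendsto_powr' tendsto_rabs tendsto_const) auto
      qed
      show "r (n + M) \<ge> M" for n using seq_suble[OF r(1), of "n + M"] by simp
    qed measurable
  qed
  have "(\<lambda>n. ennreal (?S (2 * d + 2 * (1 / real (Suc n))))) \<longlonglongrightarrow> ennreal (?S (2 * d + 2 * 0))"
    using q d by (intro tendsto_ennrealI tendsto_powr' tendsto_intros LIMSEQ_Suc[OF lim_1_over_n])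
      (auto simp: sobolev_const_def intro!: always_eventually mult_nonneg_nonneg)
  then have "powr_integral ?q u \<le> ennreal (?S (2 * d + 2 * 0))"
    by (rule tendsto_lowerbound) (intro always_eventually allI bound, simp_all)
  then show "powr_integral ?q u \<le> ennreal ((sobolev_const TYPE('a) * (2 * d)) powr (?q / 2))"
    by simp
qed

theorem admissible_eq_energy_space:
  assumes dim: "DIM('a::euclidean_space) \<ge> 3"
  shows "(admissible :: ('a \<Rightarrow> real) set) = energy_space"
proof (intro set_eqI iffI)
  fix u :: "'a \<Rightarrow> real"
  assume "u \<in> admissible"
  then obtain L where L: "L-lipschitz_on UNIV u" and u: "u \<in> D12" "AE x in lborel. norm (gradient u x) \<le> 1"
    unfolding admissible_def by (auto simp: AE_completion_iff)
  have [measurable]: "u \<in> borel_measurable borel" "gradient u \<in> borel_measurable borel"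
    using lipschitz_borel[OF L] lipschitz_gradient_borel[OF L] by auto
  have L1: "1-lipschitz_on UNIV u" by (rule lipschitz_if_gradient_le[OF L u(2)]) simp
  have fin: "norm_sq_integral (gradient u) < \<top>" by (rule D12_lipschitz(1)[OF dim u(1) L])
  then have i1: "integrable lborel (\<lambda>x. (norm (gradient u x))\<^sup>2)" by (intro integrableI_nonneg) auto
  have "powr_integral (sobolev_exponent TYPE('a)) u < \<top>"
    using D12_lipschitz(2)[OF dim u(1) L eq_refl[OF nn_dirichlet[OF i1]] dirichlet_nonneg]
    by (rule order_le_less_trans) simp
  then have "integrable lborel (\<lambda>x. \<bar>u x\<bar> powr sobolev_exponent TYPE('a))" by (intro integrableI_nonneg) auto
  with L1 i1 show "u \<in> energy_space" by (simp add: energy_space_def)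
next
  fix u :: "'a \<Rightarrow> real"
  assume u: "u \<in> energy_space"
  note L = energy_spaceD(1)[OF u]
  have "u \<in> D12"
  proof (rule D12_if_integrable[OF dim L])
    show "norm_sq_integral (gradient u) < \<top>"
      using nn_dirichlet[OF energy_spaceD(2)[OF u]] by simp
    show "powr_integral (sobolev_exponent TYPE('a)) u < \<top>"
      using nn_integral_eq_integral[OF energy_spaceD(3)[OF u]] by simp
  qed
  moreover have "AE x in lebesgue. norm (gradient u x) \<le> 1"
    unfolding AE_completion_iff using AE_GDERIV[OF L] by eventually_elim (rule norm_gradient_le[OF L])
  ultimately show "u \<in> admissible" using L by (auto simp: admissible_def)
qed

lemma sobolev_energy_space:
  assumes dim: "DIM('a::euclidean_space) \<ge> 3" and u: "(u :: 'a \<Rightarrow> real) \<in> energy_space"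
  shows "powr_integral (sobolev_exponent TYPE('a)) u
      \<le> ennreal ((sobolev_const TYPE('a) * (2 * dirichlet u)) powr (sobolev_exponent TYPE('a) / 2))"
proof (rule D12_lipschitz(2)[OF dim _ energy_spaceD(1)[OF u] eq_refl dirichlet_nonneg])
  show "u \<in> D12" using u admissible_eq_energy_space[OF dim] unfolding admissible_def by blast
  show "norm_sq_integral (gradient u) = ennreal (dirichlet u)"
    by (rule nn_dirichlet[OF energy_spaceD(2)[OF u]])
qed

text \<open>If |u(x)| = 2 h, the Lipschitz constant 1 keeps |u| at least \<open>h\<close> on the
  ball of radius \<open>h\<close> around \<open>x\<close>. The integral of |u|^q is then at least a
  multiple of h^(q + N), while the Sobolev inequality bounds it by a multiple of the power
  \<open>q / 2\<close> of the Dirichlet integral. That the resulting exponent is below 1/2 makes the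
  action coercive.\<close>

lemma sup_bound:
  assumes dim: "DIM('a::euclidean_space) \<ge> 3"
  obtains A \<theta> where "A \<ge> 0" "0 < \<theta>" "\<theta> < 1 / 2"
    "\<And>u x. (u :: 'a \<Rightarrow> real) \<in> energy_space \<Longrightarrow> \<bar>u x\<bar> \<le> A * dirichlet u powr \<theta>"
proof -
  define q where "q = sobolev_exponent TYPE('a)"
  define N where "N = real DIM('a)"
  define \<beta> where "\<beta> = unit_ball_vol N"
  define K where "K = 2 * sobolev_const TYPE('a)"
  define \<theta> where "\<theta> = (q / 2) / (q + N)"
  define A where "A = 2 * (K powr (q / 2) / \<beta>) powr (1 / (q + N))"
  have q: "q > 0" unfolding q_def by (rule sobolev_exponent_pos[OF dim])
  have N: "N \<ge> 3" using dim by (simp add: N_def)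
  have \<beta>: "\<beta> > 0" unfolding \<beta>_def using N by (intro unit_ball_vol_pos) simp
  have K: "K \<ge> 0" by (simp add: K_def sobolev_const_def)
  have qN: "q + N > 0" using q N by simp
  have bound: "\<bar>u x\<bar> \<le> A * dirichlet u powr \<theta>" if u: "u \<in> energy_space" for u :: "'a \<Rightarrow> real" and x
  proof (cases "u x = 0")
    case True
    then show ?thesis by (simp add: A_def)
  next
    case False
    define h where "h = \<bar>u x\<bar> / 2"
    have h: "h > 0" using False by (simp add: h_def)
    note L = energy_spaceD(1)[OF u]
    have [measurable]: "u \<in> borel_measurable borel" by (rule energy_space_borel(1)[OF u])
    have "ennreal (h powr q) * emeasure lborel (cball x h) = (\<integral>\<^sup>+y. ennreal (h powr q) * indicator (cball x h) y \<partial>lborel)"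
      by (rule nn_integral_cmult_indicator[symmetric]) simp
    also have "\<dots> \<le> powr_integral q u"
    proof (rule nn_integral_mono)
      fix y
      show "ennreal (h powr q) * indicator (cball x h) y \<le> ennreal (\<bar>u y\<bar> powr q)"
      proof (cases "y \<in> cball x h")
        case True
        have "\<bar>u x - u y\<bar> \<le> 1 * dist x y" using lipschitz_onD[OF L, of x y] by (simp add: dist_real_def)
        then have "h \<le> \<bar>u y\<bar>" using True unfolding h_def by simp
        then show ?thesis using h q True by (auto intro!: ennreal_leI powr_mono2)
      qed simp
    qed
    also have "\<dots> \<le> ennreal ((K * dirichlet u) powr (q / 2))"
      using sobolev_energy_space[OF dim u] by (simp add: q_def K_def mult_ac)
    also have "ennreal (h powr q) * emeasure lborel (cball x h) = ennreal (h powr q * (\<beta> * h ^ DIM('a)))"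
      using h \<beta> by (simp add: emeasure_cball \<beta>_def N_def ennreal_mult)
    also have "h ^ DIM('a) = h powr N" using h by (simp add: N_def powr_realpow)
    finally have "h powr q * (\<beta> * h powr N) \<le> (K * dirichlet u) powr (q / 2)" by (simp add: ennreal_le_iff)
    then have "h powr (q + N) \<le> K powr (q / 2) / \<beta> * dirichlet u powr (q / 2)"
      using \<beta> K dirichlet_nonneg[of u] by (simp add: powr_add powr_mult field_simps)
    then have "(h powr (q + N)) powr (1 / (q + N)) \<le> (K powr (q / 2) / \<beta> * dirichlet u powr (q / 2)) powr (1 / (q + N))"
      using qN by (intro powr_mono2) auto
    also have "(h powr (q + N)) powr (1 / (q + N)) = h" using h qN by (simp add: powr_powr)
    also have "(K powr (q / 2) / \<beta> * dirichlet u powr (q / 2)) powr (1 / (q + N)) = (K powr (q / 2) / \<beta>) powr (1 / (q + N)) * dirichlet u powr \<theta>"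
      using \<beta> by (subst powr_mult) (auto simp: powr_powr \<theta>_def)
    finally show ?thesis by (simp add: h_def A_def)
  qed
  have "A \<ge> 0" by (simp add: A_def)
  moreover have "0 < \<theta>" "\<theta> < 1 / 2" using q N by (auto simp: \<theta>_def field_simps)
  ultimately show ?thesis using bound by (rule that)
qed

section \<open>The action and its minimizer\<close>

definition bi :: "'a::real_inner \<Rightarrow> real" where
  "bi g = 1 - sqrt (1 - (norm g)\<^sup>2)"

definition bi_energy :: "('a::euclidean_space \<Rightarrow> real) \<Rightarrow> real" where
  "bi_energy u = (\<integral>x. bi (gradient u x) \<partial>lborel)"

lemma norm_sq_le_1: "norm g \<le> 1 \<Longrightarrow> (norm g)\<^sup>2 \<le> 1"
  by (simp add: power_le_one)

lemma bi_le: "norm g \<le> 1 \<Longrightarrow> bi g \<le> (norm g)\<^sup>2"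
proof -
  assume "norm g \<le> 1"
  then have t: "0 \<le> 1 - (norm g)\<^sup>2" "1 - (norm g)\<^sup>2 \<le> 1" using norm_sq_le_1[of g] by auto
  have "(1 - (norm g)\<^sup>2)\<^sup>2 \<le> 1 - (norm g)\<^sup>2"
    unfolding power2_eq_square[of "1 - (norm g)\<^sup>2"] using t by (intro mult_left_le) auto
  then have "1 - (norm g)\<^sup>2 \<le> sqrt (1 - (norm g)\<^sup>2)" by (rule real_le_rsqrt)
  then show ?thesis by (simp add: bi_def)
qed

lemma bi_ge: "norm g \<le> 1 \<Longrightarrow> (norm g)\<^sup>2 / 2 \<le> bi g"
proof -
  assume "norm g \<le> 1"
  then have t: "(norm g)\<^sup>2 \<le> 1" by (rule norm_sq_le_1)
  have "sqrt (1 - (norm g)\<^sup>2) \<le> 1 - (norm g)\<^sup>2 / 2"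
  proof (rule real_le_lsqrt)
    have "0 \<le> ((norm g)\<^sup>2 / 2)\<^sup>2" by simp
    then show "1 - (norm g)\<^sup>2 \<le> (1 - (norm g)\<^sup>2 / 2)\<^sup>2" by (simp add: power2_diff)
  qed (use t in auto)
  then show ?thesis by (simp add: bi_def)
qed

lemma bi_nonneg: "norm g \<le> 1 \<Longrightarrow> 0 \<le> bi g"
  using bi_ge[of g] zero_le_power2[of "norm g"] by linarith

lemma parallelogram: "(norm (a + b))\<^sup>2 + (norm (a - b))\<^sup>2 = 2 * (norm a)\<^sup>2 + 2 * (norm (b::'a::real_inner))\<^sup>2"
  by (simp add: power2_norm_eq_inner inner_add_left inner_add_right inner_diff_left inner_diff_right)

text \<open>Uniform convexity on the closed unit ball. By the parallelogram law \<open>1 - m\<close>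
  equals \<open>P + e\<close>, where \<open>P\<close> is at least the square of the mean
  \<open>c\<close> of the two roots. Since \<open>c\<close> is at most \<open>1 - e / 2\<close>,
  adding \<open>e / 2\<close> to \<open>c\<close> keeps its square at most
  \<open>P + e\<close>.\<close>

lemma bi_midpoint:
  fixes a b :: "'a::real_inner"
  assumes a: "norm a \<le> 1" and b: "norm b \<le> 1"
  shows "bi ((1/2) *\<^sub>R a + (1/2) *\<^sub>R b) \<le> (bi a + bi b) / 2 - (norm ((1/2) *\<^sub>R a - (1/2) *\<^sub>R b))\<^sup>2 / 2"
proof -
  define A where "A = sqrt (1 - (norm a)\<^sup>2)"
  define B where "B = sqrt (1 - (norm b)\<^sup>2)"
  define m where "m = (norm ((1/2) *\<^sub>R a + (1/2) *\<^sub>R b))\<^sup>2"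
  define e where "e = (norm ((1/2) *\<^sub>R a - (1/2) *\<^sub>R b))\<^sup>2"
  define c where "c = (A + B) / 2"
  have A: "A \<ge> 0" "A\<^sup>2 = 1 - (norm a)\<^sup>2" using norm_sq_le_1[OF a] by (auto simp: A_def)
  have B: "B \<ge> 0" "B\<^sup>2 = 1 - (norm b)\<^sup>2" using norm_sq_le_1[OF b] by (auto simp: B_def)
  have me: "m + e = ((norm a)\<^sup>2 + (norm b)\<^sup>2) / 2"
    unfolding m_def e_def using parallelogram[of "(1/2) *\<^sub>R a" "(1/2) *\<^sub>R b"] by (simp add: power_divide)
  have e0: "e \<ge> 0" "m \<ge> 0" by (simp_all add: e_def m_def)
  have "((norm a)\<^sup>2 + (norm b)\<^sup>2) / 2 \<le> 1" using norm_sq_le_1[OF a] norm_sq_le_1[OF b] by simp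
  then have e1: "e \<le> 1" unfolding me[symmetric] using e0 by simp
  define P where "P = (A\<^sup>2 + B\<^sup>2) / 2"
  have Pm: "1 - m = P + e" unfolding P_def using me A(2) B(2) by (simp add: field_simps)
  have c2: "c\<^sup>2 \<le> P"
  proof -
    have "P - c\<^sup>2 = ((A - B) / 2)\<^sup>2" by (simp add: P_def c_def power2_eq_square field_simps)
    then show ?thesis using zero_le_power2[of "(A - B) / 2"] by linarith
  qed
  have c0: "c \<ge> 0" using A B by (simp add: c_def)
  have "c\<^sup>2 \<le> 1 - e" using c2 Pm e0 by linarith
  also have "\<dots> \<le> (1 - e / 2)\<^sup>2" using zero_le_power2[of "e / 2"] by (simp add: power2_diff)
  finally have c1: "c \<le> 1 - e / 2" by (rule power2_le_imp_le) (use e1 in simp)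
  have "(c + e / 2)\<^sup>2 = c\<^sup>2 + e * (c + e / 4)" by (simp add: power2_eq_square algebra_simps)
  also have "\<dots> \<le> P + e * 1" using c2 c1 e0 by (intro add_mono mult_left_mono) auto
  finally have "c + e / 2 \<le> sqrt (1 - m)" unfolding Pm by (intro real_le_rsqrt) simp
  then show ?thesis by (simp add: bi_def c_def A_def B_def m_def e_def field_simps)
qed

text \<open>Multiplying \<open>2 * A - (B + C)\<close> by its conjugate leaves (B - C)^2 + 4 |b|^2,
  and a second conjugation bounds |B - C| by a multiple of |b|. Both conjugates are bounded below in
  terms of \<open>\<mu>\<close> because \<open>a + b\<close> and \<open>a - b\<close> stay in the
  ball of radius \<open>k < 1\<close>.\<close>

lemma bi_second_difference:
  fixes a b :: "'a::real_inner"
  assumes k: "k < 1" and ab: "norm a \<le> 1" "norm (a + b) \<le> k" "norm (a - b) \<le> k"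
  defines "\<mu> \<equiv> sqrt (1 - k\<^sup>2)"
  shows "bi (a + b) + bi (a - b) - 2 * bi a \<le> (1 / \<mu>\<^sup>2 + 1) / \<mu> * (norm b)\<^sup>2"
proof -
  define A where "A = sqrt (1 - (norm a)\<^sup>2)"
  define B where "B = sqrt (1 - (norm (a + b))\<^sup>2)"
  define C where "C = sqrt (1 - (norm (a - b))\<^sup>2)"
  have k0: "k \<ge> 0" using ab(2) norm_ge_zero order_trans by blast
  have k2: "k\<^sup>2 < 1" using k k0 by (simp add: power_less_one_iff abs_square_less_1)
  have \<mu>: "\<mu> > 0" using k2 by (simp add: \<mu>_def)
  have sq: "(norm (a + b))\<^sup>2 \<le> k\<^sup>2" "(norm (a - b))\<^sup>2 \<le> k\<^sup>2" using ab by (auto intro: power_mono)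
  have A: "A \<ge> 0" "A\<^sup>2 = 1 - (norm a)\<^sup>2" using norm_sq_le_1[OF ab(1)] by (auto simp: A_def)
  have B: "B \<ge> \<mu>" "B\<^sup>2 = 1 - (norm (a + b))\<^sup>2" using sq k2 by (auto simp: B_def \<mu>_def)
  have C: "C \<ge> \<mu>" "C\<^sup>2 = 1 - (norm (a - b))\<^sup>2" using sq k2 by (auto simp: C_def \<mu>_def)
  have s: "B + C \<ge> 2 * \<mu>" using B C by simp
  have "(2 * A - (B + C)) * (2 * A + (B + C)) = (B - C)\<^sup>2 + 4 * (norm b)\<^sup>2"
  proof -
    have "(2 * A - (B + C)) * (2 * A + (B + C)) = 4 * A\<^sup>2 - (B + C)\<^sup>2" by (simp add: power2_eq_square algebra_simps)
    also have "\<dots> = 4 * A\<^sup>2 - 2 * (B\<^sup>2 + C\<^sup>2) + (B - C)\<^sup>2" by (simp add: power2_eq_square algebra_simps)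
    also have "4 * A\<^sup>2 - 2 * (B\<^sup>2 + C\<^sup>2) = 4 * (norm b)\<^sup>2"
      unfolding A(2) B(2) C(2) using parallelogram[of a b] by simp
    finally show ?thesis by simp
  qed
  moreover have "(B - C)\<^sup>2 \<le> 4 / \<mu>\<^sup>2 * (norm b)\<^sup>2"
  proof -
    have "B\<^sup>2 - C\<^sup>2 = - (4 * (a \<bullet> b))" unfolding B(2) C(2)
      by (simp add: power2_norm_eq_inner inner_add_left inner_add_right inner_diff_left inner_diff_right inner_commute)
    then have "((B - C) * (B + C))\<^sup>2 = 16 * (a \<bullet> b)\<^sup>2"
    proof -
      assume e: "B\<^sup>2 - C\<^sup>2 = - (4 * (a \<bullet> b))"
      have "(B - C) * (B + C) = B\<^sup>2 - C\<^sup>2" by (simp add: power2_eq_square algebra_simps)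
      then show ?thesis unfolding e by (simp add: power_mult_distrib)
    qed
    moreover have "(a \<bullet> b)\<^sup>2 \<le> (norm b)\<^sup>2"
    proof -
      have "\<bar>a \<bullet> b\<bar> \<le> norm a * norm b" by (rule Cauchy_Schwarz_ineq2)
      also have "\<dots> \<le> 1 * norm b" using ab by (intro mult_right_mono) auto
      finally show ?thesis by (simp add: abs_le_square_iff[symmetric])
    qed
    ultimately have "(B - C)\<^sup>2 * (B + C)\<^sup>2 \<le> 16 * (norm b)\<^sup>2" by (simp add: power_mult_distrib)
    moreover have "(B - C)\<^sup>2 * (2 * \<mu>)\<^sup>2 \<le> (B - C)\<^sup>2 * (B + C)\<^sup>2"
      using s \<mu> by (intro mult_left_mono power_mono) auto
    ultimately have "(B - C)\<^sup>2 * (2 * \<mu>)\<^sup>2 \<le> 16 * (norm b)\<^sup>2" by (rule order_trans[rotated])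
    then have "(B - C)\<^sup>2 * (4 * \<mu>\<^sup>2) \<le> 16 * (norm b)\<^sup>2" by (simp add: power_mult_distrib)
    then show ?thesis using \<mu> by (simp add: field_simps)
  qed
  ultimately have X: "(2 * A - (B + C)) * (2 * A + (B + C)) \<le> (4 / \<mu>\<^sup>2 + 4) * (norm b)\<^sup>2" by (simp add: distrib_right)
  have D: "2 * A + (B + C) \<ge> 2 * \<mu>" using A s by simp
  have "2 * A - (B + C) \<le> (1 / \<mu>\<^sup>2 + 1) / \<mu> * (norm b)\<^sup>2"
  proof (cases "2 * A - (B + C) \<le> 0")
    case True
    also have "0 \<le> (1 / \<mu>\<^sup>2 + 1) / \<mu> * (norm b)\<^sup>2" using \<mu> by simp
    finally show ?thesis .
  next
    case False
    \<comment> \<open>In the remaining case \<open>2 * A\<close> exceeds \<open>B + C\<close>, which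
      doubles the lower bound for the conjugate.\<close>
    then have A4: "2 * A + (B + C) \<ge> 4 * \<mu>" using s by simp
    have "(2 * A - (B + C)) * (4 * \<mu>) \<le> (2 * A - (B + C)) * (2 * A + (B + C))"
      using False A4 by (intro mult_left_mono) auto
    then have "(2 * A - (B + C)) * (4 * \<mu>) \<le> (4 / \<mu>\<^sup>2 + 4) * (norm b)\<^sup>2" using X by linarith
    then have "2 * A - (B + C) \<le> (4 / \<mu>\<^sup>2 + 4) * (norm b)\<^sup>2 / (4 * \<mu>)" using \<mu> by (simp add: pos_le_divide_eq)
    also have "\<dots> = (1 / \<mu>\<^sup>2 + 1) / \<mu> * (norm b)\<^sup>2" using \<mu> by (simp add: divide_simps distrib_right)
    finally show ?thesis .
  qed
  then show ?thesis by (simp add: bi_def A_def B_def C_def)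
qed

section \<open>The Born-Infeld energy on the energy space\<close>

lemma energy_space_AE_gradient_le:
  assumes "u \<in> energy_space" shows "AE x in lborel. norm (gradient u x) \<le> 1"
  using AE_GDERIV[OF energy_spaceD(1)[OF assms]]
  by eventually_elim (rule norm_gradient_le[OF energy_spaceD(1)[OF assms]])

lemma bi_measurable[measurable]:
  fixes f :: "'b \<Rightarrow> 'a::euclidean_space"
  assumes [measurable]: "f \<in> borel_measurable M"
  shows "(\<lambda>x. bi (f x)) \<in> borel_measurable M"
  unfolding bi_def by measurable

lemma bi_integrable:
  assumes u: "u \<in> energy_space"
  shows "integrable lborel (\<lambda>x. bi (gradient u x))"
proof (rule Bochner_Integration.integrable_bound[OF energy_spaceD(2)[OF u]])
  have [measurable]: "gradient u \<in> borel_measurable borel" by (rule energy_space_borel(2)[OF u])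
  show "(\<lambda>x. bi (gradient u x)) \<in> borel_measurable lborel" by measurable
  show "AE x in lborel. norm (bi (gradient u x)) \<le> norm ((norm (gradient u x))\<^sup>2)"
    using energy_space_AE_gradient_le[OF u] by eventually_elim (simp add: bi_nonneg bi_le)
qed

lemma bi_energy_bounds:
  assumes u: "u \<in> energy_space"
  shows "dirichlet u / 2 \<le> bi_energy u" "bi_energy u \<le> dirichlet u"
proof -
  have "(\<integral>x. (norm (gradient u x))\<^sup>2 / 2 \<partial>lborel) \<le> bi_energy u"
    unfolding bi_energy_def
    by (intro integral_mono_AE bi_integrable[OF u] integrable_divide energy_spaceD(2)[OF u]
      eventually_mono[OF energy_space_AE_gradient_le[OF u]] bi_ge)
  then show "dirichlet u / 2 \<le> bi_energy u" by (simp add: dirichlet_def)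
  show "bi_energy u \<le> dirichlet u"
    unfolding bi_energy_def dirichlet_def
    by (intro integral_mono_AE bi_integrable[OF u] energy_spaceD(2)[OF u]
      eventually_mono[OF energy_space_AE_gradient_le[OF u]] bi_le)
qed

text \<open>A membership test by domination. It serves linear combinations, truncations and maxima
  or minima with translates, all of which are controlled by two known members.\<close>

lemma energy_spaceI:
  fixes u v w :: "'a::euclidean_space \<Rightarrow> real"
  assumes dim: "DIM('a) \<ge> 3" and u: "u \<in> energy_space" and v: "v \<in> energy_space" and w: "1-lipschitz_on UNIV w"
    and g: "AE x in lborel. norm (gradient w x) \<le> c * (norm (gradient u x) + norm (gradient v x))"
    and le: "\<And>x. \<bar>w x\<bar> \<le> \<bar>u x\<bar> + \<bar>v x\<bar>"
  shows "w \<in> energy_space"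
proof -
  let ?q = "sobolev_exponent TYPE('a)"
  have q: "?q > 0" by (rule sobolev_exponent_pos[OF dim])
  have [measurable]: "w \<in> borel_measurable borel" "gradient w \<in> borel_measurable borel"
    using lipschitz_borel[OF w] lipschitz_gradient_borel[OF w] by auto
  have 1: "integrable lborel (\<lambda>x. c\<^sup>2 * (2 * (norm (gradient u x))\<^sup>2 + 2 * (norm (gradient v x))\<^sup>2))"
    using energy_spaceD(2)[OF u] energy_spaceD(2)[OF v]
    by (intro integrable_mult_right Bochner_Integration.integrable_add)
  have i1: "integrable lborel (\<lambda>x. (norm (gradient w x))\<^sup>2)"
  proof (rule Bochner_Integration.integrable_bound[OF 1])
    show "AE x in lborel. norm ((norm (gradient w x))\<^sup>2) \<le> norm (c\<^sup>2 * (2 * (norm (gradient u x))\<^sup>2 + 2 * (norm (gradient v x))\<^sup>2))"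
      using g
    proof eventually_elim
      case (elim x)
      have "(norm (gradient w x))\<^sup>2 \<le> (c * (norm (gradient u x) + norm (gradient v x)))\<^sup>2" using elim by (rule power_mono) simp
      also have "\<dots> = c\<^sup>2 * (norm (norm (gradient u x) + norm (gradient v x)))\<^sup>2" by (simp add: power_mult_distrib)
      also have "\<dots> \<le> c\<^sup>2 * (2 * (norm (norm (gradient u x)))\<^sup>2 + 2 * (norm (norm (gradient v x)))\<^sup>2)"
        by (intro mult_left_mono norm_sum_sq_le) simp
      finally show ?case by simp
    qed
  qed measurable
  have 2: "integrable lborel (\<lambda>x. 2 powr ?q * (\<bar>u x\<bar> powr ?q + \<bar>v x\<bar> powr ?q))"
    using energy_spaceD(3)[OF u] energy_spaceD(3)[OF v]
    by (intro integrable_mult_right Bochner_Integration.integrable_add)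
  have i2: "integrable lborel (\<lambda>x. \<bar>w x\<bar> powr ?q)"
  proof (rule Bochner_Integration.integrable_bound[OF 2])
    show "AE x in lborel. norm (\<bar>w x\<bar> powr ?q) \<le> norm (2 powr ?q * (\<bar>u x\<bar> powr ?q + \<bar>v x\<bar> powr ?q))"
    proof (rule AE_I2)
      fix x
      have "\<bar>w x\<bar> powr ?q \<le> (\<bar>u x\<bar> + \<bar>v x\<bar>) powr ?q" using le[of x] q by (intro powr_mono2) auto
      also have "\<dots> \<le> 2 powr ?q * (\<bar>u x\<bar> powr ?q + \<bar>v x\<bar> powr ?q)" using q by (intro powr_sum_le) auto
      finally show "norm (\<bar>w x\<bar> powr ?q) \<le> norm (2 powr ?q * (\<bar>u x\<bar> powr ?q + \<bar>v x\<bar> powr ?q))" by simp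
    qed
  qed measurable
  show ?thesis using w i1 i2 by (simp add: energy_space_def)
qed

lemma energy_space_lincomb:
  fixes u v :: "'a::euclidean_space \<Rightarrow> real"
  assumes dim: "DIM('a) \<ge> 3" and u: "u \<in> energy_space" and v: "v \<in> energy_space" and ab: "\<bar>a\<bar> + \<bar>b\<bar> \<le> 1"
  shows "(\<lambda>x. a * u x + b * v x) \<in> energy_space"
proof (rule energy_spaceI[OF dim u v, where c=1])
  have a1: "\<bar>a\<bar> \<le> 1" "\<bar>b\<bar> \<le> 1" using ab by auto
  have "(\<bar>a\<bar> * 1 + \<bar>b\<bar> * 1)-lipschitz_on UNIV (\<lambda>x. a * u x + b * v x)"
    by (intro lipschitz_lincomb energy_spaceD(1) u v)
  then show "1-lipschitz_on UNIV (\<lambda>x. a * u x + b * v x)" by (rule lipschitz_on_le) (use ab in simp)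
  show "AE x in lborel. norm (gradient (\<lambda>x. a * u x + b * v x) x) \<le> 1 * (norm (gradient u x) + norm (gradient v x))"
    using AE_gradient_lincomb[OF energy_spaceD(1)[OF u] energy_spaceD(1)[OF v], of a b]
  proof eventually_elim
    case (elim x)
    have "norm (a *\<^sub>R gradient u x + b *\<^sub>R gradient v x) \<le> \<bar>a\<bar> * norm (gradient u x) + \<bar>b\<bar> * norm (gradient v x)"
      using norm_triangle_ineq[of "a *\<^sub>R gradient u x" "b *\<^sub>R gradient v x"] by simp
    also have "\<dots> \<le> 1 * norm (gradient u x) + 1 * norm (gradient v x)" using a1 by (intro add_mono mult_right_mono) auto
    finally show ?case using elim by simp
  qed
  show "\<bar>a * u x + b * v x\<bar> \<le> \<bar>u x\<bar> + \<bar>v x\<bar>" for x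
  proof -
    have "\<bar>a * u x + b * v x\<bar> \<le> \<bar>a\<bar> * \<bar>u x\<bar> + \<bar>b\<bar> * \<bar>v x\<bar>" using abs_triangle_ineq[of "a * u x" "b * v x"] by (simp add: abs_mult)
    also have "\<dots> \<le> 1 * \<bar>u x\<bar> + 1 * \<bar>v x\<bar>" using a1 by (intro add_mono mult_right_mono) auto
    finally show ?thesis by simp
  qed
qed

lemma zero_in_energy_space:
  assumes dim: "DIM('a::euclidean_space) \<ge> 3"
  shows "(\<lambda>x::'a. 0) \<in> energy_space"
proof -
  have "gradient (\<lambda>x::'a. 0::real) x = 0" for x by (rule gradient_eq[OF GDERIV_const_zero])
  moreover have "1-lipschitz_on UNIV (\<lambda>x::'a. 0::real)" by (rule lipschitz_onI) auto
  ultimately show ?thesis using sobolev_exponent_pos[OF dim] by (simp add: energy_space_def)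
qed

text \<open>The factor 1/2 keeps the difference of two members 1-Lipschitz and hence in
  \<open>energy_space\<close>, where the Sobolev and supremum bounds apply.\<close>

definition half_dist :: "('a::euclidean_space \<Rightarrow> real) \<Rightarrow> ('a \<Rightarrow> real) \<Rightarrow> real" where
  "half_dist u v = dirichlet (\<lambda>x. (1/2) * u x + (- (1/2)) * v x)"

lemma bi_energy_midpoint:
  fixes u v :: "'a::euclidean_space \<Rightarrow> real"
  assumes dim: "DIM('a) \<ge> 3" and u: "u \<in> energy_space" and v: "v \<in> energy_space"
  shows "bi_energy (\<lambda>x. (1/2) * u x + (1/2) * v x) \<le> (bi_energy u + bi_energy v) / 2 - half_dist u v / 2"
proof -
  let ?w = "\<lambda>x. (1/2) * u x + (1/2) * v x" and ?d = "\<lambda>x. (1/2) * u x + (- (1/2)) * v x"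
  have w: "?w \<in> energy_space" by (intro energy_space_lincomb[OF dim u v]) simp
  have d: "?d \<in> energy_space" by (intro energy_space_lincomb[OF dim u v]) simp
  note L = energy_spaceD(1)[OF u] energy_spaceD(1)[OF v]
  have i: "integrable lborel (\<lambda>x. (bi (gradient u x) + bi (gradient v x)) / 2)"
    by (intro integrable_divide Bochner_Integration.integrable_add bi_integrable u v)
  have i2: "integrable lborel (\<lambda>x. (norm (gradient ?d x))\<^sup>2 / 2)" by (intro integrable_divide energy_spaceD(2)[OF d])
  have "bi_energy ?w \<le> (\<integral>x. (bi (gradient u x) + bi (gradient v x)) / 2 - (norm (gradient ?d x))\<^sup>2 / 2 \<partial>lborel)"
    unfolding bi_energy_def
  proof (rule integral_mono_AE[OF bi_integrable[OF w] Bochner_Integration.integrable_diff[OF i i2]])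
    show "AE x in lborel. bi (gradient ?w x) \<le> (bi (gradient u x) + bi (gradient v x)) / 2 - (norm (gradient ?d x))\<^sup>2 / 2"
      using AE_gradient_lincomb[OF L, of "1/2" "1/2"] AE_gradient_lincomb[OF L, of "1/2" "- (1/2)"]
        energy_space_AE_gradient_le[OF u] energy_space_AE_gradient_le[OF v]
    proof eventually_elim
      case (elim x)
      show ?case unfolding elim(1,2) using bi_midpoint[OF elim(3,4)] by simp
    qed
  qed
  also have "\<dots> = (bi_energy u + bi_energy v) / 2 - half_dist u v / 2"
    using Bochner_Integration.integral_diff[OF i i2] Bochner_Integration.integral_add[OF bi_integrable[OF u] bi_integrable[OF v]]
    by (simp add: bi_energy_def half_dist_def dirichlet_def)
  finally show ?thesis .
qed

lemma half_dist_sup: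
  assumes sup: "\<And>u x. (u :: 'a \<Rightarrow> real) \<in> energy_space \<Longrightarrow> \<bar>u x\<bar> \<le> A * dirichlet u powr \<theta>"
    and dim: "DIM('a::euclidean_space) \<ge> 3" and u: "(u :: 'a \<Rightarrow> real) \<in> energy_space" and v: "v \<in> energy_space"
  shows "\<bar>u x - v x\<bar> \<le> 2 * A * half_dist u v powr \<theta>"
proof -
  have "(\<lambda>x. (1/2) * u x + (- (1/2)) * v x) \<in> energy_space" by (intro energy_space_lincomb[OF dim u v]) simp
  from sup[OF this, of x] have "\<bar>(1/2) * u x + (- (1/2)) * v x\<bar> \<le> A * half_dist u v powr \<theta>" by (simp add: half_dist_def)
  moreover have "\<bar>u x - v x\<bar> = 2 * \<bar>(1/2) * u x + (- (1/2)) * v x\<bar>" by (simp add: abs_if)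
  ultimately show ?thesis by linarith
qed

lemma half_dist_eq_0:
  assumes dim: "DIM('a::euclidean_space) \<ge> 3" and u: "(u :: 'a \<Rightarrow> real) \<in> energy_space" and v: "v \<in> energy_space" and z: "half_dist u v \<le> 0"
  shows "u = v"
proof -
  obtain A \<theta> where A: "A \<ge> 0" "0 < \<theta>" "\<theta> < 1 / 2" "\<And>u x. (u :: 'a \<Rightarrow> real) \<in> energy_space \<Longrightarrow> \<bar>u x\<bar> \<le> A * dirichlet u powr \<theta>"
    using sup_bound[OF dim] by metis
  have "half_dist u v = 0" using z dirichlet_nonneg by (metis half_dist_def order_antisym)
  then have "\<bar>u x - v x\<bar> \<le> 0" for x using half_dist_sup[OF A(4) dim u v, of x] by simp
  then show ?thesis by (auto simp: fun_eq_iff)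
qed

text \<open>\<open>sup_bound\<close> turns the Cauchy property for \<open>half_dist\<close> into
  uniform convergence, and lower semicontinuity makes the gradients converge in the mean square. A
  subsequence of the gradients converges almost everywhere, so Fatou's lemma gives the inequality
  for \<open>bi_energy\<close>.\<close>

lemma energy_space_complete:
  fixes f :: "nat \<Rightarrow> 'a::euclidean_space \<Rightarrow> real"
  assumes dim: "DIM('a) \<ge> 3" and f: "\<And>n. f n \<in> energy_space"
    and c: "\<And>j k. k \<le> j \<Longrightarrow> half_dist (f j) (f k) \<le> \<epsilon> k" and \<epsilon>: "\<epsilon> \<longlonglongrightarrow> 0"
    and B: "\<And>n. dirichlet (f n) \<le> B"
  shows "\<exists>u\<in>energy_space. uniform_limit UNIV f u sequentially \<and> (\<forall>J. (\<lambda>n. bi_energy (f n)) \<longlonglongrightarrow> J \<longrightarrow> bi_energy u \<le> J)"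
proof -
  let ?q = "sobolev_exponent TYPE('a)"
  have q: "?q > 0" by (rule sobolev_exponent_pos[OF dim])
  obtain A \<theta> where A: "A \<ge> 0" "0 < \<theta>" "\<theta> < 1 / 2" "\<And>u x. (u :: 'a \<Rightarrow> real) \<in> energy_space \<Longrightarrow> \<bar>u x\<bar> \<le> A * dirichlet u powr \<theta>"
    using sup_bound[OF dim] by metis
  define \<eta> where "\<eta> = (\<lambda>k. 2 * A * \<epsilon> k powr \<theta>)"
  have \<epsilon>0: "\<epsilon> k \<ge> 0" for k using c[of k k] dirichlet_nonneg unfolding half_dist_def by (meson order_refl order_trans)
  have close: "\<bar>f j x - f k x\<bar> \<le> \<eta> k" if "k \<le> j" for j k x
  proof -
    have "\<bar>f j x - f k x\<bar> \<le> 2 * A * half_dist (f j) (f k) powr \<theta>" by (rule half_dist_sup[OF A(4) dim f f])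
    also have "\<dots> \<le> \<eta> k" unfolding \<eta>_def using A c[OF that] dirichlet_nonneg
      by (intro mult_left_mono powr_mono2) (auto simp: half_dist_def)
    finally show ?thesis .
  qed
  have "(\<lambda>k. \<epsilon> k powr \<theta>) \<longlonglongrightarrow> 0 powr \<theta>" using A(2) \<epsilon>0 by (intro tendsto_powr' \<epsilon> tendsto_const) auto
  then have \<eta>0: "\<eta> \<longlonglongrightarrow> 0" unfolding \<eta>_def by (intro tendsto_mult_right_zero) simp
  have "\<exists>l. (\<lambda>n. f n x) \<longlonglongrightarrow> l" for x
  proof -
    have "Cauchy (\<lambda>n. f n x)"
    proof (rule CauchyI)
      fix e :: real assume "e > 0"
      then have "eventually (\<lambda>k. \<eta> k < e / 2) sequentially" by (intro order_tendstoD(2)[OF \<eta>0]) simp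
      then obtain k where k: "\<eta> k < e / 2" by (auto simp: eventually_sequentially)
      show "\<exists>M. \<forall>m\<ge>M. \<forall>n\<ge>M. norm (f m x - f n x) < e"
      proof (intro exI[of _ k] allI impI)
        fix m n assume "m \<ge> k" "n \<ge> k"
        then show "norm (f m x - f n x) < e" using close[of k m x] close[of k n x] k by (simp add: abs_le_iff abs_less_iff)
      qed
    qed
    then show ?thesis using Cauchy_convergent convergent_def by blast
  qed
  then have "\<forall>x. \<exists>l. (\<lambda>n. f n x) \<longlonglongrightarrow> l" by blast
  from choice[OF this] obtain u where lim: "\<And>x. (\<lambda>n. f n x) \<longlonglongrightarrow> u x" by blast
  have uclose: "\<bar>u x - f k x\<bar> \<le> \<eta> k" for k x
  proof (rule tendsto_upperbound[OF tendsto_rabs[OF tendsto_diff[OF lim tendsto_const]]])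
    show "eventually (\<lambda>j. \<bar>f j x - f k x\<bar> \<le> \<eta> k) sequentially"
      using close unfolding eventually_sequentially by blast
  qed simp
  have ul: "uniform_limit UNIV f u sequentially"
  proof (rule uniform_limitI)
    fix e :: real assume "e > 0"
    then have "eventually (\<lambda>k. \<eta> k < e) sequentially" by (intro order_tendstoD(2)[OF \<eta>0])
    then show "eventually (\<lambda>n. \<forall>x\<in>UNIV. dist (f n x) (u x) < e) sequentially"
      by eventually_elim (use uclose in \<open>auto simp: dist_real_def abs_minus_commute intro: order_le_less_trans\<close>)
  qed
  have L: "1-lipschitz_on UNIV u"
  proof (rule lipschitz_onI)
    fix x y
    have "(\<lambda>n. \<bar>f n x - f n y\<bar>) \<longlonglongrightarrow> \<bar>u x - u y\<bar>" by (intro tendsto_intros lim)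
    then have "\<bar>u x - u y\<bar> \<le> 1 * dist x y"
      by (rule tendsto_upperbound) (use lipschitz_onD[OF energy_spaceD(1)[OF f]] in \<open>auto simp: dist_real_def\<close>)
    then show "dist (u x) (u y) \<le> 1 * dist x y" by (simp add: dist_real_def)
  qed simp
  have [measurable]: "u \<in> borel_measurable borel" "gradient u \<in> borel_measurable borel"
    using lipschitz_borel[OF L] lipschitz_gradient_borel[OF L] by auto
  have fm[measurable]: "f n \<in> borel_measurable borel" "gradient (f n) \<in> borel_measurable borel" for n
    using energy_space_borel[OF f] by auto
  have h: "(\<lambda>x. (1/2) * f j x + (- (1/2)) * f k x) \<in> energy_space" for j k by (intro energy_space_lincomb[OF dim f f]) simp
  have grad: "norm_sq_integral (\<lambda>x. (1/2) *\<^sub>R gradient u x + (- (1/2)) *\<^sub>R gradient (f k) x) \<le> ennreal (\<epsilon> k)" for k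
  proof -
    have "norm_sq_integral (gradient (\<lambda>x. (1/2) * u x + (- (1/2)) * f k x)) \<le> ennreal (\<epsilon> k)"
    proof (rule gradient_norm_lsc[where f="\<lambda>n x. (1/2) * f (n + k) x + (- (1/2)) * f k x"])
      show "1-lipschitz_on UNIV (\<lambda>x. (1/2) * f (n + k) x + (- (1/2)) * f k x)" for n by (rule energy_spaceD(1)[OF h])
      show "(\<bar>1/2\<bar> * 1 + \<bar>- (1/2)\<bar> * 1)-lipschitz_on UNIV (\<lambda>x. (1/2) * u x + (- (1/2)) * f k x)"
        by (intro lipschitz_lincomb L energy_spaceD(1)[OF f])
      show "AE x in lborel. (\<lambda>n. (1/2) * f (n + k) x + (- (1/2)) * f k x) \<longlonglongrightarrow> (1/2) * u x + (- (1/2)) * f k x"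
        by (intro AE_I2 tendsto_intros LIMSEQ_ignore_initial_segment[OF lim])
      show "norm_sq_integral (gradient (\<lambda>x. (1/2) * f (n + k) x + (- (1/2)) * f k x)) \<le> ennreal (\<epsilon> k)" for n
        unfolding nn_dirichlet[OF energy_spaceD(2)[OF h]] using c[of k "n + k"] by (intro ennreal_leI) (simp add: half_dist_def)
    qed
    also have "norm_sq_integral (gradient (\<lambda>x. (1/2) * u x + (- (1/2)) * f k x))
       = norm_sq_integral (\<lambda>x. (1/2) *\<^sub>R gradient u x + (- (1/2)) *\<^sub>R gradient (f k) x)"
      using AE_gradient_lincomb[OF L energy_spaceD(1)[OF f], of "1/2" "- (1/2)" k] by (intro nn_integral_cong_AE) (auto elim!: eventually_mono)
    finally show ?thesis .
  qed
  have grad2: "powr_integral 2 (\<lambda>x. norm (gradient (f k) x - gradient u x) - 0) \<le> ennreal (4 * \<epsilon> k)" for k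
  proof -
    have "ennreal (\<bar>norm (gradient (f k) x - gradient u x) - 0\<bar> powr 2) = 4 * ennreal ((norm ((1/2) *\<^sub>R gradient u x + (- (1/2)) *\<^sub>R gradient (f k) x))\<^sup>2)" for x
    proof -
      have "(1/2) *\<^sub>R gradient u x + (- (1/2)) *\<^sub>R gradient (f k) x = (1/2) *\<^sub>R (gradient u x - gradient (f k) x)"
        by (simp add: scaleR_diff_right)
      then have "(norm (gradient (f k) x - gradient u x))\<^sup>2 = 4 * (norm ((1/2) *\<^sub>R gradient u x + (- (1/2)) *\<^sub>R gradient (f k) x))\<^sup>2"
        by (simp add: norm_minus_commute power_divide)
      then show ?thesis by (simp add: ennreal_mult)
    qed
    then have "powr_integral 2 (\<lambda>x. norm (gradient (f k) x - gradient u x) - 0)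
       = 4 * norm_sq_integral (\<lambda>x. (1/2) *\<^sub>R gradient u x + (- (1/2)) *\<^sub>R gradient (f k) x)"
      by (simp only:) (rule nn_integral_cmult, measurable)
    also have "\<dots> \<le> 4 * ennreal (\<epsilon> k)" by (intro mult_left_mono grad) simp
    finally show ?thesis using \<epsilon>0[of k] by (simp add: ennreal_mult)
  qed
  have finD: "norm_sq_integral (\<lambda>x. gradient u x - 0) < \<top>"
  proof -
    have "norm_sq_integral (\<lambda>x. gradient u x - 0)
      \<le> 2 * norm_sq_integral (\<lambda>x. gradient u x - gradient (f 0) x) + 2 * norm_sq_integral (\<lambda>x. gradient (f 0) x - 0)"
      by (rule nn_integral_norm_sq_triangle) measurable
    also have "\<dots> < \<top>"
      using order_le_less_trans[OF grad2[of 0] ennreal_less_top] nn_dirichlet[OF energy_spaceD(2)[OF f], of 0]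
      by (simp add: ennreal_add_less_top ennreal_mult_less_top norm_minus_commute)
    finally show ?thesis .
  qed
  define S where "S = (sobolev_const TYPE('a) * (2 * B)) powr (?q / 2)"
  have Sn: "powr_integral ?q (f n) \<le> ennreal S" for n
  proof -
    have "powr_integral ?q (f n) \<le> ennreal ((sobolev_const TYPE('a) * (2 * dirichlet (f n))) powr (?q / 2))"
      by (rule sobolev_energy_space[OF dim f])
    also have "\<dots> \<le> ennreal S" unfolding S_def using B[of n] q dirichlet_nonneg[of "f n"]
      by (intro ennreal_leI powr_mono2 mult_left_mono mult_nonneg_nonneg) (auto simp: sobolev_const_def)
    finally show ?thesis .
  qed
  have "powr_integral ?q u \<le> ennreal S"
    using q by (intro nn_integral_le_if_AE_tendsto[where g="\<lambda>n x. ennreal (\<bar>f n x\<bar> powr ?q)", OF _ _ Sn tendsto_const] AE_I2 tendsto_ennrealI tendsto_powr' tendsto_rabs lim tendsto_const) auto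
  also have "\<dots> < \<top>" by simp
  finally have finq: "powr_integral ?q u < \<top>" .
  have u: "u \<in> energy_space"
    using L finD finq by (auto simp: energy_space_def intro!: integrableI_nonneg)
  have "(\<lambda>k. \<integral>\<^sup>+x. ennreal (\<bar>norm (gradient (f k) x - gradient u x) - 0\<bar> powr 2) \<partial>lborel) \<longlonglongrightarrow> 0"
  proof (rule tendsto_sandwich[OF _ _ tendsto_const])
    have "(\<lambda>k. 4 * \<epsilon> k) \<longlonglongrightarrow> 4 * 0" by (intro tendsto_intros \<epsilon>)
    from tendsto_ennrealI[OF this] show "(\<lambda>k. ennreal (4 * \<epsilon> k)) \<longlonglongrightarrow> 0" by simp
  qed (use grad2 in auto)
  then obtain r where r: "strict_mono (r :: nat \<Rightarrow> nat)" "AE x in lborel. (\<lambda>k. norm (gradient (f (r k)) x - gradient u x)) \<longlonglongrightarrow> 0"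
    using powr_AE_subseq[where f="\<lambda>k x. norm (gradient (f k) x - gradient u x)" and u="\<lambda>x. 0" and q=2] by auto
  have "bi_energy u \<le> J" if J: "(\<lambda>n. bi_energy (f n)) \<longlonglongrightarrow> J" for J
  proof -
    have "ennreal (bi_energy u) = (\<integral>\<^sup>+x. ennreal (bi (gradient u x)) \<partial>lborel)"
      unfolding bi_energy_def using energy_space_AE_gradient_le[OF u]
      by (intro nn_integral_eq_integral[symmetric] bi_integrable[OF u]) (auto elim!: eventually_mono intro: bi_nonneg)
    also have "\<dots> \<le> ennreal J"
    proof (rule nn_integral_le_if_AE_tendsto)
      show "AE x in lborel. (\<lambda>k. ennreal (bi (gradient (f (r k)) x))) \<longlonglongrightarrow> ennreal (bi (gradient u x))"
        using r(2)
      proof eventually_elim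
        case (elim x)
        have "(\<lambda>k. gradient (f (r k)) x) \<longlonglongrightarrow> gradient u x" using elim by (simp add: tendsto_norm_zero_iff LIM_zero_iff)
        then show ?case unfolding bi_def by (intro tendsto_ennrealI tendsto_intros)
      qed
      show "(\<integral>\<^sup>+x. ennreal (bi (gradient (f (r k)) x)) \<partial>lborel) \<le> ennreal (bi_energy (f (r k)))" for k
        unfolding bi_energy_def using energy_space_AE_gradient_le[OF f, of "r k"]
        by (intro eq_refl nn_integral_eq_integral bi_integrable[OF f]) (auto elim!: eventually_mono intro: bi_nonneg)
      show "(\<lambda>k. ennreal (bi_energy (f (r k)))) \<longlonglongrightarrow> ennreal J"
        using tendsto_ennrealI[OF LIMSEQ_subseq_LIMSEQ[OF J r(1)]] by (simp add: o_def)
    qed measurable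
    finally have "ennreal (bi_energy u) \<le> ennreal J" .
    moreover have "J \<ge> 0"
    proof (rule tendsto_lowerbound[OF J])
      have "0 \<le> bi_energy (f n)" for n
        using bi_energy_bounds(1)[OF f, of n] dirichlet_nonneg[of "f n"] by linarith
      then show "eventually (\<lambda>n. 0 \<le> bi_energy (f n)) sequentially" by simp
    qed simp
    ultimately show ?thesis by (simp add: ennreal_le_iff)
  qed
  then show ?thesis using u ul by blast
qed

section \<open>The direct method for the action\<close>

definition action :: "'a::euclidean_space measure \<Rightarrow> ('a \<Rightarrow> real) \<Rightarrow> real" where
  "action \<rho> u = bi_energy u - (\<integral>x. u x \<partial>\<rho>)"

lemma born_infeld_action_eq:
  assumes u: "u \<in> energy_space"
  shows "born_infeld_action \<rho> u = action \<rho> u"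
proof -
  have "(\<lambda>x. bi (gradient u x)) \<in> borel_measurable lborel"
    using energy_space_borel(2)[OF u] by measurable
  then have "(\<integral>x. bi (gradient u x) \<partial>lebesgue) = bi_energy u"
    unfolding bi_energy_def by (rule integral_completion)
  then show ?thesis by (simp add: born_infeld_action_def action_def bi_def)
qed

lemma continuous_bounded_integrable:
  fixes u :: "'a::euclidean_space \<Rightarrow> real"
  assumes \<rho>: "prob_space \<rho>" "sets \<rho> = sets borel" and u: "continuous_on UNIV u" "\<And>x. \<bar>u x\<bar> \<le> B"
  shows "integrable \<rho> u" "\<bar>\<integral>x. u x \<partial>\<rho>\<bar> \<le> B"
proof -
  interpret prob_space \<rho> by fact
  have m: "u \<in> borel_measurable \<rho>"
    using borel_measurable_continuous_onI[OF u(1)] \<rho>(2) by (simp cong: measurable_cong_sets)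
  show i: "integrable \<rho> u" using u(2) m by (intro integrable_const_bound[where B=B]) auto
  have "\<bar>\<integral>x. u x \<partial>\<rho>\<bar> \<le> (\<integral>x. \<bar>u x\<bar> \<partial>\<rho>)" by (rule integral_abs_bound)
  also have "\<dots> \<le> (\<integral>x. B \<partial>\<rho>)" using i u(2) by (intro integral_mono) auto
  also have "\<dots> = B" by (simp add: prob_space)
  finally show "\<bar>\<integral>x. u x \<partial>\<rho>\<bar> \<le> B" .
qed

lemma energy_space_bounded:
  assumes "DIM('a::euclidean_space) \<ge> 3" and u: "(u :: 'a \<Rightarrow> real) \<in> energy_space"
  obtains B where "\<And>x. \<bar>u x\<bar> \<le> B"
  using sup_bound[OF assms(1)] u by metis

lemma energy_space_integrable:
  fixes u :: "'a::euclidean_space \<Rightarrow> real"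
  assumes dim: "DIM('a) \<ge> 3" and \<rho>: "prob_space \<rho>" "sets \<rho> = sets borel" and u: "u \<in> energy_space"
  shows "integrable \<rho> u"
proof -
  obtain B where "\<And>x. \<bar>u x\<bar> \<le> B" using energy_space_bounded[OF dim u] by blast
  then show ?thesis using continuous_bounded_integrable(1)[OF \<rho> energy_space_borel(3)[OF u]] by blast
qed

lemma action_midpoint:
  fixes u v :: "'a::euclidean_space \<Rightarrow> real"
  assumes dim: "DIM('a) \<ge> 3" and \<rho>: "prob_space \<rho>" "sets \<rho> = sets borel" and u: "u \<in> energy_space" and v: "v \<in> energy_space"
  shows "action \<rho> (\<lambda>x. (1/2) * u x + (1/2) * v x) \<le> (action \<rho> u + action \<rho> v) / 2 - half_dist u v / 2"
proof -
  have "(\<integral>x. (1/2) * u x + (1/2) * v x \<partial>\<rho>) = (1/2) * (\<integral>x. u x \<partial>\<rho>) + (1/2) * (\<integral>x. v x \<partial>\<rho>)"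
    using energy_space_integrable[OF dim \<rho> u] energy_space_integrable[OF dim \<rho> v]
    by (subst Bochner_Integration.integral_add) auto
  then show ?thesis using bi_energy_midpoint[OF dim u v] by (simp add: action_def field_simps)
qed

text \<open>An exponent below 1/2 gives d^\<theta> <= 1 + sqrt d, and the root is absorbed by
  completing the square. The coefficient 1/4 is smaller than the 1/2 in the lower bound of
  \<open>bi_energy\<close>, so the action is bounded below and controls the Dirichlet
  integral.\<close>

lemma sup_bound_linear:
  assumes dim: "DIM('a::euclidean_space) \<ge> 3"
  obtains K where "K \<ge> 0" "\<And>u x. (u :: 'a \<Rightarrow> real) \<in> energy_space \<Longrightarrow> \<bar>u x\<bar> \<le> K + dirichlet u / 4"
proof -
  obtain A \<theta> where A: "A \<ge> 0" "0 < \<theta>" "\<theta> < 1 / 2" "\<And>u x. (u :: 'a \<Rightarrow> real) \<in> energy_space \<Longrightarrow> \<bar>u x\<bar> \<le> A * dirichlet u powr \<theta>"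
    using sup_bound[OF dim] by metis
  have "A * d powr \<theta> \<le> (A + A\<^sup>2) + d / 4" if d: "d \<ge> 0" for d :: real
  proof -
    have "d powr \<theta> \<le> 1 + sqrt d"
    proof (cases "d \<le> 1")
      case True
      then have "d powr \<theta> \<le> 1 powr \<theta>" using d A(2) by (intro powr_mono2) auto
      then show ?thesis using d by (simp add: add_increasing2)
    next
      case False
      then have "d powr \<theta> \<le> d powr (1/2)" using A(3) by (intro powr_mono) auto
      then show ?thesis using d by (simp add: powr_half_sqrt)
    qed
    then have "A * d powr \<theta> \<le> A * (1 + sqrt d)" using A(1) by (rule mult_left_mono)
    also have "\<dots> = A + A * sqrt d" by (simp add: distrib_left)
    also have "A * sqrt d \<le> A\<^sup>2 + d / 4"
    proof -
      have "0 \<le> (A - sqrt d / 2)\<^sup>2" by simp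
      also have "(A - sqrt d / 2)\<^sup>2 = A\<^sup>2 + (sqrt d)\<^sup>2 / 4 - A * sqrt d" by (simp add: power2_eq_square algebra_simps)
      finally show ?thesis using d by simp
    qed
    finally show ?thesis by simp
  qed
  then have "\<bar>u x\<bar> \<le> (A + A\<^sup>2) + dirichlet u / 4" if "u \<in> energy_space" for u :: "'a \<Rightarrow> real" and x
    using A(4)[OF that, of x] dirichlet_nonneg[of u] order_trans by blast
  moreover have "A + A\<^sup>2 \<ge> 0" using A(1) by simp
  ultimately show ?thesis by (intro that)
qed

lemma minimizing_sequence:
  fixes g :: "'b \<Rightarrow> real"
  assumes "A \<noteq> {}" "bdd_below (g ` A)"
  obtains f where "\<And>k::nat. f k \<in> A" "\<And>k. g (f k) < (INF x\<in>A. g x) + 1 / real (Suc k)" "(\<lambda>k. g (f k)) \<longlonglongrightarrow> (INF x\<in>A. g x)"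
proof -
  let ?m = "INF x\<in>A. g x"
  have "\<exists>x. x \<in> A \<and> g x < ?m + 1 / real (Suc k)" for k
    using cINF_less_iff[OF assms, of "?m + 1 / real (Suc k)"] by auto
  then have "\<forall>k. \<exists>x. x \<in> A \<and> g x < ?m + 1 / real (Suc k)" by blast
  from choice[OF this] obtain f where f: "\<And>k. f k \<in> A" "\<And>k. g (f k) < ?m + 1 / real (Suc k)" by blast
  have "(\<lambda>k. ?m + 1 / real (Suc k)) \<longlonglongrightarrow> ?m + 0" by (intro tendsto_intros LIMSEQ_Suc[OF lim_1_over_n])
  then have lim: "(\<lambda>k. ?m + 1 / real (Suc k)) \<longlonglongrightarrow> ?m" by simp
  have "(\<lambda>k. g (f k)) \<longlonglongrightarrow> ?m"
    by (rule tendsto_sandwich[OF _ _ tendsto_const lim])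
      (use cINF_lower[OF assms(2) f(1)] f(2) in \<open>auto intro!: always_eventually less_imp_le\<close>)
  with f show ?thesis by (rule that)
qed

text \<open>For a minimizing sequence the midpoint inequality bounds \<open>half_dist\<close> of two
  members by the sum of their excesses over the infimum. The sequence is therefore Cauchy, and its
  uniform limit also passes through the integral against \<open>\<rho>\<close>.\<close>

theorem action_minimizer:
  fixes \<rho> :: "'a::euclidean_space measure"
  assumes dim: "DIM('a) \<ge> 3" and \<rho>: "prob_space \<rho>" "sets \<rho> = sets borel"
  shows "\<exists>u\<in>energy_space. \<forall>v\<in>energy_space. action \<rho> u \<le> action \<rho> v"
proof -
  interpret prob_space \<rho> by fact
  obtain K where K: "K \<ge> 0" "\<And>u x. (u :: 'a \<Rightarrow> real) \<in> energy_space \<Longrightarrow> \<bar>u x\<bar> \<le> K + dirichlet u / 4"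
    using sup_bound_linear[OF dim] by metis
  have below: "- K \<le> action \<rho> u" if u: "u \<in> energy_space" for u
  proof -
    have "\<bar>\<integral>x. u x \<partial>\<rho>\<bar> \<le> K + dirichlet u / 4"
      by (rule continuous_bounded_integrable(2)[OF \<rho> energy_space_borel(3)[OF u] K(2)[OF u]])
    then show ?thesis using bi_energy_bounds(1)[OF u] dirichlet_nonneg[of u] unfolding action_def by linarith
  qed
  have bdd: "bdd_below (action \<rho> ` energy_space)" using below by (intro bdd_belowI2)
  define m where "m = (INF u\<in>energy_space. action \<rho> u)"
  have m: "m \<le> action \<rho> u" if "u \<in> energy_space" for u unfolding m_def using bdd that by (rule cINF_lower)
  have ne: "energy_space \<noteq> ({} :: ('a \<Rightarrow> real) set)" using zero_in_energy_space[OF dim] by blast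
  obtain f where f: "\<And>k. f k \<in> energy_space" "\<And>k. action \<rho> (f k) < m + 1 / real (Suc k)" and act: "(\<lambda>k. action \<rho> (f k)) \<longlonglongrightarrow> m"
    by (rule minimizing_sequence[OF ne bdd, folded m_def], rule that)
  define \<epsilon> where "\<epsilon> = (\<lambda>k::nat. 2 / real (Suc k))"
  have hd: "half_dist (f j) (f k) \<le> \<epsilon> k" if "k \<le> j" for j k
  proof -
    have "m \<le> action \<rho> (\<lambda>x. (1/2) * f j x + (1/2) * f k x)" by (intro m energy_space_lincomb[OF dim f(1) f(1)]) simp
    also have "\<dots> \<le> (action \<rho> (f j) + action \<rho> (f k)) / 2 - half_dist (f j) (f k) / 2" by (rule action_midpoint[OF dim \<rho> f(1) f(1)])
    finally have "half_dist (f j) (f k) \<le> action \<rho> (f j) + action \<rho> (f k) - 2 * m" by (simp add: field_simps)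
    also have "\<dots> \<le> 1 / real (Suc j) + 1 / real (Suc k)" using f(2)[of j] f(2)[of k] by linarith
    also have "\<dots> \<le> 1 / real (Suc k) + 1 / real (Suc k)" using that by (intro add_mono divide_left_mono) auto
    finally show ?thesis by (simp add: \<epsilon>_def)
  qed
  have \<epsilon>0: "\<epsilon> \<longlonglongrightarrow> 0"
    using tendsto_mult_right_zero[OF LIMSEQ_Suc[OF lim_1_over_n], of 2] by (simp add: \<epsilon>_def)
  have fi: "integrable \<rho> (f k)" for k by (rule energy_space_integrable[OF dim \<rho> f(1)])
  have "dirichlet (f k) \<le> 4 * (m + 1 + K)" for k
  proof -
    have "(\<integral>x. f k x \<partial>\<rho>) \<le> K + dirichlet (f k) / 4"
      by (rule abs_le_D1, rule continuous_bounded_integrable(2)[OF \<rho> energy_space_borel(3)[OF f(1)] K(2)[OF f(1)]])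
    moreover have "action \<rho> (f k) < m + 1" by (rule order_less_le_trans[OF f(2)]) simp
    ultimately show ?thesis using bi_energy_bounds(1)[OF f(1), of k] unfolding action_def by simp
  qed
  from energy_space_complete[OF dim f(1) hd \<epsilon>0 this]
  obtain u where u: "u \<in> energy_space" "uniform_limit UNIV f u sequentially"
    "\<And>J. (\<lambda>n. bi_energy (f n)) \<longlonglongrightarrow> J \<Longrightarrow> bi_energy u \<le> J" by blast
  have ui: "integrable \<rho> u" by (rule energy_space_integrable[OF dim \<rho> u(1)])
  have p: "(\<lambda>n. \<integral>x. f n x \<partial>\<rho>) \<longlonglongrightarrow> (\<integral>x. u x \<partial>\<rho>)"
  proof (rule tendstoI)
    fix e :: real assume e: "e > 0"
    have "eventually (\<lambda>n. \<forall>x\<in>UNIV. dist (f n x) (u x) < e / 2) sequentially"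
      by (rule uniform_limitD[OF u(2)]) (use e in simp)
    then show "eventually (\<lambda>n. dist (\<integral>x. f n x \<partial>\<rho>) (\<integral>x. u x \<partial>\<rho>) < e) sequentially"
    proof eventually_elim
      case (elim n)
      have "\<bar>\<integral>x. f n x - u x \<partial>\<rho>\<bar> \<le> e / 2"
        using elim energy_space_borel(3)[OF f(1)] energy_space_borel(3)[OF u(1)]
        by (intro continuous_bounded_integrable(2)[OF \<rho>] continuous_on_diff) (auto simp: dist_real_def less_imp_le)
      then show ?case using e unfolding dist_real_def by (subst Bochner_Integration.integral_diff[symmetric]) (auto intro: fi ui)
    qed
  qed
  have "(\<lambda>k. action \<rho> (f k) + (\<integral>x. f k x \<partial>\<rho>)) \<longlonglongrightarrow> m + (\<integral>x. u x \<partial>\<rho>)" by (intro tendsto_add act p)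
  then have "bi_energy u \<le> m + (\<integral>x. u x \<partial>\<rho>)" by (intro u(3)) (simp add: action_def)
  then have "action \<rho> u \<le> m" by (simp add: action_def)
  then show ?thesis using u(1) m order_trans by blast
qed

text \<open>Quadratic growth at the minimizer: minimality is tested at the midpoint of
  \<open>u\<close> and \<open>v\<close>, where strong convexity gains
  \<open>half_dist u v / 2\<close>.\<close>

lemma action_minimizer_strong:
  fixes \<rho> :: "'a::euclidean_space measure"
  assumes dim: "DIM('a) \<ge> 3" and \<rho>: "prob_space \<rho>" "sets \<rho> = sets borel"
    and u: "u \<in> energy_space" "\<And>v. v \<in> energy_space \<Longrightarrow> action \<rho> u \<le> action \<rho> v" and v: "v \<in> energy_space"
  shows "action \<rho> u + half_dist u v \<le> action \<rho> v"
proof -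
  have "action \<rho> u \<le> action \<rho> (\<lambda>x. (1/2) * u x + (1/2) * v x)" by (intro u energy_space_lincomb[OF dim u(1) v]) simp
  also have "\<dots> \<le> (action \<rho> u + action \<rho> v) / 2 - half_dist u v / 2" by (rule action_midpoint[OF dim \<rho> u(1) v])
  finally show ?thesis by (simp add: field_simps)
qed

text \<open>Uniqueness makes the definite description in \<open>potential\<close> pick the
  minimizer. The growth estimate is kept alongside, because it controls how the potential reacts to
  a change of the measure.\<close>

theorem potential_minimizes:
  fixes \<rho> :: "'a::euclidean_space measure"
  assumes dim: "DIM('a) \<ge> 3" and \<rho>: "prob_space \<rho>" "sets \<rho> = sets borel"
  shows "potential \<rho> \<in> energy_space"
    and "v \<in> energy_space \<Longrightarrow> action \<rho> (potential \<rho>) + half_dist (potential \<rho>) v \<le> action \<rho> v"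
    and "electrostatic_energy \<rho> = - action \<rho> (potential \<rho>)"
    and "v \<in> energy_space \<Longrightarrow> action \<rho> v \<le> action \<rho> (potential \<rho>) \<Longrightarrow> v = potential \<rho>"
proof -
  obtain u where u: "u \<in> energy_space" "\<And>v. v \<in> energy_space \<Longrightarrow> action \<rho> u \<le> action \<rho> v"
    using action_minimizer[OF assms] by blast
  have strong: "action \<rho> u + half_dist u v \<le> action \<rho> v" if "v \<in> energy_space" for v
    by (rule action_minimizer_strong[OF dim \<rho> u(1) _ that]) (rule u(2))
  have uniq: "v = u" if "v \<in> energy_space" "action \<rho> v \<le> action \<rho> u" for v
    using half_dist_eq_0[OF dim u(1) that(1)] strong[OF that(1)] that(2) by simp
  have eq: "potential \<rho> = u"
    unfolding potential_def
  proof (rule the_equality)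
    show "is_arg_min (born_infeld_action \<rho>) (\<lambda>\<psi>. \<psi> \<in> admissible) u"
      using u by (auto simp: is_arg_min_def admissible_eq_energy_space[OF dim] born_infeld_action_eq not_less)
    fix v assume "is_arg_min (born_infeld_action \<rho>) (\<lambda>\<psi>. \<psi> \<in> admissible) v"
    then have "v \<in> energy_space" "\<not> action \<rho> u < action \<rho> v"
      using u(1) by (auto simp: is_arg_min_def admissible_eq_energy_space[OF dim] born_infeld_action_eq)
    then show "v = u" by (intro uniq) auto
  qed
  show "potential \<rho> \<in> energy_space" using u(1) eq by simp
  show "action \<rho> (potential \<rho>) + half_dist (potential \<rho>) v \<le> action \<rho> v" if "v \<in> energy_space"
    using strong[OF that] eq by simp
  show "electrostatic_energy \<rho> = - action \<rho> (potential \<rho>)"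
    using u(1) eq by (simp add: electrostatic_energy_def born_infeld_action_eq)
  show "v = potential \<rho>" if "v \<in> energy_space" "action \<rho> v \<le> action \<rho> (potential \<rho>)"
    using uniq that eq by simp
qed

section \<open>The interior ball condition\<close>

lemma locally_Hoelder_on_bounded:
  fixes f :: "'a::euclidean_space \<Rightarrow> real"
  assumes "locally_Hoelder_on \<alpha> UNIV f" and \<alpha>: "\<alpha> > 0"
  shows "\<exists>r>0. \<exists>B. \<forall>x\<in>ball p r. \<bar>f x\<bar> \<le> B"
proof -
  obtain r C where r: "r > 0" "\<forall>y\<in>ball p r. \<forall>z\<in>ball p r. \<bar>f y - f z\<bar> \<le> C * dist y z powr \<alpha>"
    using assms(1)[unfolded locally_Hoelder_on_def, rule_format, of p] by auto
  have "\<bar>f x\<bar> \<le> \<bar>f p\<bar> + \<bar>C\<bar> * r powr \<alpha>" if x: "x \<in> ball p r" for x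
  proof -
    have "\<bar>f x - f p\<bar> \<le> C * dist x p powr \<alpha>" using r x by simp
    also have "\<dots> \<le> \<bar>C\<bar> * dist x p powr \<alpha>" by (intro mult_right_mono) auto
    also have "\<dots> \<le> \<bar>C\<bar> * r powr \<alpha>" using x \<alpha> by (intro mult_left_mono powr_mono2) (auto simp: dist_commute)
    finally show ?thesis by linarith
  qed
  then show ?thesis using r(1) by blast
qed

lemma norm_le_DIM_bound:
  fixes x :: "'a::euclidean_space"
  assumes "\<And>b. b \<in> Basis \<Longrightarrow> \<bar>b \<bullet> x\<bar> \<le> B"
  shows "norm x \<le> real DIM('a) * B"
proof -
  have "norm x \<le> (\<Sum>b\<in>Basis. \<bar>x \<bullet> b\<bar>)" by (rule norm_le_l1)
  also have "\<dots> \<le> (\<Sum>b\<in>(Basis::'a set). B)" using assms by (intro sum_mono) (simp add: inner_commute)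
  finally show ?thesis by simp
qed

text \<open>Hoelder continuous second derivatives are locally bounded, and the mean value inequality
  for each component of the gradient does the rest. The two factors \<open>N\<close> come from
  passing between norms and coordinates.\<close>

lemma C2_Hoelder_gradient_locally_lipschitz:
  fixes f :: "'a::euclidean_space \<Rightarrow> real"
  assumes f: "C_k_Hoelder_on 2 \<alpha> UNIV f" and \<alpha>: "\<alpha> > 0"
  shows "\<And>x. GDERIV f x :> gradient f x"
    and "\<exists>r>0. \<exists>K\<ge>0. \<forall>x\<in>ball p r. \<forall>y\<in>ball p r. norm (gradient f x - gradient f y) \<le> K * norm (x - y)"
proof -
  have d1: "f differentiable (at x)" and d2: "(\<lambda>x. frechet_derivative f (at x) v) differentiable (at x)"
    and h: "locally_Hoelder_on \<alpha> UNIV (\<lambda>x. frechet_derivative (\<lambda>x. frechet_derivative f (at x) v) (at x) w)" for x v w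
    using f by (auto simp: numeral_2_eq_2)
  show g: "GDERIV f x :> gradient f x" for x using d1 by (rule GDERIV_gradient)
  have fd: "frechet_derivative f (at x) v = v \<bullet> gradient f x" for x v
    using fun_cong[OF frechet_derivative_at[OF g[of x, unfolded gderiv_def]], of v] by simp
  define G where "G = (\<lambda>b x. b \<bullet> gradient f x)"
  have gG: "GDERIV (G b) x :> gradient (G b) x" for b x
    using d2[of b x] unfolding fd G_def by (rule GDERIV_gradient)
  have fdG: "frechet_derivative (G b) (at x) c = c \<bullet> gradient (G b) x" for b c x
    using fun_cong[OF frechet_derivative_at[OF gG[of b x, unfolded gderiv_def]], of c] by simp
  have hG: "locally_Hoelder_on \<alpha> UNIV (\<lambda>x. c \<bullet> gradient (G b) x)" for b c
  proof -
    have eq: "(\<lambda>x. b \<bullet> gradient f x) = G b" by (simp add: G_def)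
    show ?thesis using h[of b c] unfolding fd eq fdG .
  qed
  have "\<forall>bc. \<exists>rB. fst rB > 0 \<and> (\<forall>x\<in>ball p (fst rB). \<bar>snd bc \<bullet> gradient (G (fst bc)) x\<bar> \<le> snd rB)"
  proof
    fix bc
    obtain r B where "r > 0" "\<forall>x\<in>ball p r. \<bar>snd bc \<bullet> gradient (G (fst bc)) x\<bar> \<le> B"
      using locally_Hoelder_on_bounded[OF hG \<alpha>, of p "snd bc" "fst bc"] by blast
    then show "\<exists>rB. fst rB > 0 \<and> (\<forall>x\<in>ball p (fst rB). \<bar>snd bc \<bullet> gradient (G (fst bc)) x\<bar> \<le> snd rB)"
      by (intro exI[of _ "(r, B)"]) simp
  qed
  from choice[OF this] obtain H :: "'a \<times> 'a \<Rightarrow> real \<times> real" where H: "\<And>bc. fst (H bc) > 0"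
    "\<And>bc x. x \<in> ball p (fst (H bc)) \<Longrightarrow> \<bar>snd bc \<bullet> gradient (G (fst bc)) x\<bar> \<le> snd (H bc)"
    by blast
  define r where "r = (\<lambda>b c. fst (H (b, c)))"
  define B where "B = (\<lambda>b c. snd (H (b, c)))"
  have r: "r b c > 0" for b c using H(1) by (simp add: r_def)
  have B: "\<bar>c \<bullet> gradient (G b) x\<bar> \<le> B b c" if "x \<in> ball p (r b c)" for b c x
    using H(2)[of x "(b, c)"] that by (simp add: r_def B_def)
  let ?P = "(Basis :: 'a set) \<times> (Basis :: 'a set)"
  define s where "s = Min ((\<lambda>(b, c). r b c) ` ?P)"
  define M where "M = (\<Sum>(b, c)\<in>?P. \<bar>B b c\<bar>)"
  have s: "s > 0" "\<And>b c. b \<in> Basis \<Longrightarrow> c \<in> Basis \<Longrightarrow> s \<le> r b c"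
    unfolding s_def using r by (auto intro!: Min_le)
  have M0: "M \<ge> 0" unfolding M_def by (intro sum_nonneg) auto
  have bM: "\<bar>c \<bullet> gradient (G b) x\<bar> \<le> M" if "x \<in> ball p s" "b \<in> Basis" "c \<in> Basis" for b c x
  proof -
    have "\<bar>c \<bullet> gradient (G b) x\<bar> \<le> \<bar>B b c\<bar>" using B[of x b c] s(2)[OF that(2,3)] that(1) by force
    also have "\<dots> \<le> M" unfolding M_def using that member_le_sum[of "(b, c)" ?P "\<lambda>(b, c). \<bar>B b c\<bar>"] by auto
    finally show ?thesis .
  qed
  define N where "N = real DIM('a)"
  have GL: "\<bar>G b x - G b y\<bar> \<le> (N * M) * norm (x - y)" if "x \<in> ball p s" "y \<in> ball p s" "b \<in> Basis" for b x y
  proof -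
    have "norm (G b x - G b y) \<le> (N * M) * norm (x - y)"
    proof (rule differentiable_bound[of "ball p s" "G b" "\<lambda>x h. h \<bullet> gradient (G b) x"])
      show "(G b has_derivative (\<lambda>h. h \<bullet> gradient (G b) x)) (at x within ball p s)" for x
        using gG by (auto simp: gderiv_def intro: has_derivative_at_withinI)
      show "onorm (\<lambda>h. h \<bullet> gradient (G b) x) \<le> N * M" if "x \<in> ball p s" for x
        unfolding N_def by (rule order_trans[OF onorm_inner_le norm_le_DIM_bound]) (rule bM[OF that \<open>b \<in> Basis\<close>])
    qed (use that in auto)
    then show ?thesis by simp
  qed
  have "norm (gradient f x - gradient f y) \<le> (N * (N * M)) * norm (x - y)" if "x \<in> ball p s" "y \<in> ball p s" for x y
  proof -
    have "norm (gradient f x - gradient f y) \<le> N * ((N * M) * norm (x - y))" unfolding N_def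
      by (rule norm_le_DIM_bound) (use GL[OF that] in \<open>auto simp: G_def inner_diff_right N_def\<close>)
    then show ?thesis by (simp add: mult.assoc)
  qed
  moreover have "N * (N * M) \<ge> 0" using M0 by (simp add: N_def)
  ultimately show "\<exists>r>0. \<exists>K\<ge>0. \<forall>x\<in>ball p r. \<forall>y\<in>ball p r. norm (gradient f x - gradient f y) \<le> K * norm (x - y)"
    using s(1) by blast
qed

text \<open>The ball is centred on the inner normal \<open>n = e - P G\<close> of the graph. By the
  quadratic remainder the graph lies below its tangent plane plus K |v|^2, and points of the ball
  satisfy |v|^2 < 2 R (\<open>v \<bullet> n\<close>) / |n|, so a radius with 2 K R < 1 keeps the
  ball above the graph. The claim is made for all small radii, so that a common radius can be taken
  afterwards.\<close>

lemma interior_ball_local: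
  fixes \<Omega> :: "'a::euclidean_space set"
  assumes op: "open \<Omega>" and C: "C_k_Hoelder_boundary 2 \<alpha> \<Omega>" and \<alpha>: "\<alpha> > 0" and x0: "x0 \<in> frontier \<Omega>"
  shows "\<exists>s>0. \<exists>R0>0. \<forall>R. 0 < R \<longrightarrow> R \<le> R0 \<longrightarrow> (\<forall>y\<in>frontier \<Omega> \<inter> ball x0 s. \<exists>z. dist z y = R \<and> ball z R \<subseteq> \<Omega>)"
proof -
  obtain r0 e \<gamma> where r0: "r0 > 0" and e: "norm e = 1" and \<gamma>: "C_k_Hoelder_on 2 \<alpha> UNIV \<gamma>"
    and eq: "\<Omega> \<inter> ball x0 r0 = {x \<in> ball x0 r0. \<gamma> (x - (x \<bullet> e) *\<^sub>R e) < x \<bullet> e}"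
    using C x0 unfolding C_k_Hoelder_boundary_def by blast
  define P where "P = (\<lambda>x. x - (x \<bullet> e) *\<^sub>R e)"
  have ee: "e \<bullet> e = 1" using e by (simp add: norm_eq_1)
  have Pdiff: "P x - P y = P (x - y)" for x y by (simp add: P_def inner_diff_left algebra_simps)
  have Pnorm: "norm (P x) \<le> norm x" for x
  proof -
    have "(norm (P x))\<^sup>2 = (norm x)\<^sup>2 - (x \<bullet> e)\<^sup>2"
      unfolding power2_norm_eq_inner P_def by (simp add: inner_diff_left inner_diff_right ee inner_commute power2_eq_square)
    then have "(norm (P x))\<^sup>2 \<le> (norm x)\<^sup>2" by simp
    then show ?thesis by (rule power2_le_imp_le) simp
  qed
  note g = C2_Hoelder_gradient_locally_lipschitz(1)[OF \<gamma> \<alpha>]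
  obtain \<rho> K where \<rho>: "\<rho> > 0" and K0: "K \<ge> 0"
    and K: "\<And>x y. x \<in> ball (P x0) \<rho> \<Longrightarrow> y \<in> ball (P x0) \<rho> \<Longrightarrow> norm (gradient \<gamma> x - gradient \<gamma> y) \<le> K * norm (x - y)"
    using C2_Hoelder_gradient_locally_lipschitz(2)[OF \<gamma> \<alpha>, of "P x0"] by blast
  have \<gamma>c: "continuous_on UNIV \<gamma>"
    using g unfolding gderiv_def by (auto intro!: continuous_at_imp_continuous_on has_derivative_continuous)
  have Pc: "continuous_on UNIV P" unfolding P_def by (intro continuous_intros)
  have PB: "P x \<in> ball (P x0) \<rho>" if "dist x0 x < \<rho>" for x
    using Pnorm[of "x0 - x"] that by (simp add: dist_norm Pdiff)
  define s where "s = min r0 \<rho> / 2"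
  \<comment> \<open>The first bound keeps the ball inside the neighbourhood where
    \<open>\<gamma>\<close> describes the domain; the second makes
    \<open>2 * K * R < 1\<close>.\<close>
  define R0 where "R0 = min (s / 2) (1 / (2 * (K + 1)))"
  have s: "s > 0" using r0 \<rho> by (simp add: s_def)
  have R0: "R0 > 0" using s K0 by (simp add: R0_def)
  have main: "\<exists>z. dist z y = R \<and> ball z R \<subseteq> \<Omega>" if R: "0 < R" "R \<le> R0" and y: "y \<in> frontier \<Omega>" "y \<in> ball x0 s" for R y
  proof -
    have yr: "y \<in> ball x0 r0" "dist x0 y < \<rho>" using y(2) r0 \<rho> by (auto simp: s_def min_def split: if_splits)
    \<comment> \<open>A boundary point lies on the graph: above it the point would belong to the
      open set \<open>\<Omega>\<close>, below it the point would have a neighbourhood free of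
      \<open>\<Omega>\<close>.\<close>
    have yg: "\<gamma> (P y) = y \<bullet> e"
    proof (rule antisym)
      show "y \<bullet> e \<le> \<gamma> (P y)"
      proof (rule ccontr)
        assume "\<not> ?thesis"
        then have "y \<in> {x \<in> ball x0 r0. \<gamma> (x - (x \<bullet> e) *\<^sub>R e) < x \<bullet> e}" using yr by (simp add: P_def)
        then have "y \<in> \<Omega>" unfolding eq[symmetric] by blast
        then show False using y(1) op by (simp add: frontier_def interior_open)
      qed
      show "\<gamma> (P y) \<le> y \<bullet> e"
      proof (rule ccontr)
        assume a: "\<not> ?thesis"
        have "open {x. x \<bullet> e < \<gamma> (P x)}"
          by (intro open_Collect_less continuous_intros continuous_on_compose2[OF \<gamma>c Pc]) auto
        then have op2: "open ({x. x \<bullet> e < \<gamma> (P x)} \<inter> ball x0 r0)" by (intro open_Int open_ball)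
        have "y \<in> {x. x \<bullet> e < \<gamma> (P x)} \<inter> ball x0 r0" using a yr by simp
        moreover have "y \<in> closure \<Omega>" using y(1) by (simp add: frontier_def)
        ultimately have "({x. x \<bullet> e < \<gamma> (P x)} \<inter> ball x0 r0) \<inter> closure \<Omega> \<noteq> {}" by blast
        then have "({x. x \<bullet> e < \<gamma> (P x)} \<inter> ball x0 r0) \<inter> \<Omega> \<noteq> {}"
          using open_Int_closure_eq_empty[OF op2, of \<Omega>] by blast
        then obtain x where x: "x \<in> \<Omega> \<inter> ball x0 r0" "x \<bullet> e < \<gamma> (P x)" by blast
        from x(1) have "\<gamma> (P x) < x \<bullet> e" unfolding eq P_def by simp
        then show False using x(2) by simp
      qed
    qed
    define G where "G = gradient \<gamma> (P y)"
    define n where "n = e - P G"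
    have ne: "n \<bullet> e = 1" by (simp add: n_def P_def inner_diff_left ee)
    have n1: "norm n \<ge> 1" using Cauchy_Schwarz_ineq2[of n e] ne e by simp
    have nL: "v \<bullet> n = v \<bullet> e - P v \<bullet> G" for v
      by (simp add: n_def P_def inner_diff_left inner_diff_right inner_commute)
    define z where "z = y + (R / norm n) *\<^sub>R n"
    have "n \<noteq> 0" using n1 by auto
    then have "dist z y = R" using R by (simp add: z_def dist_norm)
    moreover have "ball z R \<subseteq> \<Omega>"
    proof
      fix x assume "x \<in> ball z R"
      then have xz: "norm (x - z) < R" by (simp add: dist_norm norm_minus_commute)
      define v where "v = x - y"
      have v2: "(norm v)\<^sup>2 < 2 * R / norm n * (v \<bullet> n)"
      proof -
        have "x - z = v - (R / norm n) *\<^sub>R n" by (simp add: v_def z_def)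
        then have "(norm (x - z))\<^sup>2 = (norm v)\<^sup>2 - 2 * (R / norm n) * (v \<bullet> n) + (norm ((R / norm n) *\<^sub>R n))\<^sup>2"
          by (simp only: power2_norm_eq_inner) (simp add: inner_diff_left inner_diff_right inner_commute algebra_simps)
        also have "norm ((R / norm n) *\<^sub>R n) = R" using R \<open>n \<noteq> 0\<close> by simp
        finally have "(norm (x - z))\<^sup>2 = (norm v)\<^sup>2 - 2 * (R / norm n) * (v \<bullet> n) + R\<^sup>2" .
        moreover have "(norm (x - z))\<^sup>2 < R\<^sup>2" using xz by (intro power_strict_mono) auto
        ultimately show ?thesis by simp
      qed
      have vR: "norm v < 2 * R"
      proof -
        have "norm v \<le> norm (x - z) + norm (z - y)" using norm_triangle_ineq[of "x - z" "z - y"] by (simp add: v_def)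
        also have "norm (z - y) = R" using \<open>dist z y = R\<close> by (simp add: dist_norm)
        finally show ?thesis using xz by simp
      qed
      have "2 * R \<le> s" using R by (simp add: R0_def)
      have "dist x0 x \<le> dist x0 y + norm v" using dist_triangle[of x0 x y] by (simp add: v_def dist_norm norm_minus_commute)
      also have "\<dots> < s + s" using y(2) vR \<open>2 * R \<le> s\<close> by (intro add_strict_mono) auto
      also have "\<dots> = min r0 \<rho>" by (simp add: s_def)
      finally have xd: "dist x0 x < r0" "dist x0 x < \<rho>" by auto
      have Pxy: "P x = P y + P v" using Pdiff[of x y] by (simp add: v_def algebra_simps)
      have "\<bar>\<gamma> (P y + P v) - \<gamma> (P y) - P v \<bullet> gradient \<gamma> (P y)\<bar> \<le> K * (norm (P v))\<^sup>2"
      proof (rule GDERIV_quadratic_bound[OF g K0])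
        fix w assume "w \<in> closed_segment (P y) (P y + P v)"
        then have "w \<in> ball (P x0) \<rho>"
          using PB[OF xd(2)] PB[OF yr(2)] closed_segment_subset[of "P y" "ball (P x0) \<rho>" "P x"] by (auto simp: Pxy)
        then show "norm (gradient \<gamma> w - gradient \<gamma> (P y)) \<le> K * norm (w - P y)" using PB[OF yr(2)] by (rule K)
      qed
      also have "\<dots> \<le> K * (norm v)\<^sup>2" using Pnorm K0 by (intro mult_left_mono power_mono) auto
      finally have q: "\<gamma> (P x) \<le> y \<bullet> e + P v \<bullet> G + K * (norm v)\<^sup>2" unfolding Pxy yg G_def by linarith
      have "K * (norm v)\<^sup>2 < v \<bullet> n"
      proof -
        have vn: "0 < v \<bullet> n"
        proof -
          have "0 < 2 * R / norm n * (v \<bullet> n)" using v2 zero_le_power2[of "norm v"] by (rule order_le_less_trans[rotated])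
          then show ?thesis using R n1 by (simp add: zero_less_mult_iff zero_less_divide_iff)
        qed
        have "2 * R / norm n * (v \<bullet> n) \<le> 2 * R * (v \<bullet> n)"
          using divide_left_mono[of 1 "norm n" "2 * R"] R n1 vn \<open>n \<noteq> 0\<close> by (intro mult_right_mono) auto
        then have "(norm v)\<^sup>2 \<le> 2 * R * (v \<bullet> n)" using v2 by simp
        then have "K * (norm v)\<^sup>2 \<le> K * (2 * R * (v \<bullet> n))" using K0 by (rule mult_left_mono)
        also have "\<dots> = (2 * K * R) * (v \<bullet> n)" by simp
        also have "\<dots> < 1 * (v \<bullet> n)"
        proof (intro mult_strict_right_mono vn)
          have "R \<le> 1 / (2 * (K + 1))" using R by (simp add: R0_def)
          then have "2 * (K + 1) * R \<le> 1" using K0 by (simp add: field_simps)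
          moreover have "2 * K * R < 2 * (K + 1) * R" using R by (simp add: algebra_simps)
          ultimately show "2 * K * R < 1" by simp
        qed
        finally show ?thesis by simp
      qed
      then have "\<gamma> (P x) < y \<bullet> e + P v \<bullet> G + v \<bullet> n" using q by simp
      also have "\<dots> = x \<bullet> e" by (simp add: nL v_def inner_diff_left)
      finally have "\<gamma> (x - (x \<bullet> e) *\<^sub>R e) < x \<bullet> e" by (simp add: P_def)
      then have "x \<in> \<Omega> \<inter> ball x0 r0" unfolding eq using xd(1) by simp
      then show "x \<in> \<Omega>" by blast
    qed
    ultimately show ?thesis by blast
  qed
  show ?thesis using s R0 main by blast
qed

text \<open>The smallest radius of a finite subcover works at every boundary point, because the
  local statement covers all smaller radii.\<close>

theorem interior_ball:
  fixes \<Omega> :: "'a::euclidean_space set"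
  assumes \<Omega>: "bounded_domain \<Omega>" and C: "C_k_Hoelder_boundary 2 \<alpha> \<Omega>" and \<alpha>: "\<alpha> > 0"
  shows "\<exists>R>0. \<forall>y\<in>frontier \<Omega>. \<exists>z. dist z y = R \<and> ball z R \<subseteq> \<Omega>"
proof -
  have op: "open \<Omega>" and bd: "bounded \<Omega>" using \<Omega> by (auto simp: bounded_domain_def)
  have "compact (frontier \<Omega>)" using bd by (rule compact_frontier_bounded)
  have "\<forall>x\<in>frontier \<Omega>. \<exists>p. fst p > 0 \<and> snd p > 0 \<and> (\<forall>R. 0 < R \<longrightarrow> R \<le> snd p \<longrightarrow> (\<forall>y\<in>frontier \<Omega> \<inter> ball x (fst p). \<exists>z. dist z y = R \<and> ball z R \<subseteq> \<Omega>))"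
    using interior_ball_local[OF op C \<alpha>] by fastforce
  from bchoice[OF this] obtain p where p: "\<And>x. x \<in> frontier \<Omega> \<Longrightarrow> fst (p x) > (0::real)" "\<And>x. x \<in> frontier \<Omega> \<Longrightarrow> snd (p x) > (0::real)"
    "\<And>x R y. x \<in> frontier \<Omega> \<Longrightarrow> 0 < R \<Longrightarrow> R \<le> snd (p x) \<Longrightarrow> y \<in> frontier \<Omega> \<Longrightarrow> y \<in> ball x (fst (p x)) \<Longrightarrow> \<exists>z. dist z y = R \<and> ball z R \<subseteq> \<Omega>"
    by blast
  have "frontier \<Omega> \<subseteq> \<Union>((\<lambda>x. ball x (fst (p x))) ` frontier \<Omega>)" using p(1) by force
  then obtain D where D: "D \<subseteq> frontier \<Omega>" "finite D" "frontier \<Omega> \<subseteq> \<Union>((\<lambda>x. ball x (fst (p x))) ` D)"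
    using compactE_image[OF \<open>compact (frontier \<Omega>)\<close>, of "frontier \<Omega>" "\<lambda>x. ball x (fst (p x))"] by auto
  define R where "R = Min (insert 1 ((\<lambda>x. snd (p x)) ` D))"
  have "R > 0" unfolding R_def using D p(2) by (subst Min_gr_iff) auto
  moreover have "\<exists>z. dist z y = R \<and> ball z R \<subseteq> \<Omega>" if y: "y \<in> frontier \<Omega>" for y
  proof -
    obtain x where x: "x \<in> D" "y \<in> ball x (fst (p x))" using D(3) y by blast
    have "R \<le> snd (p x)" unfolding R_def using D(2) x(1) by (intro Min_le) auto
    then show ?thesis using p(3)[of x R y] D(1) x y \<open>R > 0\<close> by blast
  qed
  ultimately show ?thesis by blast
qed

section \<open>Weak compactness of probability measures\<close>

text \<open>A Borel injection into the line whose inverse is uniformly continuous on the image of a compact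
  set: it encodes membership in the sets of a countable base as base 4 digits.\<close>

definition basis_code :: "(nat \<Rightarrow> 'a set) \<Rightarrow> 'a \<Rightarrow> real" where
  "basis_code B x = (\<Sum>n. indicator (B n) x / 4 ^ n)"

lemma summable_indicator_quarter: "summable (\<lambda>n. indicator (B n) x / 4 ^ n :: real)"
proof (rule summable_comparison_test')
  show "summable (\<lambda>n. (1 / 4 :: real) ^ n)" by (rule summable_geometric) simp
  show "norm (indicator (B n) x / 4 ^ n :: real) \<le> (1 / 4) ^ n" if "n \<ge> 0" for n
    by (auto simp: indicator_def power_one_over)
qed

lemma basis_code_bounds: "0 \<le> basis_code B x" "basis_code B x \<le> 2"
proof -
  show "0 \<le> basis_code B x" unfolding basis_code_def
    by (intro suminf_nonneg summable_indicator_quarter) simp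
  have "basis_code B x \<le> (\<Sum>n. (1 / 4 :: real) ^ n)" unfolding basis_code_def
    by (intro suminf_le summable_indicator_quarter summable_geometric) (auto simp: indicator_def power_one_over)
  also have "\<dots> = 4 / 3" by (subst suminf_geometric) auto
  finally show "basis_code B x \<le> 2" by simp
qed

text \<open>At the first index \<open>k\<close> where the memberships differ, the digit contributes
  \<open>(1 / 4) ^ k\<close> and the tail at most a third of that. The codes then differ by at least
  two thirds of \<open>(1 / 4) ^ k\<close>, which exceeds the tolerance when
  \<open>k \<le> M\<close>.\<close>

lemma basis_code_close:
  assumes "\<bar>basis_code B x - basis_code B y\<bar> < (1 / 4) ^ M / 2" "n \<le> M"
  shows "x \<in> B n \<longleftrightarrow> y \<in> B n"
proof (rule ccontr)
  assume neq: "\<not> ?thesis"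
  define d where "d = (\<lambda>n. (indicator (B n) x - indicator (B n) y :: real))"
  define k where "k = (LEAST k. d k \<noteq> 0)"
  have dn: "d n \<noteq> 0" using neq by (auto simp: d_def indicator_def)
  have dk: "d k \<noteq> 0" unfolding k_def using dn by (rule LeastI)
  have kM: "k \<le> M" using Least_le[of "\<lambda>k. d k \<noteq> 0", OF dn] assms(2) by (simp add: k_def)
  have d0: "d i = 0" if "i < k" for i using not_less_Least[of i "\<lambda>k. d k \<noteq> 0"] that by (auto simp: k_def)
  have d1: "\<bar>d i\<bar> \<le> 1" for i by (auto simp: d_def indicator_def)
  have dk1: "\<bar>d k\<bar> = 1" using dk by (auto simp: d_def indicator_def)
  have sm: "summable (\<lambda>n. d n / 4 ^ n)"
    using summable_diff[OF summable_indicator_quarter[of B x] summable_indicator_quarter[of B y]]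
    by (simp add: d_def diff_divide_distrib)
  have "basis_code B x - basis_code B y = (\<Sum>n. d n / 4 ^ n)"
    unfolding basis_code_def d_def
    by (subst suminf_diff[OF summable_indicator_quarter summable_indicator_quarter]) (simp add: diff_divide_distrib)
  also have "\<dots> = (\<Sum>n. d (n + Suc k) / 4 ^ (n + Suc k)) + (\<Sum>i<Suc k. d i / 4 ^ i)"
    by (rule suminf_split_initial_segment[OF sm])
  also have "(\<Sum>i<Suc k. d i / 4 ^ i) = d k / 4 ^ k" using d0 by simp
  finally have eq: "basis_code B x - basis_code B y = (\<Sum>n. d (n + Suc k) / 4 ^ (n + Suc k)) + d k / 4 ^ k" .
  have gs: "summable (\<lambda>n. (1 / 4) ^ Suc k * (1 / 4 :: real) ^ n)" by (intro summable_mult summable_geometric) simp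
  have "norm (\<Sum>n. d (n + Suc k) / 4 ^ (n + Suc k)) \<le> (\<Sum>n. (1 / 4) ^ Suc k * (1 / 4 :: real) ^ n)"
  proof (rule norm_suminf_le[OF _ gs])
    fix n
    have "norm (d (n + Suc k) / 4 ^ (n + Suc k)) \<le> 1 / 4 ^ (n + Suc k)" using d1 by (simp add: divide_right_mono)
    also have "\<dots> = (1 / 4) ^ Suc k * (1 / 4 :: real) ^ n" by (simp add: power_one_over power_add)
    finally show "norm (d (n + Suc k) / 4 ^ (n + Suc k)) \<le> (1 / 4) ^ Suc k * (1 / 4 :: real) ^ n" .
  qed
  also have "\<dots> = (1 / 4) ^ Suc k * (\<Sum>n. (1 / 4 :: real) ^ n)" by (intro suminf_mult summable_geometric) simp
  also have "(\<Sum>n. (1 / 4 :: real) ^ n) = 4 / 3" by (subst suminf_geometric) auto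
  finally have tail: "\<bar>\<Sum>n. d (n + Suc k) / 4 ^ (n + Suc k)\<bar> \<le> (1 / 4) ^ k / 3" by simp
  have "\<bar>d k / 4 ^ k\<bar> = (1 / 4) ^ k" using dk1 by (simp add: power_one_over)
  then have "(1 / 4) ^ k * (2 / 3) \<le> \<bar>basis_code B x - basis_code B y\<bar>" unfolding eq using tail by linarith
  moreover have "(1 / 4) ^ M \<le> (1 / 4 :: real) ^ k" using kM by (intro power_decreasing) auto
  moreover have "(0::real) < (1 / 4) ^ k" by simp
  ultimately show False using assms(1) by linarith
qed

text \<open>Finitely many basis sets, each inside a ball of radius \<open>e / 2\<close>, cover
  \<open>K\<close>; points with sufficiently close codes belong to the same ones.\<close>

lemma basis_code_inverse_uniform:
  fixes K :: "'a::metric_space set"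
  assumes K: "compact K" and B: "topological_basis (range B)" and e: "e > 0"
  shows "\<exists>\<delta>>0. \<forall>x\<in>K. \<forall>y. \<bar>basis_code B x - basis_code B y\<bar> < \<delta> \<longrightarrow> dist x y < e"
proof -
  have "\<exists>n. x \<in> B n \<and> B n \<subseteq> ball x (e / 2)" for x
    using topological_basisE[OF B open_ball, of x x "e / 2"] e by (metis centre_in_ball half_gt_zero rangeE)
  then have "\<forall>x. \<exists>n. x \<in> B n \<and> B n \<subseteq> ball x (e / 2)" by blast
  from choice[OF this] obtain n where n: "\<And>x. x \<in> B (n x)" "\<And>x. B (n x) \<subseteq> ball x (e / 2)" by blast
  have "open (B k)" for k using topological_basis_open[OF B] by blast
  then obtain D where D: "D \<subseteq> K" "finite D" "K \<subseteq> (\<Union>c\<in>D. B (n c))"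
  proof (rule compactE_image[OF K, of K "\<lambda>x. B (n x)"])
    show "K \<subseteq> (\<Union>c\<in>K. B (n c))" using n(1) by auto
  qed auto
  obtain M where M: "\<And>c. c \<in> D \<Longrightarrow> n c \<le> M"
    using finite_nat_set_iff_bounded_le[of "n ` D"] D(2) by auto
  have "dist x y < e" if x: "x \<in> K" and c: "\<bar>basis_code B x - basis_code B y\<bar> < (1 / 4) ^ M / 2" for x y
  proof -
    obtain c where c': "c \<in> D" "x \<in> B (n c)" using x D(3) by blast
    then have "y \<in> B (n c)" using basis_code_close[OF c M] by blast
    then have "dist c x < e / 2" "dist c y < e / 2" using c' n(2)[of c] by auto
    then show ?thesis using dist_triangle[of x y c] dist_commute[of x c] by linarith
  qed
  moreover have "(1 / 4) ^ M / 2 > (0::real)" by simp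
  ultimately show ?thesis by blast
qed

lemma basis_code_borel:
  fixes B :: "nat \<Rightarrow> 'a::topological_space set"
  assumes "topological_basis (range B)"
  shows "basis_code B \<in> borel_measurable borel"
proof -
  have "B n \<in> sets borel" for n using topological_basis_open[OF assms, of "B n"] by auto
  then show ?thesis unfolding basis_code_def by measurable
qed

text \<open>On the image of \<open>K\<close> the code has a uniformly continuous inverse. It extends
  to the closure, still with values in \<open>K\<close>, and from there to the whole line by
  Tietze's theorem.\<close>

lemma basis_code_left_inverse:
  fixes K :: "'a::euclidean_space set"
  assumes K: "compact K" and B: "topological_basis (range B)"
  obtains G :: "real \<Rightarrow> 'a" where "continuous_on UNIV G" "\<And>x. x \<in> K \<Longrightarrow> G (basis_code B x) = x"
    "G ` closure (basis_code B ` K) \<subseteq> K"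
proof -
  let ?s = "basis_code B"
  have inj: "x = y" if xy: "x \<in> K" "?s x = ?s y" for x y
  proof (rule ccontr)
    assume "x \<noteq> y"
    then have "dist x y > 0" by simp
    then obtain \<delta> where "\<delta> > 0" "\<forall>y'. \<bar>?s x - ?s y'\<bar> < \<delta> \<longrightarrow> dist x y' < dist x y"
      using basis_code_inverse_uniform[OF K B, of "dist x y"] xy(1) by meson
    then show False using xy(2) by force
  qed
  define F where "F = the_inv_into K ?s"
  have F: "F (?s x) = x" if "x \<in> K" for x
    unfolding F_def using that inj by (intro the_inv_into_f_f) (auto simp: inj_on_def)
  have "uniformly_continuous_on (?s ` K) F"
    unfolding uniformly_continuous_on_def
  proof (intro allI impI)
    fix e :: real assume "e > 0"
    then obtain \<delta> where "\<delta> > 0" "\<forall>x\<in>K. \<forall>y. \<bar>?s x - ?s y\<bar> < \<delta> \<longrightarrow> dist x y < e"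
      using basis_code_inverse_uniform[OF K B, of e] by meson
    then show "\<exists>d>0. \<forall>x\<in>?s ` K. \<forall>x'\<in>?s ` K. dist x' x < d \<longrightarrow> dist (F x') (F x) < e"
      using F by (intro exI[of _ \<delta>]) (auto simp: dist_real_def)
  qed
  then obtain G0 where G0: "uniformly_continuous_on (closure (?s ` K)) G0" "\<And>x. x \<in> ?s ` K \<Longrightarrow> F x = G0 x"
    by (rule uniformly_continuous_on_extension_on_closure) blast
  have c0: "continuous_on (closure (?s ` K)) G0" by (rule uniformly_continuous_imp_continuous[OF G0(1)])
  have img: "G0 ` closure (?s ` K) \<subseteq> K"
    by (rule image_closure_subset[OF c0 compact_imp_closed[OF K]]) (use F G0(2) in force)
  obtain b where b: "\<And>x. x \<in> K \<Longrightarrow> norm x \<le> b" "b > 0" using compact_imp_bounded[OF K] bounded_pos by blast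
  have bd: "\<And>x. x \<in> closure (?s ` K) \<Longrightarrow> norm (G0 x) \<le> b" using img b(1) by auto
  obtain G where G: "continuous_on UNIV G" "\<And>x. x \<in> closure (?s ` K) \<Longrightarrow> G x = G0 x"
    by (rule Tietze[OF c0, of UNIV b]) (use b(2) bd in \<open>auto simp: less_imp_le\<close>)
  show ?thesis
  proof (rule that[OF G(1)])
    show "G (?s x) = x" if x: "x \<in> K" for x
    proof -
      have "?s x \<in> ?s ` K" using x by (rule imageI)
      moreover from this have "?s x \<in> closure (?s ` K)" using closure_subset by (rule rev_subsetD)
      ultimately show ?thesis using G(2)[of "?s x"] G0(2)[of "?s x"] F[OF x] by simp
    qed
    show "G ` closure (?s ` K) \<subseteq> K" using G(2) img by force
  qed
qed

lemma prob_measures_onD: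
  assumes "\<rho> \<in> prob_measures_on S" and S: "S \<in> sets borel"
  shows "prob_space \<rho>" "sets \<rho> = sets borel" "AE x in \<rho>. x \<in> S"
proof -
  show s: "sets \<rho> = sets borel" using assms by (simp add: prob_measures_on_def)
  have sp: "space \<rho> = UNIV" using sets_eq_imp_space_eq[OF s] by simp
  have "emeasure \<rho> UNIV = emeasure \<rho> S + emeasure \<rho> (- S)"
    using S s plus_emeasure[of S \<rho> "- S"] by simp
  then show "prob_space \<rho>" using assms sp by (intro prob_spaceI) (simp add: prob_measures_on_def)
  have "- S \<in> null_sets \<rho>" using assms s S by (auto simp: prob_measures_on_def null_sets_def)
  then have "AE x in \<rho>. x \<notin> - S" by (rule AE_not_in)
  then show "AE x in \<rho>. x \<in> S" by simp
qed

lemma prob_measures_onI: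
  assumes "prob_space \<rho>" "sets \<rho> = sets borel" "AE x in \<rho>. x \<in> S" and S: "S \<in> sets borel"
  shows "\<rho> \<in> prob_measures_on S"
proof -
  interpret prob_space \<rho> by fact
  have sp: "space \<rho> = UNIV" using sets_eq_imp_space_eq[OF assms(2)] by simp
  have "emeasure \<rho> S = 1" using assms(3) S assms(2) by (intro emeasure_eq_1_AE) auto
  moreover have "emeasure \<rho> (- S) = 0"
    using AE_iff_measurable[of "- S" \<rho> "\<lambda>x. x \<in> S"] assms(3) S assms(2) sp by auto
  ultimately show ?thesis using assms(2) by (simp add: prob_measures_on_def)
qed

text \<open>Helly selection on the line, carried over by the code. The images of the measures live
  in a bounded interval, so a subsequence converges weakly. Although the code is merely Borel, its
  left inverse \<open>G\<close> is continuous: a bounded continuous \<open>f\<close> becomes the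
  test function \<open>f \<circ> G\<close> on the line, and the limit is transported back by
  \<open>G\<close>.\<close>

theorem prob_measures_on_weakly_compact:
  fixes K :: "'a::euclidean_space set"
  assumes K: "compact K" "K \<noteq> {}" and \<rho>: "\<And>n. \<rho> n \<in> prob_measures_on K"
  shows "\<exists>r \<nu>. strict_mono (r :: nat \<Rightarrow> nat) \<and> \<nu> \<in> prob_measures_on K \<and>
    (\<forall>f. continuous_on UNIV f \<longrightarrow> (\<exists>b. \<forall>x. \<bar>f x\<bar> \<le> b) \<longrightarrow> (\<lambda>n. \<integral>x. f x \<partial>\<rho> (r n)) \<longlonglongrightarrow> (\<integral>x. (f x :: real) \<partial>\<nu>))"
proof -
  have Kb: "K \<in> sets borel" using K(1) by (simp add: compact_imp_closed)
  note P = prob_measures_onD[OF \<rho> Kb]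
  obtain \<B> :: "'a set set" where \<B>: "countable \<B>" "topological_basis \<B>" using ex_countable_basis by blast
  have "\<B> \<noteq> {}" using topological_basisE[OF \<B>(2) open_UNIV UNIV_I] by blast
  define B where "B = from_nat_into \<B>"
  have B: "topological_basis (range B)" using \<B> \<open>\<B> \<noteq> {}\<close> by (simp add: B_def range_from_nat_into)
  let ?s = "basis_code B"
  have sm: "?s \<in> borel_measurable borel" by (rule basis_code_borel[OF B])
  obtain G :: "real \<Rightarrow> 'a" where G: "continuous_on UNIV G" "\<And>x. x \<in> K \<Longrightarrow> G (?s x) = x" "G ` closure (?s ` K) \<subseteq> K"
    by (rule basis_code_left_inverse[OF K(1) B]) blast
  define \<mu> where "\<mu> = (\<lambda>n. distr (\<rho> n) borel ?s)"
  have smr: "?s \<in> borel_measurable (\<rho> n)" for n using sm P(2)[of n] by (simp cong: measurable_cong_sets)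
  have rd: "real_distribution (\<mu> n)" for n
    unfolding \<mu>_def by (rule prob_space.real_distribution_distr[OF P(1) smr])
  have "tight \<mu>"
    unfolding tight_def
  proof (intro conjI allI impI)
    show "real_distribution (\<mu> n)" for n by (rule rd)
    fix e :: real assume "e > 0"
    have "measure (\<mu> n) {-1<..3} = 1" for n
    proof -
      interpret prob_space "\<rho> n" by (rule P(1))
      have "-1 < ?s x" "?s x \<le> 3" for x using basis_code_bounds[of B x] by auto
      then have "?s -` {-1<..3} = UNIV" by auto
      moreover have "measure (\<mu> n) {-1<..3} = measure (\<rho> n) (?s -` {-1<..3} \<inter> space (\<rho> n))"
        unfolding \<mu>_def by (intro measure_distr smr) simp
      ultimately show ?thesis by (simp add: prob_space)
    qed
    then show "\<exists>a b. a < b \<and> (\<forall>n. 1 - e < measure (\<mu> n) {a<..b})"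
      using \<open>e > 0\<close> by (intro exI[of _ "-1"] exI[of _ 3]) simp
  qed
  then obtain r M where r: "strict_mono (r :: nat \<Rightarrow> nat)" and M: "real_distribution M" "weak_conv_m (\<mu> \<circ> r) M"
    using tight_imp_convergent_subsubsequence[of \<mu> id] by (auto simp: strict_mono_id)
  interpret M: real_distribution M by fact
  have conv: "(\<lambda>n. \<integral>x. g (?s x) \<partial>\<rho> (r n)) \<longlonglongrightarrow> (\<integral>t. g t \<partial>M)"
    if g: "continuous_on UNIV g" "\<And>t. \<bar>g t\<bar> \<le> b" for g :: "real \<Rightarrow> real" and b
  proof -
    have gm: "g \<in> borel_measurable borel" using g(1) by (rule borel_measurable_continuous_onI)
    have "(\<lambda>n. \<integral>t. g t \<partial>(\<mu> \<circ> r) n) \<longlonglongrightarrow> (\<integral>t. g t \<partial>M)"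
      by (rule weak_conv_imp_integral_bdd_continuous_conv[OF _ M(1,2), of g b])
        (use rd g in \<open>auto simp: continuous_on_eq_continuous_at\<close>)
    moreover have "(\<integral>t. g t \<partial>(\<mu> \<circ> r) n) = (\<integral>x. g (?s x) \<partial>\<rho> (r n))" for n
      unfolding \<mu>_def comp_def by (rule integral_distr[OF smr gm])
    ultimately show ?thesis by simp
  qed
  let ?T = "closure (?s ` K)"
  have T: "closed ?T" "?T \<noteq> {}" using K(2) by auto
  have "AE t in M. t \<in> ?T"
  proof -
    \<comment> \<open>A bounded continuous function that vanishes exactly on the closed set
      \<open>?T\<close>. Weak convergence gives it integral 0 against \<open>M\<close>, so
      \<open>M\<close> lives on \<open>?T\<close>, which \<open>G\<close> maps into
      \<open>K\<close>.\<close>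
    define g where "g = (\<lambda>t. min 1 (infdist t ?T))"
    have gc: "continuous_on UNIV g" unfolding g_def by (intro continuous_intros)
    have gm: "g \<in> borel_measurable M" using borel_measurable_continuous_onI[OF gc] by simp
    have gb: "\<bar>g t\<bar> \<le> 1" for t using infdist_nonneg[of t ?T] by (simp add: g_def)
    have g0: "0 \<le> g t" for t by (simp add: g_def infdist_nonneg)
    have gi: "integrable M g" using gb gm by (intro M.integrable_const_bound[where B=1]) auto
    have "(\<integral>x. g (?s x) \<partial>\<rho> (r n)) = 0" for n
    proof (rule integral_eq_zero_AE)
      show "AE x in \<rho> (r n). g (?s x) = 0" using P(3)[of "r n"]
      proof eventually_elim
        case (elim x)
        then have "?s x \<in> ?T" using closure_subset[of "?s ` K"] by blast
        then show ?case by (simp add: g_def)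
      qed
    qed
    then have "(\<integral>t. g t \<partial>M) = 0" using conv[OF gc gb] by (simp add: LIMSEQ_const_iff)
    then have "AE t in M. g t = 0" using integral_nonneg_eq_0_iff_AE[OF gi] g0 by simp
    then show ?thesis
    proof eventually_elim
      case (elim t)
      then have "infdist t ?T = 0" by (simp add: g_def min_def split: if_splits)
      then show ?case using in_closed_iff_infdist_zero[OF T] by simp
    qed
  qed
  have Gm: "G \<in> M \<rightarrow>\<^sub>M borel" using borel_measurable_continuous_onI[OF G(1)] by simp
  define \<nu> where "\<nu> = distr M borel G"
  have "\<nu> \<in> prob_measures_on K"
  proof (rule prob_measures_onI[OF _ _ _ Kb])
    show "prob_space \<nu>" unfolding \<nu>_def by (rule M.prob_space_distr[OF Gm])
    show "sets \<nu> = sets borel" by (simp add: \<nu>_def)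
    have "AE t in M. G t \<in> K" using \<open>AE t in M. t \<in> ?T\<close> by eventually_elim (use G(3) in blast)
    then show "AE x in \<nu>. x \<in> K" unfolding \<nu>_def using Gm Kb by (subst AE_distr_iff) auto
  qed
  moreover have "(\<lambda>n. \<integral>x. f x \<partial>\<rho> (r n)) \<longlonglongrightarrow> (\<integral>x. f x \<partial>\<nu>)"
    if f: "continuous_on UNIV f" "\<And>x. \<bar>f x\<bar> \<le> b" for f :: "'a \<Rightarrow> real" and b
  proof -
    have fm: "f \<in> borel_measurable borel" using f(1) by (rule borel_measurable_continuous_onI)
    have "(\<lambda>n. \<integral>x. f (G (?s x)) \<partial>\<rho> (r n)) \<longlonglongrightarrow> (\<integral>t. f (G t) \<partial>M)"
      by (rule conv) (use f continuous_on_compose2[OF f(1) G(1)] in auto)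
    moreover have "(\<integral>x. f (G (?s x)) \<partial>\<rho> (r n)) = (\<integral>x. f x \<partial>\<rho> (r n))" for n
    proof (rule integral_cong_AE)
      show "AE x in \<rho> (r n). f (G (?s x)) = f x" using P(3)[of "r n"] by eventually_elim (simp add: G(2))
      show "(\<lambda>x. f x) \<in> borel_measurable (\<rho> (r n))" using fm P(2)[of "r n"] by (simp cong: measurable_cong_sets)
      show "(\<lambda>x. f (G (?s x))) \<in> borel_measurable (\<rho> (r n))"
        using smr Gm fm by measurable
    qed
    moreover have "(\<integral>t. f (G t) \<partial>M) = (\<integral>x. f x \<partial>\<nu>)" unfolding \<nu>_def by (rule integral_distr[OF Gm fm, symmetric])
    ultimately show ?thesis by simp
  qed
  ultimately show ?thesis using r by blast
qed

section \<open>Comparison of potentials\<close>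

lemma lipschitz_max_min:
  fixes u v :: "'a::metric_space \<Rightarrow> real"
  assumes "L-lipschitz_on UNIV u" "L-lipschitz_on UNIV v"
  shows "L-lipschitz_on UNIV (\<lambda>x. max (u x) (v x))" "L-lipschitz_on UNIV (\<lambda>x. min (u x) (v x))"
proof -
  have *: "\<bar>u x - u y\<bar> \<le> L * dist x y" "\<bar>v x - v y\<bar> \<le> L * dist x y" for x y
    using assms by (auto simp: lipschitz_on_def dist_real_def)
  have "\<bar>max (u x) (v x) - max (u y) (v y)\<bar> \<le> L * dist x y" "\<bar>min (u x) (v x) - min (u y) (v y)\<bar> \<le> L * dist x y" for x y
    using *[of x y] unfolding max_def min_def abs_le_iff by (auto split: if_splits)
  then show "L-lipschitz_on UNIV (\<lambda>x. max (u x) (v x))" "L-lipschitz_on UNIV (\<lambda>x. min (u x) (v x))"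
    using lipschitz_on_nonneg[OF assms(1)] by (auto intro!: lipschitz_onI simp: dist_real_def)
qed

text \<open>Where one function touches another from below and both are differentiable, their
  gradients agree. Hence on the contact set all four gradients coincide almost everywhere, and the
  two cases of the statement are compatible.\<close>

lemma AE_gradient_max_min:
  fixes u v :: "'a::euclidean_space \<Rightarrow> real"
  assumes u: "L-lipschitz_on UNIV u" and v: "L-lipschitz_on UNIV v"
  shows "AE x in lborel.
    (v x \<le> u x \<longrightarrow> gradient (\<lambda>x. max (u x) (v x)) x = gradient u x \<and> gradient (\<lambda>x. min (u x) (v x)) x = gradient v x) \<and>
    (u x \<le> v x \<longrightarrow> gradient (\<lambda>x. max (u x) (v x)) x = gradient v x \<and> gradient (\<lambda>x. min (u x) (v x)) x = gradient u x)"
  using AE_GDERIV[OF u] AE_GDERIV[OF v] AE_GDERIV[OF lipschitz_max_min(1)[OF u v]] AE_GDERIV[OF lipschitz_max_min(2)[OF u v]]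
proof eventually_elim
  case (elim x)
  have touch: "gradient g x = gradient f x"
    if "GDERIV f x :> gradient f x" "GDERIV g x :> gradient g x" "f x = g x" "\<And>y. f y \<le> g y" for f g :: "'a \<Rightarrow> real"
    using gradient_zero_at_min[OF GDERIV_diff[OF that(2,1)]] that(3,4) by simp
  have "gradient (\<lambda>x. max (u x) (v x)) x = gradient u x" "gradient v x = gradient (\<lambda>x. min (u x) (v x)) x" if "v x \<le> u x"
    using that elim by (intro touch; simp)+
  moreover have "gradient (\<lambda>x. max (u x) (v x)) x = gradient v x" "gradient u x = gradient (\<lambda>x. min (u x) (v x)) x" if "u x \<le> v x"
    using that elim by (intro touch; simp)+
  ultimately show ?case by simp
qed

lemma bi_mono: "norm a \<le> norm b \<Longrightarrow> bi a \<le> bi b"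
  by (simp add: bi_def power_mono)

lemma bi_energy_mono:
  assumes "u \<in> energy_space" "w \<in> energy_space" "AE x in lborel. norm (gradient w x) \<le> norm (gradient u x)"
  shows "bi_energy w \<le> bi_energy u"
  unfolding bi_energy_def
  by (intro integral_mono_AE bi_integrable assms) (use assms(3) bi_mono in \<open>auto elim!: eventually_mono\<close>)

text \<open>Outside the ball the integrands are unchanged; inside, the gradient is at most 1 and the
  values are bounded, which adds a finite amount.\<close>

lemma compact_perturbation_energy_space:
  fixes u w :: "'a::euclidean_space \<Rightarrow> real"
  assumes dim: "DIM('a) \<ge> 3" and u: "u \<in> energy_space" and w: "1-lipschitz_on UNIV w"
    and eq: "\<And>x. R < norm x \<Longrightarrow> w x = u x"
  shows "w \<in> energy_space"
proof -
  let ?q = "sobolev_exponent TYPE('a)"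
  have q: "?q > 0" using sobolev_exponent_pos[OF dim] .
  have wc: "continuous_on UNIV w" using w lipschitz_on_continuous_on by blast
  have wm: "w \<in> borel_measurable borel" "gradient w \<in> borel_measurable borel"
    using borel_measurable_continuous_onI[OF wc] lipschitz_gradient_borel[OF w] by auto
  obtain B where "\<forall>y\<in>w ` cball 0 R. norm y \<le> B"
    using compact_imp_bounded[OF compact_continuous_image[OF continuous_on_subset[OF wc] compact_cball], of 0 R]
    unfolding bounded_iff by blast
  then have B: "\<bar>w x\<bar> \<le> B" if "x \<in> cball 0 R" for x using that by auto
  have ind: "integrable lborel (\<lambda>x. c * indicator (cball (0::'a) R) x :: real)" for c
    by (intro integrable_mult_right integrable_real_indicator) (use emeasure_bounded_finite[OF bounded_cball, of "0::'a" R] in \<open>auto simp: infinity_ennreal_def\<close>)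
  have "integrable lborel (\<lambda>x. (norm (gradient w x))\<^sup>2)"
  proof (rule Bochner_Integration.integrable_bound)
    show "integrable lborel (\<lambda>x. (norm (gradient u x))\<^sup>2 + 1 * indicator (cball 0 R) x)"
      by (intro Bochner_Integration.integrable_add energy_spaceD(2)[OF u] ind)
    show "(\<lambda>x. (norm (gradient w x))\<^sup>2) \<in> borel_measurable lborel" using wm by measurable
    show "AE x in lborel. norm ((norm (gradient w x))\<^sup>2) \<le> norm ((norm (gradient u x))\<^sup>2 + 1 * indicator (cball 0 R) x :: real)"
      using AE_GDERIV[OF energy_spaceD(1)[OF u]] AE_GDERIV[OF w]
    proof eventually_elim
      case (elim x)
      show ?case
      proof (cases "norm x \<le> R")
        case True
        have "(norm (gradient w x))\<^sup>2 \<le> 1\<^sup>2" using norm_gradient_le[OF w elim(2)] by (intro power_mono) auto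
        then show ?thesis using True by (simp add: add_increasing)
      next
        case False
        have "GDERIV w x :> gradient u x"
          by (rule gradient_eq_if_open[of "- cball 0 R", OF _ _ _ elim(1)]) (use False eq in \<open>auto simp: open_Compl\<close>)
        then show ?thesis by (simp add: gradient_eq)
      qed
    qed
  qed
  moreover have "integrable lborel (\<lambda>x. \<bar>w x\<bar> powr ?q)"
  proof (rule Bochner_Integration.integrable_bound)
    show "integrable lborel (\<lambda>x. \<bar>u x\<bar> powr ?q + B powr ?q * indicator (cball 0 R) x)"
      by (intro Bochner_Integration.integrable_add energy_spaceD(3)[OF u] ind)
    show "(\<lambda>x. \<bar>w x\<bar> powr ?q) \<in> borel_measurable lborel" using wm by measurable
    have "\<bar>w x\<bar> powr ?q \<le> \<bar>u x\<bar> powr ?q + B powr ?q * indicator (cball 0 R) x" for x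
    proof (cases "norm x \<le> R")
      case True
      then have "\<bar>w x\<bar> powr ?q \<le> B powr ?q" using q B[of x] by (intro powr_mono2) auto
      then show ?thesis using True by (simp add: add_increasing)
    qed (use eq in auto)
    then show "AE x in lborel. norm (\<bar>w x\<bar> powr ?q) \<le> norm (\<bar>u x\<bar> powr ?q + B powr ?q * indicator (cball 0 R) x)"
      by (intro AE_I2) (simp add: abs_of_nonneg)
  qed
  ultimately show ?thesis using w by (simp add: energy_space_def)
qed

section \<open>Translations, truncations and families of measures\<close>

lemma lipschitz_shift:
  fixes u :: "'a::real_normed_vector \<Rightarrow> real"
  assumes "L-lipschitz_on UNIV u" shows "L-lipschitz_on UNIV (\<lambda>x. u (x + h) + c)"
  using assms by (auto simp: lipschitz_on_def dist_real_def dist_norm) (metis add_diff_cancel_right)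

text \<open>The identity also covers points without derivative, because the predicates behind the
  two definite descriptions coincide.\<close>

lemma gradient_shift:
  fixes u :: "'a::euclidean_space \<Rightarrow> real"
  shows "gradient (\<lambda>x. u (x + h) + c) x = gradient u (x + h)"
proof -
  have "GDERIV (\<lambda>x. u (x + h) + c) x :> D \<longleftrightarrow> GDERIV u (x + h) :> D" for D
  proof
    assume "GDERIV u (x + h) :> D"
    then have "(u has_derivative (\<lambda>v. v \<bullet> D)) (at (x + h))" by (simp add: gderiv_def)
    moreover have "((\<lambda>x. x + h) has_derivative (\<lambda>v. v)) (at x)" by (auto intro!: derivative_eq_intros)
    ultimately have "((\<lambda>x. u (x + h)) has_derivative (\<lambda>v. v \<bullet> D)) (at x)" by (rule has_derivative_compose[rotated])
    then show "GDERIV (\<lambda>x. u (x + h) + c) x :> D" unfolding gderiv_def by (auto intro!: derivative_eq_intros)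
  next
    assume "GDERIV (\<lambda>x. u (x + h) + c) x :> D"
    then have "((\<lambda>x. u (x + h) + c) has_derivative (\<lambda>v. v \<bullet> D)) (at ((x + h) - h))" by (simp add: gderiv_def)
    moreover have "((\<lambda>x. x - h) has_derivative (\<lambda>v. v)) (at (x + h))" by (auto intro!: derivative_eq_intros)
    ultimately have "((\<lambda>x. u (x - h + h) + c) has_derivative (\<lambda>v. v \<bullet> D)) (at (x + h))" by (rule has_derivative_compose[rotated])
    then have "((\<lambda>x. u x + c) has_derivative (\<lambda>v. v \<bullet> D)) (at (x + h))" by simp
    from has_derivative_diff[OF this has_derivative_const[of c]]
    show "GDERIV u (x + h) :> D" unfolding gderiv_def by simp
  qed
  then show ?thesis by (simp add: gradient_def)
qed

lemma bi_energy_shift: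
  fixes u :: "'a::euclidean_space \<Rightarrow> real"
  assumes "L-lipschitz_on UNIV u"
  shows "bi_energy (\<lambda>x. u (x + h) + c) = bi_energy u"
  unfolding bi_energy_def gradient_shift
  by (rule integral_lborel_shift) (use lipschitz_gradient_borel[OF assms] in measurable)

lemma energy_space_shift:
  fixes u :: "'a::euclidean_space \<Rightarrow> real"
  assumes "u \<in> energy_space"
  shows "(\<lambda>x. u (x + h)) \<in> energy_space"
proof -
  note D = energy_spaceD[OF assms]
  have "gradient (\<lambda>x. u (x + h)) x = gradient u (x + h)" for x using gradient_shift[of u h 0 x] by simp
  then show ?thesis
    using lipschitz_shift[OF D(1), of h 0] integrable_lborel_shift[OF D(2), of h] integrable_lborel_shift[OF D(3), of h]
    by (simp add: energy_space_def)
qed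

text \<open>Where truncation acts, it replaces the gradient by 0. The condition
  \<open>c \<ge> 0\<close> ensures that the truncated values are no larger in modulus, which keeps
  them integrable.\<close>

lemma truncation:
  fixes u :: "'a::euclidean_space \<Rightarrow> real"
  assumes dim: "DIM('a) \<ge> 3" and u: "u \<in> energy_space"
  shows "(\<lambda>x. max (u x) 0) \<in> energy_space" "bi_energy (\<lambda>x. max (u x) 0) \<le> bi_energy u"
    and "c \<ge> 0 \<Longrightarrow> (\<lambda>x. min (u x) c) \<in> energy_space" "c \<ge> 0 \<Longrightarrow> bi_energy (\<lambda>x. min (u x) c) \<le> bi_energy u"
proof -
  note L = energy_spaceD(1)[OF u]
  have C: "1-lipschitz_on UNIV (\<lambda>x::'a. c)" for c by (intro lipschitz_onI) auto
  have z: "gradient (\<lambda>x::'a. c) x = 0" for c x by (rule gradient_eq[OF GDERIV_const_zero])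
  have "AE x in lborel. norm (gradient (\<lambda>x. max (u x) c) x) \<le> norm (gradient u x)
      \<and> norm (gradient (\<lambda>x. min (u x) c) x) \<le> norm (gradient u x)" for c
    using AE_gradient_max_min[OF L C[of c]]
  proof eventually_elim
    case (elim x)
    then show ?case using linear[of "u x" c] by (auto simp: z)
  qed
  then have g: "AE x in lborel. norm (gradient (\<lambda>x. max (u x) c) x) \<le> norm (gradient u x)"
      "AE x in lborel. norm (gradient (\<lambda>x. min (u x) c) x) \<le> norm (gradient u x)" for c
    by (auto elim!: eventually_mono)
  have X: "w \<in> energy_space" if "1-lipschitz_on UNIV w" "AE x in lborel. norm (gradient w x) \<le> norm (gradient u x)" "\<And>x. \<bar>w x\<bar> \<le> \<bar>u x\<bar>" for w
  proof (rule energy_spaceI[OF dim u u that(1), of 1])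
    show "AE x in lborel. norm (gradient w x) \<le> 1 * (norm (gradient u x) + norm (gradient u x))"
      using that(2)
    proof eventually_elim
      case (elim x)
      then have "norm (gradient w x) \<le> norm (gradient u x) + norm (gradient u x)" by (rule order_trans) simp
      then show ?case by simp
    qed
    show "\<bar>w x\<bar> \<le> \<bar>u x\<bar> + \<bar>u x\<bar>" for x using that(3)[of x] by linarith
  qed
  show 1: "(\<lambda>x. max (u x) 0) \<in> energy_space" by (intro X lipschitz_max_min L C g) auto
  show "bi_energy (\<lambda>x. max (u x) 0) \<le> bi_energy u" by (intro bi_energy_mono u 1 g)
  show 2: "(\<lambda>x. min (u x) c) \<in> energy_space" if "c \<ge> 0" by (intro X lipschitz_max_min L C g) (use that in auto)
  show "bi_energy (\<lambda>x. min (u x) c) \<le> bi_energy u" if "c \<ge> 0" by (intro bi_energy_mono u 2 g that)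
qed

text \<open>For \<open>t\<close> between 0 and 1 this is the convex combination
  \<open>(1 - t) \<rho> + t \<sigma>\<close>, realized as a random choice between the two measures
  so that the integration rules for \<open>bind\<close> apply.\<close>

definition mixture :: "real \<Rightarrow> 'a measure \<Rightarrow> 'a measure \<Rightarrow> 'a::euclidean_space measure" where
  "mixture t \<rho> \<sigma> = measure_pmf (bernoulli_pmf t) \<bind> (\<lambda>b. if b then \<sigma> else \<rho>)"

lemma mixture:
  fixes f :: "'a::euclidean_space \<Rightarrow> real"
  assumes t: "0 \<le> t" "t \<le> 1" and S: "S \<in> sets borel"
    and \<rho>: "\<rho> \<in> prob_measures_on S" and \<sigma>: "\<sigma> \<in> prob_measures_on S"
  shows "mixture t \<rho> \<sigma> \<in> prob_measures_on S"
    and "continuous_on UNIV f \<Longrightarrow> (\<And>x. \<bar>f x\<bar> \<le> B) \<Longrightarrow>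
      (\<integral>x. f x \<partial>mixture t \<rho> \<sigma>) = (1 - t) * (\<integral>x. f x \<partial>\<rho>) + t * (\<integral>x. f x \<partial>\<sigma>)"
proof -
  note P\<rho> = prob_measures_onD[OF \<rho> S] and P\<sigma> = prob_measures_onD[OF \<sigma> S]
  let ?N = "\<lambda>b. if b then \<sigma> else \<rho>"
  have N: "?N \<in> measure_pmf (bernoulli_pmf t) \<rightarrow>\<^sub>M subprob_algebra borel"
    using P\<rho> P\<sigma> prob_space_imp_subprob_space by (auto simp: space_subprob_algebra split: if_splits)
  have s: "sets (mixture t \<rho> \<sigma>) = sets borel"
    unfolding mixture_def using P\<rho> P\<sigma> by (intro sets_bind) auto
  have e: "emeasure (mixture t \<rho> \<sigma>) A = (\<integral>\<^sup>+b. emeasure (?N b) A \<partial>measure_pmf (bernoulli_pmf t))" if "A \<in> sets borel" for A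
    unfolding mixture_def by (rule emeasure_bind[OF _ N that]) simp
  have "emeasure (?N b) S = 1" "emeasure (?N b) (- S) = 0" for b
    using \<rho> \<sigma> by (auto simp: prob_measures_on_def)
  then show "mixture t \<rho> \<sigma> \<in> prob_measures_on S"
    using s S by (simp add: prob_measures_on_def e measure_pmf.emeasure_space_1[simplified])
  assume f: "continuous_on UNIV f" "\<And>x. \<bar>f x\<bar> \<le> B"
  have "(\<integral>x. f x \<partial>mixture t \<rho> \<sigma>) = (\<integral>b. (\<integral>x. f x \<partial>?N b) \<partial>measure_pmf (bernoulli_pmf t))"
    unfolding mixture_def
    by (rule integral_bind[OF _ _ N, where B=B and B'=1])
      (use f borel_measurable_continuous_onI[OF f(1)] P\<rho> P\<sigma> in \<open>auto simp: prob_space.emeasure_space_1\<close>)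
  also have "\<dots> = (1 - t) * (\<integral>x. f x \<partial>\<rho>) + t * (\<integral>x. f x \<partial>\<sigma>)" using t by (simp add: mult.commute)
  finally show "(\<integral>x. f x \<partial>mixture t \<rho> \<sigma>) = (1 - t) * (\<integral>x. f x \<partial>\<rho>) + t * (\<integral>x. f x \<partial>\<sigma>)" .
qed

lemma Dirac_prob_measures_on:
  fixes y :: "'a::euclidean_space"
  assumes "S \<in> sets borel" "y \<in> S"
  shows "return borel y \<in> prob_measures_on S"
  using assms by (auto simp: prob_measures_on_def)

text \<open>On \<open>K\<close> the indicator of an open set is a limit from below of Lipschitz
  functions with bounded support, and the open sets are a generator stable under
  intersection.\<close>

lemma prob_measures_eqI:
  fixes K :: "'a::euclidean_space set"
  assumes K: "compact K" and \<rho>: "\<rho> \<in> prob_measures_on K" and \<sigma>: "\<sigma> \<in> prob_measures_on K"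
    and eq: "\<And>(\<psi> :: 'a \<Rightarrow> real) L R. L-lipschitz_on UNIV \<psi> \<Longrightarrow> (\<And>x. R < norm x \<Longrightarrow> \<psi> x = 0) \<Longrightarrow> (\<integral>x. \<psi> x \<partial>\<rho>) = (\<integral>x. \<psi> x \<partial>\<sigma>)"
  shows "\<rho> = \<sigma>"
proof -
  have Kb: "K \<in> sets borel" using K by (simp add: compact_imp_closed)
  note P\<rho> = prob_measures_onD[OF \<rho> Kb] and P\<sigma> = prob_measures_onD[OF \<sigma> Kb]
  obtain R where R: "\<And>x. x \<in> K \<Longrightarrow> norm x \<le> R" using compact_imp_bounded[OF K] bounded_iff by blast
  \<comment> \<open>The whole space is left out because \<open>infdist\<close> to the empty set is
    0; there both measures have total mass 1.\<close>
  have open_eq: "emeasure \<rho> U = emeasure \<sigma> U" if U: "open U" "U \<noteq> UNIV" for U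
  proof -
    define f where "f = (\<lambda>n::nat. \<lambda>x. min (real n * infdist x (- U)) (min 1 (max (R + 1 - norm x) 0)))"
    have f01: "0 \<le> f n x" "f n x \<le> 1" for n x by (auto simp: f_def infdist_nonneg)
    have lip: "(real n + 1)-lipschitz_on UNIV (f n)" for n
    proof -
      have "\<bar>real n * infdist x (- U) - real n * infdist y (- U)\<bar> \<le> (real n + 1) * dist x y" for x y :: 'a
      proof -
        have "\<bar>infdist x (- U) - infdist y (- U)\<bar> \<le> dist x y"
          using infdist_triangle[of x "- U" y] infdist_triangle[of y "- U" x] dist_commute[of x y] by linarith
        then have "real n * \<bar>infdist x (- U) - infdist y (- U)\<bar> \<le> (real n + 1) * dist x y" by (intro mult_mono) auto
        then show ?thesis by (simp add: abs_mult flip: right_diff_distrib)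
      qed
      then have 1: "(real n + 1)-lipschitz_on UNIV (\<lambda>x. real n * infdist x (- U))"
        by (intro lipschitz_onI) (auto simp: dist_real_def)
      have "\<bar>(R + 1 - norm x) - (R + 1 - norm y)\<bar> \<le> 1 * dist x y" for x y :: 'a
        using norm_triangle_ineq3[of y x] by (simp add: dist_norm norm_minus_commute)
      then have "1-lipschitz_on UNIV (\<lambda>x::'a. R + 1 - norm x)" by (intro lipschitz_onI) (auto simp: dist_real_def)
      then have "(real n + 1)-lipschitz_on UNIV (\<lambda>x::'a. R + 1 - norm x)" by (rule lipschitz_on_le) simp
      then have 2: "(real n + 1)-lipschitz_on UNIV (\<lambda>x::'a. min 1 (max (R + 1 - norm x) 0))"
        by (intro lipschitz_max_min) (auto intro: lipschitz_onI)
      show ?thesis unfolding f_def by (rule lipschitz_max_min(2)[OF 1 2])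
    qed
    have ieq: "(\<integral>x. f n x \<partial>\<rho>) = (\<integral>x. f n x \<partial>\<sigma>)" for n
      by (rule eq[OF lip, of "R + 1"]) (simp add: f_def infdist_nonneg)
    have fc: "continuous_on UNIV (f n)" for n using lip lipschitz_on_continuous_on by blast
    have lim: "(\<lambda>n. f n x) \<longlonglongrightarrow> indicator U x" if x: "x \<in> K" for x
    proof (cases "x \<in> U")
      case True
      have "infdist x (- U) > 0" using U True by (subst infdist_pos_not_in_closed) auto
      then obtain k where k: "1 < real k * infdist x (- U)" using reals_Archimedean3 by blast
      have "f n x = 1" if "k \<le> n" for n
      proof -
        have "real k * infdist x (- U) \<le> real n * infdist x (- U)" using that by (intro mult_right_mono) (auto simp: infdist_nonneg)
        then show ?thesis using R[OF x] k by (simp add: f_def)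
      qed
      then have "eventually (\<lambda>n. f n x = 1) sequentially" unfolding eventually_sequentially by blast
      then show ?thesis using True by (simp add: tendsto_eventually)
    next
      case False
      then have "f n x = 0" for n using f01(1)[of n x] by (simp add: f_def)
      then show ?thesis using False by simp
    qed
    have conv: "(\<lambda>n. \<integral>x. f n x \<partial>\<mu>) \<longlonglongrightarrow> measure \<mu> U" if "prob_space \<mu>" "sets \<mu> = sets borel" "AE x in \<mu>. x \<in> K" for \<mu>
    proof -
      interpret prob_space \<mu> by fact
      have sp: "space \<mu> = UNIV" using sets_eq_imp_space_eq[OF that(2)] by simp
      have "(\<lambda>n. \<integral>x. f n x \<partial>\<mu>) \<longlonglongrightarrow> (\<integral>x. indicator U x \<partial>\<mu>)"
      proof (rule integral_dominated_convergence[where w="\<lambda>x. 1"])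
        show "f n \<in> borel_measurable \<mu>" for n
          using borel_measurable_continuous_onI[OF fc[of n]] that(2) by (simp cong: measurable_cong_sets)
        show "(\<lambda>x. indicator U x :: real) \<in> borel_measurable \<mu>" using U that(2) by (intro borel_measurable_indicator) simp
        show "AE x in \<mu>. (\<lambda>n. f n x) \<longlonglongrightarrow> indicator U x" using that(3) by eventually_elim (rule lim)
      qed (use f01 in auto)
      then show ?thesis by (simp add: sp)
    qed
    have "measure \<rho> U = measure \<sigma> U" using conv[OF P\<rho>] conv[OF P\<sigma>] ieq LIMSEQ_unique by simp
    then show ?thesis using P\<rho>(1) P\<sigma>(1) by (simp add: prob_space_def finite_measure.emeasure_eq_measure)
  qed
  have sp: "space \<rho> = UNIV" "space \<sigma> = UNIV" using sets_eq_imp_space_eq[OF P\<rho>(2)] sets_eq_imp_space_eq[OF P\<sigma>(2)] by auto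
  have all: "emeasure \<rho> U = emeasure \<sigma> U" if "open U" for U
    using open_eq[OF that] prob_space.emeasure_space_1[OF P\<rho>(1)] prob_space.emeasure_space_1[OF P\<sigma>(1)] sp by (cases "U = UNIV") auto
  show ?thesis
  proof (rule measure_eqI_generator_eq[where E="{S. open S}" and \<Omega>=UNIV and A="\<lambda>_. UNIV"])
    show "Int_stable {S :: 'a set. open S}" by (auto simp: Int_stable_def)
    show "sets \<rho> = sigma_sets UNIV {S. open S}" "sets \<sigma> = sigma_sets UNIV {S. open S}"
      using P\<rho>(2) P\<sigma>(2) sets_borel by auto
    show "emeasure \<rho> UNIV \<noteq> \<infinity>" using prob_space.emeasure_space_1[OF P\<rho>(1)] sp by simp
  qed (use all in auto)
qed

section \<open>A radial barrier for the slope\<close>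

lemma lipschitz_mult_supported:
  fixes f g :: "'a::real_normed_vector \<Rightarrow> real"
  assumes f: "M-lipschitz_on UNIV f" "\<And>x. norm x \<le> R \<Longrightarrow> \<bar>f x\<bar> \<le> A"
    and g: "L-lipschitz_on UNIV g" "\<And>x. \<bar>g x\<bar> \<le> B" "\<And>x. R < norm x \<Longrightarrow> g x = 0"
    and A: "A \<ge> 0"
  shows "(A * L + M * B)-lipschitz_on UNIV (\<lambda>x. f x * g x)"
proof (rule lipschitz_onI)
  have L: "L \<ge> 0" and M: "M \<ge> 0" using f(1) g(1) lipschitz_on_nonneg by blast+
  have B: "B \<ge> 0" using order_trans[OF abs_ge_zero g(2)] by blast
  show "0 \<le> A * L + M * B" using A B L M by simp
  have fl: "\<bar>f x - f y\<bar> \<le> M * dist x y" and gl: "\<bar>g x - g y\<bar> \<le> L * dist x y" for x y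
    using lipschitz_onD[OF f(1), of x y] lipschitz_onD[OF g(1), of x y] by (simp_all add: dist_real_def)
  have main: "\<bar>f x * g x - f y * g y\<bar> \<le> (A * L + M * B) * dist x y" if "norm x \<le> R" for x y
  proof -
    have "f x * g x - f y * g y = f x * (g x - g y) + (f x - f y) * g y" by (simp add: algebra_simps)
    then have "\<bar>f x * g x - f y * g y\<bar> \<le> \<bar>f x\<bar> * \<bar>g x - g y\<bar> + \<bar>f x - f y\<bar> * \<bar>g y\<bar>"
      by (simp add: abs_triangle_ineq order_trans[OF abs_triangle_ineq] flip: abs_mult)
    also have "\<dots> \<le> A * (L * dist x y) + (M * dist x y) * B"
      using f(2)[OF that] gl fl g(2) A M by (intro add_mono mult_mono) auto
    finally show ?thesis by (simp add: algebra_simps)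
  qed
  fix x y :: 'a
  show "dist (f x * g x) (f y * g y) \<le> (A * L + M * B) * dist x y"
  proof (cases "norm x \<le> R \<or> norm y \<le> R")
    case True
    then show ?thesis using main[of x y] main[of y x] by (auto simp: dist_real_def dist_commute abs_minus_commute)
  next
    case False
    then show ?thesis using g(3) A B L M by simp
  qed
qed

lemma lipschitz_norm_diff: "1-lipschitz_on UNIV (\<lambda>x::'a::real_normed_vector. norm (x - z))"
  using norm_triangle_ineq3[of "x - z" "y - z" for x y :: 'a] by (intro lipschitz_onI) (auto simp: dist_real_def dist_norm)

lemma GDERIV_norm_diff: "x \<noteq> z \<Longrightarrow> GDERIV (\<lambda>x::'a::euclidean_space. norm (x - z)) x :> (1 / norm (x - z)) *\<^sub>R (x - z)"
proof -
  assume "x \<noteq> z"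
  then have "(norm has_derivative (\<lambda>v. v \<bullet> sgn (x - z))) (at (x - z))" using GDERIV_norm[of "x - z"] by (simp add: gderiv_def)
  moreover have "((\<lambda>x. x - z) has_derivative (\<lambda>v. v)) (at x)" by (auto intro!: derivative_eq_intros)
  ultimately have "((\<lambda>x. norm (x - z)) has_derivative (\<lambda>v. v \<bullet> sgn (x - z))) (at x)" by (rule has_derivative_compose[rotated])
  then show ?thesis by (simp add: gderiv_def sgn_div_norm divide_inverse)
qed

text \<open>The field \<open>(x - z) / |x - z|^N\<close> is divergence free away from \<open>z\<close>.\<close>

lemma newtonian_field_orthogonal:
  fixes v :: "'a::euclidean_space \<Rightarrow> real" and z :: 'a
  assumes r: "r > 0" and L: "L-lipschitz_on UNIV v" and supp: "\<And>x. R < norm x \<Longrightarrow> v x = 0"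
    and v0: "\<And>x. norm (x - z) \<le> r \<Longrightarrow> v x = 0"
  defines "q \<equiv> \<lambda>x. r / max (norm (x - z)) r"
  shows "integrable lborel (\<lambda>x. q x ^ DIM('a) * ((x - z) \<bullet> gradient v x))"
    and "(\<integral>x. q x ^ DIM('a) * ((x - z) \<bullet> gradient v x) \<partial>lborel) = 0"
proof -
  let ?N = "DIM('a)"
  have vc: "continuous_on UNIV v" using L lipschitz_on_continuous_on by blast
  obtain B where B: "\<And>x. \<bar>v x\<bar> \<le> B" "B \<ge> 0"
    using continuous_supported_bounded[OF vc supp] by (metis real_norm_def)
  have q01: "0 < q x" "q x \<le> 1" for x using r by (auto simp: q_def less_max_iff_disj divide_le_eq)
  have ql: "\<bar>q x - q y\<bar> \<le> 1 / r * dist x y" for x y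
  proof -
    let ?a = "max (norm (x - z)) r" and ?b = "max (norm (y - z)) r"
    have pos: "?a \<ge> r" "?b \<ge> r" by auto
    then have ne: "?a > 0" "?b > 0" using r by linarith+
    have "q x - q y = r * (?b - ?a) / (?a * ?b)" using ne unfolding q_def by (simp add: field_simps)
    then have "\<bar>q x - q y\<bar> = r * \<bar>?b - ?a\<bar> / (?a * ?b)" using r ne by (simp add: abs_mult)
    also have "\<dots> \<le> r * dist x y / (r * r)"
    proof (intro frac_le mult_left_mono mult_mono)
      have "\<bar>norm (y - z) - norm (x - z)\<bar> \<le> dist x y"
        using norm_triangle_ineq3[of "y - z" "x - z"] by (simp add: dist_norm norm_minus_commute)
      then show "\<bar>?b - ?a\<bar> \<le> dist x y" by (auto simp: max_def)
    qed (use r pos in auto)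
    also have "\<dots> = 1 / r * dist x y" using r by simp
    finally show ?thesis .
  qed
  have qN: "(real ?N / r)-lipschitz_on UNIV (\<lambda>x. q x ^ ?N)"
  proof (rule lipschitz_onI)
    fix x y :: 'a
    have "norm (q x ^ ?N - q y ^ ?N) \<le> real ?N * norm (q x - q y)"
      by (rule norm_power_diff) (use q01[of x] q01[of y] in auto)
    also have "\<dots> \<le> real ?N * (1 / r * dist x y)" using ql by (intro mult_left_mono) auto
    finally show "dist (q x ^ ?N) (q y ^ ?N) \<le> real ?N / r * dist x y" by (simp add: dist_real_def)
  qed (use r in simp)
  define A where "A = max 0 R + norm z"
  \<comment> \<open>The components of the field times \<open>v\<close>. The field is
    \<open>q x ^ DIM('a) *\<^sub>R (x - z)\<close>: a multiple of the Newtonian field outside the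
    ball, and regular inside, where \<open>v\<close> vanishes.\<close>
  define w where "w = (\<lambda>b x. q x ^ ?N * (((x - z) \<bullet> b) * v x))"
  have wlip: "\<exists>K. K-lipschitz_on UNIV (w b)" if b: "b \<in> Basis" for b
  proof -
    have nb: "norm b = 1" using b by simp
    have lin: "1-lipschitz_on UNIV (\<lambda>x. (x - z) \<bullet> b)"
    proof (rule lipschitz_onI)
      fix x y :: 'a
      have "\<bar>(x - y) \<bullet> b\<bar> \<le> norm (x - y)" using Cauchy_Schwarz_ineq2[of "x - y" b] nb by simp
      then show "dist ((x - z) \<bullet> b) ((y - z) \<bullet> b) \<le> 1 * dist x y" by (simp add: dist_real_def dist_norm inner_diff_left)
    qed simp
    have bnd: "\<bar>(x - z) \<bullet> b\<bar> \<le> A" if "norm x \<le> R" for x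
      using Cauchy_Schwarz_ineq2[of "x - z" b] nb norm_triangle_ineq4[of x z] that by (simp add: A_def)
    have A0: "A \<ge> 0" by (simp add: A_def)
    have 1: "(A * L + 1 * B)-lipschitz_on UNIV (\<lambda>x. ((x - z) \<bullet> b) * v x)"
      by (rule lipschitz_mult_supported[where R=R, OF lin bnd L B(1) supp A0])
    have 2: "\<bar>((x - z) \<bullet> b) * v x\<bar> \<le> A * B" for x
    proof (cases "norm x \<le> R")
      case True
      then show ?thesis unfolding abs_mult using bnd B A0 by (intro mult_mono) auto
    qed (use supp A0 B(2) in simp)
    have 3: "\<bar>q x ^ ?N\<bar> \<le> 1" for x using q01[of x] by (simp add: power_le_one)
    show ?thesis unfolding w_def
      by (rule exI, rule lipschitz_mult_supported[where R=R and A=1, OF qN 3 1 2]) (use supp in auto)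
  qed
  have w0: "w b x = 0" if "R < norm x" for b x using supp[OF that] by (simp add: w_def)
  have I: "integrable lborel (\<lambda>x. b \<bullet> gradient (w b) x)" "(\<integral>x. b \<bullet> gradient (w b) x \<partial>lborel) = 0" if b: "b \<in> Basis" for b
  proof -
    obtain K where K: "K-lipschitz_on UNIV (w b)" using wlip[OF b] by blast
    show "integrable lborel (\<lambda>x. b \<bullet> gradient (w b) x)" "(\<integral>x. b \<bullet> gradient (w b) x \<partial>lborel) = 0"
      using integral_gradient_zero[where v=b, OF K w0] by auto
  qed
  have "AE x in lborel. \<forall>b\<in>Basis. GDERIV (w b) x :> gradient (w b) x"
  proof (rule AE_finite_allI[OF finite_Basis])
    fix b :: 'a assume "b \<in> Basis"
    then obtain K where K: "K-lipschitz_on UNIV (w b)" using wlip by blast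
    show "AE x in lborel. GDERIV (w b) x :> gradient (w b) x" by (rule AE_GDERIV[OF K])
  qed
  moreover have "AE x in lborel. GDERIV (\<lambda>x. q x ^ ?N) x :> gradient (\<lambda>x. q x ^ ?N) x" by (rule AE_GDERIV[OF qN])
  moreover have "AE x in lborel. GDERIV v x :> gradient v x" by (rule AE_GDERIV[OF L])
  ultimately have ae: "AE x in lborel. (\<Sum>b\<in>Basis. b \<bullet> gradient (w b) x) = q x ^ ?N * ((x - z) \<bullet> gradient v x)"
  proof eventually_elim
    case (elim x)
    \<comment> \<open>Where \<open>v\<close> is not 0, the radial derivative of
      \<open>q x ^ DIM('a)\<close> cancels the divergence of \<open>x - z\<close>, which is the
      dimension.\<close>
    obtain h where h: "GDERIV (\<lambda>x. q x ^ ?N) x :> h" "v x = 0 \<or> h \<bullet> (x - z) = - (real ?N * q x ^ ?N)"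
    proof (cases "norm (x - z) \<le> r")
      case True
      then show ?thesis using that[of "gradient (\<lambda>x. q x ^ ?N) x"] elim(2) v0 by blast
    next
      case False
      then have xz: "x \<noteq> z" "norm (x - z) > 0" using r by auto
      define s where "s = norm (x - z)"
      have s: "s > 0" "s > r" using xz False by (simp_all add: s_def)
      have "DERIV (\<lambda>t. (r / t) ^ ?N) s :> - (real ?N * (r / s) ^ ?N / s)"
      proof -
        have N: "?N = Suc (?N - 1)" by simp
        have "DERIV (\<lambda>t. (r / t) ^ ?N) s :> real ?N * (r / s) ^ (?N - 1) * (- r / s\<^sup>2)"
          using s by (auto intro!: derivative_eq_intros simp: power2_eq_square)
        moreover have pw: "(r / s) ^ ?N = (r / s) ^ (?N - 1) * (r / s)" by (subst N) (simp only: power_Suc2)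
        moreover have "real ?N * (r / s) ^ (?N - 1) * (- r / s\<^sup>2) = - (real ?N * (r / s) ^ ?N / s)"
          unfolding pw by (simp add: power2_eq_square mult.assoc)
        ultimately show ?thesis by (simp only:)
      qed
      then have "GDERIV (\<lambda>x. (r / norm (x - z)) ^ ?N) x :> (- (real ?N * (r / s) ^ ?N / s)) *\<^sub>R ((1 / s) *\<^sub>R (x - z))"
        by (rule GDERIV_DERIV_compose[OF GDERIV_norm_diff[OF xz(1)], folded s_def])
      then have "GDERIV (\<lambda>x. q x ^ ?N) x :> (- (real ?N * (r / s) ^ ?N / s)) *\<^sub>R ((1 / s) *\<^sub>R (x - z))"
        by (rule gradient_eq_if_open[of "{y. r < norm (y - z)}", rotated -1])
          (use s in \<open>auto simp: q_def s_def max_def intro!: open_Collect_less continuous_intros\<close>)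
      moreover have "((- (real ?N * (r / s) ^ ?N / s)) *\<^sub>R ((1 / s) *\<^sub>R (x - z))) \<bullet> (x - z) = - (real ?N * q x ^ ?N)"
      proof -
        have "(x - z) \<bullet> (x - z) = s * s" by (simp add: s_def dot_square_norm power2_eq_square)
        moreover have "q x = r / s" using s by (simp add: q_def s_def)
        ultimately show ?thesis using s by simp
      qed
      ultimately show ?thesis by (intro that) auto
    qed
    have gw: "gradient (w b) x = q x ^ ?N *\<^sub>R (((x - z) \<bullet> b) *\<^sub>R gradient v x + v x *\<^sub>R b) + (((x - z) \<bullet> b) * v x) *\<^sub>R h" for b
    proof -
      have "GDERIV (\<lambda>x. (x - z) \<bullet> b) x :> b" unfolding gderiv_def by (auto intro!: derivative_eq_intros)
      from GDERIV_mult[OF h(1) GDERIV_mult[OF this elim(3)]]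
      show ?thesis unfolding w_def by (rule gradient_eq)
    qed
    have "(\<Sum>b\<in>Basis. b \<bullet> gradient (w b) x) = (\<Sum>b\<in>Basis. q x ^ ?N * (((x - z) \<bullet> b) * (gradient v x \<bullet> b))
        + q x ^ ?N * v x + v x * (((x - z) \<bullet> b) * (h \<bullet> b)))"
    proof (intro sum.cong refl)
      fix b :: 'a assume "b \<in> Basis"
      then have "b \<bullet> b = 1" by simp
      then show "b \<bullet> gradient (w b) x = q x ^ ?N * (((x - z) \<bullet> b) * (gradient v x \<bullet> b)) + q x ^ ?N * v x + v x * (((x - z) \<bullet> b) * (h \<bullet> b))"
        unfolding gw inner_add_right inner_scaleR_right by (simp add: inner_commute algebra_simps)
    qed
    also have "\<dots> = q x ^ ?N * ((x - z) \<bullet> gradient v x) + real ?N * (q x ^ ?N * v x) + v x * ((x - z) \<bullet> h)"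
      unfolding sum.distrib sum_distrib_left[symmetric] euclidean_inner[symmetric] by simp
    also have "\<dots> = q x ^ ?N * ((x - z) \<bullet> gradient v x)" using h(2) by (auto simp: inner_commute)
    finally show ?case .
  qed
  have S: "integrable lborel (\<lambda>x. \<Sum>b\<in>Basis. b \<bullet> gradient (w b) x)" by (intro Bochner_Integration.integrable_sum I)
  have vg: "gradient v \<in> borel_measurable borel" by (rule lipschitz_gradient_borel[OF L])
  have qm: "(\<lambda>x. q x ^ ?N) \<in> borel_measurable borel"
    using lipschitz_on_continuous_on[OF qN] by (rule borel_measurable_continuous_onI)
  have m: "(\<lambda>x. q x ^ ?N * ((x - z) \<bullet> gradient v x)) \<in> borel_measurable lborel" using vg qm by measurable
  show "integrable lborel (\<lambda>x. q x ^ ?N * ((x - z) \<bullet> gradient v x))"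
    by (rule integrable_cong_AE_imp[OF S m]) (use ae in \<open>auto elim: eventually_mono\<close>)
  have "(\<integral>x. q x ^ ?N * ((x - z) \<bullet> gradient v x) \<partial>lborel) = (\<integral>x. (\<Sum>b\<in>Basis. b \<bullet> gradient (w b) x) \<partial>lborel)"
    by (intro integral_cong_AE m) (use S ae in \<open>auto elim: eventually_mono\<close>)
  also have "\<dots> = 0" using I by (subst Bochner_Integration.integral_sum) auto
  finally show "(\<integral>x. q x ^ ?N * ((x - z) \<bullet> gradient v x) \<partial>lborel) = 0" .
qed

text \<open>The points \<open>(g, \<alpha>)\<close> and \<open>(a, \<beta>)\<close> lie on the unit
  sphere of a space with one more dimension, so their inner product is at most 1. This amounts to
  the tangent inequality for the convex function \<open>bi\<close>, valid up to |a| = 1.\<close>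

lemma bi_tangent:
  fixes a g :: "'a::real_inner"
  assumes g: "norm g < 1" and a: "norm a \<le> 1"
  shows "bi g - bi a \<le> (1 / sqrt (1 - (norm g)\<^sup>2)) * (g \<bullet> (g - a))"
proof -
  define \<alpha> \<beta> where "\<alpha> = sqrt (1 - (norm g)\<^sup>2)" and "\<beta> = sqrt (1 - (norm a)\<^sup>2)"
  have "(norm g)\<^sup>2 < 1" using g by (simp add: power_less_one_iff abs_square_less_1)
  moreover have "(norm a)\<^sup>2 \<le> 1" using a by (simp add: power_le_one)
  ultimately have \<alpha>: "\<alpha> > 0" "\<alpha>\<^sup>2 = 1 - (norm g)\<^sup>2" and \<beta>: "\<beta>\<^sup>2 = 1 - (norm a)\<^sup>2" by (auto simp: \<alpha>_def \<beta>_def)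
  have "0 \<le> (\<alpha> - \<beta>)\<^sup>2" by simp
  then have 1: "2 * (\<alpha> * \<beta>) \<le> \<alpha>\<^sup>2 + \<beta>\<^sup>2" by (simp add: power2_diff)
  have "0 \<le> (norm (g - a))\<^sup>2" by simp
  then have 2: "2 * (g \<bullet> a) \<le> (norm g)\<^sup>2 + (norm a)\<^sup>2" by (simp add: power2_norm_eq_inner inner_diff_left inner_diff_right inner_commute)
  have "\<alpha> * \<beta> + g \<bullet> a \<le> 1" using 1 2 \<alpha>(2) \<beta> by linarith
  moreover have "\<alpha> * (\<beta> - \<alpha>) = \<alpha> * \<beta> - \<alpha>\<^sup>2" by (simp add: power2_eq_square right_diff_distrib)
  moreover have "g \<bullet> (g - a) = (norm g)\<^sup>2 - g \<bullet> a" by (simp add: inner_diff_right power2_norm_eq_inner)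
  ultimately have "\<alpha> * (\<beta> - \<alpha>) \<le> g \<bullet> (g - a)" using \<alpha>(2) by linarith
  then have "\<beta> - \<alpha> \<le> (1 / \<alpha>) * (g \<bullet> (g - a))" using \<alpha>(1) by (simp add: field_simps)
  then show ?thesis by (simp add: bi_def \<alpha>_def \<beta>_def)
qed

text \<open>The radial solution of the Born-Infeld equation with flux \<open>k\<close> and slope \<open>p\<close>.\<close>

lemma radial_profile:
  fixes m r :: real and n :: nat
  assumes m: "m \<ge> 0" and r: "r > 0"
  obtains k R and p H :: "real \<Rightarrow> real" where "k > 0" "R \<ge> r" "H r = 0" "\<And>s. R \<le> s \<Longrightarrow> m \<le> H s"
    "0 \<le> p r" "p r < 1" "\<And>a b. r \<le> a \<Longrightarrow> a \<le> b \<Longrightarrow> 0 \<le> H b - H a \<and> H b - H a \<le> p r * (b - a)"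
    "\<And>s. s > r \<Longrightarrow> DERIV H s :> p s" "\<And>s. 0 \<le> p s" "\<And>s. s > r \<Longrightarrow> p s < 1 \<and> p s / sqrt (1 - (p s)\<^sup>2) = k / s ^ n"
proof -
  \<comment> \<open>Here \<open>R - r = m + 2\<close>, and \<open>k\<close> makes the slope at
    \<open>R\<close> at least \<open>(m + 1) / (m + 2)\<close>. As the slope decreases outwards, the
    profile gains at least \<open>m + 1\<close> between \<open>r\<close> and
    \<open>R\<close>.\<close>
  define R where "R = r + m + 2"
  define k where "k = (m + 1) * R ^ n"
  define D where "D = (\<lambda>s::real. sqrt (k\<^sup>2 + (s ^ n)\<^sup>2))"
  \<comment> \<open>The solution of \<open>p / sqrt (1 - p\<^sup>2) = k / s ^ n\<close>.\<close>
  define p where "p = (\<lambda>s. k / D s)"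
  define H where "H = (\<lambda>s. integral {0..s} p - integral {0..r} p)"
  have R: "R > 0" "R \<ge> r" using m r by (auto simp: R_def)
  have k: "k > 0" using m R by (simp add: k_def)
  have D2: "(D s)\<^sup>2 = k\<^sup>2 + (s ^ n)\<^sup>2" and D0: "D s > 0" for s
    using k by (auto simp: D_def intro!: add_pos_nonneg)
  have p0: "0 < p s" for s using k D0 by (simp add: p_def)
  have anti: "p b \<le> p a" if "0 < a" "a \<le> b" for a b
  proof -
    have "D a \<le> D b" using that unfolding D_def by (intro real_sqrt_le_mono add_left_mono power_mono) auto
    then show ?thesis unfolding p_def using D0 less_imp_le[OF k] by (intro divide_left_mono mult_pos_pos) auto
  qed
  have flux: "p s < 1 \<and> p s / sqrt (1 - (p s)\<^sup>2) = k / s ^ n" if "s > 0" for s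
  proof -
    have sn: "s ^ n > 0" using that by simp
    have "k\<^sup>2 < (D s)\<^sup>2" unfolding D2 using zero_less_power[OF sn, of 2] by linarith
    then have "k < D s" by (rule power2_less_imp_less) (use D0[of s] in simp)
    then have 1: "p s < 1" using D0[of s] by (simp add: p_def)
    have "1 - (p s)\<^sup>2 = (s ^ n / D s)\<^sup>2"
    proof -
      have "1 - (p s)\<^sup>2 = ((D s)\<^sup>2 - k\<^sup>2) / (D s)\<^sup>2" using D0[of s] by (simp add: p_def power_divide diff_divide_distrib)
      then show ?thesis by (simp add: D2 power_divide)
    qed
    then have "sqrt (1 - (p s)\<^sup>2) = s ^ n / D s" using sn D0[of s] by simp
    then show ?thesis using 1 sn D0[of s] by (simp add: p_def)
  qed
  have pc: "continuous_on A p" for A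
    unfolding p_def D_def using k by (intro continuous_intros) (auto simp: add_nonneg_eq_0_iff)
  have der: "DERIV H s :> p s" if "s > 0" for s
  proof -
    have "((\<lambda>x. integral {0..x} p) has_real_derivative p s) (at s within {0..s+1})"
      using that by (intro integral_has_real_derivative pc) auto
    then have "DERIV (\<lambda>x. integral {0..x} p) s :> p s" using that by (simp add: at_within_Icc_at)
    then show ?thesis unfolding H_def by (auto intro!: derivative_eq_intros)
  qed
  have mvt: "\<exists>z. a \<le> z \<and> z \<le> b \<and> H b - H a = (b - a) * p z" if ab: "r \<le> a" "a \<le> b" for a b
  proof (cases "a = b")
    case False
    have "\<exists>z. a < z \<and> z < b \<and> H b - H a = (b - a) * p z"
      by (rule MVT2) (use ab False r der in auto)
    then show ?thesis using less_imp_le by blast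
  qed auto
  have slope: "0 \<le> H b - H a \<and> H b - H a \<le> p r * (b - a)" if ab: "r \<le> a" "a \<le> b" for a b
  proof -
    obtain z where z: "a \<le> z" "H b - H a = (b - a) * p z" using mvt[OF ab] by blast
    have "p z \<le> p r" using z(1) ab r by (intro anti) auto
    then have "(b - a) * p z \<le> (b - a) * p r" using ab by (intro mult_left_mono) auto
    then show ?thesis using z ab p0[of z] by (simp add: mult.commute)
  qed
  have HR: "m \<le> H R"
  proof -
    obtain z where z: "r \<le> z" "z \<le> R" "H R - H r = (R - r) * p z" using mvt[OF order_refl R(2)] by blast
    have "(D R)\<^sup>2 \<le> (k + R ^ n)\<^sup>2" using k R by (simp add: D2 power2_sum)
    then have "D R \<le> k + R ^ n" by (rule power2_le_imp_le) (use k R in simp)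
    then have "k / (k + R ^ n) \<le> p R" unfolding p_def using less_imp_le[OF k] k D0 R by (intro divide_left_mono mult_pos_pos add_pos_pos) auto
    moreover have "k / (k + R ^ n) = (m + 1) / (m + 2)"
    proof -
      have "k + R ^ n = (m + 2) * R ^ n" by (simp add: k_def algebra_simps)
      then show ?thesis using R(1) by (simp add: k_def)
    qed
    moreover have "p R \<le> p z" using z r by (intro anti) auto
    ultimately have "(m + 2) * ((m + 1) / (m + 2)) \<le> (R - r) * p z" using m by (intro mult_mono) (auto simp: R_def)
    then show ?thesis using z(3) m by (simp add: H_def)
  qed
  show ?thesis
  proof (rule that[OF k R(2), of H p])
    show "m \<le> H s" if "R \<le> s" for s using slope[OF R(2) that] HR by linarith
  qed (use p0 flux der slope r in \<open>auto simp: H_def less_imp_le\<close>)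
qed

text \<open>The competitor is the maximum of \<open>\<phi>\<close> and the radial barrier
  \<open>m - H (s x)\<close>. Where the barrier is higher, the tangent inequality at its gradient
  bounds the change of energy by the flux of the barrier paired with the gradient of
  \<open>\<psi> - \<phi>\<close>. This flux is a multiple of the Newtonian field and the difference
  vanishes on the ball, so the bound integrates to 0, and minimality gives
  \<open>\<psi> = \<phi>\<close>. The profile is fixed before the centre \<open>z\<close>, which
  makes \<open>\<kappa>\<close> uniform.\<close>

theorem barrier:
  fixes \<phi> :: "'a::euclidean_space \<Rightarrow> real"
  assumes dim: "DIM('a) \<ge> 3" and \<phi>: "\<phi> \<in> energy_space" "\<And>x. 0 \<le> \<phi> x"
    and min: "\<And>\<psi>. \<psi> \<in> energy_space \<Longrightarrow> bi_energy \<psi> \<le> bi_energy \<phi> \<Longrightarrow> (\<And>x. \<phi> x \<le> \<psi> x) \<Longrightarrow> \<psi> = \<phi>"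
    and m: "m \<ge> 0" and r: "r > 0"
  shows "\<exists>\<kappa>. 0 \<le> \<kappa> \<and> \<kappa> < 1 \<and> (\<forall>z. (\<forall>x. norm (x - z) \<le> r \<longrightarrow> \<phi> x = m) \<longrightarrow> (\<forall>x. m - \<kappa> * (max (norm (x - z)) r - r) \<le> \<phi> x))"
proof -
  let ?N = "DIM('a)"
  obtain k R and p H :: "real \<Rightarrow> real" where k: "k > 0" and R: "R \<ge> r" and Hr: "H r = 0" and HR: "\<And>s. R \<le> s \<Longrightarrow> m \<le> H s"
    and p: "0 \<le> p r" "p r < 1" and slope: "\<And>a b. r \<le> a \<Longrightarrow> a \<le> b \<Longrightarrow> 0 \<le> H b - H a \<and> H b - H a \<le> p r * (b - a)"
    and der: "\<And>s. s > r \<Longrightarrow> DERIV H s :> p s" and p0: "\<And>s. 0 \<le> p s"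
    and flux: "\<And>s. s > r \<Longrightarrow> p s < 1 \<and> p s / sqrt (1 - (p s)\<^sup>2) = k / s ^ (?N - 1)"
    by (rule radial_profile[OF m r, of "?N - 1"]) blast
  have "m - p r * (max (norm (x - z)) r - r) \<le> \<phi> x" if z: "\<And>x. norm (x - z) \<le> r \<Longrightarrow> \<phi> x = m" for x z
  proof -
    define s where "s = (\<lambda>x. max (norm (x - z)) r)"
    define w where "w = (\<lambda>x. m - H (s x))"
    define \<psi> where "\<psi> = (\<lambda>x. max (\<phi> x) (w x))"
    define v where "v = (\<lambda>x. 1 * \<psi> x + (-1) * \<phi> x)"
    note \<phi>L = energy_spaceD(1)[OF \<phi>(1)]
    have sr: "r \<le> s x" for x by (simp add: s_def)
    have Hlip: "\<bar>H a - H b\<bar> \<le> \<bar>a - b\<bar>" if "r \<le> a" "r \<le> b" for a b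
    proof -
      have *: "\<bar>H b - H a\<bar> \<le> b - a" if "r \<le> a" "a \<le> b" for a b
        using slope[OF that] mult_right_mono[of "p r" 1 "b - a"] p that by simp
      then show ?thesis using *[of a b] *[of b a] that by (cases "a \<le> b") (auto simp: abs_minus_commute)
    qed
    have wL: "1-lipschitz_on UNIV w"
    proof (rule lipschitz_onI)
      fix x y :: 'a
      have "\<bar>s x - s y\<bar> \<le> dist x y" using lipschitz_onD[OF lipschitz_norm_diff[of z], of x y]
        by (auto simp: s_def dist_real_def max_def)
      then show "dist (w x) (w y) \<le> 1 * dist x y" using Hlip[OF sr sr, of y x] by (simp add: w_def dist_real_def abs_minus_commute)
    qed simp
    have \<psi>L: "1-lipschitz_on UNIV \<psi>" unfolding \<psi>_def by (rule lipschitz_max_min(1)[OF \<phi>L wL])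
    have vL: "(\<bar>1\<bar> * 1 + \<bar>-1\<bar> * 1)-lipschitz_on UNIV v" unfolding v_def by (rule lipschitz_lincomb[OF \<psi>L \<phi>L])
    \<comment> \<open>At distance at least \<open>R\<close> from \<open>z\<close> the barrier is at
      most 0, hence at most \<open>\<phi>\<close>.\<close>
    have out: "\<psi> x = \<phi> x" if "R + norm z < norm x" for x
    proof -
      have "R \<le> s x" using that norm_triangle_sub[of x z] by (simp add: s_def)
      then show ?thesis using HR[of "s x"] \<phi>(2)[of x] by (simp add: \<psi>_def w_def)
    qed
    have ins: "\<psi> x = \<phi> x" if "norm (x - z) \<le> r" for x
      using z[OF that] that by (simp add: \<psi>_def w_def s_def Hr)
    have \<psi>: "\<psi> \<in> energy_space" by (rule compact_perturbation_energy_space[OF dim \<phi>(1) \<psi>L out])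
    have N: "?N = Suc (?N - 1)" by simp
    \<comment> \<open>The factor between the flux of the barrier, which points inwards with strength
      \<open>k / t ^ (DIM('a) - 1)\<close>, and the field
      \<open>(r / s x) ^ DIM('a) *\<^sub>R (x - z)\<close>.\<close>
    define c where "c = - (k / r ^ ?N)"
    have nf: "integrable lborel (\<lambda>x. (r / s x) ^ ?N * ((x - z) \<bullet> gradient v x))"
      "(\<integral>x. (r / s x) ^ ?N * ((x - z) \<bullet> gradient v x) \<partial>lborel) = 0"
      using newtonian_field_orthogonal[OF r vL, of "R + norm z" z] out ins unfolding s_def by (auto simp: v_def)
    have "AE x in lborel. gradient v x = 1 *\<^sub>R gradient \<psi> x + (-1) *\<^sub>R gradient \<phi> x"
      unfolding v_def by (rule AE_gradient_lincomb[OF \<psi>L \<phi>L])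
    then have "AE x in lborel. bi (gradient \<psi> x) - bi (gradient \<phi> x) \<le> c * ((r / s x) ^ ?N * ((x - z) \<bullet> gradient v x))"
      using AE_gradient_max_min[OF \<phi>L wL] energy_space_AE_gradient_le[OF \<phi>(1)]
    proof eventually_elim
      case (elim x)
      show ?case
      proof (cases "w x \<le> \<phi> x")
        case True
        then have "gradient \<psi> x = gradient \<phi> x" using elim(2) by (simp add: \<psi>_def)
        then show ?thesis using elim(1) by simp
      next
        case False
        then have xr: "norm (x - z) > r" using ins[of x] by (auto simp: \<psi>_def max_def split: if_splits intro: ccontr)
        define t where "t = norm (x - z)"
        have t: "t > r" "t > 0" "x \<noteq> z" "s x = t" using xr r by (auto simp: t_def s_def)
        define g where "g = (- (p t / t)) *\<^sub>R (x - z)"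
        have "GDERIV (\<lambda>x. m - H (norm (x - z))) x :> 0 - p t *\<^sub>R ((1 / t) *\<^sub>R (x - z))"
          by (intro GDERIV_diff GDERIV_const GDERIV_DERIV_compose[OF GDERIV_norm_diff[OF t(3)], folded t_def] der t)
        then have "GDERIV w x :> 0 - p t *\<^sub>R ((1 / t) *\<^sub>R (x - z))"
          by (rule gradient_eq_if_open[of "{y. r < norm (y - z)}", rotated -1])
            (use xr in \<open>auto simp: w_def s_def max_def intro!: open_Collect_less continuous_intros\<close>)
        then have "gradient w x = g" by (simp add: gradient_eq g_def)
        then have g: "gradient \<psi> x = g" using elim(2) False by (simp add: \<psi>_def)
        have ng: "norm g = p t" using t p0[of t] by (simp add: g_def flip: t_def)
        have "bi g - bi (gradient \<phi> x) \<le> (1 / sqrt (1 - (norm g)\<^sup>2)) * (g \<bullet> (g - gradient \<phi> x))"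
          by (rule bi_tangent) (use flux[OF t(1)] elim(3) in \<open>auto simp: ng\<close>)
        also have "\<dots> = - (p t / sqrt (1 - (p t)\<^sup>2) / t) * ((x - z) \<bullet> (g - gradient \<phi> x))"
          unfolding ng by (simp add: g_def)
        also have "p t / sqrt (1 - (p t)\<^sup>2) / t = k / t ^ ?N"
        proof -
          have "t ^ ?N = t ^ (?N - 1) * t" by (subst N) (simp only: power_Suc2)
          then show ?thesis using flux[OF t(1)] by simp
        qed
        also have "- (k / t ^ ?N) * ((x - z) \<bullet> (g - gradient \<phi> x)) = c * ((r / s x) ^ ?N * ((x - z) \<bullet> gradient v x))"
          using r elim(1) by (simp add: c_def t(4) g power_divide)
        finally show ?thesis by (simp add: g)
      qed
    qed
    then have "(\<integral>x. bi (gradient \<psi> x) - bi (gradient \<phi> x) \<partial>lborel) \<le> (\<integral>x. c * ((r / s x) ^ ?N * ((x - z) \<bullet> gradient v x)) \<partial>lborel)"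
      by (intro integral_mono_AE Bochner_Integration.integrable_diff bi_integrable \<psi> \<phi>(1) integrable_mult_right nf(1))
    then have "bi_energy \<psi> - bi_energy \<phi> \<le> 0"
      by (simp add: nf(2) bi_energy_def Bochner_Integration.integral_diff bi_integrable \<psi> \<phi>(1))
    then have "\<psi> = \<phi>" by (intro min \<psi>) (auto simp: \<psi>_def)
    then have "w x \<le> \<phi> x" by (auto simp: \<psi>_def dest!: fun_cong[where x=x] split: if_splits simp: max_def)
    moreover have "H (s x) \<le> p r * (s x - r)" using slope[OF order_refl sr[of x]] Hr by simp
    ultimately show ?thesis by (simp add: w_def s_def)
  qed
  then show ?thesis using p by (intro exI[of _ "p r"]) blast
qed

section \<open>Equilibrium measures\<close>

context
  fixes S :: "'a::euclidean_space set"
  assumes dim: "DIM('a) \<ge> 3" and S: "compact S"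
begin

lemma S_borel: "S \<in> sets borel"
  using S by (simp add: compact_imp_closed)

lemmas PD = prob_measures_onD[OF _ S_borel]
lemmas pot = potential_minimizes[OF dim PD(1,2)]

lemma energy_eq:
  assumes "\<sigma> \<in> prob_measures_on S"
  shows "electrostatic_energy \<sigma> = (\<integral>x. potential \<sigma> x \<partial>\<sigma>) - bi_energy (potential \<sigma>)"
  using pot(3)[OF assms assms] by (simp add: action_def)

text \<open>The dual description of the energy: every function in \<open>energy_space\<close> gives
  a lower bound, with equality at the potential (\<open>energy_eq\<close>).\<close>

lemma energy_ge:
  assumes "\<sigma> \<in> prob_measures_on S" "v \<in> energy_space"
  shows "(\<integral>x. v x \<partial>\<sigma>) - bi_energy v \<le> electrostatic_energy \<sigma>"
proof -
  have "0 \<le> half_dist (potential \<sigma>) v" by (simp add: half_dist_def dirichlet_nonneg)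
  then show ?thesis using pot(2)[OF assms(1,1,2)] pot(3)[OF assms(1,1)] unfolding action_def by linarith
qed

lemma bi_energy_nonneg: "u \<in> energy_space \<Longrightarrow> 0 \<le> bi_energy u"
  using bi_energy_bounds(1)[of u] dirichlet_nonneg[of u] by linarith

lemma energy_nonneg:
  assumes "\<sigma> \<in> prob_measures_on S"
  shows "0 \<le> electrostatic_energy \<sigma>"
proof -
  have "gradient (\<lambda>x::'a. 0) x = 0" for x by (rule gradient_eq[OF GDERIV_const_zero])
  then show ?thesis using energy_ge[OF assms zero_in_energy_space[OF dim]] by (simp add: bi_energy_def bi_def)
qed

text \<open>Along a weakly convergent minimizing sequence the lower bound is tested with a single
  function, the potential of the limit measure, which is bounded and continuous.\<close>

lemma equilibrium_exists:
  assumes ne: "S \<noteq> {}"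
  shows "\<exists>\<rho>\<in>prob_measures_on S. \<forall>\<sigma>\<in>prob_measures_on S. electrostatic_energy \<rho> \<le> electrostatic_energy \<sigma>"
proof -
  let ?P = "prob_measures_on S" and ?E = "electrostatic_energy :: 'a measure \<Rightarrow> real"
  obtain y where "y \<in> S" using ne by blast
  then have P: "?P \<noteq> {}" using Dirac_prob_measures_on[OF S_borel] by blast
  have bdd: "bdd_below (?E ` ?P)" using energy_nonneg by (intro bdd_belowI2)
  define I where "I = (INF \<sigma>\<in>?P. ?E \<sigma>)"
  have I: "I \<le> ?E \<sigma>" if "\<sigma> \<in> ?P" for \<sigma> unfolding I_def using bdd that by (rule cINF_lower)
  obtain \<sigma> where \<sigma>: "\<And>k. \<sigma> k \<in> ?P" and lim: "(\<lambda>k. ?E (\<sigma> k)) \<longlonglongrightarrow> I"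
    by (rule minimizing_sequence[OF P bdd, folded I_def], rule that)
  obtain r \<nu> where r: "strict_mono (r :: nat \<Rightarrow> nat)" and \<nu>: "\<nu> \<in> ?P"
    and conv: "\<And>f. continuous_on UNIV f \<Longrightarrow> \<exists>b. \<forall>x. \<bar>f x\<bar> \<le> b \<Longrightarrow> (\<lambda>n. \<integral>x. f x \<partial>\<sigma> (r n)) \<longlonglongrightarrow> (\<integral>x. (f x :: real) \<partial>\<nu>)"
    using prob_measures_on_weakly_compact[of S \<sigma>, OF S ne \<sigma>] by blast
  let ?\<phi> = "potential \<nu>"
  have \<phi>: "?\<phi> \<in> energy_space" by (rule pot(1)[OF \<nu> \<nu>])
  obtain B where "\<And>x. \<bar>?\<phi> x\<bar> \<le> B" using energy_space_bounded[OF dim \<phi>] by blast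
  then have "(\<lambda>n. (\<integral>x. ?\<phi> x \<partial>\<sigma> (r n)) - bi_energy ?\<phi>) \<longlonglongrightarrow> (\<integral>x. ?\<phi> x \<partial>\<nu>) - bi_energy ?\<phi>"
    by (intro tendsto_intros conv energy_space_borel(3)[OF \<phi>]) blast
  then have 1: "(\<lambda>n. (\<integral>x. ?\<phi> x \<partial>\<sigma> (r n)) - bi_energy ?\<phi>) \<longlonglongrightarrow> ?E \<nu>" by (simp only: energy_eq[OF \<nu>])
  have "?E \<nu> \<le> I"
    by (rule LIMSEQ_le[OF 1 LIMSEQ_subseq_LIMSEQ[OF lim r]]) (use energy_ge[OF \<sigma> \<phi>] in auto)
  then show ?thesis using \<nu> I order_trans by blast
qed

text \<open>The first variation of the energy along the mixtures \<open>(1 - t) \<rho> + t \<sigma>\<close>; strong convexity of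
  the action controls how fast their potentials approach the one of \<open>\<rho>\<close>.\<close>

lemma equilibrium_variation:
  assumes \<rho>: "\<rho> \<in> prob_measures_on S" and \<sigma>: "\<sigma> \<in> prob_measures_on S"
    and min: "\<And>\<sigma>. \<sigma> \<in> prob_measures_on S \<Longrightarrow> electrostatic_energy \<rho> \<le> electrostatic_energy \<sigma>"
  shows "(\<integral>x. potential \<rho> x \<partial>\<rho>) \<le> (\<integral>x. potential \<rho> x \<partial>\<sigma>)"
proof -
  define \<phi> where "\<phi> = potential \<rho>"
  have \<phi>: "\<phi> \<in> energy_space" unfolding \<phi>_def by (rule pot(1)[OF \<rho> \<rho>])
  obtain K where K: "K \<ge> 0" "\<And>u x. (u :: 'a \<Rightarrow> real) \<in> energy_space \<Longrightarrow> \<bar>u x\<bar> \<le> K + dirichlet u / 4"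
    using sup_bound_linear[OF dim] by metis
  obtain A \<theta> where A: "A \<ge> 0" "0 < \<theta>" "\<theta> < 1 / 2" "\<And>u x. (u :: 'a \<Rightarrow> real) \<in> energy_space \<Longrightarrow> \<bar>u x\<bar> \<le> A * dirichlet u powr \<theta>"
    using sup_bound[OF dim] by metis
  obtain B where B: "\<And>x. \<bar>\<phi> x\<bar> \<le> B" using energy_space_bounded[OF dim \<phi>] by blast
  define t where "t = (\<lambda>n::nat. 1 / real (n + 2))"
  have t: "0 < t n" "t n \<le> 1 / 2" for n by (auto simp: t_def field_simps)
  define \<psi> where "\<psi> = (\<lambda>n. potential (mixture (t n) \<rho> \<sigma>))"
  have mx: "mixture (t n) \<rho> \<sigma> \<in> prob_measures_on S" for n
    by (rule mixture(1)[OF _ _ S_borel \<rho> \<sigma>]) (use t[of n] in auto)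
  have \<psi>: "\<psi> n \<in> energy_space" for n unfolding \<psi>_def by (rule pot(1)[OF mx mx])
  define d where "d = (\<lambda>n. half_dist \<phi> (\<psi> n))"
  have d0: "0 \<le> d n" for n by (simp add: d_def half_dist_def dirichlet_nonneg)
  define \<delta> where "\<delta> = (\<lambda>f. (\<integral>x. f x \<partial>\<sigma>) - (\<integral>x. f x \<partial>\<rho> :: real))"
  have \<delta>bound: "\<bar>\<delta> f - \<delta> g\<bar> \<le> 2 * C" if f: "f \<in> energy_space" and g: "g \<in> energy_space" and C: "\<And>x. \<bar>f x - g x\<bar> \<le> C" for f g :: "'a \<Rightarrow> real" and C
  proof -
    have c: "continuous_on UNIV (\<lambda>x. f x - g x)" by (intro continuous_on_diff energy_space_borel(3) f g)
    have *: "\<bar>(\<integral>x. f x \<partial>\<mu>) - (\<integral>x. g x \<partial>\<mu>)\<bar> \<le> C" if \<mu>: "\<mu> \<in> prob_measures_on S" for \<mu>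
      using continuous_bounded_integrable(2)[OF PD(1,2)[OF \<mu>] c C]
      by (simp add: Bochner_Integration.integral_diff energy_space_integrable[OF dim PD(1,2)[OF \<mu>]] f g)
    show ?thesis using *[OF \<rho>] *[OF \<sigma>] unfolding \<delta>_def by linarith
  qed
  \<comment> \<open>Minimality of \<open>\<rho>\<close> against the mixture and quadratic growth of
    the action of \<open>\<rho>\<close> at \<open>\<phi>\<close> are added; the energies cancel and
    only the part of the measure that changed remains.\<close>
  have dt: "d n \<le> t n * \<delta> (\<psi> n)" for n
  proof -
    obtain B' where B': "\<And>x. \<bar>\<psi> n x\<bar> \<le> B'" using energy_space_bounded[OF dim \<psi>] by blast
    have mi: "(\<integral>x. \<psi> n x \<partial>mixture (t n) \<rho> \<sigma>) = (1 - t n) * (\<integral>x. \<psi> n x \<partial>\<rho>) + t n * (\<integral>x. \<psi> n x \<partial>\<sigma>)"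
      by (rule mixture(2)[OF _ _ S_borel \<rho> \<sigma> energy_space_borel(3)[OF \<psi>] B']) (use t[of n] in auto)
    have "(\<integral>x. \<phi> x \<partial>\<rho>) - bi_energy \<phi> \<le> (\<integral>x. \<psi> n x \<partial>mixture (t n) \<rho> \<sigma>) - bi_energy (\<psi> n)"
      using min[OF mx, of n] energy_eq[OF mx, of n] energy_eq[OF \<rho>] by (simp add: \<phi>_def \<psi>_def)
    moreover have "bi_energy \<phi> - (\<integral>x. \<phi> x \<partial>\<rho>) + d n \<le> bi_energy (\<psi> n) - (\<integral>x. \<psi> n x \<partial>\<rho>)"
      using pot(2)[OF \<rho> \<rho> \<psi>, of n] by (simp add: \<phi>_def d_def action_def)
    ultimately show ?thesis unfolding mi \<delta>_def by (simp add: algebra_simps)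
  qed
  \<comment> \<open>A crude supremum bound, linear in \<open>d n\<close>, is inserted into
    \<open>dt\<close>; \<open>t n \<le> 1 / 2\<close> allows the term \<open>t n * d n\<close> to be
    absorbed.\<close>
  have dn: "d n \<le> t n * (4 * B + 8 * K)" for n
  proof -
    have h: "\<bar>(1/2) * \<phi> x + (- (1/2)) * \<psi> n x\<bar> \<le> K + d n / 4" for x
      unfolding d_def half_dist_def by (rule K(2)) (rule energy_space_lincomb[OF dim \<phi> \<psi>], simp)
    have "\<bar>\<psi> n x - 0\<bar> \<le> B + 2 * K + d n / 2" for x
      using h[of x] B[of x] unfolding abs_le_iff by (simp add: field_simps)
    from \<delta>bound[OF \<psi> zero_in_energy_space[OF dim] this]
    have "\<delta> (\<psi> n) \<le> 2 * B + 4 * K + d n" by (simp add: \<delta>_def abs_le_iff)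
    then have "d n \<le> t n * (2 * B + 4 * K + d n)" using dt[of n] mult_left_mono[of _ _ "t n"] t(1)[of n] by (meson less_imp_le order_trans)
    moreover have "t n * d n \<le> 1 / 2 * d n" using t d0 by (intro mult_right_mono) auto
    ultimately show ?thesis by (simp add: algebra_simps)
  qed
  have t0: "t \<longlonglongrightarrow> 0" unfolding t_def using LIMSEQ_ignore_initial_segment[OF lim_1_over_n, of 2] by simp
  have "d \<longlonglongrightarrow> 0"
  proof (rule tendsto_sandwich[OF _ _ tendsto_const])
    show "(\<lambda>n. t n * (4 * B + 8 * K)) \<longlonglongrightarrow> 0" by (rule tendsto_mult_left_zero[OF t0])
  qed (use dn d0 in auto)
  then have "(\<lambda>n. d n powr \<theta>) \<longlonglongrightarrow> 0 powr \<theta>" using A(2) d0 by (intro tendsto_powr' tendsto_const) auto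
  then have lim: "(\<lambda>n. 2 * (2 * A * d n powr \<theta>)) \<longlonglongrightarrow> 0" by (intro tendsto_mult_right_zero) simp
  \<comment> \<open>By \<open>dt\<close> the value \<open>\<delta> (\<psi> n)\<close> is
    nonnegative, and \<open>\<psi> n\<close> is uniformly close to \<open>\<phi>\<close>.\<close>
  have "- \<delta> \<phi> \<le> 2 * (2 * A * d n powr \<theta>)" for n
  proof -
    have "\<bar>\<delta> \<phi> - \<delta> (\<psi> n)\<bar> \<le> 2 * (2 * A * d n powr \<theta>)"
      unfolding d_def by (rule \<delta>bound[OF \<phi> \<psi> half_dist_sup[OF A(4) dim \<phi> \<psi>]])
    moreover have "0 \<le> \<delta> (\<psi> n)"
    proof -
      have "0 \<le> t n * \<delta> (\<psi> n)" using dt[of n] d0[of n] by linarith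
      then show ?thesis using t(1)[of n] by (simp add: zero_le_mult_iff)
    qed
    ultimately show ?thesis by linarith
  qed
  then have "- \<delta> \<phi> \<le> 0" by (intro LIMSEQ_le_const[OF lim]) blast
  then show ?thesis by (simp add: \<delta>_def \<phi>_def)
qed

end

section \<open>Rigidity of the potential of an equilibrium measure\<close>

locale equilibrium =
  fixes \<Omega> :: "'a::euclidean_space set" and \<alpha> :: real and \<rho> :: "'a measure"
  assumes dim: "DIM('a) \<ge> 3" and \<Omega>: "bounded_domain \<Omega>" and \<alpha>: "\<alpha> > 0"
    and boundary: "C_k_Hoelder_boundary 2 \<alpha> \<Omega>"
    and \<rho>: "\<rho> \<in> prob_measures_on (frontier \<Omega>)"
    and min: "\<And>\<sigma>. \<sigma> \<in> prob_measures_on (frontier \<Omega>) \<Longrightarrow> electrostatic_energy \<rho> \<le> electrostatic_energy \<sigma>"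
begin

abbreviation \<phi> :: "'a \<Rightarrow> real" where "\<phi> \<equiv> potential \<rho>"
definition m :: real where "m = (\<integral>x. \<phi> x \<partial>\<rho>)"

lemma op: "open \<Omega>" and bd: "bounded \<Omega>"
  using \<Omega> by (auto simp: bounded_domain_def)

lemma S: "compact (frontier \<Omega>)"
  using bd by (rule compact_frontier_bounded)

lemmas S_borel = S_borel[OF dim S]
lemmas \<rho>D = prob_measures_onD[OF \<rho> S_borel]
lemmas pot = potential_minimizes[OF dim \<rho>D(1,2)]

lemma \<phi>L: "1-lipschitz_on UNIV \<phi>"
  by (rule energy_spaceD(1)[OF pot(1)])

lemma ge_m: "y \<in> frontier \<Omega> \<Longrightarrow> m \<le> \<phi> y"
  using equilibrium_variation[OF dim S \<rho> Dirac_prob_measures_on[OF S_borel] min] energy_space_borel(1)[OF pot(1)]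
  by (simp add: m_def integral_return)

lemma integral_ge_m:
  assumes \<psi>: "\<psi> \<in> energy_space" "\<And>y. y \<in> frontier \<Omega> \<Longrightarrow> m \<le> \<psi> y"
  shows "m \<le> (\<integral>x. \<psi> x \<partial>\<rho>)"
proof -
  interpret prob_space \<rho> by (rule \<rho>D(1))
  have "(\<integral>x. m \<partial>\<rho>) \<le> (\<integral>x. \<psi> x \<partial>\<rho>)"
  proof (rule integral_mono_AE[OF _ energy_space_integrable[OF dim \<rho>D(1,2) \<psi>(1)]])
    show "AE x in \<rho>. m \<le> \<psi> x" using \<rho>D(3) by eventually_elim (rule \<psi>(2))
  qed simp
  then show ?thesis by (simp add: prob_space)
qed

text \<open>For functions that are at least \<open>m\<close> on the boundary the action is at most
  their energy minus \<open>m\<close>, with equality for \<open>\<phi>\<close> by the choice of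
  \<open>m\<close>. The measure thus drops out: \<open>\<phi>\<close> solves an obstacle problem,
  and competitors are tested in this form.\<close>

lemma unique:
  assumes "\<psi> \<in> energy_space" "\<And>y. y \<in> frontier \<Omega> \<Longrightarrow> m \<le> \<psi> y" "bi_energy \<psi> \<le> bi_energy \<phi>"
  shows "\<psi> = \<phi>"
  using pot(4)[OF assms(1)] integral_ge_m[OF assms(1,2)] assms(3) by (simp add: action_def m_def)

lemma m_nonneg: "0 \<le> m"
  using energy_nonneg[OF dim S \<rho>] energy_eq[OF dim S \<rho>] bi_energy_nonneg[OF dim S pot(1)] by (simp add: m_def)

lemma min_m: "min (\<phi> x) m = \<phi> x"
proof -
  have "(\<lambda>x. min (\<phi> x) m) = \<phi>"
    using truncation(3,4)[OF dim pot(1) m_nonneg] ge_m by (intro unique) auto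
  then show ?thesis by (rule fun_cong)
qed

lemma le_m: "\<phi> x \<le> m"
  using min_m[of x] by linarith

lemma frontier_m: "y \<in> frontier \<Omega> \<Longrightarrow> \<phi> y = m"
  using ge_m[of y] le_m[of y] by simp

lemma nonneg: "0 \<le> \<phi> x"
proof -
  have "(\<lambda>x. max (\<phi> x) 0) = \<phi>"
    using truncation(1,2)[OF dim pot(1)] ge_m by (intro unique) (auto intro: max.coboundedI1)
  then have "max (\<phi> x) 0 = \<phi> x" by (rule fun_cong)
  then show ?thesis by linarith
qed

text \<open>Replacing \<open>\<phi>\<close> by \<open>m\<close> inside the domain keeps the
  Lipschitz constant, since a segment that leaves the domain crosses the boundary, where
  \<open>\<phi> = m\<close>. The new function has gradient 0 inside and touches
  \<open>\<phi>\<close> from above outside, so its energy is no larger.\<close>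

lemma domain_m:
  assumes "x \<in> \<Omega>" shows "\<phi> x = m"
proof -
  define u where "u = (\<lambda>x. if x \<in> \<Omega> then m else \<phi> x)"
  have le: "\<phi> y \<le> u y" "u y \<le> m" for y using le_m by (auto simp: u_def)
  have cross: "\<bar>m - \<phi> y\<bar> \<le> dist x y" if "x \<in> \<Omega>" "y \<notin> \<Omega>" for x y
  proof -
    have "closed_segment x y \<inter> frontier \<Omega> \<noteq> {}" using that by (intro connected_Int_frontier) auto
    then obtain p where p: "p \<in> closed_segment x y" "p \<in> frontier \<Omega>" by blast
    have "\<bar>m - \<phi> y\<bar> \<le> dist p y" using lipschitz_onD[OF \<phi>L, of p y] frontier_m[OF p(2)] by (simp add: dist_real_def)
    also have "\<dots> \<le> dist x y" using dist_in_closed_segment[OF p(1)] by simp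
    finally show ?thesis .
  qed
  have uL: "1-lipschitz_on UNIV u"
  proof (rule lipschitz_onI)
    show "dist (u x) (u y) \<le> 1 * dist x y" for x y
      using cross[of x y] cross[of y x] lipschitz_onD[OF \<phi>L, of x y]
      by (auto simp: u_def dist_real_def dist_commute abs_minus_commute)
  qed simp
  obtain R where R: "\<And>x. x \<in> \<Omega> \<Longrightarrow> norm x \<le> R" using bd bounded_iff by blast
  have u: "u \<in> energy_space"
    by (rule compact_perturbation_energy_space[OF dim pot(1) uL, of R]) (use R in \<open>force simp: u_def\<close>)
  have "AE x in lborel. norm (gradient u x) \<le> norm (gradient \<phi> x)"
    using AE_GDERIV[OF \<phi>L] AE_GDERIV[OF uL]
  proof eventually_elim
    case (elim x)
    show ?case
    proof (cases "x \<in> \<Omega>")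
      case True
      then have "- gradient u x = 0" using le(2)
        by (intro gradient_zero_at_min[OF GDERIV_minus[OF elim(2)]]) (simp add: u_def)
      then show ?thesis by simp
    next
      case False
      then have "gradient u x - gradient \<phi> x = 0" using le(1)
        by (intro gradient_zero_at_min[OF GDERIV_diff[OF elim(2,1)]]) (simp add: u_def)
      then show ?thesis by simp
    qed
  qed
  then have "u = \<phi>" using ge_m le order_trans by (intro unique u bi_energy_mono pot(1)) blast+
  then show ?thesis using assms by (auto simp: u_def dest: fun_cong[where x=x])
qed

text \<open>The closed interior ball at a boundary point lies in the closure of the domain, where
  \<open>\<phi> = m\<close>, so the barrier around this ball is available; the distance to the ball
  is at most the distance to the boundary point.\<close>

lemma slope_at_boundary:
  obtains \<kappa> where "0 \<le> \<kappa>" "\<kappa> < 1" "\<And>x y. y \<in> frontier \<Omega> \<Longrightarrow> m - \<kappa> * dist x y \<le> \<phi> x"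
proof -
  obtain r where r: "r > 0" "\<And>y. y \<in> frontier \<Omega> \<Longrightarrow> \<exists>z. dist z y = r \<and> ball z r \<subseteq> \<Omega>"
    using interior_ball[OF \<Omega> boundary \<alpha>] by blast
  have "\<psi> = \<phi>" if "\<psi> \<in> energy_space" "bi_energy \<psi> \<le> bi_energy \<phi>" "\<And>x. \<phi> x \<le> \<psi> x" for \<psi>
    by (rule unique[OF that(1) _ that(2)]) (use ge_m that(3) order_trans in blast)
  from barrier[OF dim pot(1) nonneg this m_nonneg r(1)]
  obtain \<kappa> where \<kappa>: "0 \<le> \<kappa>" "\<kappa> < 1"
    "\<And>z x. \<forall>x. norm (x - z) \<le> r \<longrightarrow> \<phi> x = m \<Longrightarrow> m - \<kappa> * (max (norm (x - z)) r - r) \<le> \<phi> x"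
    by blast
  have "m - \<kappa> * dist x y \<le> \<phi> x" if y: "y \<in> frontier \<Omega>" for x y
  proof -
    obtain z where z: "dist z y = r" "ball z r \<subseteq> \<Omega>" using r(2)[OF y] by blast
    have "cball z r \<subseteq> closure \<Omega>" using closure_mono[OF z(2)] r(1) by (simp add: closure_ball)
    also have "\<dots> = \<Omega> \<union> frontier \<Omega>" using op closure_Un_frontier[of \<Omega>] by simp
    finally have "cball z r \<subseteq> \<Omega> \<union> frontier \<Omega>" .
    then have "\<forall>x. norm (x - z) \<le> r \<longrightarrow> \<phi> x = m"
      using domain_m frontier_m by (auto simp: subset_iff dist_norm norm_minus_commute)
    from \<kappa>(3)[OF this] have "m - \<kappa> * (max (norm (x - z)) r - r) \<le> \<phi> x" .
    moreover have "max (norm (x - z)) r - r \<le> dist x y"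
      using dist_triangle[of x z y] z(1) by (simp add: dist_norm norm_minus_commute max_def)
    then have "\<kappa> * (max (norm (x - z)) r - r) \<le> \<kappa> * dist x y" using \<kappa>(1) by (rule mult_left_mono)
    ultimately show ?thesis by linarith
  qed
  then show ?thesis using \<kappa> by (intro that) auto
qed

text \<open>Comparing \<open>\<phi>\<close> with its translates carries the bound on the slope from the boundary to the
  whole space.\<close>

lemma potential_lipschitz:
  obtains \<kappa> where "0 \<le> \<kappa>" "\<kappa> < 1" "\<kappa>-lipschitz_on UNIV \<phi>"
proof -
  obtain \<kappa> where \<kappa>: "0 \<le> \<kappa>" "\<kappa> < 1" and slope: "\<And>x y. y \<in> frontier \<Omega> \<Longrightarrow> m - \<kappa> * dist x y \<le> \<phi> x"
    by (rule slope_at_boundary) blast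
  have main: "\<phi> (x + h) - \<kappa> * norm h \<le> \<phi> x" for x h
  proof -
    define c where "c = \<kappa> * norm h"
    define f where "f = (\<lambda>x. \<phi> (x + h) + (- c))"
    define f' where "f' = (\<lambda>x. \<phi> (x + (- h)) + c)"
    \<comment> \<open>If the lowered translate \<open>f\<close> exceeded \<open>\<phi>\<close>
      somewhere, \<open>\<xi>\<close> would be a different competitor with no more energy.\<close>
    define \<xi> where "\<xi> = (\<lambda>x. max (f x) (\<phi> x))"
    define b where "b = (\<lambda>x. min (f' x) (\<phi> x))"
    \<comment> \<open>The minimum of \<open>f\<close> and \<open>\<phi>\<close> tends to
      \<open>- c\<close> at infinity and may fail to be integrable. Translated back and raised by
      \<open>c\<close> it becomes \<open>b\<close>, which lies in \<open>energy_space\<close> and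
      has the same energy.\<close>
    define b' where "b' = (\<lambda>x. min (f x) (\<phi> x))"
    have c: "c \<ge> 0" using \<kappa> by (simp add: c_def)
    have fL: "1-lipschitz_on UNIV f" and f'L: "1-lipschitz_on UNIV f'"
      unfolding f_def f'_def by (rule lipschitz_shift[OF \<phi>L])+
    have sh: "(\<lambda>x. \<phi> (x + k)) \<in> energy_space" for k by (rule energy_space_shift[OF pot(1)])
    have gs: "gradient (\<lambda>x. \<phi> (x + k)) x = gradient \<phi> (x + k)" for k x using gradient_shift[of \<phi> k 0 x] by simp
    have gf: "gradient f x = gradient \<phi> (x + h)" "gradient f' x = gradient \<phi> (x + (- h))" for x
      unfolding f_def f'_def by (rule gradient_shift)+
    have \<xi>: "\<xi> \<in> energy_space"
    proof (rule energy_spaceI[OF dim sh[of h] pot(1), of _ 1])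
      show "1-lipschitz_on UNIV \<xi>" unfolding \<xi>_def by (rule lipschitz_max_min(1)[OF fL \<phi>L])
      show "AE x in lborel. norm (gradient \<xi> x) \<le> 1 * (norm (gradient (\<lambda>x. \<phi> (x + h)) x) + norm (gradient \<phi> x))"
        using AE_gradient_max_min[OF fL \<phi>L]
      proof eventually_elim
        case (elim x)
        then show ?case using linear[of "f x" "\<phi> x"] by (auto simp: \<xi>_def gf gs)
      qed
      show "\<bar>\<xi> x\<bar> \<le> \<bar>\<phi> (x + h)\<bar> + \<bar>\<phi> x\<bar>" for x using nonneg[of x] nonneg[of "x + h"] c by (auto simp: \<xi>_def f_def)
    qed
    have b: "b \<in> energy_space"
    proof (rule energy_spaceI[OF dim sh[of "- h"] pot(1), of _ 1])
      show "1-lipschitz_on UNIV b" unfolding b_def by (rule lipschitz_max_min(2)[OF f'L \<phi>L])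
      show "AE x in lborel. norm (gradient b x) \<le> 1 * (norm (gradient (\<lambda>x. \<phi> (x + (- h))) x) + norm (gradient \<phi> x))"
        using AE_gradient_max_min[OF f'L \<phi>L]
      proof eventually_elim
        case (elim x)
        then show ?case using linear[of "f' x" "\<phi> x"] unfolding gs gf[symmetric] by (auto simp: b_def)
      qed
      show "\<bar>b x\<bar> \<le> \<bar>\<phi> (x + (- h))\<bar> + \<bar>\<phi> x\<bar>" for x using nonneg[of x] nonneg[of "x + (- h)"] c by (auto simp: b_def f'_def)
    qed
    have b': "b' = (\<lambda>x. b (x + h) + (- c))" by (auto simp: b'_def b_def f_def f'_def fun_eq_iff)
    have bL: "1-lipschitz_on UNIV b" by (rule energy_spaceD(1)[OF b])
    have ib: "integrable lborel (\<lambda>x. bi (gradient b' x))"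
      unfolding b' gradient_shift by (rule integrable_lborel_shift[OF bi_integrable[OF b]])
    have jf: "integrable lborel (\<lambda>x. bi (gradient f x))"
      unfolding gf by (rule integrable_lborel_shift[OF bi_integrable[OF pot(1)]])
    \<comment> \<open>At almost every point the maximum takes one of the gradients of
      \<open>f\<close> and \<open>\<phi>\<close> and the minimum the other, so the total energy is
      preserved.\<close>
    have "AE x in lborel. bi (gradient \<xi> x) + bi (gradient b' x) = bi (gradient f x) + bi (gradient \<phi> x)"
      using AE_gradient_max_min[OF fL \<phi>L]
    proof eventually_elim
      case (elim x)
      then show ?case using linear[of "f x" "\<phi> x"] by (auto simp: \<xi>_def b'_def)
    qed
    then have "(\<integral>x. bi (gradient \<xi> x) + bi (gradient b' x) \<partial>lborel) = (\<integral>x. bi (gradient f x) + bi (gradient \<phi> x) \<partial>lborel)"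
      using ib jf bi_integrable[OF \<xi>] bi_integrable[OF pot(1)] by (intro integral_cong_AE) auto
    then have "bi_energy \<xi> + bi_energy b' = bi_energy f + bi_energy \<phi>"
      using ib jf bi_integrable[OF \<xi>] bi_integrable[OF pot(1)] by (simp add: bi_energy_def)
    moreover have "bi_energy b' = bi_energy b" unfolding b' by (rule bi_energy_shift[OF bL])
    moreover have "bi_energy f = bi_energy \<phi>" unfolding f_def by (rule bi_energy_shift[OF \<phi>L])
    moreover have "bi_energy \<phi> \<le> bi_energy b"
    proof -
      \<comment> \<open>By the slope bound at the boundary, \<open>\<phi> (y - h) + c\<close> is at
        least \<open>m\<close>. Hence \<open>b\<close> is a competitor, and its energy is at least
        that of \<open>\<phi>\<close>.\<close>
      have "m \<le> b y" if y: "y \<in> frontier \<Omega>" for y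
        using slope[OF y, of "y + (- h)"] frontier_m[OF y] by (simp add: b_def f'_def c_def dist_norm)
      then have "m \<le> (\<integral>x. b x \<partial>\<rho>)" by (rule integral_ge_m[OF b])
      moreover have "0 \<le> half_dist \<phi> b" by (simp add: half_dist_def dirichlet_nonneg)
      ultimately show ?thesis using pot(2)[OF b] unfolding action_def m_def by linarith
    qed
    ultimately have "bi_energy \<xi> \<le> bi_energy \<phi>" by linarith
    then have "\<xi> = \<phi>" using frontier_m by (intro unique \<xi>) (auto simp: \<xi>_def)
    then have "max (f x) (\<phi> x) = \<phi> x" unfolding \<xi>_def by (rule fun_cong)
    then show ?thesis by (simp add: f_def c_def max_def split: if_splits)
  qed
  have "\<kappa>-lipschitz_on UNIV \<phi>"
  proof (rule lipschitz_onI)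
    show "dist (\<phi> x) (\<phi> y) \<le> \<kappa> * dist x y" for x y
      using main[of x "y - x"] main[of y "x - y"] by (simp add: dist_real_def dist_norm norm_minus_commute abs_le_iff)
  qed fact
  with \<kappa> show ?thesis by (rule that)
qed

end

text \<open>Both measures have the same potential. Adding \<open>t\<close> times
  \<open>\<psi>\<close> to it is tested against \<open>\<rho>\<close>, subtracting it against
  \<open>\<sigma>\<close>; the slope bound below 1 makes both variations admissible for small
  \<open>t\<close>. The sum of the two minimality inequalities compares the difference of the
  integrals, times \<open>t\<close>, with a second difference of the energy, which is of order t^2.
  Dividing by \<open>t\<close> and letting it tend to 0 gives the inequality.\<close>

lemma equilibrium_integral_le:
  fixes \<psi> :: "'a::euclidean_space \<Rightarrow> real"
  assumes e1: "equilibrium \<Omega> \<alpha> \<rho>" and e2: "equilibrium \<Omega> \<alpha> \<sigma>"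
    and \<psi>: "L-lipschitz_on UNIV \<psi>" "\<And>x. R < norm x \<Longrightarrow> \<psi> x = 0"
  shows "(\<integral>x. \<psi> x \<partial>\<rho>) \<le> (\<integral>x. \<psi> x \<partial>\<sigma>)"
proof -
  interpret E1: equilibrium \<Omega> \<alpha> \<rho> by fact
  interpret E2: equilibrium \<Omega> \<alpha> \<sigma> by fact
  note dim = E1.dim
  let ?\<phi> = "potential \<rho>"
  interpret \<sigma>: prob_space \<sigma> by (rule E2.\<rho>D(1))
  \<comment> \<open>The potential of \<open>\<rho>\<close> equals the constant \<open>E1.m\<close>
    on the boundary, so it has the same action for both measures. As the two equilibrium energies
    are equal, it is also a minimizer for \<open>\<sigma>\<close>.\<close>
  have eq: "potential \<sigma> = ?\<phi>"
  proof -
    have "(\<integral>x. ?\<phi> x \<partial>\<sigma>) = (\<integral>x. E1.m \<partial>\<sigma>)"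
    proof (rule integral_cong_AE)
      show "AE x in \<sigma>. ?\<phi> x = E1.m" using E2.\<rho>D(3) by eventually_elim (rule E1.frontier_m)
    qed (use energy_space_integrable[OF dim E2.\<rho>D(1,2) E1.pot(1)] in auto)
    then have "action \<sigma> ?\<phi> = - electrostatic_energy \<rho>"
      using energy_eq[OF dim E1.S E1.\<rho>] by (simp add: action_def E1.m_def \<sigma>.prob_space)
    also have "\<dots> = action \<sigma> (potential \<sigma>)"
      using E1.min[OF E2.\<rho>] E2.min[OF E1.\<rho>] E2.pot(3) by simp
    finally have "action \<sigma> ?\<phi> \<le> action \<sigma> (potential \<sigma>)" by simp
    from E2.pot(4)[OF E1.pot(1) this] show ?thesis ..
  qed
  obtain \<kappa> where \<kappa>: "0 \<le> \<kappa>" "\<kappa> < 1" "\<kappa>-lipschitz_on UNIV ?\<phi>" by (rule E1.potential_lipschitz)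
  have L: "L \<ge> 0" by (rule lipschitz_on_nonneg[OF \<psi>(1)])
  \<comment> \<open>Halfway between \<open>\<kappa>\<close> and 1: a common Lipschitz constant for
    all variations of size at most \<open>T\<close>, which \<open>bi_second_difference\<close>
    requires to be below 1.\<close>
  define k where "k = (1 + \<kappa>) / 2"
  define C where "C = (1 / (sqrt (1 - k\<^sup>2))\<^sup>2 + 1) / sqrt (1 - k\<^sup>2) * L\<^sup>2 * measure lborel (cball (0::'a) R)"
  define T where "T = (1 - \<kappa>) / (2 * (L + 1))"
  have k: "k < 1" using \<kappa> by (simp add: k_def)
  have k2: "k\<^sup>2 < 1" using \<kappa> k by (simp add: abs_square_less_1 k_def)
  have C: "C \<ge> 0" unfolding C_def using k2 by (intro mult_nonneg_nonneg divide_nonneg_nonneg) auto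
  have T: "T > 0" using \<kappa> L by (simp add: T_def)
  define \<delta> where "\<delta> = (\<integral>x. \<psi> x \<partial>\<rho>) - (\<integral>x. \<psi> x \<partial>\<sigma>)"
  have "\<delta> \<le> C * t" if t: "0 < t" "t \<le> T" for t
  proof -
    define u where "u = (\<lambda>s x. 1 * ?\<phi> x + s * \<psi> x)"
    have tL: "\<kappa> + t * L \<le> k"
    proof -
      have "t * L \<le> T * (L + 1)" using t L T by (intro mult_mono) auto
      also have "\<dots> = (1 - \<kappa>) / (2 * (L + 1)) * (L + 1)" by (simp only: T_def)
      also have "\<dots> = (1 - \<kappa>) / 2" using L by (simp del: distrib_left_numeral add: divide_simps)
      finally show ?thesis by (simp add: k_def field_simps)
    qed
    have uL: "k-lipschitz_on UNIV (u s)" if "\<bar>s\<bar> = t" for s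
      unfolding u_def by (rule lipschitz_on_le[OF lipschitz_lincomb[OF \<kappa>(3) \<psi>(1)]]) (use tL that in simp)
    have u: "u s \<in> energy_space" if "\<bar>s\<bar> = t" for s
      by (rule compact_perturbation_energy_space[OF dim E1.pot(1) lipschitz_on_le[OF uL[OF that]]])
        (use k \<psi>(2) in \<open>auto simp: u_def\<close>)
    have abs_t: "\<bar>t\<bar> = t" "\<bar>- t\<bar> = t" using t(1) by auto
    note u1 = u[OF abs_t(1)] and u2 = u[OF abs_t(2)]
    have gr: "AE x in lborel. gradient (u s) x = 1 *\<^sub>R gradient ?\<phi> x + s *\<^sub>R gradient \<psi> x" for s
      unfolding u_def by (rule AE_gradient_lincomb[OF \<kappa>(3) \<psi>(1)])
    let ?M = "(1 / (sqrt (1 - k\<^sup>2))\<^sup>2 + 1) / sqrt (1 - k\<^sup>2)"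
    have M0: "?M \<ge> 0" using k2 by (intro divide_nonneg_nonneg add_nonneg_nonneg) auto
    have "AE x in lborel. bi (gradient (u t) x) + bi (gradient (u (- t)) x) - 2 * bi (gradient ?\<phi> x)
        \<le> (?M * (t\<^sup>2 * L\<^sup>2)) * indicator (cball 0 R) x"
      using gr[of t] gr[of "- t"] AE_GDERIV[OF uL[OF abs_t(1)]] AE_GDERIV[OF uL[OF abs_t(2)]]
        AE_GDERIV[OF \<psi>(1)] energy_space_AE_gradient_le[OF E1.pot(1)] AE_gradient_zero_on_zero_set[OF \<psi>(1)]
    proof eventually_elim
      case (elim x)
      have n: "norm (gradient (u t) x) \<le> k" "norm (gradient (u (- t)) x) \<le> k"
        by (rule norm_gradient_le[OF uL elim(3)], fact abs_t) (rule norm_gradient_le[OF uL elim(4)], fact abs_t)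
      have "bi (gradient (u t) x) + bi (gradient (u (- t)) x) - 2 * bi (gradient ?\<phi> x) \<le> ?M * (norm (t *\<^sub>R gradient \<psi> x))\<^sup>2"
        using bi_second_difference[OF k elim(6), of "t *\<^sub>R gradient \<psi> x"] n elim(1,2) by simp
      also have "\<dots> \<le> ?M * ((t\<^sup>2 * L\<^sup>2) * indicator (cball 0 R) x)"
      proof (rule mult_left_mono[OF _ M0])
        show "(norm (t *\<^sub>R gradient \<psi> x))\<^sup>2 \<le> (t\<^sup>2 * L\<^sup>2) * indicator (cball 0 R) x"
        proof (cases "norm x \<le> R")
          case True
          have "norm (gradient \<psi> x) \<le> L" by (rule norm_gradient_le[OF \<psi>(1) elim(5)])
          then have "(norm (gradient \<psi> x))\<^sup>2 \<le> L\<^sup>2" by (intro power_mono) auto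
          then show ?thesis using True by (simp add: power_mult_distrib mult_left_mono)
        next
          case False
          then show ?thesis using elim(7) \<psi>(2) by simp
        qed
      qed
      finally show ?case by (simp add: mult.assoc)
    qed
    moreover have "integrable lborel (\<lambda>x. (?M * (t\<^sup>2 * L\<^sup>2)) * indicator (cball (0::'a) R) x :: real)"
      using emeasure_bounded_finite[OF bounded_cball, of "0::'a" R] by (intro integrable_mult_right integrable_real_indicator) auto
    ultimately have "(\<integral>x. bi (gradient (u t) x) + bi (gradient (u (- t)) x) - 2 * bi (gradient ?\<phi> x) \<partial>lborel)
        \<le> (\<integral>x. (?M * (t\<^sup>2 * L\<^sup>2)) * indicator (cball (0::'a) R) x \<partial>lborel)"
      using bi_integrable[OF u1] bi_integrable[OF u2] bi_integrable[OF E1.pot(1)] t(1) by (intro integral_mono_AE) auto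
    also have "\<dots> = t * (C * t)" by (simp add: C_def power2_eq_square)
    finally have J: "bi_energy (u t) + bi_energy (u (- t)) - 2 * bi_energy ?\<phi> \<le> t * (C * t)"
      using bi_integrable[OF u1] bi_integrable[OF u2] bi_integrable[OF E1.pot(1)] t(1) by (simp add: bi_energy_def)
    have act: "bi_energy ?\<phi> + s * (\<integral>x. \<psi> x \<partial>\<mu>) \<le> bi_energy (u s)"
      if \<mu>: "prob_space \<mu>" "sets \<mu> = sets borel" and p: "potential \<mu> = ?\<phi>" and s: "\<bar>s\<bar> = t" for \<mu> s
    proof -
      have i1: "integrable \<mu> ?\<phi>" and i2: "integrable \<mu> (u s)"
        using energy_space_integrable[OF dim \<mu> E1.pot(1)] energy_space_integrable[OF dim \<mu> u[OF s]] by auto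
      have "s \<noteq> 0" using s t(1) by auto
      then have eq: "(\<lambda>x. (1 / s) * (u s x - ?\<phi> x)) = \<psi>" by (auto simp: u_def)
      have "integrable \<mu> (\<lambda>x. (1 / s) * (u s x - ?\<phi> x))"
        by (intro integrable_mult_right Bochner_Integration.integrable_diff i1 i2)
      then have i3: "integrable \<mu> \<psi>" by (simp only: eq)
      have "(\<integral>x. u s x \<partial>\<mu>) = (\<integral>x. ?\<phi> x \<partial>\<mu>) + s * (\<integral>x. \<psi> x \<partial>\<mu>)"
        using i1 i3 by (simp add: u_def)
      moreover have "action \<mu> ?\<phi> + half_dist ?\<phi> (u s) \<le> action \<mu> (u s)"
        using potential_minimizes(2)[OF dim \<mu> u[OF s]] p by simp
      moreover have "0 \<le> half_dist ?\<phi> (u s)" by (simp add: half_dist_def dirichlet_nonneg)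
      ultimately show ?thesis by (simp add: action_def)
    qed
    \<comment> \<open>The variation with \<open>+ t\<close> enters through \<open>\<rho>\<close> and
      the one with \<open>- t\<close> through \<open>\<sigma>\<close>, so the two integrals of
      \<open>\<psi>\<close> appear with opposite signs.\<close>
    have "t * \<delta> \<le> t * (C * t)"
      using act[OF E1.\<rho>D(1,2) refl abs_t(1)] act[OF E2.\<rho>D(1,2) eq abs_t(2)] J t(1) by (simp add: \<delta>_def right_diff_distrib)
    then show ?thesis using t(1) by simp
  qed
  note small = this
  have "\<delta> \<le> 0"
  proof (rule ccontr)
    assume "\<not> ?thesis"
    then have d: "\<delta> > 0" by simp
    \<comment> \<open>The second bound makes \<open>C * t\<close> at most half of
      \<open>\<delta>\<close>; the summand 1 guards against \<open>C = 0\<close>.\<close>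
    define t where "t = min T (\<delta> / (2 * (C + 1)))"
    have "\<delta> \<le> C * t" using T C d by (intro small) (auto simp: t_def)
    also have "\<dots> \<le> (C + 1) * (\<delta> / (2 * (C + 1)))" using C T d by (intro mult_mono) (auto simp: t_def)
    also have "\<dots> = \<delta> / 2" using C by (simp del: distrib_left_numeral add: divide_simps)
    finally show False using d by simp
  qed
  then show ?thesis by (simp add: \<delta>_def)
qed

theorem equilibrium_unique:
  fixes \<Omega> :: "'a::euclidean_space set"
  assumes e1: "equilibrium \<Omega> \<alpha> \<rho>" and e2: "equilibrium \<Omega> \<alpha> \<sigma>"
  shows "\<rho> = \<sigma>"
proof -
  interpret E1: equilibrium \<Omega> \<alpha> \<rho> by fact
  interpret E2: equilibrium \<Omega> \<alpha> \<sigma> by fact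
  show ?thesis
    by (rule prob_measures_eqI[OF E1.S E1.\<rho> E2.\<rho>])
      (use equilibrium_integral_le[OF e1 e2] equilibrium_integral_le[OF e2 e1] order_antisym in blast)
qed

theorem corollary4p12:
  fixes \<Omega> :: "(real ^ 'n) set" and \<alpha> :: real
  assumes "CARD('n) \<ge> 3"
    and "bounded_domain \<Omega>"
    and "\<alpha> > 0"
    and "C_k_Hoelder_boundary 2 \<alpha> \<Omega>"
  shows "\<exists>!\<rho>. \<rho> \<in> prob_measures_on (frontier \<Omega>) \<and>
           electrostatic_energy \<rho> = (INF \<sigma>\<in>prob_measures_on (frontier \<Omega>). electrostatic_energy \<sigma>)"
proof -
  let ?P = "prob_measures_on (frontier \<Omega>)"
  have dim: "DIM(real ^ 'n) \<ge> 3" using assms(1) by simp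
  have bd: "bounded \<Omega>" "\<Omega> \<noteq> {}" using assms(2) by (auto simp: bounded_domain_def)
  have S: "compact (frontier \<Omega>)" using bd(1) by (rule compact_frontier_bounded)
  have "frontier \<Omega> \<noteq> {}" using bd not_bounded_UNIV by (auto simp: frontier_eq_empty)
  from equilibrium_exists[OF dim S this] obtain \<rho> where \<rho>: "\<rho> \<in> ?P"
    "\<And>\<sigma>. \<sigma> \<in> ?P \<Longrightarrow> electrostatic_energy \<rho> \<le> electrostatic_energy \<sigma>" by blast
  have bdd: "bdd_below (electrostatic_energy ` ?P)" using energy_nonneg[OF dim S] by (intro bdd_belowI2)
  show ?thesis
  proof (rule ex1I[of _ \<rho>], intro conjI)
    show "electrostatic_energy \<rho> = (INF \<sigma>\<in>?P. electrostatic_energy \<sigma>)"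
      using \<rho> bdd by (intro antisym cINF_greatest cINF_lower) auto
    fix \<sigma> assume \<sigma>: "\<sigma> \<in> ?P \<and> electrostatic_energy \<sigma> = (INF \<sigma>\<in>?P. electrostatic_energy \<sigma>)"
    then have "electrostatic_energy \<sigma> \<le> electrostatic_energy \<tau>" if "\<tau> \<in> ?P" for \<tau>
      using cINF_lower[OF bdd that] by simp
    then have "equilibrium \<Omega> \<alpha> \<sigma>" "equilibrium \<Omega> \<alpha> \<rho>" using \<sigma> \<rho> dim assms by (auto simp: equilibrium_def)
    then show "\<sigma> = \<rho>" by (rule equilibrium_unique)
  qed (rule \<rho>(1))
qed

end
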